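(* Let $n\ge1$, let $\mathcal{L}$ be the sublaplacian on the Heisenberg group $\mathbb{H}^n$, and let $f$ be a smooth function on $\mathbb{H}^n$ such that $$f(\rho\,\omega\sqrt{\sin\theta},\,\rho^2\cos\theta)=f(\rho\,\omega,0)\qquad\text{for all }\rho>0,\ \omega\in S^{2n-1}\subset\mathbb{C}^n,\ 0\le\theta\le\pi .$$ Assume that $\mathcal{L}^m f\in L^2(\mathbb{H}^n)$ for all $m\in\mathbb{N}$ and that $$\sum_{m=1}^\infty\|\mathcal{L}^m f\|_2^{-\frac1{2m}}=\infty .$$ If $f$ and all its partial derivatives vanish at $0$, then $f$ is identically zero.
   Context: $\mathbb{H}^n=\mathbb{C}^n\times\mathbb{R}$ is the Heisenberg group with group law $(z,t)(w,s)=\big(z+w,\,t+s+\tfrac12\operatorname{Im}(z\cdot\bar w)\big)$; Haar measure is Lebesgue measure $dz\,dt$ and $\|\cdot\|_2$ is the norm of $L^2(\mathbb{H}^n)$. Writing $z=x+iy$, the left invariant vector fields are $X_j=\frac{\partial}{\partial x_j}+\frac12 y_j\frac{\partial}{\partial t}$, $Y_j=\frac{\partial}{\partial y_j}-\frac12 x_j\frac{\partial}{\partial t}$ ($j=1,\dots,n$), and the sublaplacian is $\mathcal{L}=-\sum_{j=1}^n(X_j^2+Y_j^2)$. Here $\mathbb{N}=\{0,1,2,\dots\}$. A term $0^{-1/(2m)}$ is read as $+\infty$. *)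

theory Defs
  imports "HOL-Analysis.Analysis"
begin

text \<open>
  The Heisenberg group of complex dimension \<open>n = CARD('n) \<ge> 1\<close>; its Haar measure \<open>dz dt\<close> is
  \<^term>\<open>lborel\<close>.  The group law \<open>(z,t)(w,s) = (z + w, t + s + Im (z \<cdot> cnj w) / 2)\<close> enters only
  through the left invariant fields below: \<open>X_field j\<close> and \<open>Y_field j\<close> differentiate \<open>f\<close> at \<open>p\<close>
  along \<open>p(s e\<^sub>j, 0)\<close> and \<open>p(s \<i> e\<^sub>j, 0)\<close> at \<open>s = 0\<close>.
\<close>
type_synonym 'n heis = "(complex ^ 'n) \<times> real"

definition pd :: "'a \<Rightarrow> ('a::real_normed_vector \<Rightarrow> 'b::real_normed_vector) \<Rightarrow> 'a \<Rightarrow> 'b" where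
  "pd v f = (\<lambda>x. frechet_derivative f (at x) v)"

text \<open>\<open>iter_pd vs f\<close> is an arbitrary iterated partial derivative when \<open>set vs \<subseteq> Basis\<close>;
  the empty list gives \<open>f\<close> itself.\<close>
definition iter_pd :: "'a list \<Rightarrow> ('a::real_normed_vector \<Rightarrow> 'b::real_normed_vector) \<Rightarrow> 'a \<Rightarrow> 'b" where
  "iter_pd vs f = foldr pd vs f"

text \<open>Class \<open>C\<^sup>\<infinity>\<close> on the whole space.  Continuity of all the partial derivatives is implied,
  because each of them is required to be (Frechet) differentiable.\<close>
definition smooth :: "('a::euclidean_space \<Rightarrow> 'b::real_normed_vector) \<Rightarrow> bool" where
  "smooth f \<longleftrightarrow> (\<forall>vs. set vs \<subseteq> Basis \<longrightarrow> iter_pd vs f differentiable_on UNIV)"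

definition X_field :: "'n::finite \<Rightarrow> ('n heis \<Rightarrow> complex) \<Rightarrow> 'n heis \<Rightarrow> complex" where
  "X_field j f = (\<lambda>(z, t). pd (axis j 1, 0) f (z, t) + (Im (z $ j) / 2) *\<^sub>R pd (0, 1) f (z, t))"

definition Y_field :: "'n::finite \<Rightarrow> ('n heis \<Rightarrow> complex) \<Rightarrow> 'n heis \<Rightarrow> complex" where
  "Y_field j f = (\<lambda>(z, t). pd (axis j \<i>, 0) f (z, t) - (Re (z $ j) / 2) *\<^sub>R pd (0, 1) f (z, t))"

definition sublaplacian :: "('n::finite heis \<Rightarrow> complex) \<Rightarrow> 'n heis \<Rightarrow> complex" where
  "sublaplacian f = (\<lambda>p. - (\<Sum>j\<in>UNIV. X_field j (X_field j f) p + Y_field j (Y_field j f) p))"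

definition in_L2 :: "('a::euclidean_space \<Rightarrow> complex) \<Rightarrow> bool" where
  "in_L2 g \<longleftrightarrow> g \<in> borel_measurable lborel \<and> integrable lborel (\<lambda>p. (norm (g p))\<^sup>2)"

definition L2_norm :: "('a::euclidean_space \<Rightarrow> complex) \<Rightarrow> real" where
  "L2_norm g = sqrt (\<integral>p. (norm (g p))\<^sup>2 \<partial>lborel)"

text \<open>\<open>x\<^sup>-\<^sup>a\<close> for \<open>x \<ge> 0\<close>, with \<open>0\<^sup>-\<^sup>a = \<infinity>\<close> (whereas \<open>0 powr (-a) = 0\<close>).\<close>
definition neg_powr :: "real \<Rightarrow> real \<Rightarrow> ennreal" where
  "neg_powr x a = (if x = 0 then \<infinity> else ennreal (x powr (- a)))"

end

theory Submission
  imports Defs "HOL-Real_Asymp.Real_Asymp" "HOL-Probability.Probability" "HOL-Complex_Analysis.Complex_Analysis"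
begin

text \<open>
  Write \<open>L\<close> for the sublaplacian, a symmetric nonnegative operator, and let \<open>p\<^sub>\<tau>\<close> be its heat kernel.  The function
  \<open>u(\<tau>) = \<integral> f p\<^sub>\<tau>\<close> is the heat evolution of \<open>f\<close> at the origin; the functions \<open>q(L) f\<close>, for \<open>q\<close> a polynomial, all
  evolve from the value \<open>0\<close>, since \<open>f\<close> is flat there.  Hence, for \<open>a > 0\<close>, the functional
  \<open>\<psi>(q) = \<integral> \<tau>^n exp(-a \<tau>) (\<integral> q(L) f p\<^sub>\<tau>) d\<tau>\<close>, which is bounded by a multiple of the \<open>L\<^sup>2\<close> norm of \<open>q(L) f\<close>,
  annihilates the multiples of \<open>(x + a)^(n+1)\<close>.  If \<open>\<psi>((x + a)^n)\<close> were nonzero, evaluation of polynomials at the point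
  \<open>-a\<close> would be bounded for a Stieltjes moment functional built from the moments \<open>\<langle>L^m f, f\<rangle>\<close>; growth of the orthogonal
  polynomials together with Carleman's inequality shows that this contradicts the divergence of the series.  So
  \<open>\<psi>((x + a)^n) = n! \<integral> exp(-a \<tau>) u(\<tau>) d\<tau>\<close> vanishes for all \<open>a > 0\<close>, and \<open>u = 0\<close>.

  By the symmetry hypothesis \<open>f\<close> is a function \<open>H\<close> of the gauge \<open>(|z|^4 + t\<^sup>2)^(1/2)\<close>.  In polar coordinates adapted to the
  gauge, the Mellin transform of \<open>u\<close> is the product of the Mellin transform of \<open>H\<close> and an analytic factor that depends only
  on the heat kernel and is not identically zero because the kernel is positive near the origin.  Hence \<open>H = 0\<close>.
\<close>

subsection \<open>Functionals on polynomials and Carleman's theorem\<close>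

text \<open>Evaluation at the origin is unbounded on \<open>L\<^sup>2\<close>, so flatness cannot be
  played off directly against the norms of the functions L^m f. Averaging the heat evolution against
  \<tau>^n exp(-a \<tau>) amounts to applying a multiple of (L + a)^(-n-1), which tames the blow-up
  \<tau>^(-(n+1)/2) of the bound for the pairing with the kernel at short times. Each factor x + a
  of q lowers the power of \<tau> by one, and only the last of them meets the flatness; this is why
  the annihilated multiples are those of (x + a)^(n+1) and not of x + a. The point -a lies outside
  the half line on which the moments of L live. Bounded evaluation at such a point is the mark of an
  indeterminate moment problem, and Carleman's condition excludes exactly that. For the moment
  functional, L enters through its symmetry and nonnegativity on the functions q(L) f. This half of
  the argument yields the vanishing of one function of the single variable \<tau>. That determines f
  because the symmetry hypothesis leaves f a function of one variable, and dilations turn the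
  relation between the two into a multiplicative convolution.\<close>

definition mom :: "(nat \<Rightarrow> real) \<Rightarrow> real poly \<Rightarrow> real" where
  "mom h p = (\<Sum>i\<le>degree p. coeff p i * h i)"

lemma mom_eq: assumes "degree p \<le> N" shows "mom h p = (\<Sum>i\<le>N. coeff p i * h i)"
  unfolding mom_def
  by (rule sum.mono_neutral_left) (use assms in \<open>auto simp: coeff_eq_0\<close>)

lemma mom_add: "mom h (p + q) = mom h p + mom h q"
proof -
  let ?N = "max (degree p) (degree q)"
  have "degree (p + q) \<le> ?N" by (rule degree_add_le_max)
  then show ?thesis
    by (simp add: mom_eq[of _ ?N] algebra_simps sum.distrib)
qed

lemma mom_smult: "mom h (smult c p) = c * mom h p"
  by (simp add: mom_eq[of "smult c p" "degree p"] degree_smult_le mom_def sum_distrib_left mult.assoc)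

lemma mom_0 [simp]: "mom h 0 = 0"
  by (simp add: mom_def)

lemma mom_diff: "mom h (p - q) = mom h p - mom h q"
  using mom_add[of h p "smult (-1) q"] mom_smult[of h "-1" q] by simp

lemma mom_sum: "mom h (\<Sum>i\<in>A. f i) = (\<Sum>i\<in>A. mom h (f i))"
  by (induction A rule: infinite_finite_induct) (auto simp: mom_add)

lemma mom_pCons: "mom h (pCons a p) = a * h 0 + mom (\<lambda>i. h (Suc i)) p"
proof -
  have "mom h (pCons a p) = (\<Sum>i\<le>Suc (degree p). coeff (pCons a p) i * h i)"
    by (rule mom_eq) (rule degree_pCons_le)
  also have "\<dots> = a * h 0 + (\<Sum>i\<le>degree p. coeff p i * h (Suc i))"
    by (subst sum.atMost_Suc_shift) simp
  finally show ?thesis by (simp add: mom_def)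
qed

lemma mom_1 [simp]: "mom h 1 = h 0"
  by (simp add: mom_def)

lemma mom_monom: "mom h (monom c n) = c * h n"
  by (induction n arbitrary: h) (auto simp: monom_0 monom_Suc mom_pCons)

lemma mom_monom_mult: "mom h (monom 1 n * p) = mom (\<lambda>i. h (i + n)) p"
  by (induction n arbitrary: h) (auto simp: monom_0 monom_Suc mom_pCons)

lemma discriminant_nonneg:
  fixes a b c :: real
  assumes "\<And>t. 0 \<le> a + 2 * t * b + t\<^sup>2 * c" and c: "c \<ge> 0"
  shows "b\<^sup>2 \<le> a * c"
proof (cases "c = 0")
  case True
  have "b = 0"
  proof (rule ccontr)
    assume "b \<noteq> 0"
    \<comment> \<open>At this \<open>t\<close> the affine function a + 2tb has the value -1.\<close>
    with assms(1)[of "- (a + 1) / (2 * b)"] True show False by (simp add: field_simps)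
  qed
  with True show ?thesis by simp
next
  case False
  then have "c > 0" using c by simp
  with assms(1)[of "- b / c"] show ?thesis by (simp add: field_simps power2_eq_square)
qed

lemma mom_cauchy_schwarz:
  assumes "\<And>q. mom h (q * q) \<ge> 0"
  shows "(mom h (p * q))\<^sup>2 \<le> mom h (p * p) * mom h (q * q)"
proof (rule discriminant_nonneg)
  fix t :: real
  have "mom h ((p + smult t q) * (p + smult t q)) =
      mom h (p * p) + 2 * t * mom h (p * q) + t\<^sup>2 * mom h (q * q)"
    by (simp add: mom_add mom_smult power2_eq_square ring_distribs mult.commute[of q p])
  then show "0 \<le> mom h (p * p) + 2 * t * mom h (p * q) + t\<^sup>2 * mom h (q * q)"
    using assms[of "p + smult t q"] by simp
qed (rule assms)

text \<open>Carleman's proof by AM-GM: the weights \<open>c i = (i+1)^i / i^(i-1)\<close> satisfy \<open>c 1 \<cdots> c m = (m+1)^m\<close>,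
  which makes the resulting double sum telescope.\<close>

lemma prod_carleman_weights:
  "(\<Prod>i\<in>{1..m}. (real (i + 1) ^ i / real i ^ (i - 1))) = real (m + 1) ^ m"
proof (induction m)
  case (Suc m)
  have "(\<Prod>i\<in>{1..Suc m}. (real (i + 1) ^ i / real i ^ (i - 1)))
     = real (m + 1) ^ m * (real (Suc m + 1) ^ Suc m / real (Suc m) ^ m)"
    using Suc by (simp add: prod.nat_ivl_Suc')
  then show ?case by (simp add: add.commute)
qed simp

lemma carleman_inequality:
  fixes a :: "nat \<Rightarrow> real"
  assumes a: "\<And>i. a i \<ge> 0"
  shows "(\<Sum>m=1..N. (\<Prod>i=1..m. a i) powr (1 / real m)) \<le> exp 1 * (\<Sum>i=1..N. a i)"
proof -
  define c where "c i = real (i + 1) ^ i / real i ^ (i - 1)" for i :: nat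
  have cpos: "c i \<ge> 0" for i by (simp add: c_def)
  \<comment> \<open>The quotient is (1 + 1/i)^i, hence the constant e of the inequality.\<close>
  have c_le: "c i / real i \<le> exp 1" if "i \<ge> 1" for i
  proof -
    have "c i / real i = (real (i + 1) / real i) ^ i"
      using that by (cases i) (auto simp: c_def power_divide)
    also have "\<dots> = (1 + 1 / real i) ^ i" using that by (simp add: field_simps)
    also have "\<dots> \<le> exp (1 / real i) ^ i"
      by (intro power_mono) (auto simp: exp_ge_add_one_self)
    also have "\<dots> = exp 1" using that by (simp flip: exp_of_nat_mult)
    finally show ?thesis .
  qed
  have step: "(\<Prod>i=1..m. a i) powr (1 / real m) \<le> (\<Sum>i=1..m. c i * a i) / (real m * real (m + 1))"
    if m: "m \<ge> 1" for m
  proof -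
    have "((\<Prod>i=1..m. c i * a i)) = real (m+1) ^ m * (\<Prod>i=1..m. a i)"
      using prod_carleman_weights[of m] unfolding c_def prod.distrib by simp
    then have "(\<Prod>i=1..m. c i * a i) powr (1 / real m) = real (m+1) * (\<Prod>i=1..m. a i) powr (1 / real m)"
      using m by (simp add: powr_mult prod_nonneg a powr_powr flip: powr_realpow)
    moreover have "(\<Prod>i=1..m. c i * a i) powr (1 / real m) \<le> (\<Sum>i=1..m. c i * a i / real m)"
    proof -
      have "(\<Prod>i\<in>{1..m}. (c i * a i)) powr (1 / real m) = (\<Prod>i\<in>{1..m}. (c i * a i) powr (1 / real m))"
        by (simp add: prod_powr_distrib a cpos)
      also have "\<dots> \<le> (\<Sum>i\<in>{1..m}. (1 / real m) * (c i * a i))"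
        using arith_geom_mean[of "{1..m}" "\<lambda>i. c i * a i"] m a cpos
        by (simp add: prod_powr_distrib root_powr_inverse sum_distrib_left sum_divide_distrib prod_nonneg)
      finally show ?thesis by (simp add: algebra_simps)
    qed
    ultimately have "real (m+1) * (\<Prod>i=1..m. a i) powr (1 / real m) \<le> (\<Sum>i=1..m. c i * a i) / real m"
      by (simp add: sum_divide_distrib)
    then have "(\<Prod>i=1..m. a i) powr (1 / real m) \<le> (\<Sum>i=1..m. c i * a i) / real m / real (m + 1)"
      by (subst pos_le_divide_eq) (auto simp: mult.commute)
    then show ?thesis by simp
  qed
  have tele: "(\<Sum>m=i..N. 1 / (real m * real (m + 1))) = 1 / real i - 1 / real (N + 1)" if "1 \<le> i" "i \<le> N" for i
    using that(2)
  proof (induction N rule: dec_induct)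
    case base then show ?case using that by (simp add: field_simps)
  next
    case (step k)
    have "1 / (real (Suc k) * real (Suc k + 1)) = 1 / real (k + 1) - 1 / real (Suc k + 1)"
      by (simp add: field_simps)
    then show ?case using step that by simp
  qed
  have "(\<Sum>m=1..N. (\<Prod>i=1..m. a i) powr (1 / real m)) \<le> (\<Sum>m=1..N. \<Sum>i=1..m. c i * a i / (real m * real (m + 1)))"
    by (intro sum_mono) (use step in \<open>auto simp: sum_divide_distrib\<close>)
  also have "\<dots> = (\<Sum>i=1..N. \<Sum>m=i..N. c i * a i / (real m * real (m + 1)))"
  proof -
    have "(\<Sum>m=1..N. \<Sum>i=1..m. g i m) = (\<Sum>i=1..N. \<Sum>m=i..N. g i m)" for g :: "nat \<Rightarrow> nat \<Rightarrow> real"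
    proof -
      have "(\<Sum>m=1..N. \<Sum>i=1..m. g i m) = (\<Sum>m=1..N. \<Sum>i | i \<in> {1..N} \<and> i \<le> m. g i m)"
        by (intro sum.cong) auto
      also have "\<dots> = (\<Sum>i=1..N. \<Sum>m | m \<in> {1..N} \<and> i \<le> m. g i m)"
        by (rule sum.swap_restrict) auto
      also have "\<dots> = (\<Sum>i=1..N. \<Sum>m=i..N. g i m)"
        by (intro sum.cong) auto
      finally show ?thesis .
    qed
    then show ?thesis .
  qed
  also have "\<dots> \<le> (\<Sum>i=1..N. exp 1 * a i)"
  proof (rule sum_mono)
    fix i assume i: "i \<in> {1..N}"
    have "(\<Sum>m=i..N. c i * a i / (real m * real (m + 1))) = c i * a i * (1 / real i - 1 / real (N + 1))"
      using tele[of i] i by (simp only: divide_inverse flip: sum_distrib_left) simp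
    also have "\<dots> \<le> c i * a i * (1 / real i)" by (intro mult_left_mono) (auto simp: a cpos)
    also have "\<dots> = (c i / real i) * a i" by simp
    also have "\<dots> \<le> exp 1 * a i" using c_le[of i] i a by (intro mult_right_mono) auto
    finally show "(\<Sum>m=i..N. c i * a i / (real m * real (m + 1))) \<le> exp 1 * a i" .
  qed
  finally show ?thesis by (simp add: sum_distrib_left)
qed

section \<open>Orthogonal polynomials of a symmetric functional with bounded evaluation on the
  imaginary axis\<close>

locale symmetric_moments =
  fixes h :: "nat \<Rightarrow> real" and y c :: real
  assumes psd: "mom h (q * q) \<ge> 0"
    and odd_moment: "odd i \<Longrightarrow> h i = 0"
    and y_pos: "y > 0"
    and bound: "(c * mom (\<lambda>i. y ^ i * (- 1) ^ (i div 2)) q)\<^sup>2 \<le> mom h (q * q)"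
    and c_pos: "c > 0"
begin

abbreviation "X \<equiv> [:0, 1:] :: real poly"

text \<open>On a polynomial of parity \<open>i\<close>, \<open>ev\<close> is the value at \<open>\<i> y\<close> divided by \<open>\<i>^(i mod 2)\<close>.\<close>
definition ev :: "real poly \<Rightarrow> real" where
  "ev = mom (\<lambda>i. y ^ i * (- 1) ^ (i div 2))"

definition parity :: "nat \<Rightarrow> real poly \<Rightarrow> bool" where
  "parity m q \<longleftrightarrow> (\<forall>i. odd (i + m) \<longrightarrow> coeff q i = 0)"

lemma parity_X: "parity m q \<Longrightarrow> parity (Suc m) (X * q)"
  by (auto simp: parity_def coeff_pCons split: nat.split)

lemma parity_Suc2: "parity m q \<Longrightarrow> parity (Suc (Suc m)) q"
  by (auto simp: parity_def)

lemma parity_diff: "parity m p \<Longrightarrow> parity m q \<Longrightarrow> parity m (p - smult b q)"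
  by (auto simp: parity_def)

lemma parity_mult: assumes "parity m p" "parity k q" shows "parity (m + k) (p * q)"
  unfolding parity_def
proof (intro allI impI)
  fix i assume i: "odd (i + (m + k))"
  have "coeff p j * coeff q (i - j) = 0" if "j \<le> i" for j
  proof -
    have "i + (m + k) = (j + m) + (i - j + k)" using that by simp
    then have "odd (j + m) \<or> odd (i - j + k)" using i by (metis odd_add)
    then have "coeff p j = 0 \<or> coeff q (i - j) = 0" using assms unfolding parity_def by blast
    then show ?thesis by simp
  qed
  then show "coeff (p * q) i = 0" unfolding coeff_mult by (intro sum.neutral) blast
qed

lemma mom_odd: "parity m q \<Longrightarrow> odd m \<Longrightarrow> mom h q = 0"
  unfolding mom_def parity_def using odd_moment by (intro sum.neutral) fastforce

text \<open>Multiplication by \<open>\<i> y\<close> turns the real values of even polynomials into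
  imaginary ones; on odd polynomials it contributes \<i>^2 = -1, hence the sign.\<close>

lemma ev_X:
  assumes "parity m q"
  shows "ev (X * q) = (if even m then y else - y) * ev q"
proof -
  have "ev (X * q) = mom (\<lambda>i. y ^ Suc i * (- 1) ^ (Suc i div 2)) q"
    by (simp add: ev_def mom_pCons)
  also have "\<dots> = (if even m then y else - y) * ev q"
    unfolding ev_def mom_def sum_distrib_left
  proof (intro sum.cong refl)
    fix i
    show "coeff q i * (y ^ Suc i * (- 1) ^ (Suc i div 2)) =
        (if even m then y else - y) * (coeff q i * (y ^ i * (- 1) ^ (i div 2)))"
    proof (cases "odd (i + m)")
      case True then show ?thesis using assms by (auto simp: parity_def)
    next
      case False
      then have "even m \<longleftrightarrow> even i" by simp
      then show ?thesis by (cases "even i") (simp_all add: even_Suc_div_two odd_Suc_div_two)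
    qed
  qed
  finally show ?thesis .
qed

text \<open>The monic orthogonal polynomials of the functional \<open>mom h\<close>, by their three-term recurrence.\<close>
fun opoly :: "nat \<Rightarrow> real poly" where
  "opoly 0 = 1"
| "opoly (Suc 0) = X"
| "opoly (Suc (Suc m)) = X * opoly (Suc m) -
     smult (mom h (opoly (Suc m) * opoly (Suc m)) / mom h (opoly m * opoly m)) (opoly m)"

definition H where "H m = mom h (opoly m * opoly m)"
definition \<beta> where "\<beta> m = H (Suc m) / H m"

lemma opoly_rec: "opoly (Suc (Suc m)) = X * opoly (Suc m) - smult (\<beta> m) (opoly m)"
  by (simp add: \<beta>_def H_def)

lemma parity_opoly: "parity m (opoly m)"
proof (induction m rule: opoly.induct)
  case 3
  then show ?case unfolding opoly_rec by (intro parity_diff parity_X parity_Suc2)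
qed (auto simp: parity_def coeff_pCons odd_pos split: nat.split)

lemma degree_opoly: "degree (opoly m) = m \<and> coeff (opoly m) m = 1"
proof (induction m rule: opoly.induct)
  case (3 m)
  have "degree (X * opoly (Suc m)) = Suc (Suc m)"
    using 3 by (subst degree_mult_eq) auto
  moreover have "degree (smult (\<beta> m) (opoly m)) < Suc (Suc m)"
    using 3 degree_smult_le[of "\<beta> m" "opoly m"] by linarith
  ultimately show ?case
    unfolding opoly_rec using 3
    by (auto simp: degree_add_eq_left coeff_eq_0 coeff_pCons diff_conv_add_uminus simp del: add_uminus_conv_diff)
qed auto

text \<open>\<open>\<rho> m\<close> is the pair of the moduli of \<open>opoly m\<close> and \<open>opoly (Suc m)\<close> at \<open>\<i> y\<close>.\<close>
primrec \<rho> where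
  "\<rho> 0 = (1::real, y)"
| "\<rho> (Suc m) = (snd (\<rho> m), y * snd (\<rho> m) + \<beta> m * fst (\<rho> m))"

lemma H_nonneg: "H m \<ge> 0" by (simp add: H_def psd)
lemma \<beta>_nonneg: "\<beta> m \<ge> 0" by (simp add: \<beta>_def H_nonneg)

text \<open>At \<open>\<i> y\<close> the two terms of the three-term recurrence have the same phase,
  so the moduli add and no cancellation can occur. Nonnegative coefficients suffice for this; that
  they are positive only follows from \<open>H_pos\<close>.\<close>

lemma \<rho>_pos: "fst (\<rho> m) > 0 \<and> snd (\<rho> m) > 0"
  by (induction m) (use y_pos \<beta>_nonneg in \<open>auto intro!: add_pos_nonneg\<close>)

lemma ev_opoly: "ev (opoly m) = (- 1) ^ (m div 2) * fst (\<rho> m)"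
proof (induction m rule: opoly.induct)
  case (3 m)
  have "ev (opoly (Suc (Suc m))) = ev (X * opoly (Suc m)) - \<beta> m * ev (opoly m)"
    unfolding opoly_rec ev_def by (simp add: mom_diff mom_smult)
  also have "\<dots> = (if even (Suc m) then y else - y) * ev (opoly (Suc m)) - \<beta> m * ev (opoly m)"
    by (simp only: ev_X[OF parity_opoly])
  finally show ?case using 3
    by (cases "even m") (simp_all add: even_Suc_div_two odd_Suc_div_two algebra_simps del: opoly.simps)
qed (auto simp: ev_def mom_pCons)

text \<open>The functional is assumed semidefinite only. Nondegeneracy comes from
  \<open>bound\<close>, which says that the sum of the real and imaginary part of the value at
  \<open>\<i> y\<close> is a bounded functional, and from \<open>opoly m\<close> not vanishing
  there. Up to this point a quotient by \<open>H m = 0\<close> would have been 0 by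
  convention.\<close>

lemma H_pos: "H m > 0"
proof -
  have "(c * ev (opoly m))\<^sup>2 \<le> H m"
    using bound[of "opoly m"] by (simp add: ev_def H_def)
  moreover have "(c * ev (opoly m))\<^sup>2 > 0"
    using c_pos \<rho>_pos[of m] by (simp add: ev_opoly)
  ultimately show ?thesis by linarith
qed

lemma X_opoly: "\<exists>b. X * opoly j = opoly (Suc j) + smult b (opoly (j - 1)) \<and> (j = 0 \<longrightarrow> b = 0)"
proof (cases j)
  case 0 then show ?thesis by (intro exI[of _ 0]) simp
next
  case (Suc i)
  then show ?thesis by (intro exI[of _ "\<beta> i"]) (simp add: opoly_rec del: opoly.simps)
qed

text \<open>Induction along the recurrence. Neighbours are orthogonal by parity; for smaller
  \<open>j\<close> the factor \<open>X\<close> is moved over to \<open>opoly j\<close>, and for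
  \<open>j = k\<close> the coefficient \<open>\<beta> k\<close> is the one that cancels the norm
  which remains.\<close>

lemma orthogonal_aux: "i \<le> m \<Longrightarrow> j < i \<Longrightarrow> mom h (opoly i * opoly j) = 0"
proof (induction m arbitrary: i j)
  case (Suc m)
  show ?case
  proof (cases "i \<le> m")
    case False
    then have i: "i = Suc m" using Suc by simp
    show ?thesis
    proof (cases "j = m")
      case True
      then show ?thesis using mom_odd[OF parity_mult[OF parity_opoly[of i] parity_opoly[of j]]] i by simp
    next
      case False
      then obtain k where m: "m = Suc k" using i Suc.prems by (cases m) auto
      then have j: "j \<le> k" using i Suc.prems False by simp
      obtain b where b: "X * opoly j = opoly (Suc j) + smult b (opoly (j - 1))" "j = 0 \<longrightarrow> b = 0"
        using X_opoly by blast
      have "mom h (opoly i * opoly j) = mom h (opoly m * (X * opoly j)) - \<beta> k * mom h (opoly k * opoly j)"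
      proof -
        have "opoly i * opoly j = opoly m * (X * opoly j) - smult (\<beta> k) (opoly k * opoly j)"
          unfolding i m opoly_rec left_diff_distrib mult_smult_left by (simp only: mult_ac)
        then show ?thesis by (simp only: mom_diff mom_smult)
      qed
      also have "mom h (opoly m * (X * opoly j)) = mom h (opoly m * opoly (Suc j)) + b * mom h (opoly m * opoly (j - 1))"
        unfolding b(1) by (simp only: distrib_left mult_smult_right mom_add mom_smult)
      also have "b * mom h (opoly m * opoly (j - 1)) = 0"
        using b(2) Suc.IH[of m "j - 1"] j m by (cases "j = 0") auto
      also have "mom h (opoly m * opoly (Suc j)) + 0 - \<beta> k * mom h (opoly k * opoly j) = 0"
      proof (cases "j = k")
        case True
        then show ?thesis using H_pos[of k] m by (simp add: \<beta>_def flip: H_def)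
      next
        case False
        then show ?thesis using Suc.IH[of m "Suc j"] Suc.IH[of k j] j m by simp
      qed
      finally show ?thesis .
    qed
  qed (use Suc in auto)
qed auto

lemma orthogonal_opoly: "i \<noteq> j \<Longrightarrow> mom h (opoly i * opoly j) = 0"
  using orthogonal_aux[of i i j] orthogonal_aux[of j j i] by (cases "i < j") (auto simp: mult.commute)

lemma orthogonal_low_degree: "degree q < m \<Longrightarrow> mom h (opoly m * q) = 0"
proof (induction "degree q" arbitrary: q rule: less_induct)
  case less
  let ?r = "q - smult (lead_coeff q) (opoly (degree q))"
  have q: "mom h (opoly m * q) = mom h (opoly m * ?r)"
    using orthogonal_opoly[of m "degree q"] less.prems by (simp add: right_diff_distrib mom_diff mom_smult)
  show ?case
  proof (cases "degree q = 0")
    case True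
    then have "q = smult (lead_coeff q) (opoly 0)" by (metis degree_0_id opoly.simps(1) smult_one)
    then have "?r = 0" using True by simp
    then show ?thesis using q by simp
  next
    case False
    have "degree ?r \<le> degree q"
      using degree_opoly[of "degree q"] by (intro degree_diff_le) (auto intro: order_trans[OF degree_smult_le])
    moreover have "coeff ?r (degree q) = 0" using degree_opoly[of "degree q"] by simp
    ultimately have "degree ?r < degree q"
      using False eq_zero_or_degree_less[of ?r "degree q"] by fastforce
    then show ?thesis using less.hyps[of ?r] less.prems q by simp
  qed
qed

text \<open>Among monic polynomials of degree \<open>m\<close> the orthogonal one has least norm: it
  differs from x^m by lower degrees, to which it is orthogonal, so that Cauchy-Schwarz against x^m
  gives the bound.\<close>

lemma H_le: "H m \<le> h (2 * m)"
proof -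
  have "degree (monom 1 m - opoly m) < m \<or> m = 0"
  proof (cases "m = 0")
    case False
    have "degree (monom 1 m - opoly m) \<le> m"
      using degree_opoly[of m] by (intro degree_diff_le) (auto simp: degree_monom_le)
    moreover have "coeff (monom 1 m - opoly m) m = 0" using degree_opoly[of m] by simp
    ultimately show ?thesis using False eq_zero_or_degree_less[of "monom 1 m - opoly m" m] by fastforce
  qed simp
  then have "mom h (opoly m * (monom 1 m - opoly m)) = 0"
    using orthogonal_low_degree by (cases "m = 0") (auto simp: monom_0 one_pCons)
  then have "H m = mom h (opoly m * monom 1 m)"
    by (simp add: H_def right_diff_distrib mom_diff)
  then have "(H m)\<^sup>2 \<le> H m * mom h (monom 1 m * monom 1 m)"
    using mom_cauchy_schwarz[of h "opoly m" "monom 1 m"] psd by (simp add: H_def)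
  then have "H m * H m \<le> H m * h (2 * m)"
    by (simp add: mult_monom mom_monom power2_eq_square mult_2)
  then show ?thesis using H_pos[of m] by simp
qed

text \<open>Modulus at \<open>\<i> y\<close> of the orthonormal polynomial of degree
  \<open>m\<close>.\<close>

definition r where "r m = fst (\<rho> m) / sqrt (H m)"

lemma r_pos: "r m > 0" using \<rho>_pos[of m] H_pos[of m] by (simp add: r_def)

text \<open>The test polynomial \<open>q\<close> is the truncated reproducing kernel at
  \<open>\<i> y\<close>. Both \<open>ev q\<close> and its squared norm equal \<open>S\<close>, so
  \<open>bound\<close> reads (c S)^2 \<le> S.\<close>

lemma sum_r_bound: "(\<Sum>m\<le>N. (r m)\<^sup>2) \<le> 1 / c\<^sup>2"
proof -
  define S where "S = (\<Sum>m\<le>N. (r m)\<^sup>2)"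
  define e where "e m = r m * (- 1) ^ (m div 2) / sqrt (H m)" for m
  define q where "q = (\<Sum>m\<le>N. smult (e m) (opoly m))"
  have "ev q = (\<Sum>m\<le>N. e m * ev (opoly m))"
    by (simp add: q_def ev_def mom_sum mom_smult)
  also have "\<dots> = S"
    unfolding S_def by (intro sum.cong) (auto simp: e_def ev_opoly r_def power2_eq_square field_simps simp flip: power_add)
  finally have ev: "ev q = S" .
  have "mom h (q * q) = (\<Sum>i\<le>N. \<Sum>j\<le>N. e i * (e j * mom h (opoly i * opoly j)))"
    by (simp add: q_def sum_product mom_sum mom_smult mult_ac)
  also have "\<dots> = (\<Sum>i\<le>N. \<Sum>j\<le>N. if i = j then (e i)\<^sup>2 * H i else 0)"
    by (intro sum.cong refl) (auto simp: orthogonal_opoly H_def power2_eq_square)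
  also have "\<dots> = (\<Sum>i\<le>N. (e i)\<^sup>2 * H i)" by simp
  also have "\<dots> = S"
    unfolding S_def using H_pos less_imp_neq[OF H_pos, symmetric]
    by (intro sum.cong) (auto simp: e_def power_mult_distrib power_divide less_imp_le simp flip: power_mult)
  finally have "(c * S)\<^sup>2 \<le> S" using bound[of q] ev by (simp add: ev_def)
  then have "S * (c\<^sup>2 * S) \<le> S * 1" by (simp add: power2_eq_square mult_ac)
  moreover have "S > 0" unfolding S_def using r_pos by (intro sum_pos zero_less_power r_pos) auto
  ultimately have "c\<^sup>2 * S \<le> 1" by simp
  then show ?thesis using c_pos by (simp add: S_def field_simps)
qed

text \<open>By the recurrence the quotient \<open>snd (\<rho> m) * fst (\<rho> m) / H m\<close> does
  not decrease with \<open>m\<close>, and at 0 it equals \<open>y / H 0\<close>.\<close>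

lemma r_prod: "r m * r (Suc m) \<ge> (y / H 0) / sqrt (\<beta> m)"
proof -
  have *: "snd (\<rho> m) * fst (\<rho> m) / H m \<ge> y / H 0"
  proof (induction m)
    case 0 then show ?case by simp
  next
    case (Suc m)
    have "snd (\<rho> (Suc m)) * fst (\<rho> (Suc m)) / H (Suc m) =
        y * (snd (\<rho> m))\<^sup>2 / H (Suc m) + snd (\<rho> m) * fst (\<rho> m) / H m"
      using H_pos[of m] H_pos[of "Suc m"] by (simp add: \<beta>_def field_simps power2_eq_square)
    moreover have "y * (snd (\<rho> m))\<^sup>2 / H (Suc m) \<ge> 0" using y_pos H_pos[of "Suc m"] by simp
    ultimately show ?case using Suc by linarith
  qed
  have "r m * r (Suc m) = (snd (\<rho> m) * fst (\<rho> m) / H m) / sqrt (\<beta> m)"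
    using H_pos[of m] H_pos[of "Suc m"]
    by (simp add: r_def \<beta>_def real_sqrt_divide field_simps)
  also have "\<dots> \<ge> (y / H 0) / sqrt (\<beta> m)"
    by (rule divide_right_mono) (use * \<beta>_nonneg in auto)
  finally show ?thesis .
qed

text \<open>Square summability of \<open>r\<close> controls the sum of the products of neighbours,
  and by \<open>r_prod\<close> these dominate the terms on the left up to the factor
  \<open>y / H 0\<close>.\<close>

lemma sum_inverse_sqrt_\<beta>: "(\<Sum>m\<le>N. 1 / sqrt (\<beta> m)) \<le> (H 0 / y) * (1 / c\<^sup>2)"
proof -
  have "(y / H 0) * (\<Sum>m\<le>N. 1 / sqrt (\<beta> m)) = (\<Sum>m\<le>N. (y / H 0) / sqrt (\<beta> m))"
    by (simp add: sum_distrib_left)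
  also have "\<dots> \<le> (\<Sum>m\<le>N. ((r m)\<^sup>2 + (r (Suc m))\<^sup>2) / 2)"
  proof (rule sum_mono)
    fix m
    have "r m * r (Suc m) \<le> ((r m)\<^sup>2 + (r (Suc m))\<^sup>2) / 2"
      using sum_squares_bound[of "r m" "r (Suc m)"] by simp
    then show "(y / H 0) / sqrt (\<beta> m) \<le> ((r m)\<^sup>2 + (r (Suc m))\<^sup>2) / 2" using r_prod[of m] by linarith
  qed
  also have "\<dots> = ((\<Sum>m\<le>N. (r m)\<^sup>2) + (\<Sum>m\<le>N. (r (Suc m))\<^sup>2)) / 2"
    by (simp add: sum.distrib flip: sum_divide_distrib)
  also have "(\<Sum>m\<le>N. (r (Suc m))\<^sup>2) \<le> (\<Sum>m\<le>Suc N. (r m)\<^sup>2)"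
    by (simp only: sum.atMost_Suc_shift) simp
  also have "((\<Sum>m\<le>N. (r m)\<^sup>2) + (\<Sum>m\<le>Suc N. (r m)\<^sup>2)) / 2 \<le> 1 / c\<^sup>2"
    using sum_r_bound[of N] sum_r_bound[of "Suc N"] by (simp add: field_simps)
  finally have "(y / H 0) * (\<Sum>m\<le>N. 1 / sqrt (\<beta> m)) \<le> 1 / c\<^sup>2" by simp
  then have "(H 0 / y) * ((y / H 0) * (\<Sum>m\<le>N. 1 / sqrt (\<beta> m))) \<le> (H 0 / y) * (1 / c\<^sup>2)"
    using y_pos H_pos[of 0] by (intro mult_left_mono) auto
  then show ?thesis using y_pos H_pos[of 0] by simp
qed

lemma H_prod: "H m = H 0 * (\<Prod>i=1..m. \<beta> (i - 1))"
proof (induction m)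
  case (Suc m)
  have "H (Suc m) = H m * \<beta> m" using H_pos[of m] by (simp add: \<beta>_def)
  also have "H m = H 0 * (\<Prod>i=1..m. \<beta> (i - 1))" by (rule Suc)
  finally show ?case by (simp add: prod.nat_ivl_Suc' mult_ac)
qed simp

text \<open>The moment \<open>h (2 * m)\<close> is at least \<open>H m\<close>, which is
  \<open>H 0\<close> times a product of the coefficients \<beta>. Its negative 2m-th root is thus
  governed by the geometric mean of the numbers 1 / sqrt \<beta>, and Carleman's inequality bounds
  the sum of these means by the sum of the numbers themselves.\<close>

theorem summable_moments: "summable (\<lambda>m. h (2 * Suc m) powr (- 1 / (2 * real (Suc m))))"
proof -
  \<comment> \<open>An upper bound for \<open>H 0\<close> to the power -1/(2m), uniform in m \<ge>
    1.\<close>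
  define D where "D = max 1 (H 0 powr (- 1 / 2))"
  have trm: "h (2 * m) powr (- 1 / (2 * real m)) \<le> D * (\<Prod>i=1..m. 1 / sqrt (\<beta> (i - 1))) powr (1 / real m)"
    if m: "m \<ge> 1" for m
  proof -
    have P: "(\<Prod>i=1..m. \<beta> (i - 1)) > 0"
      using H_prod[of m] H_pos[of m] H_pos[of 0] by (metis zero_less_mult_pos)
    have "h (2 * m) powr (- 1 / (2 * real m)) \<le> H m powr (- 1 / (2 * real m))"
      using H_le[of m] H_pos[of m] by (intro powr_mono2') auto
    also have "\<dots> = H 0 powr (- 1 / (2 * real m)) * (\<Prod>i=1..m. \<beta> (i - 1)) powr (- 1 / (2 * real m))"
      unfolding H_prod[of m] using P H_pos[of 0] by (simp add: powr_mult)
    also have "(\<Prod>i=1..m. \<beta> (i - 1)) powr (- 1 / (2 * real m)) = (\<Prod>i=1..m. 1 / sqrt (\<beta> (i - 1))) powr (1 / real m)"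
    proof -
      have "(\<Prod>i=1..m. 1 / sqrt (\<beta> (i - 1))) = (\<Prod>i=1..m. (\<beta> (i - 1)) powr (- 1 / 2))"
        by (intro prod.cong) (auto simp: \<beta>_nonneg powr_minus_divide powr_half_sqrt)
      also have "\<dots> = (\<Prod>i=1..m. \<beta> (i - 1)) powr (- 1 / 2)"
        by (simp add: prod_powr_distrib \<beta>_nonneg)
      finally show ?thesis by (simp add: powr_powr)
    qed
    also have "H 0 powr (- 1 / (2 * real m)) = (H 0 powr (- 1 / 2)) powr (1 / real m)"
      by (simp add: powr_powr)
    also have "\<dots> \<le> D powr (1 / real m)" by (intro powr_mono2) (auto simp: D_def)
    also have "\<dots> \<le> D powr 1" using m by (intro powr_mono) (auto simp: D_def)
    also have "\<dots> = D" by (simp add: D_def)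
    finally show ?thesis by (simp add: mult_right_mono)
  qed
  have nn: "h (2 * Suc m) powr (- 1 / (2 * real (Suc m))) \<ge> 0" for m by simp
  show ?thesis
  proof (rule bounded_imp_summable[OF nn])
    fix N
    have "(\<Sum>m\<le>N. h (2 * Suc m) powr (- 1 / (2 * real (Suc m)))) = (\<Sum>m=1..Suc N. h (2 * m) powr (- 1 / (2 * real m)))"
      by (simp only: atMost_atLeast0 sum.atLeast_Suc_atMost_Suc_shift One_nat_def o_def)
    also have "\<dots> \<le> (\<Sum>m=1..Suc N. D * (\<Prod>i=1..m. 1 / sqrt (\<beta> (i - 1))) powr (1 / real m))"
      by (intro sum_mono trm) simp
    also have "\<dots> \<le> D * (exp 1 * (\<Sum>i=1..Suc N. 1 / sqrt (\<beta> (i - 1))))"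
      unfolding sum_distrib_left[of D, symmetric]
      by (intro mult_left_mono carleman_inequality) (auto simp: D_def \<beta>_nonneg)
    also have "(\<Sum>i=1..Suc N. 1 / sqrt (\<beta> (i - 1))) = (\<Sum>m\<le>N. 1 / sqrt (\<beta> m))"
      by (simp only: atMost_atLeast0 sum.atLeast_Suc_atMost_Suc_shift One_nat_def o_def diff_Suc_Suc diff_zero)
    also have "D * (exp 1 * \<dots>) \<le> D * (exp 1 * ((H 0 / y) * (1 / c\<^sup>2)))"
      using sum_inverse_sqrt_\<beta>[of N] by (intro mult_left_mono) (auto simp: D_def)
    finally show "(\<Sum>m\<le>N. h (2 * Suc m) powr (- 1 / (2 * real (Suc m)))) \<le> D * (exp 1 * ((H 0 / y) * (1 / c\<^sup>2)))" .
  qed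
qed

lemma moment_pos: "h (2 * m) > 0" using H_pos[of m] H_le[of m] by linarith
end

section \<open>Functionals on the half line, made symmetric by squaring the variable\<close>

lemma mom_pcompose_square: "mom g (pcompose p [:0, 0, 1:]) = mom (\<lambda>i. g (2 * i)) p"
proof (induction p arbitrary: g)
  case (pCons a p)
  have "pcompose (pCons a p) [:0, 0, 1:] = pCons a (pCons 0 (pcompose p [:0, 0, 1:]))"
    by (simp add: pcompose_pCons)
  then show ?case by (simp add: mom_pCons pCons.IH)
qed simp

lemma even_odd_decomposition:
  fixes q :: "real poly"
  obtains p r where "q = pcompose p [:0, 0, 1:] + pCons 0 (pcompose r [:0, 0, 1:])"
proof -
  have "\<exists>p r. q = pcompose p [:0, 0, 1:] + pCons 0 (pcompose r [:0, 0, 1:])"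
  proof (induction q)
    case 0 show ?case by (intro exI[of _ 0]) simp
  next
    case (pCons a q)
    then obtain p r where q: "q = pcompose p [:0, 0, 1:] + pCons 0 (pcompose r [:0, 0, 1:])" by blast
    have "pCons a q = pcompose (pCons a r) [:0, 0, 1:] + pCons 0 (pcompose p [:0, 0, 1:])"
      by (subst q) (simp add: pcompose_pCons)
    then show ?case by blast
  qed
  then show ?thesis using that by blast
qed

lemma mom_shifted: "mom (\<lambda>m. mom s (B * monom 1 m)) p = mom s (B * p)"
proof (induction p arbitrary: B)
  case (pCons a p)
  have "mom s (B * monom 1 (Suc m)) = mom s ((B * [:0, 1:]) * monom 1 m)" for m
    by (simp add: monom_Suc)
  then have "mom (\<lambda>m. mom s (B * monom 1 m)) (pCons a p) = a * mom s B + mom s ((B * [:0, 1:]) * p)"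
    by (simp add: mom_pCons pCons.IH monom_0 one_pCons[symmetric] del: mult_pCons_right mult_pCons_left)
  also have "\<dots> = mom s (B * pCons a p)" by (simp add: mom_add mom_smult)
  finally show ?case .
qed simp

lemma mom_power: "mom (\<lambda>i. x ^ i) p = poly p x"
  unfolding mom_def by (simp add: poly_altdef)

text \<open>The increments of a convex sequence increase: either the sequence climbs from index
  \<open>i\<close> to \<open>s N\<close>, or it has descended from \<open>s 0\<close> to
  \<open>s i\<close>.\<close>

lemma convex_sequence_le_max:
  fixes s :: "nat \<Rightarrow> real"
  assumes conv: "\<And>j. 2 * s (Suc j) \<le> s j + s (Suc (Suc j))" and "i \<le> N"
  shows "s i \<le> max (s 0) (s N)"
proof -
  define d where "d j = s (Suc j) - s j" for j
  have inc: "incseq d" by (rule incseq_SucI) (use conv in \<open>simp add: d_def algebra_simps\<close>)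
  show ?thesis
  proof (cases "d i \<ge> 0")
    case True
    have "s i \<le> s N" using \<open>i \<le> N\<close>
    proof (induction N rule: dec_induct)
      case (step n)
      then have "d n \<ge> 0" using incseqD[OF inc, of i n] True by simp
      then show ?case using step by (simp add: d_def)
    qed simp
    then show ?thesis by simp
  next
    case False
    have "s i \<le> s j" if "j \<le> i" for j
      using that
    proof (induction j rule: inc_induct)
      case (step n)
      then have "d n < 0" using incseqD[OF inc, of n i] False by simp
      then show ?case using step by (simp add: d_def)
    qed simp
    then show ?thesis using le0 by (simp add: le_max_iff_disj)
  qed
qed

text \<open>Carleman's condition tolerates a constant factor and a bounded shift of the index. The
  shift changes the exponent 1/(4J) into 1/(4(J+K)). Terms below J^(-2) are summable in any case,
  and above this threshold the change of exponent costs at most the factor exp(2K).\<close>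

lemma carleman_shift:
  fixes s t :: "nat \<Rightarrow> real"
  assumes D: "D \<ge> 1" and t_pos: "\<And>m. t m > 0" and t_le: "\<And>j. t (2 * j) \<le> D * max 1 (s (2 * (j + K)))"
    and t_sum: "summable (\<lambda>m. t (Suc m) powr (- 1 / (2 * real (Suc m))))"
  shows "summable (\<lambda>m. s (2 * Suc m) powr (- 1 / (4 * real (Suc m))))"
proof -
  \<comment> \<open>Of the series for \<open>t\<close> only the even indices are kept:
    \<open>Suc (2 * j + 1)\<close> is \<open>2 * Suc j\<close>, and the exponent becomes 1/(4 Suc
    j).\<close>
  have "summable ((\<lambda>m. t (Suc m) powr (- 1 / (2 * real (Suc m)))) \<circ> (\<lambda>j. 2 * j + 1))"
    by (rule summable_reindex[OF t_sum]) (auto simp: inj_def)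
  then have S1: "summable (\<lambda>j. t (2 * Suc j) powr (- 1 / (4 * real (Suc j))))"
    by (simp add: o_def algebra_simps)
  define x where "x m = max 1 (s (2 * m)) powr (- 1 / (4 * real m))" for m
  have bd: "x (Suc j + K) \<le> inverse (real (Suc j) ^ 2) +
       exp (2 * real K) * (D * t (2 * Suc j) powr (- 1 / (4 * real (Suc j))))" for j
  proof -
    define J where "J = Suc j"
    have J: "real J \<ge> 1" by (simp add: J_def)
    define Y where "Y = max 1 (s (2 * (J + K)))"
    define u where "u = x (J + K)"
    have u: "0 < u" by (simp add: u_def x_def)
    have Y: "Y \<ge> 1" by (simp add: Y_def)
    have e: "u powr (real (J + K) / real J) = Y powr (- 1 / (4 * real J))"
    proof -
      have "- 1 / (4 * real (J + K)) * (real (J + K) / real J) = - 1 / (4 * real J)"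
        using J by (simp add: divide_simps)
      then show ?thesis unfolding u_def x_def powr_powr Y_def by simp
    qed
    \<comment> \<open>The spare factor \<open>D\<close> outside compensates the power -1/(4J) of the
      \<open>D\<close> inside, as \<open>D\<close> is at least 1.\<close>
    have "D * t (2 * J) powr (- 1 / (4 * real J)) \<ge> D * (D * Y) powr (- 1 / (4 * real J))"
      using D t_pos t_le[of J] by (intro mult_left_mono powr_mono2') (auto simp: Y_def)
    moreover have "D * (D * Y) powr (- 1 / (4 * real J)) = D powr (1 - 1 / (4 * real J)) * Y powr (- 1 / (4 * real J))"
      using D Y by (simp add: powr_mult powr_diff powr_minus field_simps)
    moreover have "\<dots> \<ge> 1 * Y powr (- 1 / (4 * real J))"
      using D J by (intro mult_right_mono ge_one_powr_ge_zero) auto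
    ultimately have low: "D * t (2 * J) powr (- 1 / (4 * real J)) \<ge> u powr (real (J + K) / real J)"
      using e by linarith
    show ?thesis
    proof (cases "u \<ge> inverse (real J ^ 2)")
      case True
      have "u powr (real K / real J) \<ge> (inverse (real J ^ 2)) powr (real K / real J)"
        using True J by (intro powr_mono2) auto
      also have "(inverse (real J ^ 2)) powr (real K / real J) = exp (- 2 * real K * (ln (real J) / real J))"
        using J by (simp add: powr_def ln_inverse ln_realpow)
      also have "\<dots> \<ge> exp (- 2 * real K * 1)"
      proof -
        have "ln (real J) / real J \<le> 1" using J ln_le_minus_one[of "real J"] by simp
        then have "(2 * real K) * (ln (real J) / real J) \<le> (2 * real K) * 1" by (intro mult_left_mono) auto
        then show ?thesis by simp
      qed
      finally have "exp (2 * real K) * u powr (real K / real J) \<ge> exp (2 * real K) * exp (- 2 * real K)"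
        by (intro mult_left_mono) auto
      then have "exp (2 * real K) * u powr (real K / real J) \<ge> 1" by (simp flip: exp_add)
      then have "u * 1 \<le> u * (exp (2 * real K) * u powr (real K / real J))" using u by (intro mult_left_mono) auto
      also have "\<dots> = exp (2 * real K) * u powr (real (J + K) / real J)"
      proof -
        have "real (J + K) / real J = 1 + real K / real J" using J by (simp add: field_simps)
        then have "u powr (real (J + K) / real J) = u * u powr (real K / real J)"
          using u by (simp only: powr_add) simp
        then show ?thesis by simp
      qed
      also have "\<dots> \<le> exp (2 * real K) * (D * t (2 * J) powr (- 1 / (4 * real J)))"
        using low by (intro mult_left_mono) auto
      finally show ?thesis by (simp add: u_def J_def add_increasing)
    next
      case False
      then have "u \<le> inverse (real J ^ 2)" by simp
      moreover have "0 \<le> exp (2 * real K) * (D * t (2 * J) powr (- 1 / (4 * real J)))" using D by simp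
      ultimately show ?thesis unfolding u_def J_def by linarith
    qed
  qed
  have "summable (\<lambda>j. inverse (real (Suc j) ^ 2))"
    using inverse_power_summable[of 2, where 'a=real] by (subst summable_Suc_iff[of "\<lambda>n. inverse (real n ^ 2)"]) simp
  then have "summable (\<lambda>j. inverse (real (Suc j) ^ 2) +
       exp (2 * real K) * (D * t (2 * Suc j) powr (- 1 / (4 * real (Suc j)))))"
    by (intro summable_add summable_mult S1)
  then have "summable (\<lambda>j. x (Suc j + K))"
    by (rule summable_comparison_test') (use bd in \<open>simp add: x_def\<close>)
  then have sx: "summable x" using summable_iff_shift[of x "Suc K"] by (simp add: add.commute add.left_commute)
  then have "x \<longlonglongrightarrow> 0" by (rule summable_LIMSEQ_zero)
  \<comment> \<open>If \<open>x m < 1\<close> then \<open>s (2 * m)\<close> exceeds 1, so the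
    truncation by 1 is eventually inactive.\<close>
  then have "eventually (\<lambda>m. x m < 1) sequentially" by (rule order_tendstoD) simp
  then have "eventually (\<lambda>m. s (2 * m) powr (- 1 / (4 * real m)) = x m) sequentially"
    by (rule eventually_mono) (auto simp: x_def max_def split: if_splits)
  then have "summable (\<lambda>m. s (2 * m) powr (- 1 / (4 * real m)))" using sx by (simp add: summable_cong)
  then show ?thesis by (subst summable_Suc_iff[of "\<lambda>m. s (2 * m) powr (- 1 / (4 * real m))"])
qed

text \<open>If \<open>\<psi>\<close> did not vanish, then \<open>\<psi> ([:a, 1:] ^ k * p) = p(-a) \<psi> ([:a, 1:] ^ k)\<close> would make evaluation at \<open>-a\<close> bounded
  for the functional with density \<open>(x + a)^(2k+1)\<close>.  After the substitution \<open>x \<mapsto> x\<^sup>2\<close> this is the situation of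
  \<open>symmetric_moments\<close>, whose Carleman series converges.\<close>
theorem carleman_functional:
  fixes s :: "nat \<Rightarrow> real" and \<psi> :: "real poly \<Rightarrow> 'b::real_normed_vector"
  assumes pos0: "\<And>q. mom s (q * q) \<ge> 0" and pos1: "\<And>q. mom s (pCons 0 (q * q)) \<ge> 0"
    and add: "\<And>p q. \<psi> (p + q) = \<psi> p + \<psi> q" and smult: "\<And>c q. \<psi> (smult c q) = c *\<^sub>R \<psi> q"
    and bd: "\<And>q. (norm (\<psi> q))\<^sup>2 \<le> C * mom s (q * q)"
    and a: "a > 0" and ann: "\<And>q. \<psi> ([:a, 1:] ^ Suc k * q) = 0"
    and div: "(\<exists>m. s (2 * m) = 0) \<or> \<not> summable (\<lambda>m. s (2 * Suc m) powr (- 1 / (4 * real (Suc m))))"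
  shows "\<psi> ([:a, 1:] ^ k) = 0"
proof (rule ccontr)
  define A where "A = [:a, 1:]"
  \<comment> \<open>The exponent is odd: two copies of \<open>A ^ k\<close> form the square
    controlled by \<open>bd\<close>, and the remaining factor \<open>A\<close> gives lower bounds in
    both parities.\<close>
  define B where "B = A ^ (2 * k + 1)"
  define t where "t m = mom s (B * monom 1 m)" for m
  \<comment> \<open>The symmetric functional whose image under squaring of the variable has the
    moments \<open>t\<close>.\<close>
  define h where "h i = (if even i then t (i div 2) else 0)" for i
  \<comment> \<open>Chosen so that the square of \<open>\<i> y\<close> is -a.\<close>
  define y where "y = sqrt a"
  define c0 where "c0 = norm (\<psi> (A ^ k))"
  assume "\<psi> ([:a, 1:] ^ k) \<noteq> 0"
  then have c0: "c0 > 0" by (simp add: c0_def A_def)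
  then have "0 < c0\<^sup>2" by simp
  also have "\<dots> \<le> C * mom s (A ^ k * A ^ k)" unfolding c0_def by (rule bd)
  finally have C: "C > 0" using pos0[of "A ^ k"] by (simp add: zero_less_mult_iff)
  have y: "y > 0" "y\<^sup>2 = a" using a by (auto simp: y_def)
  have mom_t: "mom t p = mom s (B * p)" for p
    unfolding t_def by (rule mom_shifted)
  have mom_tS: "mom (\<lambda>i. t (Suc i)) p = mom s (pCons 0 (B * p))" for p
    using mom_t[of "pCons 0 p"] by (simp add: mom_pCons)
  \<comment> \<open>By the remainder theorem \<open>p\<close> minus its value at -a is a multiple of
    \<open>A\<close>, and \<open>ann\<close> kills what this contributes.\<close>
  have eval: "\<psi> (A ^ k * p) = poly p (- a) *\<^sub>R \<psi> (A ^ k)" for p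
  proof -
    have "A dvd p - [:poly p (- a):]"
      using poly_eq_0_iff_dvd[of "p - [:poly p (- a):]" "- a"] by (simp add: A_def)
    then obtain r where "p - [:poly p (- a):] = A * r" by (elim dvdE)
    then have p: "p = [:poly p (- a):] + A * r" by (metis diff_add_cancel add.commute)
    have "A ^ k * p = smult (poly p (- a)) (A ^ k) + A ^ Suc k * r"
    proof -
      have "A ^ k * p = A ^ k * [:poly p (- a):] + A ^ k * (A * r)" by (subst p) (rule distrib_left)
      then show ?thesis by (simp add: mult_ac)
    qed
    then show ?thesis by (simp only: add smult) (simp add: ann[folded A_def] del: power_Suc)
  qed
  have B2: "B * (p * p) = A * ((A ^ k * p) * (A ^ k * p))" for p
    unfolding B_def power_add power_even_eq power_one_right power2_eq_square by (simp only: mult_ac)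
  \<comment> \<open>With g = A^k p the density is (x + a) g^2 = a g^2 + x g^2, and the second part
    is nonnegative by \<open>pos1\<close>.\<close>
  have low_even: "a * mom s ((A ^ k * p) * (A ^ k * p)) \<le> mom t (p * p)" for p
  proof -
    define g where "g = A ^ k * p"
    have "mom t (p * p) = a * mom s (g * g) + mom s (pCons 0 (g * g))"
      by (simp add: mom_t B2 flip: g_def) (simp add: A_def mom_add mom_smult)
    then show ?thesis using pos1[of g] by (simp add: g_def)
  qed
  \<comment> \<open>Here the density is x (x + a) g^2 = a x g^2 + (x g)^2; this time the second part
    is kept.\<close>
  have low_odd: "mom s ((A ^ k * (pCons 0 p)) * (A ^ k * (pCons 0 p))) \<le> mom (\<lambda>i. t (Suc i)) (p * p)" for p
  proof -
    define g where "g = A ^ k * p"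
    have g: "A ^ k * (pCons 0 p) = pCons 0 g" by (simp add: g_def)
    have "mom (\<lambda>i. t (Suc i)) (p * p) = a * mom s (pCons 0 (g * g)) + mom s (pCons 0 g * pCons 0 g)"
      by (simp add: mom_tS B2 flip: g_def) (simp add: A_def mom_add mom_smult mom_pCons)
    then show ?thesis using pos1[of g] a g by simp
  qed
  have split: "mom h (q * q) = mom t (p * p) + mom (\<lambda>i. t (Suc i)) (r * r)"
    "mom (\<lambda>i. y ^ i * (- 1) ^ (i div 2)) q = poly p (- a) + y * poly r (- a)"
    if q: "q = pcompose p [:0, 0, 1:] + pCons 0 (pcompose r [:0, 0, 1:])" for p q r
  proof -
    let ?E = "\<lambda>p. pcompose p [:0, 0, 1::real:]"
    have "q * q = ?E (p * p) + smult 2 (pCons 0 (?E (p * r))) + pCons 0 (pCons 0 (?E (r * r)))"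
      by (simp add: q pcompose_mult algebra_simps) (simp add: numeral_poly)
    then have "mom h (q * q) = mom (\<lambda>i. h (2 * i)) (p * p) + 2 * mom (\<lambda>i. h (Suc (2 * i))) (p * r) +
        mom (\<lambda>i. h (Suc (Suc (2 * i)))) (r * r)"
      by (simp add: mom_add mom_smult mom_pCons mom_pcompose_square)
    then show "mom h (q * q) = mom t (p * p) + mom (\<lambda>i. t (Suc i)) (r * r)"
      by (simp add: h_def mom_def)
    have "mom (\<lambda>i. y ^ i * (- 1) ^ (i div 2)) q =
        mom (\<lambda>i. y ^ (2 * i) * (- 1) ^ i) p + mom (\<lambda>i. y ^ Suc (2 * i) * (- 1) ^ i) r"
      by (simp add: q mom_add mom_pCons mom_pcompose_square)
    also have "(\<lambda>i. y ^ (2 * i) * (- 1) ^ i) = (\<lambda>i. (- a) ^ i)"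
      by (simp add: power_mult y(2) flip: power_mult_distrib)
    also have "(\<lambda>i. y ^ Suc (2 * i) * (- 1) ^ i) = (\<lambda>i. y * (- a) ^ i)"
      by (simp add: power_mult y(2) mult.assoc flip: power_mult_distrib)
    also have "mom (\<lambda>i. y * (- a) ^ i) r = y * mom (\<lambda>i. (- a) ^ i) r"
      by (simp add: mom_def sum_distrib_left mult_ac)
    finally show "mom (\<lambda>i. y ^ i * (- 1) ^ (i div 2)) q = poly p (- a) + y * poly r (- a)"
      by (simp add: mom_power)
  qed
  have even_bd: "c0\<^sup>2 * (poly p (- a))\<^sup>2 \<le> C / a * mom t (p * p)" for p
  proof -
    have "c0\<^sup>2 * (poly p (- a))\<^sup>2 = (norm (\<psi> (A ^ k * p)))\<^sup>2"
      by (simp add: eval c0_def power_mult_distrib)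
    also have "\<dots> \<le> C * mom s ((A ^ k * p) * (A ^ k * p))" by (rule bd)
    also have "\<dots> \<le> C * (mom t (p * p) / a)"
      using low_even[of p] a C by (intro mult_left_mono) (auto simp: field_simps)
    finally show ?thesis by simp
  qed
  have odd_bd: "c0\<^sup>2 * (a\<^sup>2 * (poly p (- a))\<^sup>2) \<le> C * mom (\<lambda>i. t (Suc i)) (p * p)" for p
  proof -
    have "c0\<^sup>2 * (a\<^sup>2 * (poly p (- a))\<^sup>2) = (norm (\<psi> (A ^ k * pCons 0 p)))\<^sup>2"
      unfolding eval by (simp add: c0_def power_mult_distrib)
    also have "\<dots> \<le> C * mom s ((A ^ k * pCons 0 p) * (A ^ k * pCons 0 p))" by (rule bd)
    also have "\<dots> \<le> C * mom (\<lambda>i. t (Suc i)) (p * p)"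
      using low_odd[of p] C by (intro mult_left_mono) auto
    finally show ?thesis .
  qed
  \<comment> \<open>Together with (u + v)^2 \<le> 2 u^2 + 2 v^2 this value makes the even and the
    odd bound add up to exactly \<open>mom h (q * q)\<close>.\<close>
  define c where "c = c0 * sqrt (a / (2 * C))"
  have c2: "c\<^sup>2 = c0\<^sup>2 * (a / (2 * C))" using a C by (simp add: c_def power_mult_distrib)
  interpret symmetric_moments h y c
  proof
    fix q :: "real poly"
    obtain p r where q: "q = pcompose p [:0, 0, 1:] + pCons 0 (pcompose r [:0, 0, 1:])"
      by (rule even_odd_decomposition)
    have "0 \<le> mom t (p * p)" using low_even[of p] pos0[of "A ^ k * p"] a
      by (meson mult_nonneg_nonneg less_imp_le order_trans)
    moreover have "0 \<le> mom (\<lambda>i. t (Suc i)) (r * r)" using low_odd[of r] pos0[of "A ^ k * pCons 0 r"]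
      by linarith
    ultimately show "0 \<le> mom h (q * q)" by (simp add: split[OF q])
    have "(c * (poly p (- a) + y * poly r (- a)))\<^sup>2 \<le> c\<^sup>2 * (2 * (poly p (- a))\<^sup>2 + 2 * (a * (poly r (- a))\<^sup>2))"
    proof -
      have "(poly p (- a) + y * poly r (- a))\<^sup>2 \<le> 2 * (poly p (- a))\<^sup>2 + 2 * (y * poly r (- a))\<^sup>2"
        using sum_squares_bound[of "poly p (- a)" "y * poly r (- a)"] by (simp add: power2_sum)
      then show ?thesis using y by (simp add: power_mult_distrib mult_left_mono)
    qed
    also have "\<dots> = a / C * (c0\<^sup>2 * (poly p (- a))\<^sup>2) + (c0\<^sup>2 * (a\<^sup>2 * (poly r (- a))\<^sup>2)) / C"
      unfolding c2 using C by (simp add: field_simps power2_eq_square)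
    also have "\<dots> \<le> a / C * (C / a * mom t (p * p)) + (C * mom (\<lambda>i. t (Suc i)) (r * r)) / C"
      using a C by (intro add_mono mult_left_mono divide_right_mono even_bd odd_bd) auto
    also have "\<dots> = mom h (q * q)" using a C by (simp add: split(1)[OF q])
    finally show "(c * mom (\<lambda>i. y ^ i * (- 1) ^ (i div 2)) q)\<^sup>2 \<le> mom h (q * q)"
      by (simp only: split(2)[OF q])
  qed (use y c0 a C in \<open>auto simp: h_def c_def\<close>)
  have t_pos: "t m > 0" for m using moment_pos[of m] by (simp add: h_def)
  have t_sum: "summable (\<lambda>m. t (Suc m) powr (- 1 / (2 * real (Suc m))))"
    using summable_moments by (simp add: h_def)
  \<comment> \<open>By Cauchy-Schwarz a vanishing moment would force \<open>t (2 * m)\<close> to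
    vanish too. This removes the first alternative of \<open>div\<close>.\<close>
  have "s (2 * m) \<noteq> 0" for m
  proof
    assume "s (2 * m) = 0"
    then have "mom s (monom 1 m * monom 1 m) = 0" by (simp add: mult_monom mom_monom mult_2)
    moreover have "t (2 * m) = mom s ((B * monom 1 m) * monom 1 m)"
      by (simp add: t_def mult.assoc mult_monom mult_2)
    ultimately have "(t (2 * m))\<^sup>2 \<le> 0" using mom_cauchy_schwarz[of s "B * monom 1 m" "monom 1 m"] pos0 by simp
    then show False using t_pos[of "2 * m"] by simp
  qed
  then have div': "\<not> summable (\<lambda>m. s (2 * Suc m) powr (- 1 / (4 * real (Suc m))))" using div by blast
  \<comment> \<open>The polynomial x^j (x - 1)^2 is a square or x times a square, according to the
    parity of \<open>j\<close>.\<close>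
  have conv: "2 * s (Suc j) \<le> s j + s (Suc (Suc j))" for j
  proof -
    have *: "0 \<le> mom s (pCons 0 (q * q))" "0 \<le> mom s (q * q)" for q by (rule pos1 pos0)+
    let ?q = "monom 1 (j div 2) * [:-1, 1::real:]"
    have q: "?q * ?q = monom 1 (2 * (j div 2)) * [:1, -2, 1:]"
    proof -
      have "?q * ?q = (monom 1 (j div 2) * monom 1 (j div 2)) * ([:-1, 1:] * [:-1, 1:])"
        by (simp only: mult_ac)
      also have "[:-1, 1:] * [:-1, 1:] = [:1, -2, 1::real:]" by simp
      finally show ?thesis by (simp only: mult_monom mult_2 mult_1)
    qed
    show ?thesis
    proof (cases "even j")
      case True
      then show ?thesis using *(2)[of ?q] unfolding q mom_monom_mult by (simp add: mom_pCons)
    next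
      case False
      then have "Suc (2 * (j div 2)) = j" by simp
      moreover have "mom s (pCons 0 (?q * ?q)) = mom (\<lambda>i. s (Suc (i + 2 * (j div 2)))) [:1, -2, 1:]"
        unfolding q mom_pCons mom_monom_mult by simp
      ultimately show ?thesis using *(1)[of ?q] by (simp add: mom_pCons flip: add_Suc_right)
    qed
  qed
  define K where "K = 2 * k + 1"
  have coeff_nonneg: "coeff (A ^ i) j \<ge> 0" for i j
  proof (induction i arbitrary: j)
    case (Suc i)
    then show ?case using a by (auto simp: A_def coeff_pCons split: nat.split intro!: add_nonneg_nonneg)
  qed auto
  define D where "D = (1 + a) ^ K * max 1 (s 0)"
  have D: "D \<ge> 1" using a one_le_power[of "1 + a" K] mult_mono[of 1 "(1 + a) ^ K" 1 "max 1 (s 0)"]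
    by (simp add: D_def)
  \<comment> \<open>\<open>B\<close> has nonnegative coefficients with sum (1 + a)^K, and convexity
    bounds every moment that occurs by those of index 0 and 2(j + K).\<close>
  have t_le: "t (2 * j) \<le> D * max 1 (s (2 * (j + K)))" for j
  proof -
    have dB: "degree B \<le> 2 * K"
    proof -
      have "degree B \<le> degree A * K" unfolding B_def K_def by (rule degree_power_le)
      also have "degree A = 1" by (simp add: A_def)
      finally show ?thesis by simp
    qed
    have le: "s (i + 2 * j) \<le> max 1 (s 0) * max 1 (s (2 * (j + K)))" if "i \<le> degree B" for i
    proof -
      have "i + 2 * j \<le> 2 * (j + K)" using that dB by simp
      then have "s (i + 2 * j) \<le> max (s 0) (s (2 * (j + K)))"
        by (rule convex_sequence_le_max[of s, OF conv])
      also have "\<dots> \<le> max 1 (s 0) * max 1 (s (2 * (j + K)))"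
        using mult_mono[of "s 0" "max 1 (s 0)" 1 "max 1 (s (2 * (j + K)))"]
          mult_mono[of 1 "max 1 (s 0)" "s (2 * (j + K))" "max 1 (s (2 * (j + K)))"]
        by (cases "s 0 \<le> 0"; cases "s (2 * (j + K)) \<le> 0") (auto simp: max_def split: if_splits)
      finally show ?thesis .
    qed
    have "t (2 * j) = (\<Sum>i\<le>degree B. coeff B i * s (i + 2 * j))"
      by (simp add: t_def mult.commute[of B] mom_monom_mult) (simp add: mom_def)
    also have "\<dots> \<le> (\<Sum>i\<le>degree B. coeff B i * (max 1 (s 0) * max 1 (s (2 * (j + K)))))"
      using coeff_nonneg[of "2 * k + 1", folded B_def] by (intro sum_mono mult_left_mono le) auto
    also have "\<dots> = poly B 1 * (max 1 (s 0) * max 1 (s (2 * (j + K))))"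
      by (simp add: poly_altdef sum_distrib_right)
    also have "poly B 1 = (1 + a) ^ K" unfolding B_def K_def poly_power by (simp add: A_def add.commute)
    finally show ?thesis by (simp add: D_def)
  qed
  show False using carleman_shift[of D t s K, OF D t_pos t_le t_sum] div' by blast
qed

subsection \<open>Uniqueness for Laplace transforms\<close>

text \<open>Dominated convergence along sequences for the difference quotients of the remainder,
  which the mean value inequality bounds by \<open>2 * g\<close>. The Frechet form serves complex
  derivatives, derivatives in time and derivatives on the group alike.\<close>

lemma has_derivative_lebesgue_integral:
  fixes F :: "'a \<Rightarrow> 'e::real_normed_vector \<Rightarrow> 'b::{banach,second_countable_topology}"
  assumes d: "d > 0"
    and int: "\<And>y. dist y x < d \<Longrightarrow> integrable M (\<lambda>\<omega>. F \<omega> y)"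
    and der: "\<And>\<omega> y. dist y x < d \<Longrightarrow> (F \<omega> has_derivative F' \<omega> y) (at y)"
    and bound: "\<And>\<omega> y v. dist y x < d \<Longrightarrow> norm (F' \<omega> y v) \<le> g \<omega> * norm v"
    and g: "integrable M g"
    and meas: "\<And>v. (\<lambda>\<omega>. F' \<omega> x v) \<in> borel_measurable M"
  shows "((\<lambda>y. \<integral>\<omega>. F \<omega> y \<partial>M) has_derivative (\<lambda>v. \<integral>\<omega>. F' \<omega> x v \<partial>M)) (at x)"
proof -
  have lin: "bounded_linear (F' \<omega> x)" for \<omega>
    using der[of x \<omega>] d by (auto dest: has_derivative_bounded_linear)
  have int': "integrable M (\<lambda>\<omega>. F' \<omega> x v)" for v
  proof (rule Bochner_Integration.integrable_bound[of M "\<lambda>\<omega>. g \<omega> * norm v"])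
    show "AE \<omega> in M. norm (F' \<omega> x v) \<le> norm (g \<omega> * norm v)"
    proof (rule AE_I2)
      fix \<omega>
      show "norm (F' \<omega> x v) \<le> norm (g \<omega> * norm v)"
        using bound[of x \<omega> v] d by (metis abs_ge_self dist_self order_trans real_norm_def)
    qed
  qed (use g meas in auto)
  have bl: "bounded_linear (\<lambda>v. \<integral>\<omega>. F' \<omega> x v \<partial>M)"
  proof (rule bounded_linear_intro[where K = "\<integral>\<omega>. g \<omega> \<partial>M"])
    show "(\<integral>\<omega>. F' \<omega> x (u + v) \<partial>M) = (\<integral>\<omega>. F' \<omega> x u \<partial>M) + (\<integral>\<omega>. F' \<omega> x v \<partial>M)" for u v
      by (simp add: bounded_linear.linear[OF lin] linear_add int')
    show "(\<integral>\<omega>. F' \<omega> x (c *\<^sub>R v) \<partial>M) = c *\<^sub>R (\<integral>\<omega>. F' \<omega> x v \<partial>M)" for c v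
      by (simp add: bounded_linear.linear[OF lin] linear_scale)
    show "norm (\<integral>\<omega>. F' \<omega> x v \<partial>M) \<le> norm v * (\<integral>\<omega>. g \<omega> \<partial>M)" for v
    proof -
      have "norm (\<integral>\<omega>. F' \<omega> x v \<partial>M) \<le> (\<integral>\<omega>. norm (F' \<omega> x v) \<partial>M)" by simp
      also have "\<dots> \<le> (\<integral>\<omega>. g \<omega> * norm v \<partial>M)"
        using int' g bound[of x] d by (intro integral_mono) auto
      finally show ?thesis by (simp add: mult.commute)
    qed
  qed
  have "((\<lambda>y. norm ((\<integral>\<omega>. F \<omega> y \<partial>M) - (\<integral>\<omega>. F \<omega> x \<partial>M) - (\<integral>\<omega>. F' \<omega> x (y - x) \<partial>M)) / norm (y - x)) \<longlongrightarrow> 0) (at x)"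
    unfolding tendsto_at_iff_sequentially o_def
  proof (intro allI impI)
    fix X assume X: "\<forall>i. X i \<in> UNIV - {x}" "X \<longlonglongrightarrow> x"
    from X(2) d have "eventually (\<lambda>i. dist (X i) x < d) sequentially" by (rule tendstoD)
    then obtain N where N: "\<And>i. i \<ge> N \<Longrightarrow> dist (X i) x < d" by (auto simp: eventually_sequentially)
    \<comment> \<open>Dropping an initial segment puts the whole sequence into the ball on which the
      hypotheses hold.\<close>
    define Y where "Y i = X (i + N)" for i
    have Yx: "Y i \<noteq> x" and Yd: "dist (Y i) x < d" for i using X(1) N by (auto simp: Y_def)
    have Y: "Y \<longlonglongrightarrow> x" unfolding Y_def using X(2) by (rule LIMSEQ_ignore_initial_segment)
    define R where "R i \<omega> = norm (F \<omega> (Y i) - F \<omega> x - F' \<omega> x (Y i - x)) / norm (Y i - x)" for i \<omega>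
    have R_nonneg: "\<bar>R i \<omega>\<bar> = R i \<omega>" for i \<omega> by (simp add: R_def)
    have Rm: "R i \<in> borel_measurable M" for i
      unfolding R_def using int[OF Yd[of i]] int[of x] d int' by (intro borel_measurable_divide borel_measurable_norm borel_measurable_diff borel_measurable_integrable) auto
    have Rle: "R i \<omega> \<le> 2 * g \<omega>" for i \<omega>
    proof -
      have "norm (F \<omega> (Y i) - F \<omega> x) \<le> g \<omega> * norm (Y i - x)"
      proof (rule differentiable_bound[of "ball x d" "F \<omega>" "F' \<omega>"])
        show "(F \<omega> has_derivative F' \<omega> y) (at y within ball x d)" if "y \<in> ball x d" for y
          using der[of y \<omega>] that by (auto simp: dist_commute intro: has_derivative_at_withinI)
        show "onorm (F' \<omega> y) \<le> g \<omega>" if "y \<in> ball x d" for y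
        proof (rule onorm_bound)
          have "dist y x < d" using that by (simp add: dist_commute)
          then show b: "norm (F' \<omega> y v) \<le> g \<omega> * norm v" for v by (rule bound)
          have "0 \<le> g \<omega> * norm (Y i - x)" using b[of "Y i - x"] norm_ge_zero order_trans by blast
          then show "0 \<le> g \<omega>" using Yx[of i] by (simp add: zero_le_mult_iff)
        qed
      qed (use Yd[of i] d in \<open>auto simp: dist_commute\<close>)
      moreover have "norm (F' \<omega> x (Y i - x)) \<le> g \<omega> * norm (Y i - x)" using bound[of x] d by auto
      ultimately have "norm (F \<omega> (Y i) - F \<omega> x - F' \<omega> x (Y i - x)) \<le> 2 * g \<omega> * norm (Y i - x)"
        using norm_triangle_ineq4[of "F \<omega> (Y i) - F \<omega> x" "F' \<omega> x (Y i - x)"] by (simp add: mult_ac)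
      then show ?thesis using Yx[of i] by (simp add: R_def field_simps)
    qed
    have R0: "(\<lambda>i. R i \<omega>) \<longlonglongrightarrow> 0" for \<omega>
    proof -
      have "((\<lambda>y. norm ((F \<omega> y - F \<omega> x) - F' \<omega> x (y - x)) / norm (y - x)) \<longlongrightarrow> 0) (at x)"
        using der[of x \<omega>] d unfolding has_derivative_iff_norm by auto
      then show ?thesis unfolding tendsto_at_iff_sequentially o_def R_def using Y Yx by auto
    qed
    have Rint: "integrable M (R i)" for i
    proof (rule Bochner_Integration.integrable_bound[of M "\<lambda>\<omega>. 2 * g \<omega>"])
      have "R i \<omega> \<ge> 0" for \<omega> by (simp add: R_def)
      then show "AE \<omega> in M. norm (R i \<omega>) \<le> norm (2 * g \<omega>)"
        using Rle[of i] by (intro AE_I2) (metis abs_ge_self abs_of_nonneg order_trans real_norm_def)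
    qed (use Rm g in auto)
    have "(\<lambda>i. \<integral>\<omega>. R i \<omega> \<partial>M) \<longlonglongrightarrow> (\<integral>\<omega>. 0 \<partial>M)"
      by (rule integral_dominated_convergence[where w = "\<lambda>\<omega>. 2 * g \<omega>"])
         (use g Rm R0 Rle in \<open>auto intro!: AE_I2 simp: R_nonneg\<close>)
    then have lim: "(\<lambda>i. \<integral>\<omega>. R i \<omega> \<partial>M) \<longlonglongrightarrow> 0" by simp
    let ?q = "\<lambda>y. norm ((\<integral>\<omega>. F \<omega> y \<partial>M) - (\<integral>\<omega>. F \<omega> x \<partial>M) - (\<integral>\<omega>. F' \<omega> x (y - x) \<partial>M)) / norm (y - x)"
    have le: "?q (Y i) \<le> (\<integral>\<omega>. R i \<omega> \<partial>M)" for i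
    proof -
      have "(\<integral>\<omega>. F \<omega> (Y i) \<partial>M) - (\<integral>\<omega>. F \<omega> x \<partial>M) - (\<integral>\<omega>. F' \<omega> x (Y i - x) \<partial>M) =
          (\<integral>\<omega>. F \<omega> (Y i) - F \<omega> x - F' \<omega> x (Y i - x) \<partial>M)"
        using int[OF Yd[of i]] int[of x] d int' by simp
      also have "norm \<dots> \<le> (\<integral>\<omega>. norm (F \<omega> (Y i) - F \<omega> x - F' \<omega> x (Y i - x)) \<partial>M)" by simp
      finally show ?thesis by (simp add: R_def divide_right_mono)
    qed
    have "(\<lambda>i. ?q (Y i)) \<longlonglongrightarrow> 0"
      by (rule tendsto_sandwich[OF _ _ tendsto_const lim]) (use le in auto)
    then show "(\<lambda>i. ?q (X i)) \<longlonglongrightarrow> 0"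
      unfolding Y_def by (rule LIMSEQ_offset)
  qed
  with bl show ?thesis unfolding has_derivative_iff_norm by simp
qed

lemma laplace_integrable_strip:
  fixes \<phi> x :: "'a \<Rightarrow> real"
  assumes "integrable M (\<lambda>\<omega>. \<phi> \<omega> * exp (Re z * x \<omega>))" and [measurable]: "\<phi> \<in> borel_measurable M" "x \<in> borel_measurable M"
  shows "integrable M (\<lambda>\<omega>. of_real (\<phi> \<omega>) * exp (z * of_real (x \<omega>)))"
  by (rule Bochner_Integration.integrable_bound[OF assms(1)]) (auto simp: norm_mult norm_exp_eq_Re)

lemma laplace_holomorphic:
  fixes \<phi> x :: "'a \<Rightarrow> real"
  assumes [measurable]: "\<phi> \<in> borel_measurable M" "x \<in> borel_measurable M"
    and int: "\<And>\<zeta>. a < \<zeta> \<Longrightarrow> \<zeta> < b \<Longrightarrow> integrable M (\<lambda>\<omega>. \<phi> \<omega> * exp (\<zeta> * x \<omega>))"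
  shows "(\<lambda>z. \<integral>\<omega>. of_real (\<phi> \<omega>) * exp (z * of_real (x \<omega>)) \<partial>M) holomorphic_on {z. a < Re z \<and> Re z < b}"
proof (rule holomorphic_onI)
  fix z :: complex assume z: "z \<in> {z. a < Re z \<and> Re z < b}"
  \<comment> \<open>One \<open>e\<close> is spent on moving the point, another on the factor
    \<open>x\<close> of the derivative by way of |x| \<le> exp(e |x|) / e; hence the
    \<open>2 * e\<close> in \<open>g\<close>.\<close>
  define e where "e = min (Re z - a) (b - Re z) / 3"
  have e: "e > 0" "a < Re z - 2 * e" "Re z + 2 * e < b" using z by (auto simp: e_def min_def field_simps)
  define g where "g \<omega> = (\<bar>\<phi> \<omega> * exp ((Re z + 2 * e) * x \<omega>)\<bar> + \<bar>\<phi> \<omega> * exp ((Re z - 2 * e) * x \<omega>)\<bar>) / e" for \<omega>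
  have g: "integrable M g" unfolding g_def using e
    by (intro integrable_divide Bochner_Integration.integrable_add integrable_abs int) auto
  have bd: "norm (of_real (\<phi> \<omega>) * exp (w * of_real (x \<omega>)) * of_real (x \<omega>)) \<le> g \<omega>" if w: "dist w z < e" for w \<omega>
  proof -
    have "\<bar>Re w - Re z\<bar> \<le> e" using w abs_Re_le_cmod[of "w - z"] by (simp add: dist_norm)
    then have "(Re w - Re z) * x \<omega> \<le> e * \<bar>x \<omega>\<bar>"
      by (metis abs_ge_self abs_mult abs_ge_zero mult_right_mono order_trans)
    then have 1: "exp (Re w * x \<omega>) \<le> exp (Re z * x \<omega> + e * \<bar>x \<omega>\<bar>)" by (simp add: algebra_simps)
    have "e * \<bar>x \<omega>\<bar> \<le> exp (e * \<bar>x \<omega>\<bar>)" using exp_ge_add_one_self[of "e * \<bar>x \<omega>\<bar>"] by linarith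
    then have 2: "\<bar>x \<omega>\<bar> \<le> exp (e * \<bar>x \<omega>\<bar>) / e" using e by (simp add: field_simps)
    have "exp (Re w * x \<omega>) * \<bar>x \<omega>\<bar> \<le> exp (Re z * x \<omega> + e * \<bar>x \<omega>\<bar>) * (exp (e * \<bar>x \<omega>\<bar>) / e)"
      using 1 2 by (intro mult_mono) auto
    also have "\<dots> = exp (Re z * x \<omega> + 2 * e * \<bar>x \<omega>\<bar>) / e" by (simp flip: exp_add add: algebra_simps)
    also have "\<dots> \<le> (exp ((Re z + 2 * e) * x \<omega>) + exp ((Re z - 2 * e) * x \<omega>)) / e"
      using e by (intro divide_right_mono) (auto simp: abs_real_def algebra_simps)
    finally have "\<bar>\<phi> \<omega>\<bar> * (exp (Re w * x \<omega>) * \<bar>x \<omega>\<bar>) \<le> \<bar>\<phi> \<omega>\<bar> * ((exp ((Re z + 2 * e) * x \<omega>) + exp ((Re z - 2 * e) * x \<omega>)) / e)"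
      by (intro mult_left_mono) auto
    then show ?thesis by (simp add: g_def norm_mult norm_exp_eq_Re abs_mult algebra_simps add_divide_distrib)
  qed
  have "((\<lambda>w. \<integral>\<omega>. of_real (\<phi> \<omega>) * exp (w * of_real (x \<omega>)) \<partial>M) has_derivative
      (\<lambda>v. \<integral>\<omega>. of_real (\<phi> \<omega>) * exp (z * of_real (x \<omega>)) * of_real (x \<omega>) * v \<partial>M)) (at z)"
  proof (rule has_derivative_lebesgue_integral[OF e(1) _ _ _ g,
        where F' = "\<lambda>\<omega> w v. of_real (\<phi> \<omega>) * exp (w * of_real (x \<omega>)) * of_real (x \<omega>) * v"])
    fix w assume w: "dist w z < e"
    have "\<bar>Re w - Re z\<bar> < e" using w abs_Re_le_cmod[of "w - z"] by (simp add: dist_norm)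
    then have "a < Re w" "Re w < b" using e by linarith+
    then show "integrable M (\<lambda>\<omega>. of_real (\<phi> \<omega>) * exp (w * of_real (x \<omega>)))"
      by (intro laplace_integrable_strip int) auto
    fix \<omega>
    have "((\<lambda>y. of_real (\<phi> \<omega>) * exp (y * of_real (x \<omega>))) has_field_derivative
       of_real (\<phi> \<omega>) * exp (w * of_real (x \<omega>)) * of_real (x \<omega>)) (at w)"
      by (auto intro!: derivative_eq_intros)
    then show "((\<lambda>y. of_real (\<phi> \<omega>) * exp (y * of_real (x \<omega>))) has_derivative
       (*) (of_real (\<phi> \<omega>) * exp (w * of_real (x \<omega>)) * of_real (x \<omega>))) (at w)"
      by (simp add: has_field_derivative_def)
    show "norm (of_real (\<phi> \<omega>) * exp (w * of_real (x \<omega>)) * of_real (x \<omega>) * v) \<le> g \<omega> * norm v" for v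
      using mult_right_mono[OF bd[OF w, of \<omega>], of "norm v"] by (simp add: norm_mult)
  qed auto
  then have "((\<lambda>w. \<integral>\<omega>. of_real (\<phi> \<omega>) * exp (w * of_real (x \<omega>)) \<partial>M) has_derivative
      (*) (\<integral>\<omega>. of_real (\<phi> \<omega>) * exp (z * of_real (x \<omega>)) * of_real (x \<omega>) \<partial>M)) (at z)"
    by simp
  then show "(\<lambda>w. \<integral>\<omega>. of_real (\<phi> \<omega>) * exp (w * of_real (x \<omega>)) \<partial>M) field_differentiable at z within {z. a < Re z \<and> Re z < b}"
    unfolding field_differentiable_def has_field_derivative_def
    by (blast intro: has_derivative_at_withinI)
qed

lemma strip_open_connected: "open {z. a < Re z \<and> Re z < b}" "connected {z. a < Re z \<and> Re z < b}"
proof -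
  have *: "{z. a < Re z \<and> Re z < b} = {z. a < Re z} \<inter> {z. Re z < b}" by auto
  show "open {z. a < Re z \<and> Re z < b}" unfolding * by (intro open_Int open_halfspace_Re_gt open_halfspace_Re_lt)
  show "connected {z. a < Re z \<and> Re z < b}" unfolding *
    by (intro convex_connected convex_Int convex_halfspace_Re_gt convex_halfspace_Re_lt)
qed

lemma zero_on_interval_imp_zero_on_strip:
  assumes F: "F holomorphic_on {z. a < Re z \<and> Re z < b}"
    and cd: "a \<le> c" "c < d" "d \<le> b" and zero: "\<And>\<zeta>. c < \<zeta> \<Longrightarrow> \<zeta> < d \<Longrightarrow> F (of_real \<zeta>) = 0"
    and w: "a < Re w" "Re w < b"
  shows "F w = 0"
proof (rule analytic_continuation[OF F strip_open_connected, where U = "complex_of_real ` {c<..<d}" and \<xi> = "complex_of_real ((c + d) / 2)"])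
  have "(c + d) / 2 islimpt {c<..<d}"
    using cd by (intro interior_limit_point) (simp add: interior_open)
  then show "complex_of_real ((c + d) / 2) islimpt complex_of_real ` {c<..<d}"
  proof (rule islimpt_isCont_image)
    show "eventually (\<lambda>y. complex_of_real y \<noteq> complex_of_real ((c + d) / 2)) (at ((c + d) / 2))"
      by (simp only: of_real_eq_iff) (simp add: eventually_at_filter)
  qed auto
qed (use cd w zero in auto)

text \<open>The second transform is nonzero near \<open>\<zeta>1\<close>, so the first vanishes on
  an interval there and, by analytic continuation, on the whole strip. The factors may come from
  different measure spaces.\<close>

lemma laplace_product_zero:
  fixes \<phi> x :: "'a \<Rightarrow> real" and \<psi> y :: "'c \<Rightarrow> real"
  assumes "\<phi> \<in> borel_measurable M" "x \<in> borel_measurable M"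
    and int: "\<And>\<zeta>. a < \<zeta> \<Longrightarrow> \<zeta> < b \<Longrightarrow> integrable M (\<lambda>\<omega>. \<phi> \<omega> * exp (\<zeta> * x \<omega>))"
    and "\<psi> \<in> borel_measurable N" "y \<in> borel_measurable N"
    and int': "\<And>\<zeta>. a < \<zeta> \<Longrightarrow> \<zeta> < b \<Longrightarrow> integrable N (\<lambda>\<omega>. \<psi> \<omega> * exp (\<zeta> * y \<omega>))"
    and prod: "\<And>\<zeta>. a < \<zeta> \<Longrightarrow> \<zeta> < b \<Longrightarrow> (\<integral>\<omega>. \<phi> \<omega> * exp (\<zeta> * x \<omega>) \<partial>M) * (\<integral>\<omega>. \<psi> \<omega> * exp (\<zeta> * y \<omega>) \<partial>N) = 0"
    and nz: "a < \<zeta>1" "\<zeta>1 < b" "(\<integral>\<omega>. \<psi> \<omega> * exp (\<zeta>1 * y \<omega>) \<partial>N) \<noteq> 0"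
    and \<zeta>: "a < \<zeta>" "\<zeta> < b"
  shows "(\<integral>\<omega>. \<phi> \<omega> * exp (\<zeta> * x \<omega>) \<partial>M) = 0"
proof -
  define F where "F z = (\<integral>\<omega>. of_real (\<phi> \<omega>) * exp (z * of_real (x \<omega>)) \<partial>M)" for z :: complex
  define G where "G z = (\<integral>\<omega>. of_real (\<psi> \<omega>) * exp (z * of_real (y \<omega>)) \<partial>N)" for z :: complex
  have F: "F holomorphic_on {z. a < Re z \<and> Re z < b}" and G: "G holomorphic_on {z. a < Re z \<and> Re z < b}"
    unfolding F_def G_def by (intro laplace_holomorphic assms; assumption)+
  have Fr: "F (of_real t) = of_real (\<integral>\<omega>. \<phi> \<omega> * exp (t * x \<omega>) \<partial>M)" for t
    unfolding F_def by (subst integral_complex_of_real[symmetric]) (simp flip: exp_of_real)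
  have Gr: "G (of_real t) = of_real (\<integral>\<omega>. \<psi> \<omega> * exp (t * y \<omega>) \<partial>N)" for t
    unfolding G_def by (subst integral_complex_of_real[symmetric]) (simp flip: exp_of_real)
  have "continuous_on {a<..<b} (\<lambda>t. G (of_real t))"
    by (rule continuous_on_compose2[OF holomorphic_on_imp_continuous_on[OF G]]) (auto intro!: continuous_intros)
  then have "isCont (\<lambda>t. G (of_real t)) \<zeta>1"
    using nz by (simp add: continuous_on_eq_continuous_at)
  then have "eventually (\<lambda>t. G (of_real t) \<noteq> 0) (at \<zeta>1)"
    unfolding isCont_def using nz(3) by (intro tendsto_imp_eventually_ne) (auto simp: Gr)
  then obtain d where d: "d > 0" "\<And>t. t \<noteq> \<zeta>1 \<Longrightarrow> dist t \<zeta>1 < d \<Longrightarrow> G (of_real t) \<noteq> 0"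
    by (auto simp: eventually_at)
  have "F (of_real \<zeta>) = 0"
  proof (rule zero_on_interval_imp_zero_on_strip[OF F, where c = \<zeta>1 and d = "min b (\<zeta>1 + d)"])
    fix t assume t: "\<zeta>1 < t" "t < min b (\<zeta>1 + d)"
    then have "G (of_real t) \<noteq> 0" by (intro d) (auto simp: dist_real_def)
    then show "F (of_real t) = 0" using prod[of t] t nz by (auto simp: Fr Gr)
  qed (use nz d \<zeta> in auto)
  then show ?thesis by (simp add: Fr)
qed

text \<open>Uniqueness of characteristic functions, extended to signed densities: the positive and
  negative parts of \<open>g\<close> have the same mass \<open>m\<close>, and after division by
  \<open>m\<close> their images under \<open>x\<close> are probability laws with equal
  characteristic functions.\<close>

lemma fourier_zero_imp_zero:
  fixes g x :: "'a \<Rightarrow> real"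
  assumes g: "integrable M g" and [measurable]: "x \<in> borel_measurable M"
    and zero: "\<And>t. (\<integral>\<omega>. of_real (g \<omega>) * exp (\<i> * of_real (t * x \<omega>)) \<partial>M) = 0"
    and B[measurable]: "B \<in> sets borel"
  shows "(\<integral>\<omega>. indicator B (x \<omega>) * g \<omega> \<partial>M) = 0"
proof -
  have [measurable]: "g \<in> borel_measurable M" using g by auto
  define gp where "gp \<omega> = max 0 (g \<omega>)" for \<omega>
  define gn where "gn \<omega> = max 0 (- g \<omega>)" for \<omega>
  have [measurable]: "gp \<in> borel_measurable M" "gn \<in> borel_measurable M" by (simp_all add: gp_def[abs_def] gn_def[abs_def])
  have int: "integrable M gp" "integrable M gn"
    unfolding gp_def[abs_def] gn_def[abs_def] using g by (auto intro!: integrable_max)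
  have gd: "g \<omega> = gp \<omega> - gn \<omega>" for \<omega> by (simp add: gp_def gn_def max_def)
  have nn: "gp \<omega> \<ge> 0" "gn \<omega> \<ge> 0" for \<omega> by (simp_all add: gp_def gn_def)
  define m where "m = (\<integral>\<omega>. gp \<omega> \<partial>M)"
  have "(\<integral>\<omega>. g \<omega> \<partial>M) = 0" using zero[of 0] by simp
  then have m: "(\<integral>\<omega>. gn \<omega> \<partial>M) = m" using int by (simp add: gd m_def)
  have key: "(\<integral>\<omega>. indicator B (x \<omega>) * gp \<omega> \<partial>M) = (\<integral>\<omega>. indicator B (x \<omega>) * gn \<omega> \<partial>M)"
  proof (cases "m = 0")
    case True
    then have "AE \<omega> in M. gp \<omega> = 0" "AE \<omega> in M. gn \<omega> = 0"
      using m int nn integral_nonneg_eq_0_iff_AE[of M gp] integral_nonneg_eq_0_iff_AE[of M gn]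
      by (simp_all add: m_def)
    then show ?thesis by (intro integral_cong_AE) auto
  next
    case False
    then have mpos: "m > 0" using nn by (simp add: m_def less_le integral_nonneg)
    define D where "D k = distr (density M (\<lambda>\<omega>. ennreal (k \<omega> / m))) borel x" for k
    have D: "real_distribution (D k)"
      if [measurable]: "k \<in> borel_measurable M" and k: "integrable M k" "\<And>\<omega>. k \<omega> \<ge> 0" "(\<integral>\<omega>. k \<omega> \<partial>M) = m" for k
    proof -
      have "emeasure (density M (\<lambda>\<omega>. ennreal (k \<omega> / m))) (space M) = (\<integral>\<^sup>+\<omega>. ennreal (k \<omega> / m) \<partial>M)"
        by (subst emeasure_density) (auto intro!: nn_integral_cong)
      also have "\<dots> = ennreal (\<integral>\<omega>. k \<omega> / m \<partial>M)"
        by (intro nn_integral_eq_integral integrable_divide AE_I2 divide_nonneg_pos k(1,2) mpos)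
      also have "\<dots> = 1" using mpos by (simp add: k(3))
      finally have "prob_space (density M (\<lambda>\<omega>. ennreal (k \<omega> / m)))" by (intro prob_spaceI) simp
      then have "prob_space (D k)" unfolding D_def by (intro prob_space.prob_space_distr) auto
      then show ?thesis by (simp add: real_distribution_def real_distribution_axioms_def D_def)
    qed
    have char: "char (D k) t = (\<integral>\<omega>. of_real (k \<omega>) * exp (\<i> * of_real (t * x \<omega>)) \<partial>M) / of_real m"
      if [measurable]: "k \<in> borel_measurable M" and k: "\<And>\<omega>. k \<omega> \<ge> 0" for k t
    proof -
      have "char (D k) t = (\<integral>\<omega>. exp (\<i> * of_real (t * x \<omega>)) \<partial>density M (\<lambda>\<omega>. ennreal (k \<omega> / m)))"
        unfolding char_def D_def by (subst integral_distr) auto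
      also have "\<dots> = (\<integral>\<omega>. (k \<omega> / m) *\<^sub>R exp (\<i> * of_real (t * x \<omega>)) \<partial>M)"
        by (intro integral_density AE_I2 divide_nonneg_pos k mpos) measurable
      also have "\<dots> = (\<integral>\<omega>. of_real (k \<omega>) * exp (\<i> * of_real (t * x \<omega>)) / of_real m \<partial>M)"
        by (intro Bochner_Integration.integral_cong) (auto simp: scaleR_conv_of_real)
      finally show ?thesis by simp
    qed
    have eint: "integrable M (\<lambda>\<omega>. of_real (k \<omega>) * exp (\<i> * of_real (t * x \<omega>)))" if "integrable M k" for k t
      by (rule Bochner_Integration.integrable_bound[OF that]) (use that in \<open>auto simp: norm_mult\<close>)
    have "char (D gp) = char (D gn)"
    proof
      fix t
      have "(\<integral>\<omega>. of_real (gp \<omega>) * exp (\<i> * of_real (t * x \<omega>)) \<partial>M) - (\<integral>\<omega>. of_real (gn \<omega>) * exp (\<i> * of_real (t * x \<omega>)) \<partial>M) = 0"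
        using zero[of t] eint[OF int(1)] eint[OF int(2)] by (simp add: gd algebra_simps)
      then show "char (D gp) t = char (D gn) t" by (simp add: char nn)
    qed
    then have eq: "D gp = D gn"
      using D[of gp] D[of gn] int nn m by (intro Levy_uniqueness) (auto simp: m_def)
    have val: "integral\<^sup>L (D k) (indicator B) = (\<integral>\<omega>. indicator B (x \<omega>) * k \<omega> \<partial>M) / m"
      if [measurable]: "k \<in> borel_measurable M" and k: "\<And>\<omega>. k \<omega> \<ge> 0" for k
    proof -
      have "integral\<^sup>L (D k) (indicator B :: real \<Rightarrow> real) = (\<integral>\<omega>. indicator B (x \<omega>) \<partial>density M (\<lambda>\<omega>. ennreal (k \<omega> / m)))"
        unfolding D_def by (rule integral_distr) auto
      also have "\<dots> = (\<integral>\<omega>. (k \<omega> / m) *\<^sub>R indicator B (x \<omega>) \<partial>M)"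
        by (intro integral_density AE_I2 divide_nonneg_pos k mpos) measurable
      also have "\<dots> = (\<integral>\<omega>. indicator B (x \<omega>) * k \<omega> / m \<partial>M)"
        by (intro Bochner_Integration.integral_cong) auto
      finally show ?thesis by simp
    qed
    show ?thesis using val[of gp] val[of gn] eq nn mpos by simp
  qed
  have "integrable M (\<lambda>\<omega>. indicator B (x \<omega>) * k \<omega>)" if "integrable M k" for k :: "'a \<Rightarrow> real"
    by (rule Bochner_Integration.integrable_bound[OF that]) (use that in \<open>auto simp: indicator_def\<close>)
  then show ?thesis using key int by (simp add: gd algebra_simps)
qed

text \<open>Vanishing on a real interval continues to the vertical line through \<zeta>, and there
  the transform is the Fourier transform of the integrable density \<phi> exp(\<zeta> x).\<close>

lemma laplace_zero_imp_zero:
  fixes \<phi> x :: "'a \<Rightarrow> real"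
  assumes meas: "\<phi> \<in> borel_measurable M" "x \<in> borel_measurable M"
    and int: "\<And>\<zeta>. a < \<zeta> \<Longrightarrow> \<zeta> < b \<Longrightarrow> integrable M (\<lambda>\<omega>. \<phi> \<omega> * exp (\<zeta> * x \<omega>))"
    and zero: "\<And>\<zeta>. a < \<zeta> \<Longrightarrow> \<zeta> < b \<Longrightarrow> (\<integral>\<omega>. \<phi> \<omega> * exp (\<zeta> * x \<omega>) \<partial>M) = 0"
    and \<zeta>: "a < \<zeta>" "\<zeta> < b" and B: "B \<in> sets borel"
  shows "(\<integral>\<omega>. indicator B (x \<omega>) * (\<phi> \<omega> * exp (\<zeta> * x \<omega>)) \<partial>M) = 0"
proof -
  have "(CLINT \<omega>|M. of_real (\<phi> \<omega> * exp (\<zeta> * x \<omega>)) * exp (\<i> * of_real (t * x \<omega>))) = 0" for t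
  proof -
  define F where "F z = (\<integral>\<omega>. of_real (\<phi> \<omega>) * exp (z * of_real (x \<omega>)) \<partial>M)" for z :: complex
  have "F (Complex \<zeta> t) = 0"
  proof (rule zero_on_interval_imp_zero_on_strip[where F = F and c = a and d = b and a = a and b = b])
    show "F holomorphic_on {z. a < Re z \<and> Re z < b}"
      unfolding F_def by (intro laplace_holomorphic assms; assumption)
    fix u assume "a < u" "u < b"
    then have "complex_of_real (\<integral>\<omega>. \<phi> \<omega> * exp (u * x \<omega>) \<partial>M) = 0" using zero[of u] by simp
    then show "F (of_real u) = 0"
      unfolding F_def by (subst (asm) integral_complex_of_real[symmetric]) (simp flip: exp_of_real)
  qed (use \<zeta> in auto)
  moreover have "of_real (\<phi> \<omega>) * exp (Complex \<zeta> t * of_real (x \<omega>)) =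
      of_real (\<phi> \<omega> * exp (\<zeta> * x \<omega>)) * exp (\<i> * of_real (t * x \<omega>))" for \<omega>
    by (simp add: Complex_eq distrib_right exp_add mult.assoc flip: exp_of_real)
  ultimately show ?thesis
    by (simp add: F_def)
  qed
  then show ?thesis
    by (intro fourier_zero_imp_zero int \<zeta> meas B)
qed

subsection \<open>Flat functions and left invariant fields\<close>

definition flat0 :: "('a::euclidean_space \<Rightarrow> 'b::real_normed_vector) \<Rightarrow> bool" where
  "flat0 f \<longleftrightarrow> smooth f \<and> (\<forall>vs. set vs \<subseteq> Basis \<longrightarrow> iter_pd vs f 0 = 0)"

text \<open>Coinduction: it is enough to exhibit a family, closed under partial derivatives, of
  differentiable functions vanishing at 0. Closing a family under the product rule thus takes the
  place of a Leibniz formula for iterated derivatives.\<close>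

lemma flat0_coinduct:
  assumes "f \<in> C" and diff: "\<And>g x. g \<in> C \<Longrightarrow> g differentiable (at x)" and zero: "\<And>g. g \<in> C \<Longrightarrow> g 0 = 0"
    and pd: "\<And>g b. g \<in> C \<Longrightarrow> b \<in> Basis \<Longrightarrow> pd b g \<in> C"
  shows "flat0 f"
proof -
  have "iter_pd vs f \<in> C" if "set vs \<subseteq> Basis" for vs
    using that by (induction vs) (auto simp: iter_pd_def assms)
  then show ?thesis
    using diff zero by (auto simp: flat0_def smooth_def differentiable_on_def differentiable_at_withinI)
qed

lemma iter_pd_snoc: "iter_pd vs (pd b f) = iter_pd (vs @ [b]) f"
  by (simp add: iter_pd_def)

lemma flat0_pd: "flat0 f \<Longrightarrow> b \<in> Basis \<Longrightarrow> flat0 (pd b f)"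
  by (simp add: flat0_def smooth_def iter_pd_snoc)

lemma flat0_differentiable: "flat0 f \<Longrightarrow> f differentiable (at x)"
  unfolding flat0_def smooth_def
  by (drule conjunct1, drule spec[of _ "[]"]) (simp add: iter_pd_def differentiable_on_def)

lemma flat0_zero: "flat0 f \<Longrightarrow> f 0 = 0"
  unfolding flat0_def by (drule conjunct2, drule spec[of _ "[]"]) (simp add: iter_pd_def)

lemma flat0_has_derivative: "flat0 f \<Longrightarrow> (f has_derivative frechet_derivative f (at x)) (at x)"
  using flat0_differentiable frechet_derivative_works by blast

lemma pd_eqI: "(f has_derivative f') (at x) \<Longrightarrow> pd v f x = f' v"
  by (simp add: pd_def frechet_derivative_at[symmetric])

lemma flat0_add_scaled:
  fixes f g :: "'a::euclidean_space \<Rightarrow> 'b::real_normed_vector"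
  assumes "flat0 f" "flat0 g"
  shows "flat0 (\<lambda>x. f x + c *\<^sub>R g x)"
proof (rule flat0_coinduct[of _ "{\<lambda>x. f x + c *\<^sub>R g x | f g. flat0 f \<and> flat0 g}"])
  fix h :: "'a \<Rightarrow> 'b" assume h: "h \<in> {\<lambda>x. f x + c *\<^sub>R g x | f g. flat0 f \<and> flat0 g}"
  then obtain f g :: "'a \<Rightarrow> 'b" where *: "h = (\<lambda>x. f x + c *\<^sub>R g x)" "flat0 f" "flat0 g" by auto
  have der: "(h has_derivative (\<lambda>v. frechet_derivative f (at x) v + c *\<^sub>R frechet_derivative g (at x) v)) (at x)" for x
    unfolding *(1) by (intro has_derivative_add has_derivative_scaleR_right flat0_has_derivative *)
  then show "h differentiable (at x)" for x by (auto simp: differentiable_def)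
  show "h 0 = 0" using * by (simp add: flat0_zero)
  fix b :: 'a assume b: "b \<in> Basis"
  have "pd b h = (\<lambda>x. pd b f x + c *\<^sub>R pd b g x)"
  proof
    fix x
    show "pd b h x = pd b f x + c *\<^sub>R pd b g x" unfolding pd_eqI[OF der] by (simp add: pd_def)
  qed
  then show "pd b h \<in> {\<lambda>x. f x + c *\<^sub>R g x | f g. flat0 f \<and> flat0 g}"
    unfolding mem_Collect_eq using flat0_pd[OF *(2) b] flat0_pd[OF *(3) b] by (intro exI conjI)
qed (use assms in auto)

lemma flat0_add: "flat0 f \<Longrightarrow> flat0 g \<Longrightarrow> flat0 (\<lambda>x. f x + g x)"
  using flat0_add_scaled[of f g 1] by simp

lemma flat0_zero_fun: "flat0 (\<lambda>x. 0)"
  by (rule flat0_coinduct[of _ "{\<lambda>x. 0}"]) (auto simp: pd_def frechet_derivative_const)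

lemma flat0_scaleR: "flat0 g \<Longrightarrow> flat0 (\<lambda>x. c *\<^sub>R g x)"
  using flat0_add_scaled[OF flat0_zero_fun, of g c] by simp

lemma flat0_sum: "(\<And>i. i \<in> I \<Longrightarrow> flat0 (f i)) \<Longrightarrow> flat0 (\<lambda>x. \<Sum>i\<in>I. f i x)"
  by (induction I rule: infinite_finite_induct) (auto simp: flat0_zero_fun intro!: flat0_add)

text \<open>Differentiating \<open>l g\<close> leaves a term without the linear factor, so the
  family closed under derivatives consists of the sums \<open>f + l g\<close>, not of the products
  alone.\<close>

lemma flat0_add_linear_mult:
  fixes f g :: "'a::euclidean_space \<Rightarrow> 'b::real_normed_vector"
  assumes "flat0 f" "flat0 g" and l: "bounded_linear (l :: 'a \<Rightarrow> real)"
  shows "flat0 (\<lambda>x. f x + l x *\<^sub>R g x)"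
proof (rule flat0_coinduct[of _ "{\<lambda>x. f x + l x *\<^sub>R g x | f g. flat0 f \<and> flat0 g}"])
  have lx: "(l has_derivative l) (at x)" for x by (rule bounded_linear_imp_has_derivative[OF l])
  fix h :: "'a \<Rightarrow> 'b" assume h: "h \<in> {\<lambda>x. f x + l x *\<^sub>R g x | f g. flat0 f \<and> flat0 g}"
  then obtain f g :: "'a \<Rightarrow> 'b" where *: "h = (\<lambda>x. f x + l x *\<^sub>R g x)" "flat0 f" "flat0 g" by auto
  have der: "(h has_derivative (\<lambda>v. frechet_derivative f (at x) v +
          (l x *\<^sub>R frechet_derivative g (at x) v + l v *\<^sub>R g x))) (at x)" for x
    unfolding *(1) by (intro has_derivative_add has_derivative_scaleR flat0_has_derivative * lx)
  then show "h differentiable (at x)" for x by (auto simp: differentiable_def)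
  show "h 0 = 0" using * by (simp add: flat0_zero)
  fix b :: 'a assume b: "b \<in> Basis"
  have "pd b h = (\<lambda>x. (pd b f x + l b *\<^sub>R g x) + l x *\<^sub>R pd b g x)"
  proof
    fix x
    show "pd b h x = (pd b f x + l b *\<^sub>R g x) + l x *\<^sub>R pd b g x"
      unfolding pd_eqI[OF der] by (simp add: pd_def)
  qed
  moreover have "flat0 (\<lambda>x. pd b f x + l b *\<^sub>R g x)" by (intro flat0_add_scaled flat0_pd * b)
  ultimately show "pd b h \<in> {\<lambda>x. f x + l x *\<^sub>R g x | f g. flat0 f \<and> flat0 g}"
    unfolding mem_Collect_eq using flat0_pd[OF *(3) b] by (intro exI conjI)
qed (use assms in auto)

text \<open>Taylor's estimate at a flat point: induction on the order, each step by the mean value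
  inequality on the ball of radius \<open>norm x\<close>.\<close>

lemma flat0_bound:
  fixes f :: "'a::euclidean_space \<Rightarrow> 'b::real_normed_vector"
  assumes "flat0 f"
  shows "\<exists>C. \<forall>x. norm x \<le> 1 \<longrightarrow> norm (f x) \<le> C * norm x ^ N"
  using assms
proof (induction N arbitrary: f)
  case 0
  have "continuous_on (cball 0 1) f"
    using flat0_differentiable[OF 0] by (intro continuous_at_imp_continuous_on) (auto intro: differentiable_imp_continuous_within)
  then have "bounded (f ` cball 0 1)" by (intro compact_imp_bounded compact_continuous_image) auto
  then obtain B where "\<forall>x\<in>cball 0 1. norm (f x) \<le> B" by (auto simp: bounded_iff)
  then show ?case by (intro exI[of _ B]) auto
next
  case (Suc N)
  have "\<forall>b\<in>Basis. \<exists>C. \<forall>x. norm x \<le> 1 \<longrightarrow> norm (pd b f x) \<le> C * norm x ^ N"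
    using Suc.IH[OF flat0_pd[OF Suc.prems]] by blast
  from bchoice[OF this] obtain C where C': "\<forall>b\<in>Basis. \<forall>x. norm x \<le> 1 \<longrightarrow> norm (pd b f x) \<le> C b * norm x ^ N" ..
  then have C: "\<And>b x. b \<in> Basis \<Longrightarrow> norm x \<le> 1 \<Longrightarrow> norm (pd b f x) \<le> C b * norm x ^ N" by simp
  define K where "K = (\<Sum>b\<in>Basis. \<bar>C b\<bar>)"
  have "norm (f x) \<le> K * norm x ^ Suc N" if x: "norm x \<le> 1" for x
  proof -
    have "norm (f x - f 0) \<le> (K * norm x ^ N) * norm (x - 0)"
    proof (rule differentiable_bound[where S = "cball 0 (norm x)" and f' = "\<lambda>y. frechet_derivative f (at y)"])
      fix y :: 'a assume y: "y \<in> cball 0 (norm x)"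
      show "(f has_derivative frechet_derivative f (at y)) (at y within cball 0 (norm x))"
        by (rule has_derivative_at_withinI[OF flat0_has_derivative[OF Suc.prems]])
      show "onorm (frechet_derivative f (at y)) \<le> K * norm x ^ N"
      proof (rule onorm_bound)
        fix v :: 'a
        have lin: "linear (frechet_derivative f (at y))"
          using flat0_has_derivative[OF Suc.prems] by (rule has_derivative_linear)
        have "frechet_derivative f (at y) v = frechet_derivative f (at y) (\<Sum>b\<in>Basis. (v \<bullet> b) *\<^sub>R b)"
          by (simp only: euclidean_representation)
        also have "\<dots> = (\<Sum>b\<in>Basis. (v \<bullet> b) *\<^sub>R pd b f y)"
          by (simp add: linear_sum[OF lin] linear_scale[OF lin] pd_def)
        also have "norm \<dots> \<le> (\<Sum>b\<in>Basis. norm v * (\<bar>C b\<bar> * norm x ^ N))"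
        proof (rule sum_norm_le)
          fix b :: 'a assume b: "b \<in> Basis"
          have "norm (pd b f y) \<le> C b * norm y ^ N" using C[OF b, of y] y x by simp
          also have "\<dots> \<le> \<bar>C b\<bar> * norm x ^ N"
            using y by (intro mult_mono power_mono) auto
          finally show "norm ((v \<bullet> b) *\<^sub>R pd b f y) \<le> norm v * (\<bar>C b\<bar> * norm x ^ N)"
            using Basis_le_norm[OF b, of v] by (simp add: mult_mono)
        qed
        also have "\<dots> = K * norm x ^ N * norm v"
          by (simp add: K_def sum_distrib_left sum_distrib_right mult_ac)
        finally show "norm (frechet_derivative f (at y) v) \<le> K * norm x ^ N * norm v" .
      qed (auto simp: K_def sum_nonneg)
    qed auto
    then show ?thesis by (simp add: flat0_zero[OF Suc.prems] mult_ac)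
  qed
  then show ?case by blast
qed

text \<open>\<open>hor b\<close> is the left invariant field whose value at the identity is \<open>(b, 0)\<close>.\<close>
definition symp :: "complex ^ 'n \<Rightarrow> complex ^ 'n \<Rightarrow> real" where
  "symp b z = (\<Sum>j\<in>UNIV. Im (z $ j) * Re (b $ j) - Re (z $ j) * Im (b $ j)) / 2"

definition vf :: "complex ^ 'n \<Rightarrow> 'n::finite heis \<Rightarrow> 'n heis" where
  "vf b x = (b, symp b (fst x))"

definition hor :: "complex ^ 'n \<Rightarrow> ('n::finite heis \<Rightarrow> 'b::real_normed_vector) \<Rightarrow> 'n heis \<Rightarrow> 'b" where
  "hor b f = (\<lambda>x. frechet_derivative f (at x) (vf b x))"

lemma symp_add: "symp b (z + w) = symp b z + symp b w"
  by (simp add: symp_def sum.distrib[symmetric] add_divide_distrib[symmetric] algebra_simps)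

lemma symp_scaleR: "symp b (c *\<^sub>R z) = c * symp b z"
  by (simp add: symp_def sum_distrib_left algebra_simps)

lemma symp_self: "symp b b = 0"
  by (simp add: symp_def mult.commute)

lemma linear_symp: "linear (symp b)"
  by (rule linearI) (auto simp: symp_add symp_scaleR)

lemma bounded_linear_symp: "bounded_linear (symp b)"
  using linear_symp linear_conv_bounded_linear by blast

lemma hor_eqI: "(f has_derivative f') (at x) \<Longrightarrow> hor b f x = f' (vf b x)"
  by (simp add: hor_def frechet_derivative_at[symmetric])

lemma hor_pd:
  assumes "f differentiable (at x)"
  shows "hor b f x = pd (b, 0) f x + symp b (fst x) *\<^sub>R pd (0, 1) f x"
proof -
  have lin: "linear (frechet_derivative f (at x))"
    using assms frechet_derivative_works has_derivative_linear by blast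
  have "vf b x = (b, 0) + symp b (fst x) *\<^sub>R (0, 1)" by (simp add: vf_def)
  then show ?thesis
    by (simp only: hor_def pd_def linear_add[OF lin] linear_scale[OF lin])
qed

lemma Basis_heis: "b \<in> Basis \<Longrightarrow> (b, 0) \<in> (Basis :: 'n::finite heis set)" "(0, 1) \<in> (Basis :: 'n heis set)"
  by (auto simp: Basis_prod_def)

lemma flat0_hor:
  assumes f: "flat0 f" and b: "b \<in> Basis"
  shows "flat0 (hor b f)"
proof -
  have "hor b f = (\<lambda>x. pd (b, 0) f x + symp b (fst x) *\<^sub>R pd (0, 1) f x)"
    using hor_pd flat0_differentiable[OF f] by blast
  moreover have "flat0 \<dots>"
    by (intro flat0_add_linear_mult flat0_pd f Basis_heis b
        bounded_linear_compose[OF bounded_linear_symp bounded_linear_fst])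
  ultimately show ?thesis by simp
qed

text \<open>The sublaplacian as a sum over the real basis vectors of the first factor, which treats
  the fields X and Y uniformly. It agrees with \<open>sublaplacian\<close> on flat
  functions.\<close>

definition lap :: "('n::finite heis \<Rightarrow> 'b::real_normed_vector) \<Rightarrow> 'n heis \<Rightarrow> 'b" where
  "lap f = (\<lambda>x. - (\<Sum>b\<in>Basis. hor b (hor b f) x))"

lemma sum_Basis_complex_vec:
  "(\<Sum>b\<in>(Basis :: (complex ^ 'n) set). g b) = (\<Sum>j\<in>UNIV. g (axis j 1) + g (axis j \<i>))"
proof -
  have B: "(Basis :: (complex ^ 'n) set) = (\<lambda>(j, u). axis j u) ` (UNIV \<times> {1, \<i>})"
    by (auto simp: Basis_vec_def Basis_complex_def image_iff)
  have inj: "inj_on (\<lambda>(j, u). axis j u :: complex ^ 'n) (UNIV \<times> {1, \<i>})"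
    by (auto simp: inj_on_def axis_eq_axis)
  show ?thesis
    unfolding B sum.reindex[OF inj] using sum.cartesian_product'[of "\<lambda>(j, u). g (axis j u)" UNIV "{1, \<i>}"]
    by (simp add: o_def split_def)
qed

lemma symp_axis:
  "symp (axis j 1) z = Im (z $ j) / 2" "symp (axis j \<i>) z = - Re (z $ j) / 2"
proof -
  have *: "Im (z $ i) * Re (axis j 1 $ i) - Re (z $ i) * Im (axis j 1 $ i) = (if i = j then Im (z $ j) else 0)"
     "Im (z $ i) * Re (axis j \<i> $ i) - Re (z $ i) * Im (axis j \<i> $ i) = (if i = j then - Re (z $ j) else 0)" for i
    by (auto simp: axis_def)
  show "symp (axis j 1) z = Im (z $ j) / 2" "symp (axis j \<i>) z = - Re (z $ j) / 2"
    unfolding symp_def * by simp_all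
qed

lemma X_field_eq_hor: "(\<And>x. f differentiable (at x)) \<Longrightarrow> X_field j f = hor (axis j 1) f"
  by (rule ext) (auto simp: X_field_def hor_pd symp_axis split: prod.split)

lemma Y_field_eq_hor: "(\<And>x. f differentiable (at x)) \<Longrightarrow> Y_field j f = hor (axis j \<i>) f"
  by (rule ext) (auto simp: Y_field_def hor_pd symp_axis split: prod.split)

lemma axis_in_Basis_complex: "axis j 1 \<in> (Basis :: (complex ^ 'n) set)" "axis j \<i> \<in> (Basis :: (complex ^ 'n) set)"
  by (auto simp: axis_in_Basis_iff Basis_complex_def)

lemma sublaplacian_eq_lap:
  assumes f: "flat0 f" shows "sublaplacian f = lap f"
proof
  fix p
  have d: "\<And>x. f differentiable (at x)" "\<And>b x. b \<in> Basis \<Longrightarrow> hor b f differentiable (at x)"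
    by (auto intro!: flat0_differentiable flat0_hor f)
  show "sublaplacian f p = lap f p"
    by (simp add: sublaplacian_def lap_def sum_Basis_complex_vec X_field_eq_hor[OF d(1)] Y_field_eq_hor[OF d(1)]
        X_field_eq_hor[OF d(2)] Y_field_eq_hor[OF d(2)] axis_in_Basis_complex)
qed

lemma flat0_lap: "flat0 f \<Longrightarrow> flat0 (lap f)"
  using flat0_scaleR[of "\<lambda>x. \<Sum>b\<in>Basis. hor b (hor b f) x" "-1"]
  by (simp add: lap_def flat0_sum flat0_hor)

lemma flat0_lap_pow: "flat0 f \<Longrightarrow> flat0 ((lap ^^ m) f)"
  by (induction m) (auto simp: flat0_lap)

lemma sublaplacian_pow_eq_lap_pow: "flat0 f \<Longrightarrow> (sublaplacian ^^ m) f = (lap ^^ m) f"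
  by (induction m) (auto simp: sublaplacian_eq_lap flat0_lap_pow)

subsection \<open>Integration by parts and symmetry of the sublaplacian\<close>

lemma continuous_on_symp [continuous_intros]: "continuous_on S f \<Longrightarrow> continuous_on S (\<lambda>x. symp b (f x))"
  using bounded_linear.continuous_on[OF bounded_linear_symp] .

lemma continuous_on_vf [continuous_intros]: "continuous_on S (vf b)"
  unfolding vf_def[abs_def] by (intro continuous_intros)

section \<open>Invariance of Lebesgue measure under the flows of the left invariant fields\<close>

lemma nn_integral_heis:
  fixes f :: "'n::finite heis \<Rightarrow> ennreal"
  assumes "f \<in> borel_measurable borel"
  shows "(\<integral>\<^sup>+x. f x \<partial>lborel) = (\<integral>\<^sup>+z. \<integral>\<^sup>+t. f (z, t) \<partial>lborel \<partial>lborel)"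
proof -
  have "f \<in> borel_measurable (lborel \<Otimes>\<^sub>M lborel)" using assms by (simp add: lborel_prod)
  from lborel.nn_integral_fst[OF this] show ?thesis by (simp add: lborel_prod)
qed

lemma nn_integral_translate:
  fixes f :: "'a::euclidean_space \<Rightarrow> ennreal"
  assumes [measurable]: "f \<in> borel_measurable borel"
  shows "(\<integral>\<^sup>+x. f (c + x) \<partial>lborel) = (\<integral>\<^sup>+x. f x \<partial>lborel)"
proof -
  have "(\<integral>\<^sup>+x. f x \<partial>lborel) = (\<integral>\<^sup>+x. f x \<partial>distr lborel borel ((+) c))" by (simp add: lborel_distr_plus)
  also have "\<dots> = (\<integral>\<^sup>+x. f (c + x) \<partial>lborel)" by (rule nn_integral_distr) auto
  finally show ?thesis by simp
qed

lemma measurable_flow [measurable]: "(\<lambda>x. x + s *\<^sub>R vf b x) \<in> borel_measurable borel"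
  by (intro borel_measurable_continuous_onI continuous_intros)

text \<open>The flow is right translation by (s b, 0): a translation in z combined with a shift of t
  that depends on z alone.\<close>

lemma nn_integral_flow:
  fixes f :: "'n::finite heis \<Rightarrow> ennreal"
  assumes f[measurable]: "f \<in> borel_measurable borel"
  shows "(\<integral>\<^sup>+x. f (x + s *\<^sub>R vf b x) \<partial>lborel) = (\<integral>\<^sup>+x. f x \<partial>lborel)"
proof -
  have m: "(\<lambda>x. f (x + s *\<^sub>R vf b x)) \<in> borel_measurable borel"
    by (rule measurable_compose[OF measurable_flow f])
  have [measurable]: "(\<lambda>t. f (z, t)) \<in> borel_measurable borel" for z
    by (rule measurable_compose[OF _ f]) (auto intro!: borel_measurable_continuous_onI continuous_intros)
  have [measurable]: "(\<lambda>z. \<integral>\<^sup>+t. f (z, t) \<partial>lborel) \<in> borel_measurable borel"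
  proof -
    have "f \<in> borel_measurable (lborel \<Otimes>\<^sub>M lborel)" by (simp add: lborel_prod)
    then have "(\<lambda>z. \<integral>\<^sup>+t. f (z, t) \<partial>lborel) \<in> borel_measurable lborel" by measurable
    then show ?thesis by simp
  qed
  have "(\<integral>\<^sup>+x. f (x + s *\<^sub>R vf b x) \<partial>lborel) = (\<integral>\<^sup>+z. \<integral>\<^sup>+t. f (s *\<^sub>R b + z, s * symp b z + t) \<partial>lborel \<partial>lborel)"
    using nn_integral_heis[OF m] by (simp add: vf_def add.commute)
  also have "\<dots> = (\<integral>\<^sup>+z. \<integral>\<^sup>+t. f (s *\<^sub>R b + z, t) \<partial>lborel \<partial>lborel)"
    by (intro nn_integral_cong nn_integral_translate) measurable
  also have "\<dots> = (\<integral>\<^sup>+z. \<integral>\<^sup>+t. f (z, t) \<partial>lborel \<partial>lborel)"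
    by (rule nn_integral_translate) measurable
  also have "\<dots> = (\<integral>\<^sup>+x. f x \<partial>lborel)" by (rule nn_integral_heis[symmetric]) fact
  finally show ?thesis .
qed

lemma distr_flow: "distr lborel borel (\<lambda>x::'n::finite heis. x + s *\<^sub>R vf b x) = lborel"
proof (rule measure_eqI)
  fix A :: "'n heis set" assume "A \<in> sets (distr lborel borel (\<lambda>x. x + s *\<^sub>R vf b x))"
  then have A[measurable]: "A \<in> sets borel" by simp
  have "emeasure (distr lborel borel (\<lambda>x. x + s *\<^sub>R vf b x)) A =
      (\<integral>\<^sup>+x. indicator A x \<partial>distr lborel borel (\<lambda>x. x + s *\<^sub>R vf b x))"
    by (simp add: nn_integral_indicator)
  also have "\<dots> = (\<integral>\<^sup>+x. indicator A (x + s *\<^sub>R vf b x) \<partial>lborel)"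
    by (rule nn_integral_distr) auto
  also have "\<dots> = (\<integral>\<^sup>+x. indicator A x \<partial>lborel)" by (rule nn_integral_flow) auto
  finally show "emeasure (distr lborel borel (\<lambda>x. x + s *\<^sub>R vf b x)) A = emeasure lborel A" by simp
qed simp

lemma
  fixes f :: "'n::finite heis \<Rightarrow> real"
  assumes [measurable]: "f \<in> borel_measurable borel"
  shows integral_flow: "(\<integral>x. f (x + s *\<^sub>R vf b x) \<partial>lborel) = (\<integral>x. f x \<partial>lborel)"
    and integrable_flow: "integrable lborel f \<Longrightarrow> integrable lborel (\<lambda>x. f (x + s *\<^sub>R vf b x))"
proof -
  have m: "(\<lambda>x. x + s *\<^sub>R vf b x) \<in> measurable lborel borel" by simp
  show "(\<integral>x. f (x + s *\<^sub>R vf b x) \<partial>lborel) = (\<integral>x. f x \<partial>lborel)"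
    using integral_distr[OF m, of f] by (simp add: distr_flow)
  show "integrable lborel f \<Longrightarrow> integrable lborel (\<lambda>x. f (x + s *\<^sub>R vf b x))"
    using integrable_distr_eq[OF m, of f] by (simp add: distr_flow)
qed

text \<open>The form \<open>symp\<close> is alternating, so the field is constant along its own
  integral curves, which are straight lines.\<close>

lemma vf_flow: "vf b (x + s *\<^sub>R vf b x) = vf b x"
  by (simp add: vf_def symp_add symp_scaleR symp_self)

text \<open>The fundamental theorem along the flow over unit time expresses the increment of \<phi>
  by its derivative. The increments integrate to 0 by invariance of the measure; after Fubini their
  integral is also the integral of the derivative.\<close>

lemma integral_hor_eq_0:
  fixes \<phi> :: "'n::finite heis \<Rightarrow> real"
  assumes int: "integrable lborel \<phi>" "integrable lborel (hor b \<phi>)"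
    and diff: "\<And>x. \<phi> differentiable (at x)" and cont: "continuous_on UNIV (hor b \<phi>)"
  shows "(\<integral>x. hor b \<phi> x \<partial>lborel) = 0"
proof -
  define G where "G = hor b \<phi>"
  have [measurable]: "G \<in> borel_measurable borel" using cont by (simp add: G_def borel_measurable_continuous_onI)
  have [measurable]: "\<phi> \<in> borel_measurable borel" using int by simp
  define K where "K s x = indicator {0..1} s * G (x + s *\<^sub>R vf b x)" for s :: real and x
  have ftc: "(\<integral>s. K s x \<partial>lborel) = \<phi> (x + 1 *\<^sub>R vf b x) - \<phi> x" for x
  proof -
    have "(\<integral>s. indicator {0..1} s *\<^sub>R G (x + s *\<^sub>R vf b x) \<partial>lborel) = \<phi> (x + 1 *\<^sub>R vf b x) - \<phi> (x + 0 *\<^sub>R vf b x)"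
    proof (rule integral_FTC_Icc)
      show "continuous_on {0..1} (\<lambda>s. G (x + s *\<^sub>R vf b x))"
        unfolding G_def by (intro continuous_on_compose2[OF cont] continuous_intros) auto
      fix s :: real
      have "(\<phi> has_derivative frechet_derivative \<phi> (at (x + s *\<^sub>R vf b x))) (at (x + s *\<^sub>R vf b x))"
        using diff frechet_derivative_works by blast
      then have "((\<lambda>s. \<phi> (x + s *\<^sub>R vf b x)) has_derivative (\<lambda>h. frechet_derivative \<phi> (at (x + s *\<^sub>R vf b x)) (h *\<^sub>R vf b x))) (at s within {0..1})"
        by (rule has_derivative_compose[rotated]) (auto intro!: derivative_eq_intros)
      moreover have "frechet_derivative \<phi> (at (x + s *\<^sub>R vf b x)) (h *\<^sub>R vf b x) = h *\<^sub>R G (x + s *\<^sub>R vf b x)" for h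
        unfolding G_def hor_def vf_flow
        by (rule linear_scale) (use diff frechet_derivative_works has_derivative_linear in blast)
      ultimately show "((\<lambda>s. \<phi> (x + s *\<^sub>R vf b x)) has_vector_derivative G (x + s *\<^sub>R vf b x)) (at s within {0..1})"
        by (simp add: has_vector_derivative_def)
    qed simp
    then show ?thesis by (simp add: K_def)
  qed
  have inner: "(\<integral>x. K s x \<partial>lborel) = indicator {0..1} s * (\<integral>x. G x \<partial>lborel)" for s
    by (simp add: K_def integral_flow)
  have "integrable (lborel \<Otimes>\<^sub>M lborel) (\<lambda>(s, x). K s x)"
  proof (rule lborel_pair.Fubini_integrable)
    have "continuous_on UNIV (\<lambda>p. G (snd p + fst p *\<^sub>R vf b (snd p)))"
      unfolding G_def by (intro continuous_on_compose2[OF cont] continuous_intros continuous_on_compose2[OF continuous_on_vf]) auto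
    then have [measurable]: "(\<lambda>p. G (snd p + fst p *\<^sub>R vf b (snd p))) \<in> borel_measurable (lborel \<Otimes>\<^sub>M lborel)"
      unfolding lborel_prod by (simp add: borel_measurable_continuous_onI)
    have [measurable]: "(\<lambda>p::real \<times> 'n heis. indicator {0..1} (fst p) :: real) \<in> borel_measurable (lborel \<Otimes>\<^sub>M lborel)"
    proof -
      have "(indicator {0..1} :: real \<Rightarrow> real) \<in> borel_measurable lborel" by simp
      then show ?thesis by (rule measurable_compose[OF measurable_fst])
    qed
    show "(\<lambda>(s, x). K s x) \<in> borel_measurable (lborel \<Otimes>\<^sub>M lborel)"
      unfolding K_def split_beta by measurable
    have "(\<integral>x. norm (K s x) \<partial>lborel) = indicator {0..1} s * (\<integral>x. \<bar>G x\<bar> \<partial>lborel)" for s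
      by (simp add: K_def abs_mult integral_flow[of "\<lambda>x. \<bar>G x\<bar>"])
    then show "integrable lborel (\<lambda>s. \<integral>x. norm (case (s, x) of (s, x) \<Rightarrow> K s x) \<partial>lborel)"
      by simp
    show "AE s in lborel. integrable lborel (\<lambda>x. case (s, x) of (s, x) \<Rightarrow> K s x)"
      using int integrable_flow[of G] by (auto simp: K_def G_def)
  qed
  from lborel_pair.Fubini_integral[OF this]
  have "(\<integral>x. (\<integral>s. K s x \<partial>lborel) \<partial>lborel) = (\<integral>s. (\<integral>x. K s x \<partial>lborel) \<partial>lborel)" by simp
  moreover have "(\<integral>s. (\<integral>x. K s x \<partial>lborel) \<partial>lborel) = (\<integral>x. G x \<partial>lborel)" by (simp add: inner)
  moreover have "(\<integral>x. (\<integral>s. K s x \<partial>lborel) \<partial>lborel) = 0"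
    unfolding ftc using int integrable_flow[of \<phi> 1 b] integral_flow[of \<phi> 1 b] by simp
  ultimately show ?thesis by (simp add: G_def)
qed

section \<open>Cutoff functions adapted to the gauge\<close>

definition gauge4 :: "'n::finite heis \<Rightarrow> real" where
  "gauge4 x = (norm (fst x))\<^sup>2 * (norm (fst x))\<^sup>2 + (snd x)\<^sup>2"

text \<open>Being a function of \<open>gauge4 x / R ^ 4\<close>, with \<open>gauge4\<close>
  homogeneous of degree 4, the cutoff has horizontal derivatives of order 1/R. The outer square
  makes it continuously differentiable at the edge of its support.\<close>

definition bump :: "real \<Rightarrow> 'n::finite heis \<Rightarrow> real" where
  "bump R x = (max 0 (1 - gauge4 x / R ^ 4))\<^sup>2"

lemma gauge4_has_derivative:
  "(gauge4 has_derivative (\<lambda>h. 4 * (norm (fst x))\<^sup>2 * (fst x \<bullet> fst h) + 2 * snd x * snd h)) (at x)"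
  unfolding gauge4_def[abs_def] power2_norm_eq_inner
  by (auto intro!: derivative_eq_intros simp: inner_commute algebra_simps)

lemma max0_square_has_derivative: "((\<lambda>y::real. (max 0 y)\<^sup>2) has_real_derivative 2 * max 0 y) (at y)"
proof -
  consider "y > 0" | "y < 0" | "y = 0" by linarith
  then show ?thesis
  proof cases
    case 1
    have "((\<lambda>y::real. y\<^sup>2) has_real_derivative 2 * max 0 y) (at y)"
      using 1 by (auto intro!: derivative_eq_intros)
    moreover have "eventually (\<lambda>u. (max 0 u)\<^sup>2 = u\<^sup>2) (nhds y)"
      using 1 by (intro eventually_mono[OF eventually_nhds_in_open[of "{0<..}"]]) auto
    ultimately show ?thesis by (subst DERIV_cong_ev[OF refl _ refl]) auto
  next
    case 2
    have "((\<lambda>y::real. 0) has_real_derivative 2 * max 0 y) (at y)" using 2 by simp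
    moreover have "eventually (\<lambda>u. (max 0 u)\<^sup>2 = 0) (nhds y)"
      using 2 by (intro eventually_mono[OF eventually_nhds_in_open[of "{..<0}"]]) auto
    ultimately show ?thesis by (subst DERIV_cong_ev[OF refl _ refl]) auto
  next
    case 3
    have "((\<lambda>h. (max 0 h)\<^sup>2 / h) \<longlongrightarrow> 0) (at (0::real))"
    proof (rule Lim_null_comparison[OF _ tendsto_rabs_zero[OF tendsto_ident_at]])
      show "\<forall>\<^sub>F h in at (0::real). norm ((max 0 h)\<^sup>2 / h) \<le> \<bar>h\<bar>"
        by (rule always_eventually) (auto simp: max_def power2_eq_square)
    qed
    then show ?thesis using 3 by (simp add: DERIV_def)
  qed
qed

lemma bump_has_derivative:
  "(bump R has_derivative (\<lambda>h. - 2 * max 0 (1 - gauge4 x / R ^ 4) / R ^ 4 *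
      (4 * (norm (fst x))\<^sup>2 * (fst x \<bullet> fst h) + 2 * snd x * snd h))) (at x)"
proof -
  have "((\<lambda>y. (max 0 (1 - y / R ^ 4))\<^sup>2) has_real_derivative (2 * max 0 (1 - y / R ^ 4)) * (- 1 / R ^ 4)) (at y)" for y
    by (rule DERIV_chain2[OF max0_square_has_derivative])
       (use DERIV_diff[OF DERIV_const DERIV_cdivide[OF DERIV_ident]] in simp)
  from has_derivative_compose[OF gauge4_has_derivative this[unfolded has_field_derivative_def]]
  show ?thesis unfolding bump_def[abs_def]
    by (rule has_derivative_eq_rhs) (simp add: fun_eq_iff algebra_simps)
qed

lemma bump_differentiable: "bump R differentiable (at x)"
  using bump_has_derivative differentiable_def by blast

lemma hor_bump: "hor b (bump R) x = - 2 * max 0 (1 - gauge4 x / R ^ 4) / R ^ 4 *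
      (4 * (norm (fst x))\<^sup>2 * (fst x \<bullet> b) + 2 * snd x * symp b (fst x))"
  by (simp add: hor_eqI[OF bump_has_derivative] vf_def)

lemma continuous_on_gauge4: "continuous_on UNIV gauge4"
  unfolding gauge4_def[abs_def] by (intro continuous_intros)

lemma continuous_on_hor_bump: "R > 0 \<Longrightarrow> continuous_on UNIV (hor b (bump R))"
  unfolding hor_bump[abs_def] by (intro continuous_intros continuous_on_gauge4) auto

lemma bump_bounds: "R > 0 \<Longrightarrow> 0 \<le> bump R x" "R > 0 \<Longrightarrow> bump R x \<le> 1"
  by (auto simp: bump_def gauge4_def power_le_one_iff intro!: power_le_one)

lemma symp_le: assumes b: "b \<in> Basis" shows "\<bar>symp b z\<bar> \<le> norm z"
proof -
  obtain j u where b: "b = axis j u" "u \<in> {1, \<i>}"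
    using b by (auto simp: Basis_vec_def Basis_complex_def)
  have "\<bar>symp b z\<bar> \<le> norm (z $ j)"
    using abs_Re_le_cmod[of "z $ j"] abs_Im_le_cmod[of "z $ j"] b by (auto simp: symp_axis)
  also have "\<dots> \<le> norm z" by (rule Finite_Cartesian_Product.norm_nth_le)
  finally show ?thesis .
qed

text \<open>Where the cutoff is active, |z| \<le> R and |t| \<le> R^2, so the horizontal derivative
  of \<open>gauge4\<close> is at most (4 + 2) R^3; the outer factor is at most 2 / R^4.\<close>

lemma hor_bump_le:
  assumes R: "R > 0" and b: "b \<in> Basis"
  shows "\<bar>hor b (bump R) x\<bar> \<le> 12 / R"
proof (cases "gauge4 x \<ge> R ^ 4")
  case True
  then have "max 0 (1 - gauge4 x / R ^ 4) = 0" using R by (simp add: field_simps)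
  then show ?thesis using R by (simp add: hor_bump)
next
  case False
  define r where "r = norm (fst x)"
  have g: "r\<^sup>2 * r\<^sup>2 + (snd x)\<^sup>2 < R ^ 4" using False by (simp add: gauge4_def r_def)
  have r: "r \<le> R"
  proof (rule ccontr)
    assume "\<not> r \<le> R"
    then have "R ^ 4 \<le> r ^ 4" using R by (intro power_mono) auto
    then show False using g by (simp add: power4_eq_xxxx power2_eq_square mult_ac) (smt (verit) zero_le_square)
  qed
  have t: "\<bar>snd x\<bar> \<le> R\<^sup>2"
  proof (rule ccontr)
    assume "\<not> \<bar>snd x\<bar> \<le> R\<^sup>2"
    then have "(R\<^sup>2)\<^sup>2 \<le> \<bar>snd x\<bar>\<^sup>2" by (intro power_mono) auto
    then have "R ^ 4 \<le> (snd x)\<^sup>2" by (simp flip: power_mult)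
    moreover have "r\<^sup>2 * r\<^sup>2 \<ge> 0" by simp
    ultimately show False using g by linarith
  qed
  have m: "0 \<le> max 0 (1 - gauge4 x / R ^ 4)" "max 0 (1 - gauge4 x / R ^ 4) \<le> 1"
    using R by (auto simp: gauge4_def)
  have "\<bar>4 * r\<^sup>2 * (fst x \<bullet> b) + 2 * snd x * symp b (fst x)\<bar> \<le> 4 * r\<^sup>2 * \<bar>fst x \<bullet> b\<bar> + 2 * \<bar>snd x\<bar> * \<bar>symp b (fst x)\<bar>"
    by (rule order_trans[OF abs_triangle_ineq]) (simp add: abs_mult)
  also have "\<dots> \<le> 4 * R\<^sup>2 * R + 2 * R\<^sup>2 * R"
    using r t symp_le[OF b, of "fst x"] Basis_le_norm[OF b, of "fst x"] R
    by (intro add_mono mult_mono) (auto simp: r_def power_mono)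
  finally have N: "\<bar>4 * r\<^sup>2 * (fst x \<bullet> b) + 2 * snd x * symp b (fst x)\<bar> \<le> 6 * R ^ 3"
    by (simp add: power3_eq_cube power2_eq_square)
  have "\<bar>hor b (bump R) x\<bar> = 2 * max 0 (1 - gauge4 x / R ^ 4) / R ^ 4 *
      \<bar>4 * r\<^sup>2 * (fst x \<bullet> b) + 2 * snd x * symp b (fst x)\<bar>"
    using R m by (simp add: hor_bump abs_mult r_def)
  also have "\<dots> \<le> 2 * 1 / R ^ 4 * (6 * R ^ 3)"
    using R m N by (intro mult_mono divide_right_mono) auto
  also have "\<dots> = 12 / R" using R by (simp add: field_simps power4_eq_xxxx power3_eq_cube)
  finally show ?thesis .
qed

lemma bump_compact_support:
  assumes "R > 0"
  obtains K :: "'n::finite heis set" where "compact K" "\<And>x. x \<notin> K \<Longrightarrow> bump R x = 0" "\<And>x b. x \<notin> K \<Longrightarrow> hor b (bump R) x = 0"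
proof -
  let ?K = "{x :: 'n heis. gauge4 x \<le> R ^ 4}"
  have "closed ?K" by (intro closed_Collect_le continuous_on_gauge4 continuous_intros)
  moreover have "bounded ?K"
  proof (rule bounded_subset[of "cball 0 (R + 1) \<times> {- (R\<^sup>2 + 1)..R\<^sup>2 + 1}"])
    show "bounded (cball (0 :: complex ^ 'n) (R + 1) \<times> {- (R\<^sup>2 + 1)..R\<^sup>2 + 1})"
      by (intro bounded_Times bounded_cball bounded_closed_interval)
    show "?K \<subseteq> cball 0 (R + 1) \<times> {- (R\<^sup>2 + 1)..R\<^sup>2 + 1}"
    proof
      fix p :: "'n heis" assume "p \<in> ?K"
      moreover obtain z t where p: "p = (z, t)" by (cases p)
      ultimately have g: "(norm z)\<^sup>2 * (norm z)\<^sup>2 + t\<^sup>2 \<le> R ^ 4" by (simp add: gauge4_def)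
      have g': "(norm z) ^ 4 + t\<^sup>2 \<le> R ^ 4" using g by (simp flip: power_add)
      have "t\<^sup>2 \<le> R ^ 4" using g' zero_le_power[OF norm_ge_zero, of z 4] by linarith
      then have 1: "(norm z) ^ 4 \<le> R ^ 4" "\<bar>t\<bar>\<^sup>2 \<le> (R\<^sup>2)\<^sup>2"
        using g' zero_le_power2[of t] by (linarith, simp flip: power_mult)
      have "norm z \<le> R" using 1(1) assms by (subst (asm) power_mono_iff) auto
      moreover have "\<bar>t\<bar> \<le> R\<^sup>2" using 1(2) by (subst (asm) power_mono_iff) auto
      ultimately show "p \<in> cball 0 (R + 1) \<times> {- (R\<^sup>2 + 1)..R\<^sup>2 + 1}" by (auto simp: p)
    qed
  qed
  ultimately have "compact ?K" by (simp add: compact_eq_bounded_closed)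
  moreover have "max 0 (1 - gauge4 x / R ^ 4) = 0" if "x \<notin> ?K" for x
    using that assms by (simp add: field_simps)
  ultimately show ?thesis by (intro that[of ?K]) (simp_all add: bump_def hor_bump)
qed

lemma integrable_compact_support:
  fixes f :: "'a::euclidean_space \<Rightarrow> real"
  assumes "continuous_on UNIV f" "compact K" "\<And>x. x \<notin> K \<Longrightarrow> f x = 0"
  shows "integrable lborel f"
proof -
  have "integrable lborel (\<lambda>x. indicator K x *\<^sub>R f x)"
    by (rule borel_integrable_compact) (use assms continuous_on_subset[OF assms(1)] in auto)
  moreover have "(\<lambda>x. indicator K x *\<^sub>R f x) = f" using assms(3) by (auto simp: indicator_def fun_eq_iff)
  ultimately show ?thesis by simp
qed

text \<open>The regularity on which the integrations by parts rest, shared by flat functions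
  (\<open>flat0_hor2\<close>) and heat kernels (\<open>hor2_heat\<close>).\<close>

definition hor2 :: "('n::finite heis \<Rightarrow> complex) \<Rightarrow> bool" where
  "hor2 g \<longleftrightarrow> (\<forall>x. g differentiable (at x)) \<and>
     (\<forall>b\<in>Basis. (\<forall>x. hor b g differentiable (at x)) \<and> continuous_on UNIV (hor b (hor b g)))"

lemma continuous_on_UNIV_of_differentiable: "(\<And>x. g differentiable (at x)) \<Longrightarrow> continuous_on UNIV g"
  by (auto simp: continuous_on_eq_continuous_at intro: differentiable_imp_continuous_within)

lemma hor2_continuous:
  assumes "hor2 g"
  shows "continuous_on UNIV g" "b \<in> Basis \<Longrightarrow> continuous_on UNIV (hor b g)" "b \<in> Basis \<Longrightarrow> continuous_on UNIV (hor b (hor b g))"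
  using assms by (auto simp: hor2_def intro!: continuous_on_UNIV_of_differentiable)

lemma hor2_differentiable:
  assumes "hor2 g" shows "g differentiable (at x)" "b \<in> Basis \<Longrightarrow> hor b g differentiable (at x)"
  using assms unfolding hor2_def by blast+

lemma flat0_hor2: "flat0 g \<Longrightarrow> hor2 g"
  unfolding hor2_def by (auto intro!: flat0_differentiable flat0_hor continuous_on_UNIV_of_differentiable)

lemma hor2_continuous_lap: "hor2 g \<Longrightarrow> continuous_on UNIV (lap g)"
  unfolding lap_def by (intro continuous_intros hor2_continuous)

lemma integrable_bump_mult:
  assumes "R > 0" "continuous_on UNIV f"
  shows "integrable lborel (\<lambda>x. bump R x * f x)" "integrable lborel (\<lambda>x. hor b (bump R) x * f x)"
    "integrable lborel (\<lambda>x. (bump R x)\<^sup>2 * f x)"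
proof -
  obtain K :: "'a heis set" where K: "compact K" "\<And>x. x \<notin> K \<Longrightarrow> bump R x = 0" "\<And>x b. x \<notin> K \<Longrightarrow> hor b (bump R) x = 0"
    using bump_compact_support[OF assms(1)] by metis
  have c: "continuous_on UNIV (bump R :: 'a heis \<Rightarrow> real)"
    by (rule continuous_on_UNIV_of_differentiable[OF bump_differentiable])
  show "integrable lborel (\<lambda>x. bump R x * f x)" "integrable lborel (\<lambda>x. hor b (bump R) x * f x)"
    "integrable lborel (\<lambda>x. (bump R x)\<^sup>2 * f x)"
    by (rule integrable_compact_support[OF _ K(1)];
        use K in \<open>auto intro!: continuous_intros c assms continuous_on_hor_bump\<close>)+
qed

lemma hor_mult_inner:
  fixes u :: "'n::finite heis \<Rightarrow> real" and g h :: "'n heis \<Rightarrow> complex"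
  assumes "u differentiable (at x)" "g differentiable (at x)" "h differentiable (at x)"
  shows "hor b (\<lambda>x. u x * (g x \<bullet> h x)) x = hor b u x * (g x \<bullet> h x) + u x * (hor b g x \<bullet> h x) + u x * (g x \<bullet> hor b h x)"
    "(\<lambda>x. u x * (g x \<bullet> h x)) differentiable (at x)"
proof -
  have "((\<lambda>x. u x * (g x \<bullet> h x)) has_derivative
     (\<lambda>v. u x * (g x \<bullet> frechet_derivative h (at x) v + frechet_derivative g (at x) v \<bullet> h x) +
       frechet_derivative u (at x) v * (g x \<bullet> h x))) (at x)"
    by (intro has_derivative_mult has_derivative_inner frechet_derivative_works[THEN iffD1] assms)
  then show "hor b (\<lambda>x. u x * (g x \<bullet> h x)) x = hor b u x * (g x \<bullet> h x) + u x * (hor b g x \<bullet> h x) + u x * (g x \<bullet> hor b h x)"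
    "(\<lambda>x. u x * (g x \<bullet> h x)) differentiable (at x)"
    by (auto simp: hor_eqI differentiable_def algebra_simps) (simp add: hor_def algebra_simps)
qed

lemma bump_power2_differentiable: "(\<lambda>x. (bump R x)\<^sup>2) differentiable (at x)"
  and hor_bump_power2: "hor b (\<lambda>x. (bump R x)\<^sup>2) x = 2 * bump R x * hor b (bump R) x"
proof -
  have "((\<lambda>x. (bump R x)\<^sup>2) has_derivative (\<lambda>v. 2 * bump R x * frechet_derivative (bump R) (at x) v)) (at x)"
    using has_derivative_power[OF frechet_derivative_works[THEN iffD1, OF bump_differentiable[of R x]], of 2] by (simp add: mult_ac)
  then show "(\<lambda>x. (bump R x)\<^sup>2) differentiable (at x)" "hor b (\<lambda>x. (bump R x)\<^sup>2) x = 2 * bump R x * hor b (bump R) x"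
    by (auto simp: differentiable_def hor_eqI) (simp add: hor_def)
qed

lemma bump_ibp:
  assumes g: "hor2 g" and h: "hor2 h" and R: "R > 0" and b: "b \<in> Basis"
  shows "(\<integral>x. bump R x * (g x \<bullet> hor b (hor b h) x) \<partial>lborel) =
     - (\<integral>x. hor b (bump R) x * (g x \<bullet> hor b h x) \<partial>lborel) - (\<integral>x. bump R x * (hor b g x \<bullet> hor b h x) \<partial>lborel)"
proof -
  note c = hor2_continuous[OF g] hor2_continuous[OF h]
  let ?\<phi> = "\<lambda>x. bump R x * (g x \<bullet> hor b h x)"
  have e: "hor b ?\<phi> = (\<lambda>x. hor b (bump R) x * (g x \<bullet> hor b h x) + bump R x * (hor b g x \<bullet> hor b h x) +
      bump R x * (g x \<bullet> hor b (hor b h) x))"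
    by (intro ext hor_mult_inner bump_differentiable hor2_differentiable g h b)
  have i: "integrable lborel (\<lambda>x. hor b (bump R) x * (g x \<bullet> hor b h x))"
    "integrable lborel (\<lambda>x. bump R x * (hor b g x \<bullet> hor b h x))"
    "integrable lborel (\<lambda>x. bump R x * (g x \<bullet> hor b (hor b h) x))"
    by (intro integrable_bump_mult R continuous_intros c b)+
  have "(\<integral>x. hor b ?\<phi> x \<partial>lborel) = 0"
  proof (rule integral_hor_eq_0)
    show "integrable lborel ?\<phi>" by (intro integrable_bump_mult R continuous_intros c b)
    show "integrable lborel (hor b ?\<phi>)" unfolding e using i by simp
    show "?\<phi> differentiable (at x)" for x
      by (intro hor_mult_inner bump_differentiable hor2_differentiable g h b)
    show "continuous_on UNIV (hor b ?\<phi>)" unfolding e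
      by (intro continuous_intros c b continuous_on_hor_bump R
          continuous_on_UNIV_of_differentiable[OF bump_differentiable])
  qed
  then show ?thesis unfolding e using i by simp
qed

lemma bump_power2_ibp:
  assumes g: "hor2 g" and R: "R > 0" and b: "b \<in> Basis"
  shows "(\<integral>x. (bump R x)\<^sup>2 * (g x \<bullet> hor b (hor b g) x) \<partial>lborel) =
     - (\<integral>x. hor b (bump R) x * (2 * bump R x * (g x \<bullet> hor b g x)) \<partial>lborel) - (\<integral>x. (bump R x)\<^sup>2 * (norm (hor b g x))\<^sup>2 \<partial>lborel)"
proof -
  note c = hor2_continuous[OF g] continuous_on_UNIV_of_differentiable[OF bump_differentiable]
  let ?\<phi> = "\<lambda>x. (bump R x)\<^sup>2 * (g x \<bullet> hor b g x)"
  have e: "hor b ?\<phi> = (\<lambda>x. hor b (bump R) x * (2 * bump R x * (g x \<bullet> hor b g x)) + (bump R x)\<^sup>2 * (norm (hor b g x))\<^sup>2 +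
      (bump R x)\<^sup>2 * (g x \<bullet> hor b (hor b g) x))"
  proof
    fix x
    show "hor b ?\<phi> x = hor b (bump R) x * (2 * bump R x * (g x \<bullet> hor b g x)) + (bump R x)\<^sup>2 * (norm (hor b g x))\<^sup>2 +
      (bump R x)\<^sup>2 * (g x \<bullet> hor b (hor b g) x)"
      by (subst hor_mult_inner(1)[OF bump_power2_differentiable hor2_differentiable(1)[OF g] hor2_differentiable(2)[OF g b]])
         (simp add: hor_bump_power2 power2_norm_eq_inner)
  qed
  have i: "integrable lborel (\<lambda>x. hor b (bump R) x * (2 * bump R x * (g x \<bullet> hor b g x)))"
    "integrable lborel (\<lambda>x. (bump R x)\<^sup>2 * (norm (hor b g x))\<^sup>2)"
    "integrable lborel (\<lambda>x. (bump R x)\<^sup>2 * (g x \<bullet> hor b (hor b g) x))"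
    by (intro integrable_bump_mult R continuous_intros c b)+
  have "(\<integral>x. hor b ?\<phi> x \<partial>lborel) = 0"
  proof (rule integral_hor_eq_0)
    show "integrable lborel ?\<phi>" by (intro integrable_bump_mult R continuous_intros c b)
    show "integrable lborel (hor b ?\<phi>)" unfolding e using i by simp
    show "?\<phi> differentiable (at x)" for x
      by (intro hor_mult_inner bump_power2_differentiable hor2_differentiable g b)
    show "continuous_on UNIV (hor b ?\<phi>)" unfolding e
      by (intro continuous_intros c b continuous_on_hor_bump R)
  qed
  then show ?thesis unfolding e using i by simp
qed

section \<open>Energy estimates in L2 and removal of the cutoff\<close>

lemma in_L2_I: "continuous_on UNIV g \<Longrightarrow> integrable lborel (\<lambda>x. (norm (g x))\<^sup>2) \<Longrightarrow> in_L2 g"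
  by (simp add: in_L2_def borel_measurable_continuous_onI)

lemma in_L2_integrable_inner:
  assumes "in_L2 g" "in_L2 h"
  shows "integrable lborel (\<lambda>x. norm (g x) * norm (h x))" "integrable lborel (\<lambda>x. g x \<bullet> h x)"
proof -
  have [measurable]: "g \<in> borel_measurable borel" "h \<in> borel_measurable borel" using assms by (auto simp: in_L2_def)
  have i: "integrable lborel (\<lambda>x. (norm (g x))\<^sup>2 + (norm (h x))\<^sup>2)"
    using assms by (auto simp: in_L2_def)
  have le: "norm (g x) * norm (h x) \<le> (norm (g x))\<^sup>2 + (norm (h x))\<^sup>2" for x
    using sum_squares_bound[of "norm (g x)" "norm (h x)"] mult_nonneg_nonneg[OF norm_ge_zero norm_ge_zero, of "g x" "h x"]
    by linarith
  show "integrable lborel (\<lambda>x. norm (g x) * norm (h x))"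
    by (rule Bochner_Integration.integrable_bound[OF i]) (auto simp: le abs_mult)
  then show "integrable lborel (\<lambda>x. g x \<bullet> h x)"
    by (rule Bochner_Integration.integrable_bound) (auto simp: Cauchy_Schwarz_ineq2 abs_mult)
qed

lemma bump_tendsto: "(\<lambda>k. bump (real (Suc k)) x) \<longlonglongrightarrow> 1"
proof -
  have "filterlim (\<lambda>k. real (Suc k) ^ 4) at_top sequentially"
    by (intro filterlim_pow_at_top filterlim_compose[OF filterlim_real_sequentially filterlim_Suc]) auto
  then have "(\<lambda>k. gauge4 x / real (Suc k) ^ 4) \<longlonglongrightarrow> 0"
    by (rule real_tendsto_divide_at_top[OF tendsto_const])
  then have "(\<lambda>k. (max 0 (1 - gauge4 x / real (Suc k) ^ 4))\<^sup>2) \<longlonglongrightarrow> (max 0 (1 - 0))\<^sup>2"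
    by (intro tendsto_intros)
  then show ?thesis by (simp add: bump_def[abs_def])
qed

text \<open>A Caccioppoli estimate. The term with a derivative on the cutoff is at most 2 A B \<le>
  A^2 / 2 + 2 B^2; the first summand is absorbed by the energy, and the second, with the constant 12
  of \<open>hor_bump_le\<close>, produces 2 * 12^2 = 288.\<close>

lemma energy_bound:
  fixes g :: "'n::finite heis \<Rightarrow> complex"
  assumes g: "hor2 g" and R: "R \<ge> 1" and L2: "in_L2 g"
  shows "(\<Sum>b\<in>Basis. (\<integral>x. (bump R x)\<^sup>2 * (norm (hor b g x))\<^sup>2 \<partial>lborel)) / 2
    \<le> (\<integral>x. (bump R x)\<^sup>2 * (g x \<bullet> lap g x) \<partial>lborel) + (\<Sum>b\<in>(Basis :: (complex ^ 'n) set). 288 / R\<^sup>2 * (\<integral>x. (norm (g x))\<^sup>2 \<partial>lborel))"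
proof -
  have R0: "R > 0" using R by simp
  note c = hor2_continuous[OF g] continuous_on_UNIV_of_differentiable[OF bump_differentiable]
  have i1: "integrable lborel (\<lambda>x. (bump R x)\<^sup>2 * (g x \<bullet> hor b (hor b g) x))" if "b \<in> Basis" for b
    by (intro integrable_bump_mult R0 continuous_intros c that)
  have i2: "integrable lborel (\<lambda>x. (bump R x)\<^sup>2 * (norm (hor b g x))\<^sup>2)" if "b \<in> Basis" for b
    by (intro integrable_bump_mult R0 continuous_intros c that)
  have i3: "integrable lborel (\<lambda>x. hor b (bump R) x * (2 * bump R x * (g x \<bullet> hor b g x)))" if "b \<in> Basis" for b
    by (intro integrable_bump_mult R0 continuous_intros c that)
  have i4: "integrable lborel (\<lambda>x. (norm (g x))\<^sup>2)" using L2 by (simp add: in_L2_def)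
  have E: "(\<integral>x. (bump R x)\<^sup>2 * (g x \<bullet> lap g x) \<partial>lborel) = (\<Sum>b\<in>Basis. - (\<integral>x. (bump R x)\<^sup>2 * (g x \<bullet> hor b (hor b g) x) \<partial>lborel))"
    using i1 by (simp add: lap_def inner_sum_right sum_distrib_left sum_negf)
  have "(\<integral>x. (bump R x)\<^sup>2 * (norm (hor b g x))\<^sup>2 \<partial>lborel) / 2
      \<le> - (\<integral>x. (bump R x)\<^sup>2 * (g x \<bullet> hor b (hor b g) x) \<partial>lborel) + 288 / R\<^sup>2 * (\<integral>x. (norm (g x))\<^sup>2 \<partial>lborel)"
    if b: "b \<in> Basis" for b
  proof -
    have pt: "- (hor b (bump R) x * (2 * bump R x * (g x \<bullet> hor b g x)))
        \<le> (bump R x)\<^sup>2 * (norm (hor b g x))\<^sup>2 / 2 + 288 / R\<^sup>2 * (norm (g x))\<^sup>2" for x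
    proof -
      define A where "A = bump R x * norm (hor b g x)"
      define B where "B = \<bar>hor b (bump R) x\<bar> * norm (g x)"
      have "- (hor b (bump R) x * (2 * bump R x * (g x \<bullet> hor b g x))) \<le> \<bar>hor b (bump R) x * (2 * bump R x * (g x \<bullet> hor b g x))\<bar>"
        by (rule abs_ge_minus_self)
      also have "\<dots> = \<bar>hor b (bump R) x\<bar> * (2 * bump R x) * \<bar>g x \<bullet> hor b g x\<bar>"
        using bump_bounds[OF R0, of x] by (simp add: abs_mult)
      also have "\<dots> \<le> \<bar>hor b (bump R) x\<bar> * (2 * bump R x) * (norm (g x) * norm (hor b g x))"
        using bump_bounds[OF R0, of x] by (intro mult_left_mono Cauchy_Schwarz_ineq2) auto
      also have "\<dots> = 2 * (A * B)" by (simp add: A_def B_def)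
      also have "\<dots> \<le> A\<^sup>2 / 2 + 2 * B\<^sup>2"
        using zero_le_power2[of "A - 2 * B"] by (simp add: power2_diff)
      also have "B\<^sup>2 \<le> (12 / R * norm (g x))\<^sup>2"
        unfolding B_def by (intro power_mono mult_right_mono hor_bump_le R0 b) auto
      finally show ?thesis by (simp add: A_def power_mult_distrib power_divide)
    qed
    have "- (\<integral>x. hor b (bump R) x * (2 * bump R x * (g x \<bullet> hor b g x)) \<partial>lborel) =
        (\<integral>x. - (hor b (bump R) x * (2 * bump R x * (g x \<bullet> hor b g x))) \<partial>lborel)" by simp
    also have "\<dots> \<le> (\<integral>x. (bump R x)\<^sup>2 * (norm (hor b g x))\<^sup>2 / 2 + 288 / R\<^sup>2 * (norm (g x))\<^sup>2 \<partial>lborel)"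
      by (intro integral_mono Bochner_Integration.integrable_add integrable_minus i3[OF b] pt
          integrable_divide i2[OF b] integrable_mult_right i4)
    also have "\<dots> = (\<integral>x. (bump R x)\<^sup>2 * (norm (hor b g x))\<^sup>2 \<partial>lborel) / 2 + 288 / R\<^sup>2 * (\<integral>x. (norm (g x))\<^sup>2 \<partial>lborel)"
      using i2[OF b] i4 by simp
    finally show ?thesis using bump_power2_ibp[OF g R0 b] by linarith
  qed
  then have "(\<Sum>b\<in>Basis. (\<integral>x. (bump R x)\<^sup>2 * (norm (hor b g x))\<^sup>2 \<partial>lborel) / 2)
    \<le> (\<Sum>b\<in>Basis. - (\<integral>x. (bump R x)\<^sup>2 * (g x \<bullet> hor b (hor b g) x) \<partial>lborel) + 288 / R\<^sup>2 * (\<integral>x. (norm (g x))\<^sup>2 \<partial>lborel))"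
    by (rule sum_mono)
  then show ?thesis by (simp only: E sum.distrib sum_divide_distrib)
qed

lemma bump_power2_inner_tendsto:
  assumes "integrable lborel f" "continuous_on UNIV (f :: 'n::finite heis \<Rightarrow> real)"
  shows "(\<lambda>k. \<integral>x. (bump (real (Suc k)) x)\<^sup>2 * f x \<partial>lborel) \<longlonglongrightarrow> (\<integral>x. f x \<partial>lborel)"
    "(\<lambda>k. \<integral>x. bump (real (Suc k)) x * f x \<partial>lborel) \<longlonglongrightarrow> (\<integral>x. f x \<partial>lborel)"
proof -
  have [measurable]: "f \<in> borel_measurable borel" "bump R \<in> borel_measurable borel" for R
    using assms by (auto intro!: borel_measurable_continuous_onI continuous_on_UNIV_of_differentiable bump_differentiable)
  have b: "\<bar>bump (real (Suc k)) x\<bar> \<le> 1" "(bump (real (Suc k)) x)\<^sup>2 \<le> 1" for k and x :: "'n heis"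
    using bump_bounds[of "real (Suc k)" x] by (auto intro: power_le_one)
  show "(\<lambda>k. \<integral>x. (bump (real (Suc k)) x)\<^sup>2 * f x \<partial>lborel) \<longlonglongrightarrow> (\<integral>x. f x \<partial>lborel)"
  proof (rule integral_dominated_convergence[where w = "\<lambda>x. \<bar>f x\<bar>"])
    show "AE x in lborel. (\<lambda>k. (bump (real (Suc k)) x)\<^sup>2 * f x) \<longlonglongrightarrow> f x"
    proof (rule AE_I2)
      fix x :: "'n heis"
      show "(\<lambda>k. (bump (real (Suc k)) x)\<^sup>2 * f x) \<longlonglongrightarrow> f x"
        using tendsto_mult[OF tendsto_power[OF bump_tendsto[of x], of 2] tendsto_const[of "f x"]] by simp
    qed
    show "AE x in lborel. norm ((bump (real (Suc k)) x)\<^sup>2 * f x) \<le> \<bar>f x\<bar>" for k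
      using mult_right_mono[OF b(2) abs_ge_zero] by (auto simp: abs_mult)
  qed (use assms in auto)
  show "(\<lambda>k. \<integral>x. bump (real (Suc k)) x * f x \<partial>lborel) \<longlonglongrightarrow> (\<integral>x. f x \<partial>lborel)"
  proof (rule integral_dominated_convergence[where w = "\<lambda>x. \<bar>f x\<bar>"])
    show "AE x in lborel. (\<lambda>k. bump (real (Suc k)) x * f x) \<longlonglongrightarrow> f x"
    proof (rule AE_I2)
      fix x :: "'n heis"
      show "(\<lambda>k. bump (real (Suc k)) x * f x) \<longlonglongrightarrow> f x"
        using tendsto_mult[OF bump_tendsto[of x] tendsto_const[of "f x"]] by simp
    qed
    show "AE x in lborel. norm (bump (real (Suc k)) x * f x) \<le> \<bar>f x\<bar>" for k
      using mult_right_mono[OF b(1) abs_ge_zero] by (auto simp: abs_mult)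
  qed (use assms in auto)
qed

text \<open>The energies cut off at radius \<open>R\<close> stay bounded by
  \<open>energy_bound\<close>, and Fatou's lemma lets \<open>R\<close> tend to infinity.\<close>

lemma hor_in_L2:
  fixes g :: "'n::finite heis \<Rightarrow> complex"
  assumes g: "hor2 g" and L2: "in_L2 g" "in_L2 (lap g)" and b: "b \<in> Basis"
  shows "in_L2 (hor b g)"
proof (rule in_L2_I)
  note c = hor2_continuous[OF g] hor2_continuous_lap[OF g] continuous_on_UNIV_of_differentiable[OF bump_differentiable]
  show "continuous_on UNIV (hor b g)" using c b by auto
  have [measurable]: "bump R \<in> borel_measurable borel" "hor b g \<in> borel_measurable borel" for R
    by (auto intro!: borel_measurable_continuous_onI c b)
  define B where "B = 2 * ((\<integral>x. norm (g x) * norm (lap g x) \<partial>lborel) +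
     (\<Sum>b\<in>(Basis :: (complex ^ 'n) set). 288 * (\<integral>x. (norm (g x))\<^sup>2 \<partial>lborel)))"
  have le: "(\<integral>x. (bump R x)\<^sup>2 * (norm (hor b g x))\<^sup>2 \<partial>lborel) \<le> B" if R: "R \<ge> 1" for R
  proof -
    have "(\<integral>x. (bump R x)\<^sup>2 * (norm (hor b g x))\<^sup>2 \<partial>lborel) \<le> (\<Sum>b\<in>Basis. (\<integral>x. (bump R x)\<^sup>2 * (norm (hor b g x))\<^sup>2 \<partial>lborel))"
      by (rule member_le_sum) (use b in auto)
    moreover have "(\<integral>x. (bump R x)\<^sup>2 * (g x \<bullet> lap g x) \<partial>lborel) \<le> (\<integral>x. norm (g x) * norm (lap g x) \<partial>lborel)"
    proof (rule integral_mono)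
      show "integrable lborel (\<lambda>x. (bump R x)\<^sup>2 * (g x \<bullet> lap g x))"
        using R by (intro integrable_bump_mult continuous_intros c) auto
      fix x
      have "(bump R x)\<^sup>2 * (g x \<bullet> lap g x) \<le> (bump R x)\<^sup>2 * (norm (g x) * norm (lap g x))"
        by (intro mult_left_mono norm_cauchy_schwarz) auto
      also have "\<dots> \<le> 1 * (norm (g x) * norm (lap g x))"
        using R bump_bounds[of R x] by (intro mult_right_mono power_le_one) auto
      finally show "(bump R x)\<^sup>2 * (g x \<bullet> lap g x) \<le> norm (g x) * norm (lap g x)" by simp
    qed (rule in_L2_integrable_inner[OF L2])
    moreover have "(\<Sum>b\<in>(Basis :: (complex ^ 'n) set). 288 / R\<^sup>2 * (\<integral>x. (norm (g x))\<^sup>2 \<partial>lborel)) \<le>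
        (\<Sum>b\<in>(Basis :: (complex ^ 'n) set). 288 * (\<integral>x. (norm (g x))\<^sup>2 \<partial>lborel))"
    proof (intro sum_mono mult_right_mono)
      show "288 / R\<^sup>2 \<le> 288" using R by (simp add: divide_le_eq one_le_power)
    qed auto
    ultimately show ?thesis using energy_bound[OF g R L2(1)] by (simp add: B_def)
  qed
  have "(\<integral>\<^sup>+x. ennreal ((norm (hor b g x))\<^sup>2) \<partial>lborel) =
      (\<integral>\<^sup>+x. liminf (\<lambda>k. ennreal ((bump (real (Suc k)) x)\<^sup>2 * (norm (hor b g x))\<^sup>2)) \<partial>lborel)"
  proof (rule nn_integral_cong)
    fix x :: "'n heis"
    have "(\<lambda>k. (bump (real (Suc k)) x)\<^sup>2 * (norm (hor b g x))\<^sup>2) \<longlonglongrightarrow> (norm (hor b g x))\<^sup>2"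
      using tendsto_mult[OF tendsto_power[OF bump_tendsto[of x], of 2] tendsto_const[of "(norm (hor b g x))\<^sup>2"]] by simp
    then have "(\<lambda>k. ennreal ((bump (real (Suc k)) x)\<^sup>2 * (norm (hor b g x))\<^sup>2)) \<longlonglongrightarrow> ennreal ((norm (hor b g x))\<^sup>2)"
      by (rule tendsto_ennrealI)
    then show "ennreal ((norm (hor b g x))\<^sup>2) = liminf (\<lambda>k. ennreal ((bump (real (Suc k)) x)\<^sup>2 * (norm (hor b g x))\<^sup>2))"
      by (intro lim_imp_Liminf[symmetric] trivial_limit_sequentially)
  qed
  also have "\<dots> \<le> liminf (\<lambda>k. \<integral>\<^sup>+x. ennreal ((bump (real (Suc k)) x)\<^sup>2 * (norm (hor b g x))\<^sup>2) \<partial>lborel)"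
    by (rule nn_integral_liminf) measurable
  also have "\<dots> \<le> liminf (\<lambda>k::nat. ennreal B)"
  proof (intro Liminf_mono always_eventually allI)
    fix k
    have "(\<integral>\<^sup>+x. ennreal ((bump (real (Suc k)) x)\<^sup>2 * (norm (hor b g x))\<^sup>2) \<partial>lborel) =
        ennreal (\<integral>x. (bump (real (Suc k)) x)\<^sup>2 * (norm (hor b g x))\<^sup>2 \<partial>lborel)"
      by (intro nn_integral_eq_integral integrable_bump_mult continuous_intros c b) auto
    also have "\<dots> \<le> ennreal B" by (intro ennreal_leI le) auto
    finally show "(\<integral>\<^sup>+x. ennreal ((bump (real (Suc k)) x)\<^sup>2 * (norm (hor b g x))\<^sup>2) \<partial>lborel) \<le> ennreal B" .
  qed
  also have "\<dots> < \<infinity>" by (simp add: Liminf_const)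
  finally show "integrable lborel (\<lambda>x. (norm (hor b g x))\<^sup>2)"
    by (intro integrableI_bounded) auto
qed

text \<open>In the limit of \<open>energy_bound\<close> the error, of order 1/R^2, disappears, and
  the energy on its left side is nonnegative.\<close>

lemma lap_nonneg:
  fixes g :: "'n::finite heis \<Rightarrow> complex"
  assumes g: "hor2 g" and L2: "in_L2 g" "in_L2 (lap g)"
  shows "(\<integral>x. g x \<bullet> lap g x \<partial>lborel) \<ge> 0"
proof (rule LIMSEQ_le_const)
  define S where "S = (\<Sum>b\<in>(Basis :: (complex ^ 'n) set). 288 * (\<integral>x. (norm (g x))\<^sup>2 \<partial>lborel))"
  let ?a = "\<lambda>k. (\<integral>x. (bump (real (Suc k)) x)\<^sup>2 * (g x \<bullet> lap g x) \<partial>lborel) + S / (real (Suc k))\<^sup>2"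
  have "filterlim (\<lambda>k. real (Suc k) ^ 2) at_top sequentially"
    by (intro filterlim_pow_at_top filterlim_compose[OF filterlim_real_sequentially filterlim_Suc]) auto
  then have "(\<lambda>k. S / (real (Suc k))\<^sup>2) \<longlonglongrightarrow> 0"
    by (rule real_tendsto_divide_at_top[OF tendsto_const])
  from tendsto_add[OF bump_power2_inner_tendsto(1)[OF in_L2_integrable_inner(2)[OF L2]] this]
  show "?a \<longlonglongrightarrow> (\<integral>x. g x \<bullet> lap g x \<partial>lborel)"
    by (simp add: continuous_on_inner hor2_continuous[OF g] hor2_continuous_lap[OF g])
  show "\<exists>N. \<forall>n\<ge>N. 0 \<le> ?a n"
  proof (intro exI allI impI)
    fix k :: nat
    have "0 \<le> (\<Sum>b\<in>Basis. (\<integral>x. (bump (real (Suc k)) x)\<^sup>2 * (norm (hor b g x))\<^sup>2 \<partial>lborel)) / 2"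
      by (intro divide_nonneg_nonneg sum_nonneg integral_nonneg) auto
    also have "\<dots> \<le> (\<integral>x. (bump (real (Suc k)) x)\<^sup>2 * (g x \<bullet> lap g x) \<partial>lborel) +
        (\<Sum>b\<in>(Basis :: (complex ^ 'n) set). 288 / (real (Suc k))\<^sup>2 * (\<integral>x. (norm (g x))\<^sup>2 \<partial>lborel))"
      by (rule energy_bound[OF g _ L2(1)]) simp
    also have "(\<Sum>b\<in>(Basis :: (complex ^ 'n) set). 288 / (real (Suc k))\<^sup>2 * (\<integral>x. (norm (g x))\<^sup>2 \<partial>lborel)) = S / (real (Suc k))\<^sup>2"
      by (simp add: S_def)
    finally show "0 \<le> ?a k" .
  qed
qed

text \<open>Under the cutoff one integration by parts on each side leaves the same energy term,
  which cancels, and terms with a derivative on the cutoff. The latter are of order 1/R because the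
  horizontal derivatives are in L2 by \<open>hor_in_L2\<close>.\<close>

lemma lap_symmetric:
  fixes g h :: "'n::finite heis \<Rightarrow> complex"
  assumes g: "hor2 g" "in_L2 g" "in_L2 (lap g)" and h: "hor2 h" "in_L2 h" "in_L2 (lap h)"
  shows "(\<integral>x. g x \<bullet> lap h x \<partial>lborel) = (\<integral>x. lap g x \<bullet> h x \<partial>lborel)"
proof -
  note c = hor2_continuous[OF g(1)] hor2_continuous_lap[OF g(1)] hor2_continuous[OF h(1)] hor2_continuous_lap[OF h(1)]
  define C where "C = (\<Sum>b\<in>(Basis :: (complex ^ 'n) set). 12 *
      ((\<integral>x. norm (g x) * norm (hor b h x) \<partial>lborel) + (\<integral>x. norm (h x) * norm (hor b g x) \<partial>lborel)))"
  have half: "(\<integral>x. bump R x * (u x \<bullet> lap v x) \<partial>lborel) =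
      (\<Sum>b\<in>Basis. (\<integral>x. hor b (bump R) x * (u x \<bullet> hor b v x) \<partial>lborel) + (\<integral>x. bump R x * (hor b u x \<bullet> hor b v x) \<partial>lborel))"
    if u: "hor2 u" and v: "hor2 v" and R: "R > 0" for u v :: "'n heis \<Rightarrow> complex" and R
  proof -
    have i: "integrable lborel (\<lambda>x. bump R x * (u x \<bullet> hor b (hor b v) x))" if "b \<in> Basis" for b
      by (intro integrable_bump_mult R continuous_intros hor2_continuous u v that)
    have "(\<integral>x. bump R x * (u x \<bullet> lap v x) \<partial>lborel) = (\<Sum>b\<in>Basis. - (\<integral>x. bump R x * (u x \<bullet> hor b (hor b v) x) \<partial>lborel))"
      using i by (simp add: lap_def inner_sum_right sum_distrib_left sum_negf)
    also have "\<dots> = (\<Sum>b\<in>Basis. (\<integral>x. hor b (bump R) x * (u x \<bullet> hor b v x) \<partial>lborel) + (\<integral>x. bump R x * (hor b u x \<bullet> hor b v x) \<partial>lborel))"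
      by (intro sum.cong refl) (simp add: bump_ibp[OF u v R])
    finally show ?thesis .
  qed
  have diff: "\<bar>(\<integral>x. bump R x * (g x \<bullet> lap h x) \<partial>lborel) - (\<integral>x. bump R x * (h x \<bullet> lap g x) \<partial>lborel)\<bar> \<le> C / R" if R: "R > 0" for R
  proof -
    have "(\<integral>x. bump R x * (g x \<bullet> lap h x) \<partial>lborel) - (\<integral>x. bump R x * (h x \<bullet> lap g x) \<partial>lborel) =
       (\<Sum>b\<in>Basis. (\<integral>x. hor b (bump R) x * (g x \<bullet> hor b h x) \<partial>lborel) - (\<integral>x. hor b (bump R) x * (h x \<bullet> hor b g x) \<partial>lborel))"
      unfolding half[OF g(1) h(1) R] half[OF h(1) g(1) R] by (simp add: inner_commute flip: sum_subtractf)
    also have "\<bar>\<dots>\<bar> \<le> (\<Sum>b\<in>Basis. \<bar>(\<integral>x. hor b (bump R) x * (g x \<bullet> hor b h x) \<partial>lborel) - (\<integral>x. hor b (bump R) x * (h x \<bullet> hor b g x) \<partial>lborel)\<bar>)"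
      by (rule sum_abs)
    also have "\<dots> \<le> (\<Sum>b\<in>(Basis :: (complex ^ 'n) set). 12 *
      ((\<integral>x. norm (g x) * norm (hor b h x) \<partial>lborel) + (\<integral>x. norm (h x) * norm (hor b g x) \<partial>lborel)) / R)"
    proof (rule sum_mono)
      fix b :: "complex ^ 'n" assume b: "b \<in> Basis"
      have bd: "\<bar>\<integral>x. hor b (bump R) x * (u x \<bullet> hor b v x) \<partial>lborel\<bar> \<le> 12 / R * (\<integral>x. norm (u x) * norm (hor b v x) \<partial>lborel)"
        if u: "hor2 u" "in_L2 u" and v: "hor2 v" "in_L2 v" "in_L2 (lap v)" for u v :: "'n heis \<Rightarrow> complex"
      proof -
        have i: "integrable lborel (\<lambda>x. norm (u x) * norm (hor b v x))"
          by (intro in_L2_integrable_inner u hor_in_L2 v b)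
        have "\<bar>\<integral>x. hor b (bump R) x * (u x \<bullet> hor b v x) \<partial>lborel\<bar> \<le> (\<integral>x. \<bar>hor b (bump R) x * (u x \<bullet> hor b v x)\<bar> \<partial>lborel)"
          by (rule integral_abs_bound)
        also have "\<dots> \<le> (\<integral>x. 12 / R * (norm (u x) * norm (hor b v x)) \<partial>lborel)"
        proof (rule integral_mono)
          show "integrable lborel (\<lambda>x. \<bar>hor b (bump R) x * (u x \<bullet> hor b v x)\<bar>)"
            by (intro integrable_abs integrable_bump_mult R continuous_intros hor2_continuous u v b)
          show "integrable lborel (\<lambda>x. 12 / R * (norm (u x) * norm (hor b v x)))" using i by simp
          show "\<bar>hor b (bump R) x * (u x \<bullet> hor b v x)\<bar> \<le> 12 / R * (norm (u x) * norm (hor b v x))" for x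
            unfolding abs_mult using R by (intro mult_mono hor_bump_le b Cauchy_Schwarz_ineq2) auto
        qed
        finally show ?thesis by simp
      qed
      show "\<bar>(\<integral>x. hor b (bump R) x * (g x \<bullet> hor b h x) \<partial>lborel) - (\<integral>x. hor b (bump R) x * (h x \<bullet> hor b g x) \<partial>lborel)\<bar>
        \<le> 12 * ((\<integral>x. norm (g x) * norm (hor b h x) \<partial>lborel) + (\<integral>x. norm (h x) * norm (hor b g x) \<partial>lborel)) / R"
        using bd[OF g(1,2) h] bd[OF h(1,2) g] by (simp add: distrib_left add_divide_distrib)
    qed
    also have "\<dots> = C / R" by (simp add: C_def sum_divide_distrib)
    finally show ?thesis .
  qed
  have 1: "(\<lambda>k. \<integral>x. bump (real (Suc k)) x * (g x \<bullet> lap h x) \<partial>lborel) \<longlonglongrightarrow> (\<integral>x. g x \<bullet> lap h x \<partial>lborel)"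
    by (intro bump_power2_inner_tendsto in_L2_integrable_inner g h continuous_intros c)
  have 2: "(\<lambda>k. \<integral>x. bump (real (Suc k)) x * (h x \<bullet> lap g x) \<partial>lborel) \<longlonglongrightarrow> (\<integral>x. h x \<bullet> lap g x \<partial>lborel)"
    by (intro bump_power2_inner_tendsto in_L2_integrable_inner g h continuous_intros c)
  have "(\<lambda>k. C / real (Suc k)) \<longlonglongrightarrow> 0"
    by (rule real_tendsto_divide_at_top[OF tendsto_const filterlim_compose[OF filterlim_real_sequentially filterlim_Suc]])
  then have "(\<lambda>k. (\<integral>x. bump (real (Suc k)) x * (g x \<bullet> lap h x) \<partial>lborel) - (\<integral>x. bump (real (Suc k)) x * (h x \<bullet> lap g x) \<partial>lborel)) \<longlonglongrightarrow> 0"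
    by (rule Lim_null_comparison[rotated]) (use diff in \<open>auto intro!: always_eventually\<close>)
  with tendsto_diff[OF 1 2] have "(\<integral>x. g x \<bullet> lap h x \<partial>lborel) - (\<integral>x. h x \<bullet> lap g x \<partial>lborel) = 0"
    by (rule LIMSEQ_unique)
  then show ?thesis by (simp add: inner_commute)
qed

subsection \<open>Contour integrals for the heat kernel\<close>

text \<open>\<open>shc\<close> and \<open>cothc\<close> are sinh z / z and z coth z with the
  singularity at 0 filled in. The zeros of \<open>shc\<close> have |Im z| \<ge> \<pi>; holomorphy is
  used for |Im z| < 3, and bounds are stated for |Im z| \<le> 1.\<close>

definition shc :: "complex \<Rightarrow> complex" where "shc z = (if z = 0 then 1 else sinh z / z)"
definition cothc :: "complex \<Rightarrow> complex" where "cothc z = cosh z / shc z"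

lemma sinh_holomorphic: "sinh holomorphic_on (S :: complex set)" and cosh_holomorphic: "cosh holomorphic_on (S :: complex set)"
  by (auto simp: holomorphic_on_def field_differentiable_def intro!: exI derivative_eq_intros)

lemma shc_holomorphic: "shc holomorphic_on UNIV"
proof (rule pole_theorem_0[of sinh _ 0])
  have "(sinh has_field_derivative 1) (at (0 :: complex))" by (auto intro!: derivative_eq_intros)
  then show "shc 0 = deriv sinh 0" by (simp add: shc_def DERIV_imp_deriv)
qed (auto simp: shc_def sinh_holomorphic)

lemma norm_sinh_sq: "(norm (sinh z))\<^sup>2 = (sinh (Re z))\<^sup>2 + (sin (Im z))\<^sup>2"
proof -
  have 1: "Re (sinh z) = sinh (Re z) * cos (Im z)" "Im (sinh z) = cosh (Re z) * sin (Im z)"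
    by (simp_all add: sinh_field_def cosh_field_def Re_exp Im_exp field_simps)
  have "(cosh (Re z))\<^sup>2 = 1 + (sinh (Re z))\<^sup>2" by (simp add: cosh_square_eq)
  then have "(norm (sinh z))\<^sup>2 = (sinh (Re z))\<^sup>2 * ((cos (Im z))\<^sup>2 + (sin (Im z))\<^sup>2) + (sin (Im z))\<^sup>2"
    unfolding cmod_power2 1 by algebra
  then show ?thesis by simp
qed

lemma norm_cosh_le: "norm (cosh z) \<le> exp \<bar>Re z\<bar>"
proof -
  have "norm (cosh z) \<le> (norm (exp z) + norm (exp (- z))) / 2"
    unfolding cosh_field_def using norm_triangle_ineq[of "exp z" "exp (- z)"] by (simp add: norm_divide)
  also have "\<dots> \<le> exp \<bar>Re z\<bar>"
  proof -
    have "exp (Re z) + exp (- Re z) \<le> exp \<bar>Re z\<bar> + exp \<bar>Re z\<bar>" by (intro add_mono) simp_all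
    then show ?thesis by (simp add: norm_exp_eq_Re)
  qed
  finally show ?thesis .
qed

lemma pi_gt_3: "pi > 3" using pi_approx by simp

lemma shc_nonzero: assumes "\<bar>Im z\<bar> < 3" shows "shc z \<noteq> 0"
proof (cases "z = 0")
  case False
  have "sinh z \<noteq> 0"
  proof
    assume "sinh z = 0"
    then have *: "(sinh (Re z))\<^sup>2 + (sin (Im z))\<^sup>2 = 0" using norm_sinh_sq[of z] by simp
    then have "Re z = 0" "sin (Im z) = 0" by (simp_all add: sum_power2_eq_zero_iff)
    moreover have "sin (Im z) > 0" if "Im z > 0" using that assms pi_gt_3 by (intro sin_gt_zero) auto
    moreover have "sin (- Im z) > 0" if "Im z < 0" using that assms pi_gt_3 by (intro sin_gt_zero) auto
    ultimately show False using False by (cases "Im z" "0::real" rule: linorder_cases) (auto simp: complex_eq_iff)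
  qed
  then show ?thesis using False by (simp add: shc_def)
qed (simp add: shc_def)

lemma sinh_ge_quarter_exp: "x \<ge> 1 \<Longrightarrow> sinh x \<ge> exp x / 4" for x :: real
proof -
  assume x: "x \<ge> 1"
  have "exp x \<ge> 2" using exp_ge_add_one_self[of x] x by linarith
  moreover have "exp (- x) \<le> 1" using x by simp
  moreover have "a / 4 \<le> (a - b) / 2" if "2 \<le> a" "b \<le> 1" for a b :: real
    using that by (simp add: field_simps)
  ultimately show ?thesis unfolding sinh_field_def by blast
qed

lemma norm_sinh_ge: "norm (sinh z) \<ge> sinh \<bar>Re z\<bar>"
proof -
  have "(sinh \<bar>Re z\<bar>)\<^sup>2 \<le> (norm (sinh z))\<^sup>2"
    unfolding norm_sinh_sq by (simp add: sinh_real_abs)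
  then show ?thesis by (rule power2_le_imp_le) simp
qed

lemma compact_rect: "compact {z. \<bar>Re z\<bar> \<le> 1 \<and> \<bar>Im z\<bar> \<le> 1}"
proof -
  have "{z. \<bar>Re z\<bar> \<le> 1 \<and> \<bar>Im z\<bar> \<le> 1} = cbox (Complex (-1) (-1)) (Complex 1 1)"
    by (auto simp: in_cbox_complex_iff)
  then show ?thesis by simp
qed

text \<open>For large |Re z| the modulus of sinh z is at least exp |Re z| / 4, and half of this
  decay absorbs the numerator z. The remaining rectangle is compact.\<close>

lemma inverse_shc_bound: "\<exists>C\<ge>0. \<forall>z. \<bar>Im z\<bar> \<le> 1 \<longrightarrow> norm (1 / shc z) \<le> C * exp (- \<bar>Re z\<bar> / 2)"
proof -
  let ?K = "{z. \<bar>Re z\<bar> \<le> 1 \<and> \<bar>Im z\<bar> \<le> 1}"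
  have "continuous_on ?K (\<lambda>z. 1 / shc z)"
    using holomorphic_on_imp_continuous_on[OF shc_holomorphic] shc_nonzero
    by (intro continuous_intros) (auto intro: continuous_on_subset)
  then have "bounded ((\<lambda>z. 1 / shc z) ` ?K)" by (intro compact_imp_bounded compact_continuous_image compact_rect)
  then obtain B where B: "B > 0" "\<And>z. z \<in> ?K \<Longrightarrow> norm (1 / shc z) \<le> B" by (auto simp: bounded_pos)
  have "norm (1 / shc z) \<le> (8 + 2 * B) * exp (- \<bar>Re z\<bar> / 2)" if z: "\<bar>Im z\<bar> \<le> 1" for z
  proof (cases "\<bar>Re z\<bar> \<le> 1")
    case True
    define E where "E = exp (- \<bar>Re z\<bar> / 2)"
    have "E \<ge> 1 + (- \<bar>Re z\<bar> / 2)" unfolding E_def by (rule exp_ge_add_one_self)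
    then have E: "E \<ge> 1 / 2" using True by linarith
    then have "2 * B * E \<ge> 2 * B * (1 / 2)" using B by (intro mult_left_mono) auto
    moreover have "norm (1 / shc z) \<le> B" using B True z by auto
    ultimately have "norm (1 / shc z) \<le> (8 + 2 * B) * E" using E by (simp add: distrib_right)
    then show ?thesis by (simp only: E_def)
  next
    case False
    define r where "r = \<bar>Re z\<bar>"
    have r: "r \<ge> 1" using False by (simp add: r_def)
    have zn: "norm z \<le> r + 1" using cmod_le[of z] z by (simp add: r_def)
    have "norm (sinh z) \<ge> exp r / 4" using norm_sinh_ge[of z] sinh_ge_quarter_exp[OF r] by (simp add: r_def)
    then have "norm z / norm (sinh z) \<le> (r + 1) / (exp r / 4)"
      using zn r by (intro frac_le) auto
    also have "\<dots> = 4 * (r + 1) * exp (- r)" by (simp add: exp_minus field_simps)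
    also have "\<dots> \<le> 4 * (2 * exp (r / 2)) * exp (- r)"
    proof (rule mult_right_mono)
      have "1 + r / 2 \<le> exp (r / 2)" by (rule exp_ge_add_one_self)
      then show "4 * (r + 1) \<le> 4 * (2 * exp (r / 2))" by argo
    qed simp
    also have "\<dots> = 8 * exp (- r / 2)" by (simp flip: exp_add)
    also have "\<dots> \<le> (8 + 2 * B) * exp (- r / 2)" using B by (intro mult_right_mono) auto
    finally show ?thesis using r by (auto simp: shc_def norm_divide r_def)
  qed
  then show ?thesis using B by (intro exI[of _ "8 + 2 * B"]) auto
qed

lemma cothc_bound: "\<exists>C\<ge>0. \<forall>z. \<bar>Im z\<bar> \<le> 1 \<longrightarrow> norm (cothc z) \<le> C * (1 + \<bar>Re z\<bar>)"
proof -
  let ?K = "{z. \<bar>Re z\<bar> \<le> 1 \<and> \<bar>Im z\<bar> \<le> 1}"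
  have "continuous_on ?K (\<lambda>z. cothc z)" unfolding cothc_def
    using holomorphic_on_imp_continuous_on[OF shc_holomorphic] holomorphic_on_imp_continuous_on[OF cosh_holomorphic] shc_nonzero
    by (intro continuous_on_divide) (auto intro: continuous_on_subset)
  then have "bounded (cothc ` ?K)" by (intro compact_imp_bounded compact_continuous_image compact_rect)
  then obtain B where B: "B > 0" "\<And>z. z \<in> ?K \<Longrightarrow> norm (cothc z) \<le> B" by (auto simp: bounded_pos)
  have "norm (cothc z) \<le> (4 + B) * (1 + \<bar>Re z\<bar>)" if z: "\<bar>Im z\<bar> \<le> 1" for z
  proof (cases "\<bar>Re z\<bar> \<le> 1")
    case True
    have "norm (cothc z) \<le> B * 1" using B True z by auto
    also have "\<dots> \<le> (4 + B) * (1 + \<bar>Re z\<bar>)" using B by (intro mult_mono) auto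
    finally show ?thesis .
  next
    case False
    define r where "r = \<bar>Re z\<bar>"
    have r: "r \<ge> 1" using False by (simp add: r_def)
    have zn: "norm z \<le> r + 1" using cmod_le[of z] z by (simp add: r_def)
    have "norm (sinh z) \<ge> exp r / 4" using norm_sinh_ge[of z] sinh_ge_quarter_exp[OF r] by (simp add: r_def)
    then have "norm (cosh z) * norm z / norm (sinh z) \<le> exp r * (r + 1) / (exp r / 4)"
      using zn norm_cosh_le[of z] by (intro frac_le mult_mono) (auto simp: r_def)
    also have "\<dots> = 4 * (1 + r)" by simp
    also have "\<dots> \<le> (4 + B) * (1 + r)" using B r by (intro mult_right_mono) auto
    finally show ?thesis using r by (auto simp: cothc_def shc_def norm_divide norm_mult r_def)
  qed
  then show ?thesis using B by (intro exI[of _ "4 + B"]) auto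
qed

lemma sinh_le_mult_cosh: assumes "x \<ge> 0" shows "sinh x \<le> x * cosh (x::real)"
proof -
  have "0 * cosh 0 - sinh 0 \<le> x * cosh x - sinh x"
  proof (rule DERIV_nonneg_imp_nondecreasing[OF assms])
    fix t :: real assume "0 \<le> t" "t \<le> x"
    then show "\<exists>y. ((\<lambda>t. t * cosh t - sinh t) has_real_derivative y) (at t) \<and> 0 \<le> y"
      by (intro exI[of _ "t * sinh t"]) (auto intro!: derivative_eq_intros mult_nonneg_nonneg)
  qed
  then show ?thesis by simp
qed

text \<open>Multiplication by the conjugate of sinh z gives the real part (x sinh x cosh x + y sin y
  cos y) / (sinh^2 x + sin^2 y). The first term is at least sinh^2 x; since |y| \<le> 1 < \<pi>/3,
  cos y is at least 1/2 and the second is at least sin^2 y / 2.\<close>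

lemma Re_cothc_ge: assumes z: "\<bar>Im z\<bar> \<le> 1" shows "Re (cothc z) \<ge> 1 / 2"
proof (cases "z = 0")
  case True then show ?thesis by (simp add: cothc_def shc_def)
next
  case False
  define x y where "x = Re z" and "y = Im z"
  define N where "N = (norm (sinh z))\<^sup>2"
  have Npos: "N > 0" using shc_nonzero[of z] z False by (auto simp: N_def shc_def)
  have N: "N = (sinh x)\<^sup>2 + (sin y)\<^sup>2" by (simp add: N_def norm_sinh_sq x_def y_def)
  have ReIm: "Re (sinh z) = sinh x * cos y" "Im (sinh z) = cosh x * sin y"
     "Re (cosh z) = cosh x * cos y" "Im (cosh z) = sinh x * sin y"
    by (simp_all add: sinh_field_def cosh_field_def Re_exp Im_exp field_simps x_def y_def)
  have c: "cosh z * cnj (sinh z) = Complex (sinh x * cosh x) (- (sin y * cos y))"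
  proof (rule complex_eqI)
    have "Re (cosh z * cnj (sinh z)) = sinh x * cosh x * ((cos y)\<^sup>2 + (sin y)\<^sup>2)"
      unfolding times_complex.sel cnj.sel ReIm by algebra
    then show "Re (cosh z * cnj (sinh z)) = Re (Complex (sinh x * cosh x) (- (sin y * cos y)))" by simp
    have "Im (cosh z * cnj (sinh z)) = - ((cosh x)\<^sup>2 - (sinh x)\<^sup>2) * (sin y * cos y)"
      unfolding times_complex.sel cnj.sel ReIm by algebra
    then show "Im (cosh z * cnj (sinh z)) = Im (Complex (sinh x * cosh x) (- (sin y * cos y)))"
      by (simp add: cosh_square_eq)
  qed
  have "cothc z = z * (cosh z * cnj (sinh z)) / of_real N"
  proof -
    have "of_real N = sinh z * cnj (sinh z)" by (simp add: N_def complex_norm_square flip: complex_norm_square)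
    moreover have "sinh z \<noteq> 0" using Npos by (auto simp: N_def)
    ultimately show ?thesis using False by (simp add: cothc_def shc_def field_simps)
  qed
  then have "Re (cothc z) = (x * (sinh x * cosh x) + y * (sin y * cos y)) / N"
    unfolding c by (simp add: Re_divide_of_real x_def y_def)
  moreover have "x * (sinh x * cosh x) \<ge> (sinh x)\<^sup>2"
  proof -
    have "sinh \<bar>x\<bar> * sinh \<bar>x\<bar> \<le> sinh \<bar>x\<bar> * (\<bar>x\<bar> * cosh \<bar>x\<bar>)"
      by (intro mult_left_mono sinh_le_mult_cosh) auto
    then show ?thesis by (simp add: sinh_real_abs cosh_real_abs power2_eq_square abs_mult_self_eq mult_ac abs_if split: if_splits)
  qed
  moreover have "y * (sin y * cos y) \<ge> (sin y)\<^sup>2 / 2"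
  proof -
    have "cos \<bar>y\<bar> \<ge> cos (pi / 3)" using z pi_gt_3 by (intro cos_monotone_0_pi_le) (auto simp: y_def)
    then have cy: "cos y \<ge> 1 / 2" by (simp add: cos_60)
    have "\<bar>sin y\<bar> * (1 / 2) \<le> \<bar>y\<bar> * cos y" using cy abs_sin_x_le_abs_x[of y] by (intro mult_mono) auto
    then have le: "\<bar>sin y\<bar> * (\<bar>sin y\<bar> * (1 / 2)) \<le> \<bar>sin y\<bar> * (\<bar>y\<bar> * cos y)" by (intro mult_left_mono) auto
    have "\<bar>sin y\<bar> * \<bar>y\<bar> = y * sin y"
    proof -
      have "y * sin y \<ge> 0"
      proof (cases "y \<ge> 0")
        case True then have "sin y \<ge> 0" using z pi_gt_3 by (intro sin_ge_zero) (auto simp: y_def)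
        then show ?thesis using True by simp
      next
        case False then have "sin (- y) \<ge> 0" using z pi_gt_3 by (intro sin_ge_zero) (auto simp: y_def)
        then show ?thesis using False by (simp add: mult_nonpos_nonpos)
      qed
      then show ?thesis by (simp add: abs_mult[symmetric] mult.commute)
    qed
    then have "\<bar>sin y\<bar> * (\<bar>y\<bar> * cos y) = y * (sin y * cos y)" by (metis mult.assoc)
    moreover have "\<bar>sin y\<bar> * (\<bar>sin y\<bar> * (1 / 2)) = (sin y)\<^sup>2 / 2" by (simp add: power2_eq_square)
    ultimately show ?thesis using le by (simp only:)
  qed
  moreover have "N / 2 \<le> u + v" if "(sinh x)\<^sup>2 \<le> u" "(sin y)\<^sup>2 / 2 \<le> v" for u v
  proof -
    have "(sinh x)\<^sup>2 / 2 \<le> u" using that(1) zero_le_power2[of "sinh x"] by linarith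
    with that(2) show ?thesis unfolding N add_divide_distrib by (rule add_mono[rotated])
  qed
  ultimately have "Re (cothc z) \<ge> (N / 2) / N"
    using Npos by (simp only: divide_right_mono less_imp_le)
  then show ?thesis using Npos by simp
qed

definition wt :: "nat \<Rightarrow> nat \<Rightarrow> nat \<Rightarrow> complex \<Rightarrow> complex" where
  "wt n j l z = (1 / shc z) ^ n * cothc z ^ j * z ^ l"

definition strip3 :: "complex set" where "strip3 = {z. - 3 < Im z \<and> Im z < 3}"

lemma strip3: "open strip3" "convex strip3" "\<bar>Im z\<bar> \<le> 1 \<Longrightarrow> z \<in> strip3"
proof -
  have *: "strip3 = {z. - 3 < Im z} \<inter> {z. Im z < 3}" by (auto simp: strip3_def)
  show "open strip3" "convex strip3" unfolding *
    by (intro open_Int open_halfspace_Im_gt open_halfspace_Im_lt convex_Int convex_halfspace_Im_gt convex_halfspace_Im_lt)+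
  show "\<bar>Im z\<bar> \<le> 1 \<Longrightarrow> z \<in> strip3" by (auto simp: strip3_def)
qed

lemma cothc_holomorphic: "cothc holomorphic_on strip3"
  unfolding cothc_def using shc_nonzero
  by (intro holomorphic_on_divide cosh_holomorphic holomorphic_on_subset[OF shc_holomorphic]) (auto simp: strip3_def)

lemma wt_holomorphic: "wt n j l holomorphic_on strip3"
  unfolding wt_def using shc_nonzero
  by (intro holomorphic_intros holomorphic_on_subset[OF shc_holomorphic] cothc_holomorphic) (auto simp: strip3_def)

text \<open>One factor 1 / shc decays like exp(-|Re z| / 2), and half of that absorbs the polynomial
  growth of the other factors; hence the condition on \<open>n\<close>.\<close>

lemma wt_bound: assumes n: "n \<ge> 1"
  shows "\<exists>C\<ge>0. \<forall>z. \<bar>Im z\<bar> \<le> 1 \<longrightarrow> norm (wt n j l z) \<le> C * exp (- \<bar>Re z\<bar> / 4)"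
proof -
  obtain A where A: "A \<ge> 0" "\<And>z. \<bar>Im z\<bar> \<le> 1 \<Longrightarrow> norm (1 / shc z) \<le> A * exp (- \<bar>Re z\<bar> / 2)"
    using inverse_shc_bound by blast
  obtain B where B: "B \<ge> 0" "\<And>z. \<bar>Im z\<bar> \<le> 1 \<Longrightarrow> norm (cothc z) \<le> B * (1 + \<bar>Re z\<bar>)"
    using cothc_bound by blast
  define m where "m = j + l"
  define D where "D = (4 * real m + 1) ^ m"
  have "norm (wt n j l z) \<le> (A ^ n * B ^ j * D) * exp (- \<bar>Re z\<bar> / 4)" if z: "\<bar>Im z\<bar> \<le> 1" for z
  proof -
    define r where "r = \<bar>Re z\<bar>"
    have r: "r \<ge> 0" by (simp add: r_def)
    have "norm (wt n j l z) = norm (1 / shc z) ^ n * norm (cothc z) ^ j * norm z ^ l"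
      by (simp add: wt_def norm_mult norm_power norm_divide)
    also have "\<dots> \<le> (A * exp (- r / 2)) ^ n * (B * (1 + r)) ^ j * (1 + r) ^ l"
      using A B z cmod_le[of z] by (intro mult_mono power_mono) (auto simp: r_def)
    also have "\<dots> = A ^ n * B ^ j * (exp (- r / 2) ^ n * (1 + r) ^ m)"
      by (simp add: power_mult_distrib power_add m_def)
    also have "\<dots> \<le> A ^ n * B ^ j * (exp (- r / 2) * (D * exp (r / 4)))"
    proof (intro mult_left_mono mult_mono)
      show "exp (- r / 2) ^ n \<le> exp (- r / 2)"
        using power_decreasing[of 1 n "exp (- r / 2)"] n r by simp
      show "(1 + r) ^ m \<le> D * exp (r / 4)"
      proof (cases "m = 0")
        case True then show ?thesis using r by (simp add: D_def)
      next
        case False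
        have "1 + r \<le> (4 * real m + 1) * exp (r / (4 * real m))"
        proof -
          have "1 + r \<le> 4 * real m * (1 + r / (4 * real m))" using False r by (simp add: field_simps)
          also have "\<dots> \<le> (4 * real m + 1) * exp (r / (4 * real m))"
            using exp_ge_add_one_self[of "r / (4 * real m)"] r by (intro mult_mono) auto
          finally show ?thesis .
        qed
        then have "(1 + r) ^ m \<le> ((4 * real m + 1) * exp (r / (4 * real m))) ^ m"
          using r by (intro power_mono) auto
        also have "\<dots> = D * exp (r / 4)"
          using False by (simp add: power_mult_distrib D_def flip: exp_of_nat_mult)
        finally show ?thesis .
      qed
    qed (use A B r in \<open>auto simp: D_def\<close>)
    also have "exp (- r / 2) * (D * exp (r / 4)) = D * exp (- r / 4)" by (simp add: mult.left_commute flip: exp_add)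
    finally show ?thesis by (simp add: r_def mult_ac)
  qed
  then show ?thesis using A B by (intro exI[of _ "A ^ n * B ^ j * D"]) (auto simp: D_def)
qed

section \<open>Contour shifts for exponentially decaying integrands\<close>

lemma integrable_exp_abs: "c > 0 \<Longrightarrow> integrable lborel (\<lambda>x::real. exp (- \<bar>x\<bar> / c))"
proof -
  assume c: "c > 0"
  define f where "f x = indicator {0<..} x *\<^sub>R exp (- (x * (1 / c)))" for x :: real
  have f: "integrable lborel f"
    using integrable_I0i_exp_mscale[of "1 / c"] c unfolding set_integrable_def f_def by simp
  have "integrable lborel (\<lambda>x. f (0 + (-1) * x)) \<longleftrightarrow> integrable lborel f"
    by (rule lborel_integrable_real_affine_iff) simp
  with f have i: "integrable lborel (\<lambda>x. f x + f (- x))" by simp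
  show ?thesis
  proof (rule Bochner_Integration.integrable_bound[OF i])
    show "AE x in lborel. norm (exp (- \<bar>x\<bar> / c)) \<le> norm (f x + f (- x))"
      using AE_lborel_singleton[of "0::real"]
      by (rule eventually_mono) (auto simp: f_def indicator_def)
  qed auto
qed

lemma tendsto_symmetric_integral:
  fixes f :: "real \<Rightarrow> complex"
  assumes f: "integrable lborel f"
  shows "(\<lambda>k. \<integral>x. indicator {- real k..real k} x *\<^sub>R f x \<partial>lborel) \<longlonglongrightarrow> (\<integral>x. f x \<partial>lborel)"
proof (rule integral_dominated_convergence[where w = "\<lambda>x. norm (f x)"])
  show "AE x in lborel. (\<lambda>k. indicator {- real k..real k} x *\<^sub>R f x) \<longlonglongrightarrow> f x"
  proof (rule AE_I2)
    fix x :: real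
    obtain N where N: "real N \<ge> \<bar>x\<bar>" using real_arch_simple by blast
    show "(\<lambda>k. indicator {- real k..real k} x *\<^sub>R f x) \<longlonglongrightarrow> f x"
    proof (rule tendsto_eventually, rule eventually_sequentiallyI)
      fix k assume "N \<le> k"
      then have "real N \<le> real k" by simp
      then show "indicator {- real k..real k} x *\<^sub>R f x = f x" using N by (auto simp: indicator_def)
    qed
  qed
qed (use f in \<open>auto simp: indicator_def\<close>)

lemma integrable_exp_bound:
  fixes f :: "real \<Rightarrow> complex"
  assumes "continuous_on UNIV f" "\<And>x. norm (f x) \<le> C * exp (- \<bar>x\<bar> / 4)"
  shows "integrable lborel f"
proof (rule Bochner_Integration.integrable_bound)
  show "integrable lborel (\<lambda>x. C * exp (- \<bar>x\<bar> / 4))" using integrable_exp_abs[of 4] by simp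
  show "AE x in lborel. norm (f x) \<le> norm (C * exp (- \<bar>x\<bar> / 4))"
    using assms(2) by (intro AE_I2) (metis abs_ge_self order_trans real_norm_def)
qed (simp add: assms borel_measurable_continuous_onI)

lemma exp_quarter_tendsto: "(\<lambda>k. C * exp (- real k / 4)) \<longlonglongrightarrow> 0"
  by real_asymp

lemma integral_deriv_eq_0:
  fixes F f :: "real \<Rightarrow> complex"
  assumes F: "\<And>x. (F has_vector_derivative f x) (at x)" and f: "continuous_on UNIV f" "integrable lborel f"
    and bd: "\<And>x. norm (F x) \<le> C * exp (- \<bar>x\<bar> / 4)"
  shows "(\<integral>x. f x \<partial>lborel) = 0"
proof -
  have ftc: "(\<integral>x. indicator {- real k..real k} x *\<^sub>R f x \<partial>lborel) = F (real k) - F (- real k)" for k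
    by (rule integral_FTC_Icc) (use F f in \<open>auto intro: has_vector_derivative_at_within continuous_on_subset\<close>)
  have "(\<lambda>k. F (real k) - F (- real k)) \<longlonglongrightarrow> 0"
  proof (rule Lim_null_comparison[OF _ exp_quarter_tendsto[of "2 * C"]])
    show "\<forall>\<^sub>F k in sequentially. norm (F (real k) - F (- real k)) \<le> 2 * C * exp (- real k / 4)"
    proof (intro always_eventually allI)
      fix k
      show "norm (F (real k) - F (- real k)) \<le> 2 * C * exp (- real k / 4)"
        using bd[of "real k"] bd[of "- real k"] norm_triangle_ineq4[of "F (real k)" "F (- real k)"] by simp
    qed
  qed
  with tendsto_symmetric_integral[OF f(2)] show ?thesis unfolding ftc by (rule LIMSEQ_unique)
qed

text \<open>A primitive on the convex strip stands in for the integral around a rectangle: the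
  vertical sides become increments of the primitive, which decay like the integrand.\<close>

lemma contour_shift:
  assumes hol: "F holomorphic_on strip3" and bd: "\<And>z. \<bar>Im z\<bar> \<le> 1 \<Longrightarrow> norm (F z) \<le> C * exp (- \<bar>Re z\<bar> / 4)"
    and c: "\<bar>c\<bar> \<le> 1"
  shows "(\<integral>x. F (of_real x) \<partial>lborel) = (\<integral>x. F (Complex x c) \<partial>lborel)"
proof -
  have cont: "continuous_on UNIV (\<lambda>x. F (Complex x c))" if "\<bar>c\<bar> \<le> 1" for c
  proof -
    have "continuous_on UNIV (\<lambda>x. F (of_real x + \<i> * of_real c))"
      by (rule continuous_on_compose2[OF holomorphic_on_imp_continuous_on[OF hol]])
         (use that in \<open>auto simp: strip3_def intro!: continuous_intros\<close>)
    then show ?thesis by (simp add: Complex_eq)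
  qed
  have int: "integrable lborel (\<lambda>x. F (Complex x c))" if "\<bar>c\<bar> \<le> 1" for c
    by (rule integrable_exp_bound[where C = C, OF cont[OF that]]) (use bd[of "Complex _ c"] that in auto)
  obtain G where G: "\<And>z. z \<in> strip3 \<Longrightarrow> (G has_field_derivative F z) (at z)"
    by (metis holomorphic_convex_primitive'[OF strip3(2,1) hol] at_within_open[OF _ strip3(1)])
  have ftc: "(\<integral>x. indicator {- real k..real k} x *\<^sub>R F (Complex x d) \<partial>lborel) = G (Complex (real k) d) - G (Complex (- real k) d)"
    if d: "\<bar>d\<bar> \<le> 1" for k d
  proof (rule integral_FTC_Icc)
    show "continuous_on {- real k..real k} (\<lambda>x. F (Complex x d))" by (rule continuous_on_subset[OF cont[OF d]]) simp
    fix x :: real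
    have "(G has_field_derivative F (Complex x d)) (at (Complex x d))" using d by (intro G strip3(3)) simp
    moreover have "((\<lambda>x. Complex x d) has_vector_derivative 1) (at x within {- real k..real k})"
      unfolding Complex_eq by (auto intro!: derivative_eq_intros)
    ultimately show "((\<lambda>x. G (Complex x d)) has_vector_derivative F (Complex x d)) (at x within {- real k..real k})"
      using field_vector_diff_chain_within[of "\<lambda>x. Complex x d" 1 x "{- real k..real k}" G "F (Complex x d)"]
      by (auto simp: o_def intro: has_field_derivative_at_within)
  qed simp
  have side: "norm (G (Complex x c) - G (Complex x 0)) \<le> C * exp (- \<bar>x\<bar> / 4)" for x
  proof -
    have "norm (G (Complex x c) - G (Complex x 0)) \<le> (C * exp (- \<bar>x\<bar> / 4)) * norm (Complex x c - Complex x 0)"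
    proof (rule field_differentiable_bound[of "{z. Re z = x \<and> \<bar>Im z\<bar> \<le> 1}" G F])
      have "{z. Re z = x \<and> \<bar>Im z\<bar> \<le> 1} = cbox (Complex x (-1)) (Complex x 1)"
        by (auto simp: in_cbox_complex_iff)
      then show "convex {z. Re z = x \<and> \<bar>Im z\<bar> \<le> 1}" by simp
      show "(G has_field_derivative F z) (at z within {z. Re z = x \<and> \<bar>Im z\<bar> \<le> 1})" if "z \<in> {z. Re z = x \<and> \<bar>Im z\<bar> \<le> 1}" for z
        using G[OF strip3(3)] that by (auto intro: has_field_derivative_at_within)
      show "norm (F z) \<le> C * exp (- \<bar>x\<bar> / 4)" if "z \<in> {z. Re z = x \<and> \<bar>Im z\<bar> \<le> 1}" for z
        using bd[of z] that by auto
    qed (use c in auto)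
    also have "norm (Complex x c - Complex x 0) = \<bar>c\<bar>" by (simp add: cmod_def)
    also have "C * exp (- \<bar>x\<bar> / 4) * \<bar>c\<bar> \<le> C * exp (- \<bar>x\<bar> / 4) * 1"
      using c order_trans[OF norm_ge_zero bd[of "Complex x 0"]] by (intro mult_left_mono) auto
    finally show ?thesis by simp
  qed
  let ?d = "\<lambda>k. (\<integral>x. indicator {- real k..real k} x *\<^sub>R F (Complex x c) \<partial>lborel) - (\<integral>x. indicator {- real k..real k} x *\<^sub>R F (Complex x 0) \<partial>lborel)"
  have d0: "?d \<longlonglongrightarrow> 0"
  proof (rule Lim_null_comparison[OF _ exp_quarter_tendsto[of "2 * C"]])
    show "\<forall>\<^sub>F k in sequentially. norm (?d k) \<le> 2 * C * exp (- real k / 4)"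
    proof (intro always_eventually allI)
      fix k
      have "?d k = (G (Complex (real k) c) - G (Complex (real k) 0)) - (G (Complex (- real k) c) - G (Complex (- real k) 0))"
        using ftc[OF c] ftc[of 0] by simp
      then show "norm (?d k) \<le> 2 * C * exp (- real k / 4)"
        using side[of "real k"] side[of "- real k"]
          norm_triangle_ineq4[of "G (Complex (real k) c) - G (Complex (real k) 0)" "G (Complex (- real k) c) - G (Complex (- real k) 0)"]
        by simp
    qed
  qed
  have "?d \<longlonglongrightarrow> (\<integral>x. F (Complex x c) \<partial>lborel) - (\<integral>x. F (Complex x 0) \<partial>lborel)"
    by (intro tendsto_diff tendsto_symmetric_integral int c) simp
  then have "(\<integral>x. F (Complex x c) \<partial>lborel) - (\<integral>x. F (Complex x 0) \<partial>lborel) = 0"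
    using d0 by (rule LIMSEQ_unique)
  then show ?thesis by (simp add: complex_of_real_def)
qed

text \<open>\<open>ker j l\<close> at \<open>(z, t)\<close> is the integral over real \<open>x\<close> of
  \<open>(x / sinh x)^n (x coth x)^j x^l exp (- |z|\<^sup>2 x coth x / 4 + \<i> x t)\<close>; for \<open>j = l = 0\<close> this is the heat kernel at time 1,
  up to a constant factor.\<close>
definition kint :: "'n::finite itself \<Rightarrow> nat \<Rightarrow> nat \<Rightarrow> real \<Rightarrow> real \<Rightarrow> complex \<Rightarrow> complex" where
  "kint N j l u t z = wt CARD('n) j l z * exp (- of_real u * cothc z + \<i> * of_real t * z)"

definition ker :: "nat \<Rightarrow> nat \<Rightarrow> 'n::finite heis \<Rightarrow> complex" where
  "ker j l x = (\<integral>r. kint TYPE('n) j l ((norm (fst x))\<^sup>2 / 4) (snd x) (of_real r) \<partial>lborel)"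

lemma kint_holomorphic: "kint TYPE('n::finite) j l u t holomorphic_on strip3"
  unfolding kint_def by (intro holomorphic_intros wt_holomorphic cothc_holomorphic)

lemma continuous_on_kint_line: "continuous_on UNIV (\<lambda>r. kint TYPE('n::finite) j l u t (of_real r))"
  by (rule continuous_on_compose2[OF holomorphic_on_imp_continuous_on[OF kint_holomorphic]])
     (auto simp: strip3_def intro!: continuous_intros)

text \<open>A chosen constant of \<open>wt_bound\<close>, named so that the bounds for the kernels
  can record their dependence on \<open>j\<close> and \<open>l\<close>.\<close>

definition wtC :: "'n::finite itself \<Rightarrow> nat \<Rightarrow> nat \<Rightarrow> real" where
  "wtC N j l = (SOME C. C \<ge> 0 \<and> (\<forall>z. \<bar>Im z\<bar> \<le> 1 \<longrightarrow> norm (wt CARD('n) j l z) \<le> C * exp (- \<bar>Re z\<bar> / 4)))"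

lemma wtC: "wtC TYPE('n::finite) j l \<ge> 0" "\<bar>Im z\<bar> \<le> 1 \<Longrightarrow> norm (wt CARD('n) j l z) \<le> wtC TYPE('n) j l * exp (- \<bar>Re z\<bar> / 4)"
proof -
  have "CARD('n) \<ge> 1" by (simp add: Suc_leI)
  from someI_ex[OF wt_bound[OF this, of j l, unfolded Bex_def]]
  show "wtC TYPE('n) j l \<ge> 0" "\<bar>Im z\<bar> \<le> 1 \<Longrightarrow> norm (wt CARD('n) j l z) \<le> wtC TYPE('n) j l * exp (- \<bar>Re z\<bar> / 4)"
    unfolding wtC_def by auto
qed

lemma kint_bound:
  assumes "u \<ge> 0" "\<bar>Im z\<bar> \<le> 1"
  shows "norm (kint TYPE('n::finite) j l u t z) \<le> wtC TYPE('n) j l * exp (- u / 2 - t * Im z) * exp (- \<bar>Re z\<bar> / 4)"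
proof -
  have "norm (exp (- of_real u * cothc z + \<i> * of_real t * z)) = exp (- u * Re (cothc z) - t * Im z)"
    by (simp add: norm_exp_eq_Re)
  also have "\<dots> \<le> exp (- u / 2 - t * Im z)"
    using mult_left_mono[OF Re_cothc_ge[OF assms(2)] assms(1)] by simp
  finally have e: "norm (exp (- of_real u * cothc z + \<i> * of_real t * z)) \<le> exp (- u / 2 - t * Im z)" .
  have "norm (kint TYPE('n) j l u t z) \<le> (wtC TYPE('n) j l * exp (- \<bar>Re z\<bar> / 4)) * exp (- u / 2 - t * Im z)"
    unfolding kint_def norm_mult using wtC(1)[where 'n='n] wtC(2)[OF assms(2), where 'n='n] e by (intro mult_mono) auto
  then show ?thesis by (simp add: mult_ac)
qed

lemma kint_line_bound:
  "u \<ge> 0 \<Longrightarrow> norm (kint TYPE('n::finite) j l u t (of_real r)) \<le> wtC TYPE('n) j l * exp (- u / 2) * exp (- \<bar>r\<bar> / 4)"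
  using kint_bound[where 'n='n, of u "of_real r" j l t] by simp

lemma integrable_kint: "u \<ge> 0 \<Longrightarrow> integrable lborel (\<lambda>r. kint TYPE('n::finite) j l u t (of_real r))"
  by (rule integrable_exp_bound[OF continuous_on_kint_line kint_line_bound])

definition kerC :: "'n::finite itself \<Rightarrow> nat \<Rightarrow> nat \<Rightarrow> real" where
  "kerC N j l = wtC TYPE('n) j l * (\<integral>r. exp (- \<bar>r\<bar> / 4) \<partial>lborel)"

lemma kerC_nonneg: "kerC TYPE('n::finite) j l \<ge> 0"
  unfolding kerC_def by (intro mult_nonneg_nonneg wtC integral_nonneg) auto

text \<open>Moving the line of integration to height 1 or -1, according to the sign of t, gains
  exp(-|t|); on that line \<open>Re_cothc_ge\<close> still gives exp(-u/2) with u = |z|^2 /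
  4.\<close>

lemma ker_bound: "norm (ker j l (x :: 'n::finite heis)) \<le> kerC TYPE('n) j l * exp (- (norm (fst x))\<^sup>2 / 8 - \<bar>snd x\<bar>)"
proof -
  define u where "u = (norm (fst x))\<^sup>2 / 4"
  define t where "t = snd x"
  define c where "c = (if t \<ge> 0 then 1 else - 1 :: real)"
  have u: "u \<ge> 0" by (simp add: u_def)
  have c: "\<bar>c\<bar> \<le> 1" "t * c = \<bar>t\<bar>" by (auto simp: c_def)
  let ?F = "kint TYPE('n) j l u t"
  have "ker j l x = (\<integral>r. ?F (of_real r) \<partial>lborel)" by (simp add: ker_def u_def t_def)
  also have "\<dots> = (\<integral>r. ?F (Complex r c) \<partial>lborel)"
  proof (rule contour_shift[OF kint_holomorphic _ c(1)])
    fix z :: complex assume z: "\<bar>Im z\<bar> \<le> 1"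
    have "- u / 2 - t * Im z \<le> - u / 2 + \<bar>t\<bar>"
      using mult_mono[of "\<bar>t\<bar>" "\<bar>t\<bar>" "\<bar>Im z\<bar>" 1] z abs_ge_minus_self[of "t * Im z"] by (simp add: abs_mult)
    then have "wtC TYPE('n) j l * exp (- u / 2 - t * Im z) * exp (- \<bar>Re z\<bar> / 4) \<le> wtC TYPE('n) j l * exp (- u / 2 + \<bar>t\<bar>) * exp (- \<bar>Re z\<bar> / 4)"
      by (intro mult_right_mono mult_left_mono wtC) auto
    then show "norm (?F z) \<le> wtC TYPE('n) j l * exp (- u / 2 + \<bar>t\<bar>) * exp (- \<bar>Re z\<bar> / 4)"
      using kint_bound[OF u z, where 'n='n, of j l t] by linarith
  qed
  also have "norm \<dots> \<le> (\<integral>r. norm (?F (Complex r c)) \<partial>lborel)" by (rule integral_norm_bound)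
  also have "\<dots> \<le> (\<integral>r. wtC TYPE('n) j l * exp (- u / 2 - \<bar>t\<bar>) * exp (- \<bar>r\<bar> / 4) \<partial>lborel)"
  proof (rule integral_mono')
    show "integrable lborel (\<lambda>r. wtC TYPE('n) j l * exp (- u / 2 - \<bar>t\<bar>) * exp (- \<bar>r\<bar> / 4))"
      using integrable_exp_abs[of 4] by simp
    show "norm (?F (Complex r c)) \<le> wtC TYPE('n) j l * exp (- u / 2 - \<bar>t\<bar>) * exp (- \<bar>r\<bar> / 4)" for r
      using kint_bound[OF u, where 'n='n, of "Complex r c" j l t] c by simp
  qed (use wtC(1)[where 'n='n] in simp)
  also have "\<dots> = kerC TYPE('n) j l * exp (- u / 2 - \<bar>t\<bar>)" by (simp add: kerC_def)
  finally show ?thesis by (simp add: u_def t_def)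
qed

text \<open>A derivative in z brings down a factor x coth x, a derivative in t a factor \<i> x. The
  two indices exist to make the family closed under this.\<close>

lemma ker_has_derivative:
  fixes x :: "'n::finite heis"
  shows "(ker j l has_derivative (\<lambda>v. - of_real ((fst x \<bullet> fst v) / 2) * ker (Suc j) l x + \<i> * of_real (snd v) * ker j (Suc l) x)) (at x)"
proof -
  let ?k = "\<lambda>j l x r. kint TYPE('n) j l ((norm (fst x))\<^sup>2 / 4) (snd x) (of_real r)"
  let ?D = "\<lambda>r x v. - of_real ((fst x \<bullet> fst v) / 2) * ?k (Suc j) l x r + \<i> * of_real (snd v) * ?k j (Suc l) x r"
  define g where "g r = ((norm x + 1) * wtC TYPE('n) (Suc j) l + wtC TYPE('n) j (Suc l)) * exp (- \<bar>r\<bar> / 4)" for r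
  have kb: "norm (?k j l y r) \<le> wtC TYPE('n) j l * exp (- \<bar>r\<bar> / 4)" for j l y r
  proof -
    have "wtC TYPE('n) j l * exp (- ((norm (fst y))\<^sup>2 / 4) / 2) * exp (- \<bar>r\<bar> / 4) \<le> wtC TYPE('n) j l * 1 * exp (- \<bar>r\<bar> / 4)"
      by (intro mult_right_mono mult_left_mono wtC) auto
    then show ?thesis using kint_line_bound[where 'n='n, of "(norm (fst y))\<^sup>2 / 4" j l "snd y" r] by simp
  qed
  have "((\<lambda>y. \<integral>r. ?k j l y r \<partial>lborel) has_derivative (\<lambda>v. \<integral>r. ?D r x v \<partial>lborel)) (at x)"
  proof (rule has_derivative_lebesgue_integral[where d = 1 and g = g and F' = ?D])
    show "integrable lborel (?k j l y)" for y by (rule integrable_kint) simp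
    show "integrable lborel g" unfolding g_def using integrable_exp_abs[of 4] by simp
    show "(\<lambda>r. ?D r x v) \<in> borel_measurable lborel" for v
      by (subst measurable_lborel2) (intro borel_measurable_continuous_onI continuous_intros continuous_on_kint_line)
    fix r y assume y: "dist y x < 1"
    show "((\<lambda>x. ?k j l x r) has_derivative ?D r y) (at y)"
    proof -
      have 1: "((\<lambda>x. - of_real ((norm (fst x))\<^sup>2 / 4) * cothc (of_real r) + \<i> * of_real (snd x) * of_real r) has_derivative
          (\<lambda>v. - of_real ((fst y \<bullet> fst v) / 2) * cothc (of_real r) + \<i> * of_real (snd v) * of_real r)) (at y)"
        unfolding power2_norm_eq_inner by (auto intro!: derivative_eq_intros simp: inner_commute)
      have "((\<lambda>w. wt CARD('n) j l (of_real r) * exp w) has_derivative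
          (\<lambda>h. h * (wt CARD('n) j l (of_real r) * exp w0))) (at w0)" for w0
        by (rule has_derivative_eq_rhs[OF DERIV_cmult[OF DERIV_exp, unfolded has_field_derivative_def]])
           (simp add: fun_eq_iff mult_ac)
      from has_derivative_compose[OF 1 this]
      show ?thesis unfolding kint_def
        by (rule has_derivative_eq_rhs) (simp add: wt_def fun_eq_iff algebra_simps)
    qed
    fix v :: "'n heis"
    have "norm (fst y) \<le> norm x + 1"
      using norm_fst_le[of "fst y" "snd y"] norm_triangle_ineq2[of y x] y by (simp add: dist_norm)
    then have "\<bar>fst y \<bullet> fst v\<bar> / 2 \<le> (norm x + 1) * norm v"
    proof -
      assume a: "norm (fst y) \<le> norm x + 1"
      have "\<bar>fst y \<bullet> fst v\<bar> \<le> norm (fst y) * norm (fst v)" by (rule Cauchy_Schwarz_ineq2)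
      also have "\<dots> \<le> (norm x + 1) * norm v" using a norm_fst_le[of "fst v" "snd v"] by (intro mult_mono) auto
      finally show ?thesis by simp
    qed
    then have "norm (of_real ((fst y \<bullet> fst v) / 2) * ?k (Suc j) l y r) \<le> ((norm x + 1) * norm v) * (wtC TYPE('n) (Suc j) l * exp (- \<bar>r\<bar> / 4))"
      unfolding norm_mult by (intro mult_mono kb) auto
    moreover have "norm (\<i> * of_real (snd v) * ?k j (Suc l) y r) \<le> norm v * (wtC TYPE('n) j (Suc l) * exp (- \<bar>r\<bar> / 4))"
      unfolding norm_mult using norm_snd_le[of "snd v" "fst v"] by (intro mult_mono kb) auto
    ultimately have "norm (?D r y v) \<le> ((norm x + 1) * norm v) * (wtC TYPE('n) (Suc j) l * exp (- \<bar>r\<bar> / 4)) + norm v * (wtC TYPE('n) j (Suc l) * exp (- \<bar>r\<bar> / 4))"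
      using norm_triangle_ineq[of "- of_real ((fst y \<bullet> fst v) / 2) * ?k (Suc j) l y r" "\<i> * of_real (snd v) * ?k j (Suc l) y r"]
      by (simp only: norm_minus_cancel mult_minus_left)
    then show "norm (?D r y v) \<le> g r * norm v" by (simp add: g_def algebra_simps)
  qed simp
  moreover have "(\<integral>r. ?D r x v \<partial>lborel) = - of_real ((fst x \<bullet> fst v) / 2) * ker (Suc j) l x + \<i> * of_real (snd v) * ker j (Suc l) x" for v
    unfolding ker_def by (subst Bochner_Integration.integral_add) (simp_all add: integrable_kint)
  ultimately show ?thesis by (simp add: ker_def[abs_def])
qed

section \<open>The heat equation at time 1\<close>

lemma shc_derivative: "\<exists>d. (shc has_field_derivative d) (at z) \<and> z * d = cosh z - shc z"
proof (cases "z = 0")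
  case True
  have "(shc has_field_derivative deriv shc z) (at z)"
    using holomorphic_derivI[OF shc_holomorphic open_UNIV] by simp
  then show ?thesis using True by (intro exI[of _ "deriv shc z"]) (simp add: shc_def)
next
  case False
  have "((\<lambda>z. sinh z / z) has_field_derivative (cosh z * z - sinh z) / (z * z)) (at z)"
    using False by (auto intro!: derivative_eq_intros)
  moreover have "eventually (\<lambda>w. sinh w / w = shc w) (nhds z)"
    using eventually_nhds_in_open[of "- {0}" z] False by (auto elim!: eventually_mono simp: shc_def)
  ultimately have "(shc has_field_derivative (cosh z * z - sinh z) / (z * z)) (at z)"
    by (subst DERIV_cong_ev[OF refl _ refl, of _ "\<lambda>z. sinh z / z"]) (auto elim: eventually_mono)
  then show ?thesis using False by (intro exI[of _ "(cosh z * z - sinh z) / (z * z)"]) (simp add: shc_def field_simps)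
qed

lemma sinh_eq_shc: "sinh z = z * shc z"
  by (simp add: shc_def)

text \<open>The formula is for \<open>z * D\<close>, as in \<open>shc_derivative\<close>, so that z
  = 0 is included. The summands in the bracket are z times the logarithmic derivatives of (1 /
  shc)^n, exp(-u cothc) and exp(\<i> t z).\<close>

lemma kint_derivative:
  assumes z: "z \<in> strip3"
  shows "\<exists>D. (kint TYPE('n::finite) 0 0 u t has_field_derivative D) (at z) \<and>
    z * D = kint TYPE('n) 0 0 u t z * (of_nat CARD('n) * (1 - cothc z) - of_real u * (cothc z - (cothc z)\<^sup>2 + z\<^sup>2) + \<i> * of_real t * z)"
proof -
  define n where "n = CARD('n)"
  have n: "n \<ge> 1" by (simp add: n_def Suc_leI)
  obtain d where d: "(shc has_field_derivative d) (at z)" "z * d = cosh z - shc z" using shc_derivative by blast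
  have nz: "shc z \<noteq> 0" using z shc_nonzero[of z] by (auto simp: strip3_def abs_less_iff)
  define B where "B = cothc z"
  define B' where "B' = (sinh z * shc z - cosh z * d) / (shc z * shc z)"
  have B': "(cothc has_field_derivative B') (at z)" unfolding cothc_def[abs_def] B'_def
    using nz by (auto intro!: derivative_eq_intros d)
  have zB': "z * B' = B - B\<^sup>2 + z\<^sup>2"
  proof -
    have "z * B' = (z * z * (shc z * shc z) - cosh z * (z * d)) / (shc z * shc z)"
      by (simp add: B'_def sinh_eq_shc field_simps)
    also have "\<dots> = B - B\<^sup>2 + z\<^sup>2"
      unfolding d(2) B_def cothc_def using nz by (simp add: field_simps power2_eq_square)
    finally show ?thesis .
  qed
  define A' where "A' = of_nat n * (1 / shc z) ^ (n - 1) * (- d / (shc z * shc z))"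
  have A': "((\<lambda>z. (1 / shc z) ^ n) has_field_derivative A') (at z)" unfolding A'_def
  proof -
    have "((\<lambda>z. 1 / shc z) has_field_derivative - d / (shc z * shc z)) (at z)"
      using nz by (auto intro!: derivative_eq_intros d)
    from DERIV_power[OF this, of n] show "((\<lambda>z. (1 / shc z) ^ n) has_field_derivative of_nat n * (1 / shc z) ^ (n - 1) * (- d / (shc z * shc z))) (at z)"
      by (simp add: mult_ac)
  qed
  have zA': "z * A' = of_nat n * (1 / shc z) ^ n * (1 - B)"
  proof -
    have "z * A' = of_nat n * (1 / shc z) ^ (n - 1) * (- (z * d) / (shc z * shc z))" by (simp add: A'_def)
    also have "- (z * d) / (shc z * shc z) = (1 / shc z) * (1 - B)"
      unfolding d(2) B_def cothc_def using nz by (simp add: field_simps)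
    also have "of_nat n * (1 / shc z) ^ (n - 1) * ((1 / shc z) * (1 - B)) = of_nat n * ((1 / shc z) ^ (n - 1) * (1 / shc z)) * (1 - B)"
      by (simp only: mult.assoc)
    also have "(1 / shc z) ^ (n - 1) * (1 / shc z) = (1 / shc z) ^ n"
      using n by (metis power_minus_mult zero_less_one order_less_le_trans)
    finally show ?thesis .
  qed
  define E where "E = exp (- of_real u * B + \<i> * of_real t * z)"
  have e: "((\<lambda>z. exp (- of_real u * cothc z + \<i> * of_real t * z)) has_field_derivative E * (- of_real u * B' + \<i> * of_real t)) (at z)"
    unfolding E_def B_def by (auto intro!: derivative_eq_intros B')
  have "((\<lambda>z. (1 / shc z) ^ n * exp (- of_real u * cothc z + \<i> * of_real t * z)) has_field_derivative
      A' * E + (E * (- of_real u * B' + \<i> * of_real t)) * (1 / shc z) ^ n) (at z)"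
    using DERIV_mult[OF A' e] by (simp add: E_def B_def)
  then have "(kint TYPE('n) 0 0 u t has_field_derivative
      A' * E + (E * (- of_real u * B' + \<i> * of_real t)) * (1 / shc z) ^ n) (at z)"
    by (simp add: kint_def[abs_def] wt_def n_def)
  moreover have "z * (A' * E + (E * (- of_real u * B' + \<i> * of_real t)) * (1 / shc z) ^ n) =
      (1 / shc z) ^ n * E * (of_nat n * (1 - B) - of_real u * (B - B\<^sup>2 + z\<^sup>2) + \<i> * of_real t * z)"
  proof -
    have "z * (A' * E + (E * (- of_real u * B' + \<i> * of_real t)) * (1 / shc z) ^ n) =
        (z * A') * E + (E * (- of_real u * (z * B') + \<i> * of_real t * z)) * (1 / shc z) ^ n"
      by (simp add: algebra_simps)
    also have "\<dots> = (1 / shc z) ^ n * E * (of_nat n * (1 - B) - of_real u * (B - B\<^sup>2 + z\<^sup>2) + \<i> * of_real t * z)"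
      unfolding zA' zB' by (simp add: algebra_simps)
    finally show ?thesis .
  qed
  ultimately show ?thesis
    by (intro exI conjI) (auto simp: kint_def wt_def n_def E_def B_def)
qed

text \<open>The derivative of r times the integrand of \<open>ker 0 0\<close> integrates to 0. By
  \<open>lap_ker\<close> the left side is L applied to the kernel, and the right side is minus the
  \<tau>-derivative at \<tau> = 1 of the self-similar extension of the kernel to all times.\<close>

lemma ker_identity:
  fixes x :: "'n::finite heis"
  defines "u \<equiv> complex_of_real ((norm (fst x))\<^sup>2 / 4)"
  shows "of_nat CARD('n) * ker 1 0 x - u * ker 2 0 x + u * ker 0 2 x =
     (of_nat CARD('n) + 1) * ker 0 0 x - u * ker 1 0 x + \<i> * of_real (snd x) * ker 0 1 x"
proof -
  define v where "v = (norm (fst x))\<^sup>2 / 4"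
  have v: "v \<ge> 0" by (simp add: v_def)
  define t where "t = snd x"
  define k where "k j l r = kint TYPE('n) j l v t (of_real r)" for j l and r :: real
  define n where "n = complex_of_nat CARD('n)"
  define f where "f r = (1 + n) * k 0 0 r - n * k 1 0 r - u * k 1 0 r + u * k 2 0 r - u * k 0 2 r + \<i> * of_real t * k 0 1 r" for r
  have ik: "integrable lborel (k j l)" for j l unfolding k_def using integrable_kint[OF v] .
  have ck: "continuous_on UNIV (k j l)" for j l unfolding k_def by (rule continuous_on_kint_line)
  have kk: "k j l r = k 0 0 r * cothc (of_real r) ^ j * of_real r ^ l" for j l r
    by (simp add: k_def kint_def wt_def)
  have "(\<integral>r. f r \<partial>lborel) = 0"
  proof (rule integral_deriv_eq_0[where F = "k 0 1"])
    show "integrable lborel f" unfolding f_def by (intro Bochner_Integration.integrable_add Bochner_Integration.integrable_diff integrable_mult_right ik)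
    show "continuous_on UNIV f" unfolding f_def by (intro continuous_intros ck)
    show "norm (k 0 1 r) \<le> wtC TYPE('n) 0 1 * exp (- v / 2) * exp (- \<bar>r\<bar> / 4)" for r
      unfolding k_def by (rule kint_line_bound[OF v])
    fix r :: real
    obtain D where D: "(kint TYPE('n) 0 0 v t has_field_derivative D) (at (of_real r))"
      "of_real r * D = kint TYPE('n) 0 0 v t (of_real r) * (of_nat CARD('n) * (1 - cothc (of_real r)) - of_real v * (cothc (of_real r) - (cothc (of_real r))\<^sup>2 + (of_real r)\<^sup>2) + \<i> * of_real t * of_real r)"
      using kint_derivative[of "of_real r", where 'n='n and u=v and t=t] by (auto simp: strip3_def)
    have "((\<lambda>z. z * kint TYPE('n) 0 0 v t z) has_field_derivative 1 * kint TYPE('n) 0 0 v t (of_real r) + D * of_real r) (at (of_real r))"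
      by (rule DERIV_mult[OF DERIV_ident D(1)])
    note chain = field_vector_diff_chain_at[where f = complex_of_real and f' = 1 and x = r, OF _ this]
    have "((\<lambda>r. of_real r * kint TYPE('n) 0 0 v t (of_real r)) has_vector_derivative k 0 0 r + D * of_real r) (at r)"
    proof -
      have "(complex_of_real has_vector_derivative 1) (at r)" unfolding has_vector_derivative_def
        by (rule has_derivative_eq_rhs[OF has_derivative_of_real[OF has_derivative_ident]])
           (simp add: fun_eq_iff scaleR_conv_of_real)
      from chain[OF this] show ?thesis by (simp add: o_def k_def)
    qed
    moreover have "(\<lambda>r. of_real r * kint TYPE('n) 0 0 v t (of_real r)) = k 0 1"
      by (simp add: fun_eq_iff k_def kint_def wt_def mult_ac)
    moreover have "k 0 0 r + D * of_real r = f r"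
    proof -
      define B R K where "B = cothc (of_real r)" and "R = complex_of_real r" and "K = k 0 0 r"
      have DR: "D * of_real r = K * (n * (1 - B) - u * (B - B\<^sup>2 + R\<^sup>2) + \<i> * of_real t * R)"
        unfolding mult.commute[of D] D(2) by (simp only: B_def R_def K_def k_def n_def u_def v_def)
      have fr: "f r = (1 + n) * K - n * (K * B) - u * (K * B) + u * (K * B\<^sup>2) - u * (K * R\<^sup>2) + \<i> * of_real t * (K * R)"
        unfolding f_def kk[of 1 0] kk[of 2 0] kk[of 0 1] kk[of 0 2] by (simp add: B_def R_def K_def)
      show ?thesis unfolding fr DR K_def[symmetric] by (simp add: algebra_simps)
    qed
    ultimately show "(k 0 1 has_vector_derivative f r) (at r)" by simp
  qed
  moreover have "(\<integral>r. f r \<partial>lborel) = (1 + n) * ker 0 0 x - n * ker 1 0 x - u * ker 1 0 x + u * ker 2 0 x - u * ker 0 2 x + \<i> * of_real t * ker 0 1 x"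
  proof -
    have "ker j l x = (\<integral>r. k j l r \<partial>lborel)" for j l by (simp add: ker_def k_def v_def t_def)
    then show ?thesis unfolding f_def using ik by simp
  qed
  ultimately show ?thesis by (simp add: n_def t_def algebra_simps)
qed

lemma ker_differentiable: "ker j l differentiable (at x)"
  using ker_has_derivative differentiable_def by blast

lemma hor_ker: "hor b (ker j l) x = - of_real ((fst x \<bullet> b) / 2) * ker (Suc j) l x + \<i> * of_real (symp b (fst x)) * ker j (Suc l) x"
  unfolding hor_eqI[OF ker_has_derivative] by (simp add: vf_def)

lemma hor_ker_has_derivative:
  fixes x :: "'n::finite heis"
  shows "(hor b (ker j l) has_derivative (\<lambda>v.
     - of_real ((fst v \<bullet> b) / 2) * ker (Suc j) l x
     - of_real ((fst x \<bullet> b) / 2) * (- of_real ((fst x \<bullet> fst v) / 2) * ker (Suc (Suc j)) l x + \<i> * of_real (snd v) * ker (Suc j) (Suc l) x)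
     + \<i> * of_real (symp b (fst v)) * ker j (Suc l) x
     + \<i> * of_real (symp b (fst x)) * (- of_real ((fst x \<bullet> fst v) / 2) * ker (Suc j) (Suc l) x + \<i> * of_real (snd v) * ker j (Suc (Suc l)) x))) (at x)"
proof -
  have s: "((\<lambda>x. symp b (fst x)) has_derivative (\<lambda>v. symp b (fst v))) (at x)"
    by (rule bounded_linear_imp_has_derivative) (rule bounded_linear_compose[OF bounded_linear_symp bounded_linear_fst])
  have 1: "((\<lambda>x. complex_of_real ((fst x \<bullet> b) / 2)) has_derivative (\<lambda>v. of_real ((fst v \<bullet> b) / 2))) (at x)"
    by (auto intro!: derivative_eq_intros)
  have 2: "((\<lambda>x. complex_of_real (symp b (fst x))) has_derivative (\<lambda>v. of_real (symp b (fst v)))) (at x)"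
    by (rule has_derivative_of_real[OF s])
  have "((\<lambda>x. - (of_real ((fst x \<bullet> b) / 2) * ker (Suc j) l x) + \<i> * (of_real (symp b (fst x)) * ker j (Suc l) x)) has_derivative
     (\<lambda>v. - (of_real ((fst x \<bullet> b) / 2) * (- of_real ((fst x \<bullet> fst v) / 2) * ker (Suc (Suc j)) l x + \<i> * of_real (snd v) * ker (Suc j) (Suc l) x)
         + of_real ((fst v \<bullet> b) / 2) * ker (Suc j) l x)
      + \<i> * (of_real (symp b (fst x)) * (- of_real ((fst x \<bullet> fst v) / 2) * ker (Suc j) (Suc l) x + \<i> * of_real (snd v) * ker j (Suc (Suc l)) x)
         + of_real (symp b (fst v)) * ker j (Suc l) x))) (at x)"
    by (intro has_derivative_add has_derivative_minus has_derivative_mult_right has_derivative_mult 1 2 ker_has_derivative)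
  then show ?thesis unfolding hor_ker[abs_def]
    by (auto simp: mult.assoc elim!: has_derivative_eq_rhs simp del: of_real_divide intro!: ext) (simp add: algebra_simps)
qed

lemma hor_hor_ker:
  fixes x :: "'n::finite heis"
  assumes b: "b \<in> Basis"
  shows "hor b (hor b (ker j l)) x = - ker (Suc j) l x / 2 + of_real ((fst x \<bullet> b)\<^sup>2 / 4) * ker (Suc (Suc j)) l x
     - \<i> * of_real (symp b (fst x) * (fst x \<bullet> b)) * ker (Suc j) (Suc l) x - of_real ((symp b (fst x))\<^sup>2) * ker j (Suc (Suc l)) x"
  unfolding hor_eqI[OF hor_ker_has_derivative] using b
  by (simp add: vf_def symp_self power2_eq_square algebra_simps)

lemma sum_Basis_symp:
  fixes z :: "complex ^ 'n::finite"
  shows "(\<Sum>b\<in>Basis. (z \<bullet> b)\<^sup>2) = (norm z)\<^sup>2" "(\<Sum>b\<in>Basis. (symp b z)\<^sup>2) = (norm z)\<^sup>2 / 4"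
    "(\<Sum>b\<in>Basis. symp b z * (z \<bullet> b)) = 0" "card (Basis :: (complex ^ 'n) set) = 2 * CARD('n)"
proof -
  show "(\<Sum>b\<in>Basis. (z \<bullet> b)\<^sup>2) = (norm z)\<^sup>2" unfolding power2_norm_eq_inner euclidean_inner[of z z] by (simp add: power2_eq_square)
  have n: "(norm z)\<^sup>2 = (\<Sum>j\<in>UNIV. (Re (z $ j))\<^sup>2 + (Im (z $ j))\<^sup>2)"
    by (simp add: norm_vec_def L2_set_def sum_nonneg cmod_power2)
  show "(\<Sum>b\<in>Basis. (symp b z)\<^sup>2) = (norm z)\<^sup>2 / 4"
    unfolding sum_Basis_complex_vec symp_axis n by (simp add: power_divide sum_divide_distrib add_divide_distrib add.commute)
  show "(\<Sum>b\<in>Basis. symp b z * (z \<bullet> b)) = 0"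
    unfolding sum_Basis_complex_vec symp_axis by (simp add: inner_axis inner_complex_def mult.commute)
  show "card (Basis :: (complex ^ 'n) set) = 2 * CARD('n)" by simp
qed

text \<open>The terms with \<open>ker 1 1\<close> cancel because the vector with the coordinates
  \<open>symp b z\<close> is a multiple of \<i> z and thus orthogonal to z; its squared length |z|^2
  / 4 is the coefficient of \<open>ker 0 2\<close>.\<close>

lemma lap_ker:
  fixes x :: "'n::finite heis"
  shows "lap (ker 0 0) x = of_nat CARD('n) * ker 1 0 x - of_real ((norm (fst x))\<^sup>2 / 4) * ker 2 0 x + of_real ((norm (fst x))\<^sup>2 / 4) * ker 0 2 x"
proof -
  have "(\<Sum>b\<in>Basis. hor b (hor b (ker 0 0)) x) = (\<Sum>b\<in>(Basis :: (complex ^ 'n) set). - ker 1 0 x / 2 + of_real ((fst x \<bullet> b)\<^sup>2 / 4) * ker 2 0 x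
     - \<i> * of_real (symp b (fst x) * (fst x \<bullet> b)) * ker 1 1 x - of_real ((symp b (fst x))\<^sup>2) * ker 0 2 x)"
    by (intro sum.cong refl) (simp add: hor_hor_ker numeral_2_eq_2)
  also have "\<dots> = - (of_nat CARD('n) * ker 1 0 x) + of_real ((\<Sum>b\<in>Basis. (fst x \<bullet> b)\<^sup>2) / 4) * ker 2 0 x
      - \<i> * of_real (\<Sum>b\<in>Basis. symp b (fst x) * (fst x \<bullet> b)) * ker 1 1 x - of_real (\<Sum>b\<in>Basis. (symp b (fst x))\<^sup>2) * ker 0 2 x"
    unfolding sum_subtractf sum.distrib sum_distrib_left[symmetric] sum_distrib_right[symmetric] of_real_sum sum_divide_distrib
    by (simp add: sum_distrib_right sum_distrib_left)
  finally show ?thesis unfolding sum_Basis_symp by (simp add: lap_def)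
qed

subsection \<open>The heat semigroup\<close>

definition dil :: "real \<Rightarrow> 'n::finite heis \<Rightarrow> 'n heis" where
  "dil \<tau> x = ((1 / sqrt \<tau>) *\<^sub>R fst x, snd x / \<tau>)"

text \<open>The real heat kernel at time \<open>\<tau>\<close> (up to a constant factor) times the constant \<open>c\<close>; since \<open>\<bullet>\<close> on complex numbers
  is the real inner product, \<open>c = 1\<close> and \<open>c = \<i>\<close> extract real and imaginary parts.\<close>
definition heat :: "complex \<Rightarrow> real \<Rightarrow> 'n::finite heis \<Rightarrow> complex" where
  "heat c \<tau> x = ((1 / \<tau>) ^ (CARD('n) + 1) * Re (ker 0 0 (dil \<tau> x))) *\<^sub>R c"

text \<open>Decay exponent of all majorants, homogeneous under \<open>dil\<close>. It keeps half of
  the |z|^2 / 8 of \<open>ker_bound\<close>; the other half absorbs the factor |z|^2 / 4 of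
  \<open>lap_ker\<close>.\<close>

definition excess :: "'n::finite heis \<Rightarrow> real" where
  "excess x = (norm (fst x))\<^sup>2 / 16 + \<bar>snd x\<bar>"

lemma bounded_linear_dil: "bounded_linear (dil \<tau>)"
  unfolding dil_def[abs_def]
  by (intro bounded_linear_Pair bounded_linear_scaleR_right[THEN bounded_linear_compose] bounded_linear_fst
      bounded_linear_compose[OF bounded_linear_divide] bounded_linear_snd)

lemma dil_vf: "\<tau> > 0 \<Longrightarrow> dil \<tau> (vf b x) = (1 / sqrt \<tau>) *\<^sub>R vf b (dil \<tau> x)"
  by (simp add: dil_def vf_def symp_scaleR divide_inverse real_sqrt_mult_self flip: inverse_mult_distrib)

lemma excess_dil: "\<tau> > 0 \<Longrightarrow> excess (dil \<tau> x) = excess x / \<tau>"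
  by (simp add: excess_def dil_def power_mult_distrib power_divide abs_divide add_divide_distrib)

lemma excess_nonneg: "excess x \<ge> 0"
  by (simp add: excess_def)

lemma hor_linear_dil:
  assumes T: "bounded_linear T" and g: "\<And>x. g differentiable (at x)" and \<tau>: "\<tau> > 0"
  shows "hor b (\<lambda>x. T (g (dil \<tau> x))) = (\<lambda>x. T ((1 / sqrt \<tau>) *\<^sub>R hor b g (dil \<tau> x)))"
    and "(\<lambda>x. T (g (dil \<tau> x))) differentiable (at x)"
proof -
  have d: "((\<lambda>x. T (g (dil \<tau> x))) has_derivative (\<lambda>v. T (frechet_derivative g (at (dil \<tau> x)) (dil \<tau> v)))) (at x)" for x
    by (rule bounded_linear.has_derivative[OF T], rule has_derivative_compose[OF bounded_linear_imp_has_derivative[OF bounded_linear_dil]],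
        rule frechet_derivative_works[THEN iffD1, OF g])
  then show "(\<lambda>x. T (g (dil \<tau> x))) differentiable (at x)" unfolding differentiable_def by blast
  have lin: "linear (frechet_derivative g (at y))" for y
    using frechet_derivative_works[THEN iffD1, OF g] has_derivative_linear by blast
  show "hor b (\<lambda>x. T (g (dil \<tau> x))) = (\<lambda>x. T ((1 / sqrt \<tau>) *\<^sub>R hor b g (dil \<tau> x)))"
    by (rule ext) (subst hor_eqI[OF d], simp add: dil_vf[OF \<tau>] linear_scale[OF lin] hor_def)
qed

lemma continuous_on_ker: "continuous_on UNIV (ker j l)"
  by (rule continuous_on_UNIV_of_differentiable[OF ker_differentiable])

lemma hor_ker_differentiable: "hor b (ker j l) differentiable (at x)"
  using hor_ker_has_derivative differentiable_def by blast

lemma continuous_on_hor_hor_ker: "b \<in> Basis \<Longrightarrow> continuous_on UNIV (hor b (hor b (ker j l)))"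
proof -
  assume "b \<in> Basis"
  show ?thesis unfolding hor_hor_ker[OF \<open>b \<in> Basis\<close>, abs_def] by (intro continuous_intros continuous_on_ker) simp_all
qed

context
  fixes c :: complex and \<tau> :: real
  assumes \<tau>: "\<tau> > 0"
begin

text \<open>The real linear map through which \<open>heat\<close> arises from the dilated kernel.
  Derivatives pass through it, and each horizontal one contributes 1 / sqrt \<tau>.\<close>

definition heatT :: "'n::finite itself \<Rightarrow> complex \<Rightarrow> complex" where
  "heatT N \<zeta> = ((1 / \<tau>) ^ (CARD('n) + 1) * Re \<zeta>) *\<^sub>R c"

lemma bounded_linear_heatT: "bounded_linear (heatT TYPE('n::finite))"
  unfolding heatT_def[abs_def]
  by (intro bounded_linear_scaleR_left[THEN bounded_linear_compose] bounded_linear_mult_right[THEN bounded_linear_compose] bounded_linear_Re)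

lemma heat_eq: "heat c \<tau> = (\<lambda>x::'n::finite heis. heatT TYPE('n) (ker 0 0 (dil \<tau> x)))"
  by (simp add: heat_def heatT_def fun_eq_iff)

lemma hor_heat: "hor b (heat c \<tau>) = (\<lambda>x::'n::finite heis. heatT TYPE('n) ((1 / sqrt \<tau>) *\<^sub>R hor b (ker 0 0) (dil \<tau> x)))"
  unfolding heat_eq by (rule hor_linear_dil[OF bounded_linear_heatT ker_differentiable \<tau>])

lemma bounded_linear_heatT': "bounded_linear (\<lambda>\<zeta>. heatT TYPE('n::finite) ((1 / sqrt \<tau>) *\<^sub>R \<zeta>))"
  by (rule bounded_linear_compose[OF bounded_linear_heatT bounded_linear_scaleR_right])

lemma hor_hor_heat: "hor b (hor b (heat c \<tau>)) = (\<lambda>x::'n::finite heis. heatT TYPE('n) ((1 / \<tau>) *\<^sub>R hor b (hor b (ker 0 0)) (dil \<tau> x)))"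
  unfolding hor_heat hor_linear_dil(1)[OF bounded_linear_heatT' hor_ker_differentiable \<tau>]
  using \<tau> by (simp add: real_sqrt_mult_self flip: times_divide_times_eq)

lemma continuous_on_dil: "continuous_on S (dil \<tau>)"
  by (rule bounded_linear.continuous_on[OF bounded_linear_dil continuous_on_id])

lemma continuous_on_heatT_dil:
  assumes "continuous_on UNIV g" shows "continuous_on UNIV (\<lambda>x::'n::finite heis. heatT TYPE('n) (a *\<^sub>R g (dil \<tau> x)))"
  by (intro bounded_linear.continuous_on[OF bounded_linear_heatT] continuous_intros
      continuous_on_compose2[OF assms continuous_on_dil]) auto

lemma hor2_heat: "hor2 (heat c \<tau> :: 'n::finite heis \<Rightarrow> complex)"
  unfolding hor2_def
proof (intro conjI ballI allI)
  show "heat c \<tau> differentiable (at x)" for x :: "'n heis"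
    unfolding heat_eq by (rule hor_linear_dil(2)[OF bounded_linear_heatT ker_differentiable \<tau>])
  show "hor b (heat c \<tau>) differentiable (at x)" for b and x :: "'n heis"
    unfolding hor_heat by (rule hor_linear_dil(2)[OF bounded_linear_heatT' hor_ker_differentiable \<tau>])
  show "continuous_on UNIV (hor b (hor b (heat c \<tau> :: 'n heis \<Rightarrow> complex)))" if "b \<in> Basis" for b
    unfolding hor_hor_heat by (rule continuous_on_heatT_dil[OF continuous_on_hor_hor_ker[OF that]])
qed

lemma lap_heat: "lap (heat c \<tau>) (x::'n::finite heis) = heatT TYPE('n) ((1 / \<tau>) *\<^sub>R lap (ker 0 0) (dil \<tau> x))"
  unfolding lap_def hor_hor_heat
  by (simp add: linear_sum[OF bounded_linear.linear[OF bounded_linear_heatT]] linear_neg[OF bounded_linear.linear[OF bounded_linear_heatT]] scaleR_sum_right)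

lemma norm_heatT_le: "norm (heatT TYPE('n::finite) \<zeta>) \<le> (1 / \<tau>) ^ (CARD('n) + 1) * norm \<zeta> * norm c"
  unfolding heatT_def norm_scaleR abs_mult using abs_Re_le_cmod[of \<zeta>] \<tau>
  by (intro mult_right_mono mult_mono) auto

end

definition heatC :: "'n::finite itself \<Rightarrow> real" where
  "heatC N = kerC TYPE('n) 0 0 + (real CARD('n) * kerC TYPE('n) 1 0 + 4 * kerC TYPE('n) 2 0 + 4 * kerC TYPE('n) 0 2)"

lemma heatC_nonneg: "heatC TYPE('n::finite) \<ge> 0"
  by (simp add: heatC_def kerC_nonneg)

lemma norm_ker_le: "norm (ker 0 0 (x::'n::finite heis)) \<le> heatC TYPE('n) * exp (- excess x)"
proof -
  have "norm (ker 0 0 x) \<le> kerC TYPE('n) 0 0 * exp (- (norm (fst x))\<^sup>2 / 8 - \<bar>snd x\<bar>)" by (rule ker_bound)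
  also have "\<dots> \<le> heatC TYPE('n) * exp (- excess x)"
    by (intro mult_mono) (auto simp: heatC_def excess_def kerC_nonneg)
  finally show ?thesis .
qed

lemma norm_lap_ker_le: "norm (lap (ker 0 0) (x::'n::finite heis)) \<le> heatC TYPE('n) * exp (- excess x)"
proof -
  define q where "q = (norm (fst x))\<^sup>2"
  define e where "e = exp (- excess x)"
  have q: "q \<ge> 0" by (simp add: q_def)
  have kb: "norm (ker j l x) \<le> kerC TYPE('n) j l * (exp (- q / 16) * e)" for j l
    using ker_bound[of j l x] by (simp add: q_def e_def excess_def flip: exp_add)
  have e16: "exp (- q / 16) \<le> 1" using q by simp
  \<comment> \<open>This leads to (q / 4) exp(-q / 16) \<le> 4, the origin of the coefficients 4 in
    \<open>heatC\<close>.\<close>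
  have "q / 16 \<le> exp (q / 16)" using exp_ge_add_one_self[of "q / 16"] by argo
  then have "(q / 16) * exp (- q / 16) \<le> exp (q / 16) * exp (- q / 16)" by (intro mult_right_mono) auto
  then have qe: "q / 4 * exp (- q / 16) \<le> 4" by (simp flip: exp_add)
  have e: "e \<ge> 0" by (simp add: e_def)
  have kn: "kerC TYPE('n) j l \<ge> 0" for j l by (rule kerC_nonneg)
  have 1: "norm (ker j l x) \<le> kerC TYPE('n) j l * e" for j l
  proof -
    have "kerC TYPE('n) j l * (exp (- q / 16) * e) \<le> kerC TYPE('n) j l * (1 * e)"
      by (intro mult_left_mono mult_right_mono e16 e kn)
    then show ?thesis using kb[of j l] by simp
  qed
  have 2: "norm (of_real (q / 4) * ker j l x) \<le> 4 * kerC TYPE('n) j l * e" for j l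
  proof -
    have "norm (of_real (q / 4) * ker j l x) = q / 4 * norm (ker j l x)" using q by (simp add: norm_mult)
    also have "\<dots> \<le> q / 4 * (kerC TYPE('n) j l * (exp (- q / 16) * e))" using q by (intro mult_left_mono kb) auto
    also have "\<dots> = (q / 4 * exp (- q / 16)) * (kerC TYPE('n) j l * e)" by simp
    also have "\<dots> \<le> 4 * (kerC TYPE('n) j l * e)" by (intro mult_right_mono qe mult_nonneg_nonneg e kn)
    finally show ?thesis by simp
  qed
  have "norm (lap (ker 0 0) x) \<le> norm (of_nat CARD('n) * ker 1 0 x) + norm (of_real (q / 4) * ker 2 0 x) + norm (of_real (q / 4) * ker 0 2 x)"
    unfolding lap_ker q_def[symmetric]
    by (rule order_trans[OF norm_triangle_ineq add_mono[OF norm_triangle_ineq4 order_refl]])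
  also have "\<dots> \<le> real CARD('n) * (kerC TYPE('n) 1 0 * e) + 4 * kerC TYPE('n) 2 0 * e + 4 * kerC TYPE('n) 0 2 * e"
    using 1[of 1 0] by (intro add_mono 2) (simp add: norm_mult mult_left_mono)
  also have "\<dots> \<le> heatC TYPE('n) * e"
    using mult_nonneg_nonneg[OF kn e] by (simp add: heatC_def algebra_simps)
  finally show ?thesis by (simp add: e_def)
qed

lemma heat_bound:
  fixes x :: "'n::finite heis"
  assumes "\<tau> > 0"
  shows "norm (heat c \<tau> x) \<le> heatC TYPE('n) * norm c * (1 / \<tau>) ^ (CARD('n) + 1) * exp (- excess x / \<tau>)"
proof -
  have "norm (heat c \<tau> x) \<le> (1 / \<tau>) ^ (CARD('n) + 1) * norm (ker 0 0 (dil \<tau> x)) * norm c"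
    unfolding heat_eq[OF assms] by (rule norm_heatT_le[OF assms])
  also have "\<dots> \<le> (1 / \<tau>) ^ (CARD('n) + 1) * (heatC TYPE('n) * exp (- excess (dil \<tau> x))) * norm c"
    using assms by (intro mult_right_mono mult_left_mono norm_ker_le) auto
  finally show ?thesis by (simp add: excess_dil[OF assms] mult_ac)
qed

lemma lap_heat_bound:
  fixes x :: "'n::finite heis"
  assumes "\<tau> > 0"
  shows "norm (lap (heat c \<tau>) x) \<le> heatC TYPE('n) * norm c * (1 / \<tau>) ^ (CARD('n) + 2) * exp (- excess x / \<tau>)"
proof -
  have "norm (lap (heat c \<tau>) x) \<le> (1 / \<tau>) ^ (CARD('n) + 1) * norm ((1 / \<tau>) *\<^sub>R lap (ker 0 0) (dil \<tau> x)) * norm c"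
    unfolding lap_heat[OF assms] by (rule norm_heatT_le[OF assms])
  also have "\<dots> \<le> (1 / \<tau>) ^ (CARD('n) + 1) * (1 / \<tau> * (heatC TYPE('n) * exp (- excess (dil \<tau> x)))) * norm c"
    using assms unfolding norm_scaleR by (intro mult_right_mono mult_left_mono mult_mono norm_lap_ker_le) auto
  finally show ?thesis by (simp add: excess_dil[OF assms] mult_ac)
qed

text \<open>Differentiating the self-similar form in \<tau> gives n + 1 times the kernel and the
  generator of the dilations applied to it; \<open>ker_identity\<close> and \<open>lap_ker\<close>
  recognize the combination as L applied to the kernel.\<close>

lemma heat_time_derivative:
  fixes x :: "'n::finite heis"
  assumes \<tau>: "\<tau> > 0"
  shows "((\<lambda>\<tau>. heat c \<tau> x) has_vector_derivative - lap (heat c \<tau>) x) (at \<tau>)"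
proof -
  define n where "n = CARD('n)"
  define y where "y = dil \<tau> x"
  define z where "z = fst x"
  define t where "t = snd x"
  have s: "sqrt \<tau> > 0" "sqrt \<tau> * sqrt \<tau> = \<tau>" using \<tau> by auto
  have d1: "((\<lambda>\<tau>. (1 / sqrt \<tau>) *\<^sub>R z) has_vector_derivative (- 1 / (2 * \<tau> * sqrt \<tau>)) *\<^sub>R z) (at \<tau>)"
  proof -
    have "((\<lambda>\<tau>. 1 / sqrt \<tau>) has_real_derivative - 1 / (2 * \<tau> * sqrt \<tau>)) (at \<tau>)"
      using \<tau> s by (auto intro!: derivative_eq_intros simp: field_simps)
    from has_vector_derivative_scaleR[OF this has_vector_derivative_const[of z]] show ?thesis by simp
  qed
  have d2: "((\<lambda>\<tau>. t / \<tau>) has_vector_derivative - t / (\<tau> * \<tau>)) (at \<tau>)"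
    using \<tau> by (auto intro!: derivative_eq_intros simp flip: has_real_derivative_iff_has_vector_derivative)
  have "((\<lambda>\<tau>. dil \<tau> x) has_vector_derivative ((- 1 / (2 * \<tau> * sqrt \<tau>)) *\<^sub>R z, - t / (\<tau> * \<tau>))) (at \<tau>)"
    unfolding dil_def z_def[symmetric] t_def[symmetric] using has_derivative_Pair[OF d1[unfolded has_vector_derivative_def] d2[unfolded has_vector_derivative_def]]
    by (simp add: has_vector_derivative_def)
  then have "((\<lambda>\<tau>. dil \<tau> x) has_derivative (\<lambda>h. h *\<^sub>R ((- 1 / (2 * \<tau> * sqrt \<tau>)) *\<^sub>R z, - t / (\<tau> * \<tau>)))) (at \<tau>)"
    by (simp add: has_vector_derivative_def)
  from has_derivative_compose[OF this ker_has_derivative, of 0 0]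
  have "((\<lambda>\<tau>. ker 0 0 (dil \<tau> x)) has_derivative (\<lambda>h. - of_real ((fst y \<bullet> (h * (- 1 / (2 * \<tau> * sqrt \<tau>))) *\<^sub>R z) / 2) * ker 1 0 y +
      \<i> * of_real (h * (- t / (\<tau> * \<tau>))) * ker 0 1 y)) (at \<tau>)"
    by (simp add: y_def)
  moreover have "- of_real ((fst y \<bullet> (h * (- 1 / (2 * \<tau> * sqrt \<tau>))) *\<^sub>R z) / 2) * ker 1 0 y + \<i> * of_real (h * (- t / (\<tau> * \<tau>))) * ker 0 1 y
      = of_real (h / \<tau>) * (of_real ((norm (fst y))\<^sup>2 / 4) * ker 1 0 y - \<i> * of_real (snd y) * ker 0 1 y)" for h
  proof -
    have "(fst y \<bullet> (h * (- 1 / (2 * \<tau> * sqrt \<tau>))) *\<^sub>R z) / 2 = - (h / \<tau>) * ((norm z)\<^sup>2 / (4 * (sqrt \<tau> * sqrt \<tau>)))"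
      by (simp add: y_def dil_def z_def power2_norm_eq_inner field_simps)
    also have "(norm z)\<^sup>2 / (4 * (sqrt \<tau> * sqrt \<tau>)) = (norm (fst y))\<^sup>2 / 4"
      using \<tau> by (simp add: y_def dil_def z_def power_divide)
    finally have 1: "(fst y \<bullet> (h * (- 1 / (2 * \<tau> * sqrt \<tau>))) *\<^sub>R z) / 2 = - (h / \<tau>) * ((norm (fst y))\<^sup>2 / 4)" .
    have 2: "h * (- t / (\<tau> * \<tau>)) = - ((h / \<tau>) * snd y)" by (simp add: y_def dil_def t_def)
    show ?thesis unfolding 1 2 by (simp add: algebra_simps)
  qed
  ultimately have "((\<lambda>\<tau>. ker 0 0 (dil \<tau> x)) has_derivative
     (\<lambda>h. of_real (h / \<tau>) * (of_real ((norm (fst y))\<^sup>2 / 4) * ker 1 0 y - \<i> * of_real (snd y) * ker 0 1 y))) (at \<tau>)"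
    by simp
  moreover define W where "W = of_real ((norm (fst y))\<^sup>2 / 4) * ker 1 0 y - \<i> * of_real (snd y) * ker 0 1 y"
  ultimately have dk: "((\<lambda>\<tau>. ker 0 0 (dil \<tau> x)) has_derivative (\<lambda>h. of_real (h / \<tau>) * W)) (at \<tau>)" by simp
  have dr: "((\<lambda>\<tau>. Re (ker 0 0 (dil \<tau> x))) has_real_derivative Re W / \<tau>) (at \<tau>)"
    using bounded_linear.has_derivative[OF bounded_linear_Re dk]
    unfolding has_field_derivative_def by (rule has_derivative_eq_rhs) (simp add: fun_eq_iff)
  have "((\<lambda>\<tau>. 1 / \<tau>) has_real_derivative - 1 / (\<tau> * \<tau>)) (at \<tau>)"
    using \<tau> by (auto intro!: derivative_eq_intros)
  then have dp: "((\<lambda>\<tau>. (1 / \<tau>) ^ (n + 1)) has_real_derivative - (real n + 1) / \<tau> * (1 / \<tau>) ^ (n + 1)) (at \<tau>)"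
    by (rule DERIV_cong[OF DERIV_power]) (use \<tau> in \<open>simp add: field_simps\<close>)
  from DERIV_mult[OF dp dr]
  have "((\<lambda>\<tau>. (1 / \<tau>) ^ (n + 1) * Re (ker 0 0 (dil \<tau> x))) has_real_derivative
      - (real n + 1) / \<tau> * (1 / \<tau>) ^ (n + 1) * Re (ker 0 0 y) + Re W / \<tau> * (1 / \<tau>) ^ (n + 1)) (at \<tau>)"
    by (simp add: y_def)
  moreover have "- (real n + 1) / \<tau> * (1 / \<tau>) ^ (n + 1) * Re (ker 0 0 y) + Re W / \<tau> * (1 / \<tau>) ^ (n + 1) =
      - ((1 / \<tau>) ^ (n + 1) * (1 / \<tau> * Re (lap (ker 0 0) y)))"
  proof -
    have "lap (ker 0 0) y = (of_nat n + 1) * ker 0 0 y - W"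
      unfolding lap_ker W_def n_def by (subst ker_identity) simp
    then have R: "Re (lap (ker 0 0) y) = (real n + 1) * Re (ker 0 0 y) - Re W"
      by (simp flip: of_nat_Suc)
    have "- N / \<tau> * P * K + w / \<tau> * P = - (P * (1 / \<tau> * (N * K - w)))" for N P K w
      using \<tau> by (simp add: field_simps)
    then show ?thesis unfolding R .
  qed
  ultimately have "((\<lambda>\<tau>. (1 / \<tau>) ^ (n + 1) * Re (ker 0 0 (dil \<tau> x))) has_real_derivative
      - ((1 / \<tau>) ^ (n + 1) * (1 / \<tau> * Re (lap (ker 0 0) y)))) (at \<tau>)" by simp
  then have "((\<lambda>\<tau>. ((1 / \<tau>) ^ (n + 1) * Re (ker 0 0 (dil \<tau> x))) *\<^sub>R c) has_vector_derivative
      (- ((1 / \<tau>) ^ (n + 1) * (1 / \<tau> * Re (lap (ker 0 0) y)))) *\<^sub>R c) (at \<tau>)"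
    by (rule has_vector_derivative_eq_rhs[OF has_vector_derivative_scaleR[OF _ has_vector_derivative_const]]) simp
  then show ?thesis unfolding lap_heat[OF \<tau>] heatT_def[OF \<tau>]
    by (simp add: heat_def[abs_def] n_def y_def)
qed

section \<open>Integrals of the majorants and their behaviour under dilations\<close>

lemma nn_integral_scale:
  fixes f :: "'a::euclidean_space \<Rightarrow> ennreal"
  assumes [measurable]: "f \<in> borel_measurable borel" and c: "c > 0"
  shows "(\<integral>\<^sup>+x. f (c *\<^sub>R x) \<partial>lborel) = ennreal (1 / c ^ DIM('a)) * (\<integral>\<^sup>+x. f x \<partial>lborel)"
proof -
  have "(\<integral>\<^sup>+x. f x \<partial>lborel) = (\<integral>\<^sup>+x. f x \<partial>density (distr lborel borel (\<lambda>x. 0 + c *\<^sub>R x)) (\<lambda>_. ennreal (\<bar>c\<bar> ^ DIM('a))))"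
    by (rule arg_cong[OF lborel_affine]) (use c in simp)
  also have "\<dots> = (\<integral>\<^sup>+x. ennreal (\<bar>c\<bar> ^ DIM('a)) * f (c *\<^sub>R x) \<partial>lborel)"
    by (simp add: nn_integral_density nn_integral_distr)
  also have "\<dots> = ennreal (c ^ DIM('a)) * (\<integral>\<^sup>+x. f (c *\<^sub>R x) \<partial>lborel)"
    using c by (simp add: nn_integral_cmult)
  finally have "ennreal (1 / c ^ DIM('a)) * (\<integral>\<^sup>+x. f x \<partial>lborel) = (ennreal (1 / c ^ DIM('a)) * ennreal (c ^ DIM('a))) * (\<integral>\<^sup>+x. f (c *\<^sub>R x) \<partial>lborel)"
    by (simp only: mult.assoc)
  also have "ennreal (1 / c ^ DIM('a)) * ennreal (c ^ DIM('a)) = 1"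
  proof -
    have "ennreal (1 / c ^ DIM('a)) * ennreal (c ^ DIM('a)) = ennreal (1 / c ^ DIM('a) * c ^ DIM('a))"
      using c by (intro ennreal_mult[symmetric]) auto
    also have "\<dots> = 1" using c by simp
    finally show ?thesis .
  qed
  finally show ?thesis by simp
qed

lemma measurable_heis_slice [measurable]:
  fixes f :: "'n::finite heis \<Rightarrow> ennreal"
  assumes f: "f \<in> borel_measurable borel"
  shows "(\<lambda>t. f (z, t)) \<in> borel_measurable borel" "(\<lambda>z. \<integral>\<^sup>+t. f (z, t) \<partial>lborel) \<in> borel_measurable borel"
proof -
  show "(\<lambda>t. f (z, t)) \<in> borel_measurable borel"
    by (rule measurable_compose[OF _ f]) (auto intro!: borel_measurable_continuous_onI continuous_intros)
  have "f \<in> borel_measurable (lborel \<Otimes>\<^sub>M lborel)" using f by (simp add: lborel_prod)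
  then have "(\<lambda>z. \<integral>\<^sup>+t. f (z, t) \<partial>lborel) \<in> borel_measurable lborel" by measurable
  then show "(\<lambda>z. \<integral>\<^sup>+t. f (z, t) \<partial>lborel) \<in> borel_measurable borel" by simp
qed

text \<open>The 2n real coordinates of z scale by sqrt \<tau> and t by \<tau>: the homogeneous
  dimension 2n + 2.\<close>

lemma nn_integral_dil:
  fixes f :: "'n::finite heis \<Rightarrow> ennreal"
  assumes f[measurable]: "f \<in> borel_measurable borel" and \<tau>: "\<tau> > 0"
  shows "(\<integral>\<^sup>+x. f (dil \<tau> x) \<partial>lborel) = ennreal (\<tau> ^ (CARD('n) + 1)) * (\<integral>\<^sup>+x. f x \<partial>lborel)"
proof -
  have m: "(\<lambda>x. f (dil \<tau> x)) \<in> borel_measurable borel"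
    by (rule measurable_compose[OF _ f], rule borel_measurable_continuous_onI[OF continuous_on_dil[OF \<tau>]])
  have "(\<integral>\<^sup>+x. f (dil \<tau> x) \<partial>lborel) = (\<integral>\<^sup>+z. \<integral>\<^sup>+t. f ((1 / sqrt \<tau>) *\<^sub>R z, (1 / \<tau>) *\<^sub>R t) \<partial>lborel \<partial>lborel)"
    using nn_integral_heis[OF m] by (simp add: dil_def)
  also have "\<dots> = (\<integral>\<^sup>+z. ennreal \<tau> * (\<integral>\<^sup>+t. f ((1 / sqrt \<tau>) *\<^sub>R z, t) \<partial>lborel) \<partial>lborel)"
  proof (rule nn_integral_cong)
    fix z :: "complex ^ 'n"
    have "(\<lambda>t. f ((1 / sqrt \<tau>) *\<^sub>R z, t)) \<in> borel_measurable borel" by measurable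
    from nn_integral_scale[OF this, of "1 / \<tau>"]
    show "(\<integral>\<^sup>+t. f ((1 / sqrt \<tau>) *\<^sub>R z, (1 / \<tau>) *\<^sub>R t) \<partial>lborel) = ennreal \<tau> * (\<integral>\<^sup>+t. f ((1 / sqrt \<tau>) *\<^sub>R z, t) \<partial>lborel)"
      using \<tau> by simp
  qed
  also have "\<dots> = ennreal \<tau> * (\<integral>\<^sup>+z. (\<integral>\<^sup>+t. f ((1 / sqrt \<tau>) *\<^sub>R z, t) \<partial>lborel) \<partial>lborel)"
    by (rule nn_integral_cmult) (rule measurable_compose[OF _ measurable_heis_slice(2)[OF f], of "\<lambda>z. (1 / sqrt \<tau>) *\<^sub>R z"], simp)
  also have "(\<integral>\<^sup>+z. (\<integral>\<^sup>+t. f ((1 / sqrt \<tau>) *\<^sub>R z, t) \<partial>lborel) \<partial>lborel) =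
      ennreal (1 / (1 / sqrt \<tau>) ^ DIM(complex ^ 'n)) * (\<integral>\<^sup>+z. (\<integral>\<^sup>+t. f (z, t) \<partial>lborel) \<partial>lborel)"
    by (rule nn_integral_scale[OF measurable_heis_slice(2)[OF f]]) (use \<tau> in simp)
  also have "1 / (1 / sqrt \<tau>) ^ DIM(complex ^ 'n) = \<tau> ^ CARD('n)"
  proof -
    have "1 / (1 / sqrt \<tau>) ^ DIM(complex ^ 'n) = ((sqrt \<tau>)\<^sup>2) ^ CARD('n)"
      by (simp add: power_one_over mult.commute flip: power_mult)
    then show ?thesis using \<tau> by simp
  qed
  finally show ?thesis
    using \<tau> by (simp add: nn_integral_heis[OF f] ennreal_mult mult_ac)
qed

lemma integrable_one_over_one_plus_sq: "integrable lborel (\<lambda>x::real. 1 / (1 + x\<^sup>2))"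
  using integrable_inverse_1_plus_square by (simp add: set_integrable_def inverse_eq_divide einterval_eq)

text \<open>A product majorant reduces integrability of rapidly decaying functions on a Euclidean
  space to dimension one.\<close>

lemma nn_integral_inverse_square_prod:
  "(\<integral>\<^sup>+z. ennreal (\<Prod>b\<in>Basis. 1 / (1 + (z \<bullet> b)\<^sup>2)) \<partial>(lborel :: 'a::euclidean_space measure)) < \<infinity>"
proof -
  have "(\<integral>\<^sup>+z. ennreal (\<Prod>b\<in>Basis. 1 / (1 + (z \<bullet> b)\<^sup>2)) \<partial>(lborel :: 'a measure)) =
      (\<integral>\<^sup>+z. (\<Prod>b\<in>Basis. ennreal (1 / (1 + (z \<bullet> b)\<^sup>2))) \<partial>(lborel :: 'a measure))"
    by (intro nn_integral_cong prod_ennreal[symmetric]) (simp add: add_nonneg_nonneg)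
  also have "\<dots> = (\<Prod>b\<in>(Basis::'a set). (\<integral>\<^sup>+x. ennreal (1 / (1 + x\<^sup>2)) \<partial>lborel))"
    by (rule nn_integral_lborel_prod) auto
  also have "(\<integral>\<^sup>+x. ennreal (1 / (1 + x\<^sup>2)) \<partial>lborel) = ennreal (\<integral>x. 1 / (1 + x\<^sup>2) \<partial>lborel)"
    by (rule nn_integral_eq_integral[OF integrable_one_over_one_plus_sq]) (simp add: add_nonneg_nonneg)
  also have "(\<Prod>b\<in>(Basis::'a set). ennreal (\<integral>x. 1 / (1 + x\<^sup>2) \<partial>lborel)) < \<infinity>"
    using power_less_top_ennreal[of "ennreal (\<integral>x. 1 / (1 + x\<^sup>2) \<partial>lborel)" "DIM('a)"] by simp
  finally show ?thesis .
qed

lemma power_le_exp: "0 \<le> x \<Longrightarrow> x ^ m \<le> (fact m) * exp (x::real)"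
proof -
  assume x: "0 \<le> x"
  have "x ^ m / fact m \<le> (\<Sum>i<Suc m. x ^ i / fact i)"
    by (rule member_le_sum) (use x in auto)
  also have "\<dots> \<le> exp x"
  proof -
    have "(\<Sum>i<Suc m. x ^ i / fact i) \<le> (\<Sum>i. x ^ i / fact i)"
      using summable_exp[of x] x by (intro sum_le_suminf) (auto simp: divide_inverse mult.commute)
    then show ?thesis by (simp add: exp_def divide_inverse mult.commute)
  qed
  finally show ?thesis by (simp add: field_simps)
qed

lemma continuous_on_excess: "continuous_on S excess"
  unfolding excess_def[abs_def] by (intro continuous_intros) auto

lemma nn_integral_excess_finite:
  "(\<integral>\<^sup>+x. ennreal (exp (- excess (x::'n::finite heis))) \<partial>lborel) < \<infinity>"
proof -
  define m where "m = DIM(complex ^ 'n)"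
  \<comment> \<open>From (1 + q)^m = 16^m ((1 + q) / 16)^m and \<open>power_le_exp\<close>.\<close>
  define K where "K = 16 ^ m * fact m * exp (1 / 16 :: real)"
  have ez: "exp (- (norm z)\<^sup>2 / 16) \<le> K * (\<Prod>b\<in>Basis. 1 / (1 + (z \<bullet> b)\<^sup>2))" for z :: "complex ^ 'n"
  proof -
    define q where "q = (norm z)\<^sup>2"
    have q: "q \<ge> 0" by (simp add: q_def)
    have "(\<Prod>b\<in>Basis. 1 + (z \<bullet> b)\<^sup>2) \<le> (\<Prod>b\<in>(Basis :: (complex ^ 'n) set). 1 + q)"
    proof (rule prod_mono)
      fix b :: "complex ^ 'n" assume b: "b \<in> Basis"
      have "\<bar>z \<bullet> b\<bar>\<^sup>2 \<le> (norm z)\<^sup>2" by (intro power_mono Basis_le_norm b) auto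
      then show "0 \<le> 1 + (z \<bullet> b)\<^sup>2 \<and> 1 + (z \<bullet> b)\<^sup>2 \<le> 1 + q" by (simp add: q_def add_nonneg_nonneg)
    qed
    also have "\<dots> = (1 + q) ^ m" by (simp add: m_def)
    also have "\<dots> = 16 ^ m * ((1 + q) / 16) ^ m" by (simp add: power_divide)
    also have "\<dots> \<le> 16 ^ m * (fact m * exp ((1 + q) / 16))"
      using q by (intro mult_left_mono power_le_exp) auto
    also have "\<dots> = K * exp (q / 16)" by (simp add: K_def add_divide_distrib exp_add)
    finally have le: "(\<Prod>b\<in>Basis. 1 + (z \<bullet> b)\<^sup>2) \<le> K * exp (q / 16)" .
    have pos: "(\<Prod>b\<in>(Basis :: (complex ^ 'n) set). 1 + (z \<bullet> b)\<^sup>2) > 0"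
      by (intro prod_pos) (simp add: add_pos_nonneg)
    have "exp (- q / 16) * (\<Prod>b\<in>Basis. 1 + (z \<bullet> b)\<^sup>2) \<le> exp (- q / 16) * (K * exp (q / 16))"
      using le by (intro mult_left_mono) auto
    also have "\<dots> = K" by (simp add: mult.left_commute flip: exp_add)
    finally show ?thesis using pos by (simp add: q_def prod_dividef field_simps)
  qed
  have K: "K \<ge> 0" by (simp add: K_def)
  have "(\<lambda>x::'n heis. ennreal (exp (- excess x))) \<in> borel_measurable borel"
    by (intro measurable_compose[OF _ measurable_ennreal] borel_measurable_continuous_onI continuous_intros continuous_on_excess)
  note heis = nn_integral_heis[OF this]
  have "(\<integral>\<^sup>+x. ennreal (exp (- excess (x::'n heis))) \<partial>lborel) =
      (\<integral>\<^sup>+z. \<integral>\<^sup>+t. ennreal (exp (- (norm (z :: complex ^ 'n))\<^sup>2 / 16)) * ennreal (exp (- \<bar>t\<bar> / 1)) \<partial>lborel \<partial>lborel)"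
  proof -
    have "ennreal (exp (- excess (z, t))) = ennreal (exp (- (norm z)\<^sup>2 / 16)) * ennreal (exp (- \<bar>t\<bar> / 1))" for z :: "complex ^ 'n" and t
    proof -
      have "exp (- excess (z, t)) = exp (- (norm z)\<^sup>2 / 16) * exp (- \<bar>t\<bar> / 1)"
        by (simp add: excess_def flip: exp_add)
      then show ?thesis by (simp only: ennreal_mult exp_ge_zero)
    qed
    then show ?thesis unfolding heis by simp
  qed
  also have "\<dots> = (\<integral>\<^sup>+z. ennreal (exp (- (norm (z :: complex ^ 'n))\<^sup>2 / 16)) * ennreal (\<integral>t. exp (- \<bar>t\<bar> / 1) \<partial>lborel) \<partial>lborel)"
  proof (rule nn_integral_cong)
    fix z :: "complex ^ 'n"
    have "(\<integral>\<^sup>+t. ennreal (exp (- (norm z)\<^sup>2 / 16)) * ennreal (exp (- \<bar>t\<bar> / 1)) \<partial>lborel) =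
       ennreal (exp (- (norm z)\<^sup>2 / 16)) * (\<integral>\<^sup>+t. ennreal (exp (- \<bar>t\<bar> / 1)) \<partial>lborel)"
      by (rule nn_integral_cmult) simp
    also have "(\<integral>\<^sup>+t. ennreal (exp (- \<bar>t\<bar> / 1)) \<partial>lborel) = ennreal (\<integral>t. exp (- \<bar>t\<bar> / 1) \<partial>lborel)"
      by (rule nn_integral_eq_integral[OF integrable_exp_abs]) auto
    finally show "(\<integral>\<^sup>+t. ennreal (exp (- (norm z)\<^sup>2 / 16)) * ennreal (exp (- \<bar>t\<bar> / 1)) \<partial>lborel) =
      ennreal (exp (- (norm z)\<^sup>2 / 16)) * ennreal (\<integral>t. exp (- \<bar>t\<bar> / 1) \<partial>lborel)" .
  qed
  also have "\<dots> \<le> (\<integral>\<^sup>+z. ennreal (\<Prod>b\<in>Basis. 1 / (1 + ((z :: complex ^ 'n) \<bullet> b)\<^sup>2)) * ennreal (K * (\<integral>t. exp (- \<bar>t\<bar> / 1) \<partial>lborel)) \<partial>lborel)"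
  proof (rule nn_integral_mono)
    fix z :: "complex ^ 'n"
    have P: "(\<Prod>b\<in>Basis. 1 / (1 + (z \<bullet> b)\<^sup>2)) \<ge> 0" by (intro prod_nonneg) (simp add: add_nonneg_nonneg)
    have I: "(\<integral>t. exp (- \<bar>t\<bar> / 1) \<partial>lborel) \<ge> (0::real)" by (rule Bochner_Integration.integral_nonneg) auto
    have "exp (- (norm z)\<^sup>2 / 16) * (\<integral>t. exp (- \<bar>t\<bar> / 1) \<partial>lborel) \<le> (K * (\<Prod>b\<in>Basis. 1 / (1 + (z \<bullet> b)\<^sup>2))) * (\<integral>t. exp (- \<bar>t\<bar> / 1) \<partial>lborel)"
      by (rule mult_right_mono[OF ez I])
    then show "ennreal (exp (- (norm z)\<^sup>2 / 16)) * ennreal (\<integral>t. exp (- \<bar>t\<bar> / 1) \<partial>lborel) \<le>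
      ennreal (\<Prod>b\<in>Basis. 1 / (1 + (z \<bullet> b)\<^sup>2)) * ennreal (K * (\<integral>t. exp (- \<bar>t\<bar> / 1) \<partial>lborel))"
    proof -
      have KI: "K * (\<integral>t. exp (- \<bar>t\<bar> / 1) \<partial>lborel) \<ge> 0" using K I by (rule mult_nonneg_nonneg)
      show ?thesis unfolding ennreal_mult[OF exp_ge_zero I, symmetric] ennreal_mult[OF P KI, symmetric]
        using \<open>_ \<le> (K * _) * _\<close> by (intro ennreal_leI) (simp only: mult_ac)
    qed
  qed
  also have "\<dots> = (\<integral>\<^sup>+z. ennreal (\<Prod>b\<in>Basis. 1 / (1 + ((z :: complex ^ 'n) \<bullet> b)\<^sup>2)) \<partial>lborel) * ennreal (K * (\<integral>t. exp (- \<bar>t\<bar> / 1) \<partial>lborel))"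
    by (rule nn_integral_multc) measurable
  also have "\<dots> < \<infinity>"
    using nn_integral_inverse_square_prod[where 'a = "complex ^ 'n"] by (simp add: ennreal_mult_less_top)
  finally show ?thesis .
qed

definition excessM :: "'n::finite itself \<Rightarrow> real" where
  "excessM N = (\<integral>x. exp (- excess (x::'n heis)) \<partial>lborel)"

lemma excess_measurable [measurable]: "excess \<in> borel_measurable borel"
  by (rule borel_measurable_continuous_onI[OF continuous_on_excess])

lemma excess_integral:
  assumes a: "a > 0"
  shows "integrable lborel (\<lambda>x::'n::finite heis. exp (- excess x / a))"
    "(\<integral>x. exp (- excess (x::'n heis) / a) \<partial>lborel) = a ^ (CARD('n) + 1) * excessM TYPE('n)"
proof -
  have e: "(\<integral>\<^sup>+x. ennreal (exp (- excess (x::'n heis) / a)) \<partial>lborel) = ennreal (a ^ (CARD('n) + 1)) * (\<integral>\<^sup>+x. ennreal (exp (- excess (x::'n heis))) \<partial>lborel)"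
    using nn_integral_dil[of "\<lambda>x::'n heis. ennreal (exp (- excess x))" a] a by (simp add: excess_dil)
  have i1: "integrable lborel (\<lambda>x::'n heis. exp (- excess x))"
    using nn_integral_excess_finite[where 'n='n] by (intro integrableI_bounded) auto
  have n1: "(\<integral>\<^sup>+x. ennreal (exp (- excess (x::'n heis))) \<partial>lborel) = ennreal (excessM TYPE('n))"
    unfolding excessM_def by (rule nn_integral_eq_integral[OF i1]) simp
  show i: "integrable lborel (\<lambda>x::'n heis. exp (- excess x / a))"
    using e n1 by (intro integrableI_bounded) (auto simp: ennreal_mult_less_top)
  have M: "excessM TYPE('n) \<ge> 0" unfolding excessM_def by (rule Bochner_Integration.integral_nonneg) auto
  have "ennreal (\<integral>x. exp (- excess (x::'n heis) / a) \<partial>lborel) = (\<integral>\<^sup>+x. ennreal (exp (- excess (x::'n heis) / a)) \<partial>lborel)"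
    by (rule nn_integral_eq_integral[OF i, symmetric]) simp
  also have "\<dots> = ennreal (a ^ (CARD('n) + 1) * excessM TYPE('n))"
    unfolding e n1 using a M by (simp add: ennreal_mult)
  finally show "(\<integral>x. exp (- excess (x::'n heis) / a) \<partial>lborel) = a ^ (CARD('n) + 1) * excessM TYPE('n)"
    using a M by (subst (asm) ennreal_inj) (auto intro: Bochner_Integration.integral_nonneg)
qed

lemma excessM_nonneg: "excessM TYPE('n::finite) \<ge> 0"
  unfolding excessM_def by (rule Bochner_Integration.integral_nonneg) auto

lemma cauchy_schwarz_L2:
  assumes "in_L2 g" "in_L2 h"
  shows "(\<integral>x. norm (g x) * norm (h x) \<partial>lborel) \<le> L2_norm g * L2_norm h"
proof -
  have i: "integrable lborel (\<lambda>x. (norm (g x))\<^sup>2)" "integrable lborel (\<lambda>x. (norm (h x))\<^sup>2)"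
    "integrable lborel (\<lambda>x. norm (g x) * norm (h x))"
    using assms in_L2_integrable_inner[OF assms] by (auto simp: in_L2_def)
  let ?B = "\<integral>x. norm (g x) * norm (h x) \<partial>lborel"
  have "?B\<^sup>2 \<le> (\<integral>x. (norm (g x))\<^sup>2 \<partial>lborel) * (\<integral>x. (norm (h x))\<^sup>2 \<partial>lborel)"
  proof (rule discriminant_nonneg)
    fix t :: real
    have "0 \<le> (\<integral>x. (norm (g x) + t * norm (h x))\<^sup>2 \<partial>lborel)" by (rule Bochner_Integration.integral_nonneg) auto
    also have "(\<lambda>x. (norm (g x) + t * norm (h x))\<^sup>2) = (\<lambda>x. (norm (g x))\<^sup>2 + 2 * t * (norm (g x) * norm (h x)) + t\<^sup>2 * (norm (h x))\<^sup>2)"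
      by (auto simp: power2_eq_square algebra_simps)
    finally show "0 \<le> (\<integral>x. (norm (g x))\<^sup>2 \<partial>lborel) + 2 * t * ?B + t\<^sup>2 * (\<integral>x. (norm (h x))\<^sup>2 \<partial>lborel)"
      using i by simp
  qed (auto intro: Bochner_Integration.integral_nonneg)
  then have "sqrt (?B\<^sup>2) \<le> sqrt ((\<integral>x. (norm (g x))\<^sup>2 \<partial>lborel) * (\<integral>x. (norm (h x))\<^sup>2 \<partial>lborel))"
    by (rule real_sqrt_le_mono)
  moreover have "?B \<ge> 0" by (rule Bochner_Integration.integral_nonneg) auto
  ultimately show ?thesis by (simp add: L2_norm_def real_sqrt_mult)
qed

lemma L2_norm_sq: "(L2_norm g)\<^sup>2 = (\<integral>x. (norm (g x))\<^sup>2 \<partial>lborel)"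
  by (simp add: L2_norm_def Bochner_Integration.integral_nonneg)

lemma L2_norm_nonneg: "L2_norm g \<ge> 0"
  by (simp add: L2_norm_def Bochner_Integration.integral_nonneg)

lemma exp_excess_square: "(exp (- excess x / a))\<^sup>2 = exp (- excess x / (a / 2))"
  by (simp add: power2_eq_square flip: exp_add)

lemma exp_excess_in_L2:
  assumes "a > 0"
  shows "in_L2 (\<lambda>x::'n::finite heis. complex_of_real (exp (- excess x / a)))"
    "L2_norm (\<lambda>x::'n heis. complex_of_real (exp (- excess x / a))) \<le> sqrt (a ^ (CARD('n) + 1)) * sqrt (excessM TYPE('n))"
proof -
  note I = excess_integral[of "a / 2", where 'n='n]
  show "in_L2 (\<lambda>x::'n heis. complex_of_real (exp (- excess x / a)))"
    unfolding in_L2_def norm_of_real abs_exp_cancel exp_excess_square using I(1) assms by simp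
  have "(\<integral>x. (norm (complex_of_real (exp (- excess (x::'n heis) / a))))\<^sup>2 \<partial>lborel) = (a / 2) ^ (CARD('n) + 1) * excessM TYPE('n)"
    unfolding norm_of_real abs_exp_cancel exp_excess_square using I(2) assms by simp
  also have "\<dots> \<le> a ^ (CARD('n) + 1) * excessM TYPE('n)"
    using assms by (intro mult_right_mono power_mono excessM_nonneg) auto
  finally show "L2_norm (\<lambda>x::'n heis. complex_of_real (exp (- excess x / a))) \<le> sqrt (a ^ (CARD('n) + 1)) * sqrt (excessM TYPE('n))"
    unfolding L2_norm_def by (simp flip: real_sqrt_mult)
qed

lemma in_L2_dominated:
  assumes "continuous_on UNIV g" "\<And>x. norm (g x) \<le> C * norm (h x)" "in_L2 h"
  shows "in_L2 g"
proof (rule in_L2_I[OF assms(1)])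
  have "integrable lborel (\<lambda>x. C\<^sup>2 * (norm (h x))\<^sup>2)" using assms(3) by (simp add: in_L2_def)
  then show "integrable lborel (\<lambda>x. (norm (g x))\<^sup>2)"
  proof (rule Bochner_Integration.integrable_bound)
    show "(\<lambda>x. (norm (g x))\<^sup>2) \<in> borel_measurable lborel"
      using borel_measurable_continuous_onI[OF assms(1)] by simp
    show "AE x in lborel. norm ((norm (g x))\<^sup>2) \<le> norm (C\<^sup>2 * (norm (h x))\<^sup>2)"
      using power_mono[OF assms(2) norm_ge_zero, of _ 2] by (auto simp: power_mult_distrib)
  qed
qed

lemma heat_in_L2:
  assumes "\<tau> > 0"
  shows "in_L2 (heat c \<tau> :: 'n::finite heis \<Rightarrow> complex)" "in_L2 (lap (heat c \<tau>) :: 'n::finite heis \<Rightarrow> complex)"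
proof -
  show "in_L2 (heat c \<tau> :: 'n::finite heis \<Rightarrow> complex)"
    by (rule in_L2_dominated[OF hor2_continuous(1)[OF hor2_heat[OF assms]] _ exp_excess_in_L2(1)[OF assms]])
       (unfold norm_of_real abs_exp_cancel, rule heat_bound[OF assms])
  show "in_L2 (lap (heat c \<tau>) :: 'n::finite heis \<Rightarrow> complex)"
    by (rule in_L2_dominated[OF hor2_continuous_lap[OF hor2_heat[OF assms]] _ exp_excess_in_L2(1)[OF assms]])
       (unfold norm_of_real abs_exp_cancel, rule lap_heat_bound[OF assms])
qed

section \<open>Pairing of L2 functions with the heat kernel\<close>

definition hpair :: "complex \<Rightarrow> ('n::finite heis \<Rightarrow> complex) \<Rightarrow> real \<Rightarrow> real" where
  "hpair c w \<tau> = (\<integral>x. w x \<bullet> heat c \<tau> x \<partial>lborel)"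

lemma hpair_integrable: "in_L2 w \<Longrightarrow> \<tau> > 0 \<Longrightarrow> integrable lborel (\<lambda>x. w x \<bullet> heat c \<tau> x)"
  by (rule in_L2_integrable_inner(2)[OF _ heat_in_L2(1)])

text \<open>Cauchy-Schwarz with the majorant: the prefactor \<tau>^(-(n+1)) meets an L2 norm of
  order \<tau>^((n+1)/2). The resulting rate \<tau>^(-(n+1)/2) at short times is what the weight in
  \<open>\<Psi>\<close> has to compensate.\<close>

lemma hpair_bound:
  fixes w :: "'n::finite heis \<Rightarrow> complex"
  assumes w: "in_L2 w" and \<tau>: "\<tau> > 0"
  shows "\<bar>hpair c w \<tau>\<bar> \<le> heatC TYPE('n) * norm c * sqrt (excessM TYPE('n)) * sqrt ((1 / \<tau>) ^ (CARD('n) + 1)) * L2_norm w"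
proof -
  let ?e = "\<lambda>x::'n heis. complex_of_real (exp (- excess x / \<tau>))"
  let ?C = "heatC TYPE('n) * norm c * (1 / \<tau>) ^ (CARD('n) + 1)"
  have C: "?C \<ge> 0" using \<tau> heatC_nonneg[where 'n='n] by simp
  have "\<bar>hpair c w \<tau>\<bar> \<le> (\<integral>x. \<bar>w x \<bullet> heat c \<tau> x\<bar> \<partial>lborel)" unfolding hpair_def by (rule integral_abs_bound)
  also have "\<dots> \<le> (\<integral>x. ?C * (norm (w x) * norm (?e x)) \<partial>lborel)"
  proof (rule integral_mono)
    show "integrable lborel (\<lambda>x. \<bar>w x \<bullet> heat c \<tau> x\<bar>)" using hpair_integrable[OF w \<tau>] by simp
    show "integrable lborel (\<lambda>x. ?C * (norm (w x) * norm (?e x)))"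
      by (intro integrable_mult_right in_L2_integrable_inner w exp_excess_in_L2 \<tau>)
    fix x
    have "\<bar>w x \<bullet> heat c \<tau> x\<bar> \<le> norm (w x) * norm (heat c \<tau> x)" by (rule Cauchy_Schwarz_ineq2)
    also have "\<dots> \<le> norm (w x) * (?C * norm (?e x))"
      using heat_bound[OF \<tau>, of c x] by (intro mult_left_mono) auto
    finally show "\<bar>w x \<bullet> heat c \<tau> x\<bar> \<le> ?C * (norm (w x) * norm (?e x))" by (simp only: mult_ac)
  qed
  also have "\<dots> = ?C * (\<integral>x. norm (w x) * norm (?e x) \<partial>lborel)" by (rule integral_mult_right_zero)
  also have "\<dots> \<le> ?C * (L2_norm w * (sqrt (\<tau> ^ (CARD('n) + 1)) * sqrt (excessM TYPE('n))))"
    by (intro mult_left_mono[OF _ C] order_trans[OF cauchy_schwarz_L2[OF w exp_excess_in_L2(1)[OF \<tau>]]]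
        mult_left_mono[OF exp_excess_in_L2(2)[OF \<tau>] L2_norm_nonneg])
  also have "\<dots> = heatC TYPE('n) * norm c * sqrt (excessM TYPE('n)) * ((1 / \<tau>) ^ (CARD('n) + 1) * sqrt (\<tau> ^ (CARD('n) + 1))) * L2_norm w"
    by (simp only: mult_ac)
  also have "(1 / \<tau>) ^ (CARD('n) + 1) * sqrt (\<tau> ^ (CARD('n) + 1)) = sqrt ((1 / \<tau>) ^ (CARD('n) + 1))"
  proof -
    define T where "T = \<tau> ^ (CARD('n) + 1)"
    have "T > 0" using \<tau> by (simp add: T_def)
    then have "1 / T * sqrt T = sqrt (1 / T)"
      by (simp add: real_sqrt_divide field_simps)
    then show ?thesis unfolding T_def by (simp only: power_one_over)
  qed
  finally show ?thesis .
qed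

text \<open>The time derivative falls on the kernel, where it is -L; \<open>lap_symmetric\<close>
  then moves L over to \<open>w\<close>.\<close>

lemma hpair_derivative:
  fixes w :: "'n::finite heis \<Rightarrow> complex"
  assumes w: "hor2 w" "in_L2 w" "in_L2 (lap w)" and \<tau>: "\<tau> > 0"
  shows "(hpair c w has_real_derivative - hpair c (lap w) \<tau>) (at \<tau>)"
proof -
  \<comment> \<open>For times s within \<tau>/2 of \<tau> one has 1/s \<le> 2/\<tau> and exp(-excess
    / s) \<le> exp(-excess / (2 \<tau>)), so \<open>g\<close> dominates on the whole
    neighbourhood.\<close>
  define C where "C = heatC TYPE('n) * norm c * (2 / \<tau>) ^ (CARD('n) + 2)"
  define g where "g x = C * (norm (w x) * norm (complex_of_real (exp (- excess x / (2 * \<tau>)))))" for x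
  have gi: "integrable lborel g" unfolding g_def
    using \<tau> by (intro integrable_mult_right in_L2_integrable_inner w exp_excess_in_L2) auto
  have wm: "w \<in> borel_measurable borel" using w by (auto simp: in_L2_def)
  have "((\<lambda>\<tau>. \<integral>x. w x \<bullet> heat c \<tau> x \<partial>lborel) has_derivative (\<lambda>h. \<integral>x. h * (w x \<bullet> - lap (heat c \<tau>) x) \<partial>lborel)) (at \<tau>)"
  proof (rule has_derivative_lebesgue_integral[where d = "\<tau> / 2" and g = g and F' = "\<lambda>x \<tau> h. h * (w x \<bullet> - lap (heat c \<tau>) x)"])
    show "(\<lambda>x. h * (w x \<bullet> - lap (heat c \<tau>) x)) \<in> borel_measurable lborel" for h
    proof -
      note [measurable] = wm borel_measurable_continuous_onI[OF hor2_continuous_lap[OF hor2_heat[OF \<tau>]]]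
      show ?thesis by measurable
    qed
    fix s assume "dist s \<tau> < \<tau> / 2"
    then have "\<bar>s - \<tau>\<bar> < \<tau> / 2" by (simp add: dist_real_def)
    then have "s - \<tau> < \<tau> / 2" "- (s - \<tau>) < \<tau> / 2" unfolding abs_less_iff by blast+
    then have s: "s > \<tau> / 2" "s < 2 * \<tau>" "s > 0" using \<tau> by argo+
    show "integrable lborel (\<lambda>x. w x \<bullet> heat c s x)" by (rule hpair_integrable[OF w(2) s(3)])
    fix x
    have "((\<lambda>s. w x \<bullet> heat c s x) has_derivative (\<lambda>h. w x \<bullet> (h *\<^sub>R - lap (heat c s) x))) (at s)"
      using heat_time_derivative[OF s(3), of c x] unfolding has_vector_derivative_def
      by (rule has_derivative_inner_right)
    then show "((\<lambda>s. w x \<bullet> heat c s x) has_derivative (\<lambda>h. h * (w x \<bullet> - lap (heat c s) x))) (at s)" by simp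
    fix h :: real
    have "\<bar>w x \<bullet> - lap (heat c s) x\<bar> \<le> norm (w x) * norm (- lap (heat c s) x)" by (rule Cauchy_Schwarz_ineq2)
    also have "\<dots> \<le> norm (w x) * (C * exp (- excess x / (2 * \<tau>)))"
    proof (rule mult_left_mono)
      have "norm (lap (heat c s) x) \<le> heatC TYPE('n) * norm c * (1 / s) ^ (CARD('n) + 2) * exp (- excess x / s)"
        by (rule lap_heat_bound[OF s(3)])
      also have "\<dots> \<le> C * exp (- excess x / (2 * \<tau>))" unfolding C_def
      proof (intro mult_mono mult_left_mono power_mono)
        show "1 / s \<le> 2 / \<tau>" using s \<tau> by (simp add: field_simps)
        have "excess x / (2 * \<tau>) \<le> excess x / s" using s excess_nonneg[of x] by (intro divide_left_mono) auto
        then show "exp (- excess x / s) \<le> exp (- excess x / (2 * \<tau>))" by simp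
      qed (use s \<tau> heatC_nonneg[where 'n='n] in auto)
      finally show "norm (- lap (heat c s) x) \<le> C * exp (- excess x / (2 * \<tau>))" by simp
    qed simp
    finally have "\<bar>w x \<bullet> - lap (heat c s) x\<bar> \<le> g x" by (simp add: g_def mult_ac)
    then have "\<bar>h\<bar> * \<bar>w x \<bullet> - lap (heat c s) x\<bar> \<le> \<bar>h\<bar> * g x" by (intro mult_left_mono) auto
    then show "norm (h * (w x \<bullet> - lap (heat c s) x)) \<le> g x * norm h" by (simp add: abs_mult mult.commute)
  qed (use \<tau> gi in auto)
  then have "(hpair c w has_derivative (\<lambda>h. h * - (\<integral>x. w x \<bullet> lap (heat c \<tau>) x \<partial>lborel))) (at \<tau>)"
    by (simp add: hpair_def[abs_def])
  moreover have "(\<integral>x. w x \<bullet> lap (heat c \<tau>) x \<partial>lborel) = hpair c (lap w) \<tau>"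
    unfolding hpair_def by (rule lap_symmetric[OF w hor2_heat[OF \<tau>] heat_in_L2[OF \<tau>]])
  ultimately show ?thesis unfolding has_field_derivative_def
    by (elim has_derivative_eq_rhs) (simp add: fun_eq_iff)
qed

text \<open>An approximate identity acting on a function that may be unbounded. Near the origin
  \<open>w\<close> is small and the kernel has bounded mass; away from it half of the exponent
  provides the factor exp(-\<delta> / (2 \<tau>)), while the other half keeps the majorant in L2 for
  Cauchy-Schwarz.\<close>

lemma hpair_tendsto_0:
  fixes w :: "'n::finite heis \<Rightarrow> complex"
  assumes w: "continuous_on UNIV w" "in_L2 w" "w 0 = 0"
  shows "(hpair c w \<longlongrightarrow> 0) (at_right 0)"
proof (rule tendstoI)
  fix \<eta> :: real assume \<eta>: "\<eta> > 0"
  define n where "n = CARD('n) + 1"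
  define C where "C = heatC TYPE('n) * norm c"
  define M where "M = excessM TYPE('n)"
  have CM: "C \<ge> 0" "M \<ge> 0" by (simp_all add: C_def M_def heatC_nonneg excessM_nonneg)
  define \<epsilon> where "\<epsilon> = \<eta> / (2 * (C * M + 1))"
  have CM1: "C * M + 1 > 0" using CM by (simp add: add_nonneg_pos)
  have \<epsilon>: "\<epsilon> > 0" using \<eta> CM1 by (simp add: \<epsilon>_def)
  obtain r where r: "r > 0" "\<And>x. norm x < r \<Longrightarrow> norm (w x) < \<epsilon>"
    using continuous_on_eq_continuous_at[of UNIV w] w(1,3) \<epsilon>
    unfolding continuous_at_eps_delta by (metis UNIV_I open_UNIV diff_zero dist_norm)
  \<comment> \<open>If the norm of (z, t) is at least r, then |z| \<ge> r/2 or |t| \<ge> r/2, and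
    the excess is at least (r/2)^2 / 16 or r/2.\<close>
  define \<delta> where "\<delta> = min (r\<^sup>2 / 64) (r / 2)"
  have \<delta>: "\<delta> > 0" using r by (simp add: \<delta>_def)
  have far: "excess x \<ge> \<delta>" if "norm x \<ge> r" for x :: "'n heis"
  proof -
    have "norm x \<le> norm (fst x) + norm (snd x)" using norm_Pair_le[of "fst x" "snd x"] by simp
    then consider "norm (fst x) \<ge> r / 2" | "\<bar>snd x\<bar> \<ge> r / 2" using \<open>norm x \<ge> r\<close> by fastforce
    then show ?thesis
    proof cases
      case 1
      then have "(r / 2)\<^sup>2 \<le> (norm (fst x))\<^sup>2" using r by (intro power_mono) auto
      then have "r\<^sup>2 \<le> (norm (fst x))\<^sup>2 * 4" by (simp add: power_divide)
      then have "r\<^sup>2 / 64 \<le> excess x" unfolding excess_def using abs_ge_zero[of "snd x"] by argo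
      then show ?thesis by (simp add: \<delta>_def)
    next
      case 2
      have "0 \<le> (norm (fst x))\<^sup>2 / 16" by simp
      with 2 have "r / 2 \<le> excess x" unfolding excess_def by linarith
      then show ?thesis by (simp add: \<delta>_def)
    qed
  qed
  define K where "K = L2_norm w * C * sqrt (2 ^ n) * sqrt M * (fact (n + 1) * (2 / \<delta>) ^ (n + 1) + fact 1 * (2 / \<delta>) ^ 1)"
  have K: "K \<ge> 0" using \<delta> CM L2_norm_nonneg[of w] by (simp add: K_def)
  have main: "\<bar>hpair c w \<tau>\<bar> \<le> \<eta> / 2 + K * \<tau>" if \<tau>: "\<tau> > 0" for \<tau>
  proof -
    let ?e = "\<lambda>a x::'n heis. complex_of_real (exp (- excess x / a))"
    define P where "P = (1 / \<tau>) ^ n"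
    have P: "P \<ge> 0" using \<tau> by (simp add: P_def)
    have pt: "\<bar>w x \<bullet> heat c \<tau> x\<bar> \<le> \<epsilon> * (C * P) * exp (- excess x / \<tau>) + C * P * exp (- \<delta> / (2 * \<tau>)) * (norm (w x) * norm (?e (2 * \<tau>) x))" for x
    proof -
      have "\<bar>w x \<bullet> heat c \<tau> x\<bar> \<le> norm (w x) * norm (heat c \<tau> x)" by (rule Cauchy_Schwarz_ineq2)
      also have "\<dots> \<le> norm (w x) * (C * P * exp (- excess x / \<tau>))"
        using heat_bound[OF \<tau>, of c x] by (intro mult_left_mono) (auto simp: C_def P_def n_def)
      finally have 1: "\<bar>w x \<bullet> heat c \<tau> x\<bar> \<le> norm (w x) * (C * P * exp (- excess x / \<tau>))" .
      show ?thesis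
      proof (cases "norm x < r")
        case True
        have "norm (w x) * (C * P * exp (- excess x / \<tau>)) \<le> \<epsilon> * (C * P * exp (- excess x / \<tau>))"
          using r(2)[OF True] CM P by (intro mult_right_mono) auto
        moreover have "0 \<le> C * P * exp (- \<delta> / (2 * \<tau>)) * (norm (w x) * norm (?e (2 * \<tau>) x))" using CM P by simp
        ultimately show ?thesis using 1 by (simp only: mult.assoc)
      next
        case False
        have "\<delta> / (2 * \<tau>) \<le> excess x / (2 * \<tau>)" using far[of x] False \<tau> by (intro divide_right_mono) auto
        moreover have "excess x / \<tau> = excess x / (2 * \<tau>) + excess x / (2 * \<tau>)" by (simp add: field_simps)
        ultimately have "exp (- excess x / \<tau>) \<le> exp (- \<delta> / (2 * \<tau>)) * exp (- excess x / (2 * \<tau>))"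
          by (simp flip: exp_add)
        then have "norm (w x) * (C * P * exp (- excess x / \<tau>)) \<le> norm (w x) * (C * P * (exp (- \<delta> / (2 * \<tau>)) * exp (- excess x / (2 * \<tau>))))"
          using CM P by (intro mult_left_mono) auto
        moreover have "0 \<le> \<epsilon> * (C * P) * exp (- excess x / \<tau>)" using CM P \<epsilon> by simp
        ultimately show ?thesis using 1 by (simp add: mult_ac)
      qed
    qed
    have i1: "integrable lborel (\<lambda>x::'n heis. \<epsilon> * (C * P) * exp (- excess x / \<tau>))"
      using excess_integral(1)[OF \<tau>] by (rule integrable_mult_right)
    have i2: "integrable lborel (\<lambda>x::'n heis. C * P * exp (- \<delta> / (2 * \<tau>)) * (norm (w x) * norm (?e (2 * \<tau>) x)))"
      using \<tau> by (intro integrable_mult_right in_L2_integrable_inner w exp_excess_in_L2) auto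
    have "\<bar>hpair c w \<tau>\<bar> \<le> (\<integral>x. \<bar>w x \<bullet> heat c \<tau> x\<bar> \<partial>lborel)" unfolding hpair_def by (rule integral_abs_bound)
    also have "\<dots> \<le> (\<integral>x. \<epsilon> * (C * P) * exp (- excess x / \<tau>) + C * P * exp (- \<delta> / (2 * \<tau>)) * (norm (w x) * norm (?e (2 * \<tau>) x)) \<partial>lborel)"
      using hpair_integrable[OF w(2) \<tau>] by (intro integral_mono pt Bochner_Integration.integrable_add i1 i2) auto
    also have "\<dots> = \<epsilon> * (C * P) * (\<integral>x. exp (- excess (x::'n heis) / \<tau>) \<partial>lborel) + C * P * exp (- \<delta> / (2 * \<tau>)) * (\<integral>x. norm (w x) * norm (?e (2 * \<tau>) x) \<partial>lborel)"
      unfolding Bochner_Integration.integral_add[OF i1 i2] integral_mult_right_zero ..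
    also have "\<dots> \<le> \<epsilon> * (C * P) * (\<tau> ^ n * M) + C * P * exp (- \<delta> / (2 * \<tau>)) * (L2_norm w * (sqrt ((2 * \<tau>) ^ n) * sqrt M))"
    proof (intro add_mono mult_left_mono)
      show "(\<integral>x. exp (- excess (x::'n heis) / \<tau>) \<partial>lborel) \<le> \<tau> ^ n * M"
        unfolding excess_integral(2)[OF \<tau>] n_def M_def ..
      have "2 * \<tau> > 0" using \<tau> by simp
      from cauchy_schwarz_L2[OF w(2) exp_excess_in_L2(1)[OF this]] mult_left_mono[OF exp_excess_in_L2(2)[OF this, where 'n='n] L2_norm_nonneg[of w]]
      show "(\<integral>x. norm (w x) * norm (?e (2 * \<tau>) x) \<partial>lborel) \<le> L2_norm w * (sqrt ((2 * \<tau>) ^ n) * sqrt M)"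
        unfolding n_def M_def by (rule order_trans)
    qed (use \<epsilon> CM P in auto)
    also have "\<epsilon> * (C * P) * (\<tau> ^ n * M) = \<epsilon> * (C * M)"
      using \<tau> by (simp add: P_def power_one_over)
    also have "\<epsilon> * (C * M) \<le> \<eta> / 2"
    proof -
      have "\<epsilon> * (C * M) \<le> \<epsilon> * (C * M + 1)" using \<epsilon> by (intro mult_left_mono) auto
      also have "\<dots> = \<eta> / 2" using CM1 by (simp add: \<epsilon>_def field_simps)
      finally show ?thesis .
    qed
    also have "C * P * exp (- \<delta> / (2 * \<tau>)) * (L2_norm w * (sqrt ((2 * \<tau>) ^ n) * sqrt M)) \<le> K * \<tau>"
    proof -
      \<comment> \<open>The exponential is compared with the power m + 1, one above the singularity,
        so that a factor \<tau> is left over.\<close>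
      have small: "(1 / \<tau>) ^ m * exp (- \<delta> / (2 * \<tau>)) \<le> fact (m + 1) * (2 / \<delta>) ^ (m + 1) * \<tau>" for m
      proof -
        have "(\<delta> / (2 * \<tau>)) ^ (m + 1) \<le> fact (m + 1) * exp (\<delta> / (2 * \<tau>))"
          by (rule power_le_exp) (use \<delta> \<tau> in auto)
        then have "(\<delta> / (2 * \<tau>)) ^ (m + 1) * exp (- \<delta> / (2 * \<tau>)) \<le> fact (m + 1) * exp (\<delta> / (2 * \<tau>)) * exp (- \<delta> / (2 * \<tau>))"
          by (intro mult_right_mono) auto
        also have "\<dots> = fact (m + 1)" by (simp add: mult.assoc flip: exp_add)
        finally have 1: "(\<delta> / (2 * \<tau>)) ^ (m + 1) * exp (- \<delta> / (2 * \<tau>)) \<le> fact (m + 1)" .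
        have "(1 / \<tau>) ^ m * exp (- \<delta> / (2 * \<tau>)) = ((2 / \<delta>) ^ (m + 1) * \<tau>) * ((\<delta> / (2 * \<tau>)) ^ (m + 1) * exp (- \<delta> / (2 * \<tau>)))"
          using \<delta> \<tau> by (simp add: power_divide power_mult_distrib field_simps)
        also have "\<dots> \<le> ((2 / \<delta>) ^ (m + 1) * \<tau>) * fact (m + 1)" by (intro mult_left_mono 1) (use \<delta> \<tau> in auto)
        finally show ?thesis by (simp only: mult_ac)
      qed
      have "P * sqrt ((2 * \<tau>) ^ n) = sqrt (2 ^ n) * sqrt P"
      proof -
        have "P * \<tau> ^ n = 1" using \<tau> by (simp add: P_def power_one_over)
        then have "P * P * (2 * \<tau>) ^ n = 2 ^ n * P" by (simp add: power_mult_distrib mult_ac)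
        then have "sqrt (P * P * (2 * \<tau>) ^ n) = sqrt (2 ^ n * P)" by simp
        then show ?thesis using P by (simp add: real_sqrt_mult)
      qed
      moreover have "sqrt P \<le> P + 1"
        using P by (intro real_le_lsqrt) (auto simp: power2_eq_square algebra_simps)
      ultimately have "C * P * exp (- \<delta> / (2 * \<tau>)) * (L2_norm w * (sqrt ((2 * \<tau>) ^ n) * sqrt M)) \<le>
          L2_norm w * C * sqrt (2 ^ n) * sqrt M * ((P + 1) * exp (- \<delta> / (2 * \<tau>)))"
      proof -
        assume a: "P * sqrt ((2 * \<tau>) ^ n) = sqrt (2 ^ n) * sqrt P" and b: "sqrt P \<le> P + 1"
        have "C * P * exp (- \<delta> / (2 * \<tau>)) * (L2_norm w * (sqrt ((2 * \<tau>) ^ n) * sqrt M)) =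
          L2_norm w * C * sqrt M * exp (- \<delta> / (2 * \<tau>)) * (P * sqrt ((2 * \<tau>) ^ n))" by (simp only: mult_ac)
        also have "\<dots> = L2_norm w * C * sqrt (2 ^ n) * sqrt M * (sqrt P * exp (- \<delta> / (2 * \<tau>)))"
          unfolding a by (simp only: mult_ac)
        also have "\<dots> \<le> L2_norm w * C * sqrt (2 ^ n) * sqrt M * ((P + 1) * exp (- \<delta> / (2 * \<tau>)))"
          using CM L2_norm_nonneg[of w] b by (intro mult_left_mono mult_right_mono) auto
        finally show ?thesis .
      qed
      also have "\<dots> \<le> L2_norm w * C * sqrt (2 ^ n) * sqrt M * ((fact (n + 1) * (2 / \<delta>) ^ (n + 1) + fact 1 * (2 / \<delta>) ^ 1) * \<tau>)"
      proof (rule mult_left_mono)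
        show "(P + 1) * exp (- \<delta> / (2 * \<tau>)) \<le> (fact (n + 1) * (2 / \<delta>) ^ (n + 1) + fact 1 * (2 / \<delta>) ^ 1) * \<tau>"
          using small[of n] small[of 0] by (simp add: P_def distrib_right)
      qed (use CM L2_norm_nonneg[of w] in auto)
      finally show ?thesis by (simp only: K_def mult_ac)
    qed
    finally show ?thesis by simp
  qed
  have "eventually (\<lambda>\<tau>. \<tau> < \<eta> / (2 * (K + 1))) (at_right 0)"
    using \<eta> K by (intro order_tendstoD(2)[OF tendsto_ident_at]) auto
  then show "\<forall>\<^sub>F \<tau> in at_right 0. dist (hpair c w \<tau>) 0 < \<eta>"
    using eventually_at_right_less[of 0]
  proof eventually_elim
    case (elim \<tau>)
    have "K * \<tau> \<le> (K + 1) * \<tau>" using elim by (intro mult_right_mono) auto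
    also have "\<dots> < \<eta> / 2" using elim K by (simp add: field_simps)
    finally show ?case using main[of \<tau>] elim by simp
  qed
qed

subsection \<open>Vanishing of the heat evolution at the origin\<close>

lemma mom_mult: "mom s (p * q) = mom (\<lambda>i. mom (\<lambda>j. s (j + i)) q) p"
proof (induction p arbitrary: s)
  case (pCons a p)
  have "mom s (pCons a p * q) = a * mom s q + mom (\<lambda>i. s (Suc i)) (p * q)"
    by (simp add: mom_add mom_smult mom_pCons)
  then show ?case by (simp add: mom_pCons pCons.IH)
qed simp

text \<open>The function depends on \<omega> through \<open>x\<close> alone, so the sets where it is
  positive or negative are preimages of Borel sets under \<open>x\<close>, and the integral over
  each of them vanishes.\<close>

lemma laplace_zero_imp_AE_zero:
  fixes h :: "real \<Rightarrow> real" and x :: "'a \<Rightarrow> real"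
  assumes [measurable]: "h \<in> borel_measurable borel" "x \<in> borel_measurable M"
    and int: "\<And>\<zeta>. a < \<zeta> \<Longrightarrow> \<zeta> < b \<Longrightarrow> integrable M (\<lambda>\<omega>. h (x \<omega>) * exp (\<zeta> * x \<omega>))"
    and zero: "\<And>\<zeta>. a < \<zeta> \<Longrightarrow> \<zeta> < b \<Longrightarrow> (\<integral>\<omega>. h (x \<omega>) * exp (\<zeta> * x \<omega>) \<partial>M) = 0"
    and ab: "a < b"
  shows "AE \<omega> in M. h (x \<omega>) = 0"
proof -
  define \<zeta> where "\<zeta> = (a + b) / 2"
  have \<zeta>: "a < \<zeta>" "\<zeta> < b" using ab by (auto simp: \<zeta>_def)
  have key: "AE \<omega> in M. \<not> (0 < e * h (x \<omega>))" if e: "e \<in> {1, -1}" for e :: real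
  proof -
    define B where "B = {y. 0 < e * h y}"
    have B[measurable]: "B \<in> sets borel" unfolding B_def by measurable
    define g where "g \<omega> = indicator B (x \<omega>) * (h (x \<omega>) * exp (\<zeta> * x \<omega>))" for \<omega>
    have gi: "integrable M g" unfolding g_def
      by (rule Bochner_Integration.integrable_bound[OF int[OF \<zeta>]]) (auto simp: indicator_def)
    have "(\<integral>\<omega>. g \<omega> \<partial>M) = 0" unfolding g_def
      by (rule laplace_zero_imp_zero[OF _ _ int zero \<zeta> B]) auto
    then have "(\<integral>\<omega>. e * g \<omega> \<partial>M) = 0" by simp
    moreover have "0 \<le> e * g \<omega>" for \<omega> by (auto simp: g_def indicator_def B_def mult.assoc[symmetric])
    ultimately have "AE \<omega> in M. e * g \<omega> = 0"
      using gi by (subst (asm) integral_nonneg_eq_0_iff_AE) auto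
    then show ?thesis by (rule eventually_mono) (use e in \<open>auto simp: g_def indicator_def B_def\<close>)
  qed
  show ?thesis using key[of 1] key[of "-1"] by (auto elim: eventually_elim2)
qed

lemma hor_add_scaled:
  assumes "flat0 f" "flat0 g"
  shows "hor b (\<lambda>x. f x + c *\<^sub>R g x) = (\<lambda>x. hor b f x + c *\<^sub>R hor b g x)"
proof
  fix x
  have "((\<lambda>x. f x + c *\<^sub>R g x) has_derivative (\<lambda>v. frechet_derivative f (at x) v + c *\<^sub>R frechet_derivative g (at x) v)) (at x)"
    by (intro has_derivative_add has_derivative_scaleR_right flat0_has_derivative assms)
  then show "hor b (\<lambda>x. f x + c *\<^sub>R g x) x = hor b f x + c *\<^sub>R hor b g x"
    by (subst hor_eqI, assumption) (simp add: hor_def)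
qed

lemma lap_add_scaled:
  assumes "flat0 f" "flat0 g"
  shows "lap (\<lambda>x. f x + c *\<^sub>R g x) = (\<lambda>x. lap f x + c *\<^sub>R lap g x)"
proof
  fix x
  have "hor b (hor b (\<lambda>x. f x + c *\<^sub>R g x)) x = hor b (hor b f) x + c *\<^sub>R hor b (hor b g) x" if "b \<in> Basis" for b
    using that by (simp add: hor_add_scaled assms flat0_hor)
  then show "lap (\<lambda>x. f x + c *\<^sub>R g x) x = lap f x + c *\<^sub>R lap g x"
    by (simp add: lap_def sum.distrib scaleR_sum_right)
qed

lemma lap_zero: "lap (\<lambda>x. 0) = (\<lambda>x. 0)"
  by (simp add: lap_def hor_def frechet_derivative_const fun_eq_iff)

lemma in_L2_add_scaled:
  assumes "in_L2 f" "in_L2 g" shows "in_L2 (\<lambda>x. f x + c *\<^sub>R g x)"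
proof -
  have [measurable]: "f \<in> borel_measurable borel" "g \<in> borel_measurable borel" using assms by (auto simp: in_L2_def)
  have "integrable lborel (\<lambda>x. (norm (f x))\<^sup>2 + c * (2 * (f x \<bullet> g x)) + c\<^sup>2 * (norm (g x))\<^sup>2)"
    using assms in_L2_integrable_inner(2)[OF assms] by (auto simp: in_L2_def)
  moreover have "(norm (f x + c *\<^sub>R g x))\<^sup>2 = (norm (f x))\<^sup>2 + c * (2 * (f x \<bullet> g x)) + c\<^sup>2 * (norm (g x))\<^sup>2" for x
    unfolding power2_norm_eq_inner inner_add_left inner_add_right inner_scaleR_left inner_scaleR_right inner_commute[of "g x" "f x"]
    by (simp add: power2_eq_square algebra_simps)
  ultimately show ?thesis by (simp add: in_L2_def)
qed

lemma in_L2_zero: "in_L2 (\<lambda>x. 0)" by (simp add: in_L2_def)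

section \<open>The functions q(L) f and the moments of L at f\<close>

locale carleman_orbit =
  fixes f :: "'n::finite heis \<Rightarrow> complex"
  assumes flat: "flat0 f" and L2: "\<And>m. in_L2 ((lap ^^ m) f)"
    and carleman: "(\<Sum>m::nat. neg_powr (L2_norm ((lap ^^ Suc m) f)) (1 / (2 * real (Suc m)))) = \<infinity>"
begin

definition F where "F m = (lap ^^ m) f"
definition s where "s m = (\<integral>x. F m x \<bullet> F 0 x \<partial>lborel)"
definition app :: "real poly \<Rightarrow> 'n heis \<Rightarrow> complex" where
  "app p = (\<lambda>x. \<Sum>i\<le>degree p. coeff p i *\<^sub>R F i x)"

lemma flat_F: "flat0 (F m)" unfolding F_def by (rule flat0_lap_pow[OF flat])
lemma L2_F: "in_L2 (F m)" unfolding F_def by (rule L2)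
lemma F_Suc: "lap (F m) = F (Suc m)" by (simp add: F_def)
lemma hor2_F: "hor2 (F m)" by (rule flat0_hor2[OF flat_F])

text \<open>Symmetry of L makes the Gram matrix of the orbit a Hankel matrix, so that
  \<open>mom s\<close> represents the inner products of the functions q(L) f.\<close>

lemma F_inner: "(\<integral>x. F i x \<bullet> F j x \<partial>lborel) = s (i + j)"
proof (induction j arbitrary: i)
  case (Suc j)
  have "(\<integral>x. F i x \<bullet> F (Suc j) x \<partial>lborel) = (\<integral>x. F (Suc i) x \<bullet> F j x \<partial>lborel)"
    using lap_symmetric[of "F i" "F j"] by (simp add: F_Suc hor2_F L2_F)
  then show ?case by (simp add: Suc)
qed (simp add: s_def)

lemma sum_F:
  assumes "finite I"
  shows "flat0 (\<lambda>x. \<Sum>i\<in>I. a i *\<^sub>R F i x) \<and> in_L2 (\<lambda>x. \<Sum>i\<in>I. a i *\<^sub>R F i x) \<and>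
    lap (\<lambda>x. \<Sum>i\<in>I. a i *\<^sub>R F i x) = (\<lambda>x. \<Sum>i\<in>I. a i *\<^sub>R F (Suc i) x)"
  using assms
proof (induction I)
  case empty
  then show ?case by (simp add: flat0_zero_fun in_L2_zero lap_zero)
next
  case (insert j I)
  have e: "(\<lambda>x. \<Sum>i\<in>insert j I. a i *\<^sub>R F i x) = (\<lambda>x. (\<Sum>i\<in>I. a i *\<^sub>R F i x) + a j *\<^sub>R F j x)"
    using insert by (simp add: add.commute)
  show ?case unfolding e using insert
    by (simp add: flat0_add_scaled in_L2_add_scaled lap_add_scaled flat_F L2_F F_Suc) (simp add: add.commute)
qed

lemma app_props: "flat0 (app p)" "in_L2 (app p)" "lap (app p) = app (pCons 0 p)"
proof -
  show "flat0 (app p)" "in_L2 (app p)" unfolding app_def using sum_F[of "{..degree p}" "coeff p"] by auto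
  have "lap (app p) = (\<lambda>x. \<Sum>i\<le>degree p. coeff p i *\<^sub>R F (Suc i) x)"
    unfolding app_def using sum_F[of "{..degree p}" "coeff p"] by auto
  also have "\<dots> = app (pCons 0 p)"
  proof
    fix x
    show "(\<Sum>i\<le>degree p. coeff p i *\<^sub>R F (Suc i) x) = app (pCons 0 p) x"
      by (cases "p = 0") (simp_all add: app_def sum.atMost_Suc_shift del: sum.atMost_Suc)
  qed
  finally show "lap (app p) = app (pCons 0 p)" .
qed

lemma app_inner: "(\<integral>x. app p x \<bullet> app q x \<partial>lborel) = mom s (p * q)"
proof -
  have 1: "(\<integral>x. F i x \<bullet> app q x \<partial>lborel) = mom (\<lambda>j. s (j + i)) q" for i
  proof -
    have "(\<integral>x. F i x \<bullet> app q x \<partial>lborel) = (\<Sum>j\<le>degree q. coeff q j * (\<integral>x. F i x \<bullet> F j x \<partial>lborel))"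
      unfolding app_def inner_sum_right inner_scaleR_right
      by (simp add: in_L2_integrable_inner L2_F)
    then show ?thesis by (simp add: mom_def F_inner add.commute)
  qed
  have "(\<integral>x. app p x \<bullet> app q x \<partial>lborel) = (\<Sum>i\<le>degree p. coeff p i * (\<integral>x. F i x \<bullet> app q x \<partial>lborel))"
    unfolding app_def[of p] inner_sum_left inner_scaleR_left
    by (simp add: in_L2_integrable_inner L2_F app_props)
  then show ?thesis unfolding 1 by (simp add: mom_mult mom_def[of _ p])
qed

lemma L2_norm_app: "(L2_norm (app q))\<^sup>2 = mom s (q * q)"
  unfolding L2_norm_sq app_inner[symmetric] by (simp add: power2_norm_eq_inner)

lemma s_even: "s (2 * m) = (L2_norm (F m))\<^sup>2"
  unfolding L2_norm_sq using F_inner[of m m] by (simp add: power2_norm_eq_inner mult_2)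

lemma moment_pos: "mom s (q * q) \<ge> 0" "mom s (pCons 0 (q * q)) \<ge> 0"
proof -
  show "mom s (q * q) \<ge> 0" unfolding L2_norm_app[symmetric] by simp
  have "0 \<le> (\<integral>x. app q x \<bullet> lap (app q) x \<partial>lborel)"
    using app_props[of q] app_props[of "pCons 0 q"] by (intro lap_nonneg flat0_hor2) simp_all
  also have "\<dots> = mom s (pCons 0 (q * q))" by (simp add: app_props app_inner)
  finally show "mom s (pCons 0 (q * q)) \<ge> 0" .
qed

text \<open>\<open>s (2 * m)\<close> is the square of the norm of L^m f, which turns the exponent
  1/(2m) into 1/(4m). The first alternative covers an infinite term of the series, which
  \<open>powr\<close> would count as 0.\<close>

lemma carleman_moments: "(\<exists>m. s (2 * m) = 0) \<or> \<not> summable (\<lambda>m. s (2 * Suc m) powr (- 1 / (4 * real (Suc m))))"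
proof (rule ccontr)
  assume a: "\<not> ?thesis"
  have "neg_powr (L2_norm ((lap ^^ Suc m) f)) (1 / (2 * real (Suc m))) = ennreal (s (2 * Suc m) powr (- 1 / (4 * real (Suc m))))" for m
  proof -
    define N where "N = L2_norm (F (Suc m))"
    have "s (2 * Suc m) \<noteq> 0" using a by blast
    then have "N \<noteq> 0" unfolding s_even N_def by simp
    then have N: "N > 0" using L2_norm_nonneg[of "F (Suc m)"] by (simp add: N_def)
    have "s (2 * Suc m) powr (- 1 / (4 * real (Suc m))) = (N powr 2) powr (- 1 / (4 * real (Suc m)))"
      using N by (simp add: s_even N_def del: mult_Suc_right)
    also have "\<dots> = N powr (2 * (- 1 / (4 * real (Suc m))))" by (rule powr_powr)
    also have "2 * (- 1 / (4 * real (Suc m))) = - (1 / (2 * real (Suc m)))" by (simp add: field_simps)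
    finally show ?thesis using N by (simp add: neg_powr_def N_def F_def del: funpow.simps)
  qed
  then have "(\<Sum>m. ennreal (s (2 * Suc m) powr (- 1 / (4 * real (Suc m))))) = \<infinity>" using carleman by simp
  moreover have "(\<Sum>m. ennreal (s (2 * Suc m) powr (- 1 / (4 * real (Suc m))))) \<noteq> top"
    by (rule ennreal_suminf_neq_top) (use a in auto)
  ultimately show False by simp
qed

context
  fixes c :: complex
begin

definition U where "U m \<tau> = hpair c (F m) \<tau>"
definition W where "W q \<tau> = mom (\<lambda>i. U i \<tau>) q"
definition K0 where "K0 = heatC TYPE('n) * norm c * sqrt (excessM TYPE('n))"

lemma K0_nonneg: "K0 \<ge> 0" by (simp add: K0_def heatC_nonneg excessM_nonneg)

lemma U_derivative: "\<tau> > 0 \<Longrightarrow> (U m has_real_derivative - U (Suc m) \<tau>) (at \<tau>)"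
  using hpair_derivative[of "F m" \<tau> c] by (simp add: U_def[abs_def] hor2_F L2_F F_Suc)

lemma W_derivative: "\<tau> > 0 \<Longrightarrow> (W q has_real_derivative - W (pCons 0 q) \<tau>) (at \<tau>)"
proof -
  assume \<tau>: "\<tau> > 0"
  have "((\<lambda>\<tau>. \<Sum>i\<le>degree q. coeff q i * U i \<tau>) has_real_derivative (\<Sum>i\<le>degree q. coeff q i * - U (Suc i) \<tau>)) (at \<tau>)"
    by (intro DERIV_sum DERIV_cmult U_derivative \<tau>)
  moreover have "(\<Sum>i\<le>degree q. coeff q i * - U (Suc i) \<tau>) = - W (pCons 0 q) \<tau>"
    by (simp add: W_def mom_pCons sum_negf) (simp add: mom_def)
  ultimately show ?thesis by (simp add: W_def[abs_def] mom_def)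
qed

lemma W_eq_hpair: assumes "\<tau> > 0" shows "W q \<tau> = hpair c (app q) \<tau>"
  unfolding hpair_def app_def inner_sum_left inner_scaleR_left
  using hpair_integrable[OF L2_F assms] by (simp add: W_def mom_def U_def hpair_def)

lemma W_tendsto_0: "(W q \<longlongrightarrow> 0) (at_right 0)"
proof -
  have "(hpair c (app q) \<longlongrightarrow> 0) (at_right 0)"
    by (rule hpair_tendsto_0[OF hor2_continuous(1)[OF flat0_hor2] _ flat0_zero]) (rule app_props)+
  moreover have "eventually (\<lambda>\<tau>. hpair c (app q) \<tau> = W q \<tau>) (at_right 0)"
    using eventually_at_right_less[of 0] by eventually_elim (simp add: W_eq_hpair)
  ultimately show ?thesis by (rule Lim_transform_eventually)
qed

lemma W_bound: "\<tau> > 0 \<Longrightarrow> \<bar>W q \<tau>\<bar> \<le> K0 * sqrt ((1 / \<tau>) ^ (CARD('n) + 1)) * L2_norm (app q)"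
  unfolding W_eq_hpair K0_def by (rule hpair_bound[OF app_props(2)])

text \<open>Near 0 by the flatness of f; from \<open>d\<close> on by \<open>W_bound\<close>, whose
  right side decreases in \<tau>.\<close>

lemma W_bounded: "\<exists>B\<ge>0. \<forall>\<tau>>0. \<bar>W q \<tau>\<bar> \<le> B"
proof -
  have "eventually (\<lambda>\<tau>. \<bar>W q \<tau>\<bar> < 1) (at_right 0)"
    using tendstoD[OF W_tendsto_0, of 1 q] by simp
  then obtain d where d: "d > 0" "\<And>\<tau>. 0 < \<tau> \<Longrightarrow> \<tau> < d \<Longrightarrow> \<bar>W q \<tau>\<bar> < 1"
    unfolding eventually_at_right_field by auto
  define B where "B = K0 * sqrt ((1 / d) ^ (CARD('n) + 1)) * L2_norm (app q)"
  have B: "B \<ge> 0" using d K0_nonneg L2_norm_nonneg[of "app q"] by (simp add: B_def)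
  have "\<bar>W q \<tau>\<bar> \<le> 1 + B" if \<tau>: "\<tau> > 0" for \<tau>
  proof (cases "\<tau> < d")
    case True then show ?thesis using d(2)[OF \<tau> True] B by simp
  next
    case False
    have "\<bar>W q \<tau>\<bar> \<le> K0 * sqrt ((1 / \<tau>) ^ (CARD('n) + 1)) * L2_norm (app q)" by (rule W_bound[OF \<tau>])
    also have "\<dots> \<le> B" unfolding B_def
      using False d \<tau> K0_nonneg L2_norm_nonneg
      by (intro mult_right_mono mult_left_mono real_sqrt_le_mono power_mono) (auto simp: field_simps)
    finally show ?thesis by simp
  qed
  then show ?thesis using B by (intro exI[of _ "1 + B"]) auto
qed

lemma continuous_on_W: "continuous_on {0<..} (W q)"
  by (intro continuous_at_imp_continuous_on ballI DERIV_isCont[OF W_derivative]) auto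

lemma set_integrable_power_exp: "a > 0 \<Longrightarrow> set_integrable lborel {0<..} (\<lambda>\<tau>::real. \<tau> ^ k * exp (- a * \<tau>))"
proof -
  assume a: "a > 0"
  have "set_integrable lborel {0<..} (\<lambda>\<tau>. (fact k * (2 / a) ^ k) * exp (- (\<tau> * (a / 2))))"
    using a by (intro set_integrable_mult_right integrable_I0i_exp_mscale) auto
  then show ?thesis
  proof (rule set_integrable_bound)
    show "set_borel_measurable lborel {0<..} (\<lambda>\<tau>. \<tau> ^ k * exp (- a * \<tau>))"
      unfolding set_borel_measurable_def by measurable
    show "AE \<tau> in lborel. \<tau> \<in> {0<..} \<longrightarrow> norm (\<tau> ^ k * exp (- a * \<tau>)) \<le> norm ((fact k * (2 / a) ^ k) * exp (- (\<tau> * (a / 2))))"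
    proof (intro AE_I2 impI)
      fix \<tau> :: real assume "\<tau> \<in> {0<..}"
      then have \<tau>: "\<tau> > 0" by simp
      have "\<tau> ^ k = (2 / a) ^ k * (a * \<tau> / 2) ^ k" using a by (simp flip: power_mult_distrib)
      also have "\<dots> \<le> (2 / a) ^ k * (fact k * exp (a * \<tau> / 2))"
        using a \<tau> by (intro mult_left_mono power_le_exp) auto
      finally have "\<tau> ^ k * exp (- a * \<tau>) \<le> (2 / a) ^ k * (fact k * exp (a * \<tau> / 2)) * exp (- a * \<tau>)"
        by (intro mult_right_mono) auto
      also have "\<dots> = (fact k * (2 / a) ^ k) * (exp (a * \<tau> / 2) * exp (- a * \<tau>))" by (simp only: mult_ac)
      also have "exp (a * \<tau> / 2) * exp (- a * \<tau>) = exp (- (\<tau> * (a / 2)))" by (simp flip: exp_add)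
      finally show "norm (\<tau> ^ k * exp (- a * \<tau>)) \<le> norm ((fact k * (2 / a) ^ k) * exp (- (\<tau> * (a / 2))))"
        using a \<tau> by (simp add: abs_mult)
    qed
  qed
qed

text \<open>\<open>\<Psi> a k q\<close> is \<open>k!\<close> times the pairing of \<open>q(L) (L + a)^(-k-1) f\<close> with the unit mass at the origin: integration by
  parts lowers \<open>k\<close> at the cost of a factor \<open>x + a\<close>, and \<open>\<Psi> a 0\<close> annihilates multiples of \<open>x + a\<close> because \<open>f\<close> is flat.
  For \<open>k = n\<close> it is continuous in \<open>L\<^sup>2\<close>.\<close>
definition \<Psi> where "\<Psi> a k q = (LBINT \<tau>:{0<..}. \<tau> ^ k * exp (- a * \<tau>) * W q \<tau>)"

lemma \<Psi>_integrable: "a > 0 \<Longrightarrow> set_integrable lborel {0<..} (\<lambda>\<tau>. \<tau> ^ k * exp (- a * \<tau>) * W q \<tau>)"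
proof -
  assume a: "a > 0"
  obtain B where B: "B \<ge> 0" "\<And>\<tau>. \<tau> > 0 \<Longrightarrow> \<bar>W q \<tau>\<bar> \<le> B" using W_bounded by blast
  have "set_integrable lborel {0<..} (\<lambda>\<tau>. B * (\<tau> ^ k * exp (- a * \<tau>)))"
    by (intro set_integrable_mult_right set_integrable_power_exp a)
  then show ?thesis
  proof (rule set_integrable_bound)
    have "continuous_on {0<..} (\<lambda>\<tau>. \<tau> ^ k * exp (- a * \<tau>) * W q \<tau>)" by (intro continuous_intros continuous_on_W)
    then show "set_borel_measurable lborel {0<..} (\<lambda>\<tau>. \<tau> ^ k * exp (- a * \<tau>) * W q \<tau>)"
      unfolding set_borel_measurable_def by (subst measurable_lborel2) (rule borel_measurable_continuous_on_indicator, auto)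
    show "AE \<tau> in lborel. \<tau> \<in> {0<..} \<longrightarrow> norm (\<tau> ^ k * exp (- a * \<tau>) * W q \<tau>) \<le> norm (B * (\<tau> ^ k * exp (- a * \<tau>)))"
    proof (intro AE_I2 impI)
      fix \<tau> :: real assume "\<tau> \<in> {0<..}"
      then have \<tau>: "\<tau> > 0" by simp
      have "\<tau> ^ k * exp (- a * \<tau>) * \<bar>W q \<tau>\<bar> \<le> \<tau> ^ k * exp (- a * \<tau>) * B"
        using \<tau> by (intro mult_left_mono B) auto
      then show "norm (\<tau> ^ k * exp (- a * \<tau>) * W q \<tau>) \<le> norm (B * (\<tau> ^ k * exp (- a * \<tau>)))"
        using \<tau> B(1) by (simp add: abs_mult mult.commute)
    qed
  qed
qed

lemma \<Psi>_add: "a > 0 \<Longrightarrow> \<Psi> a k (p + q) = \<Psi> a k p + \<Psi> a k q"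
  unfolding \<Psi>_def W_def mom_add distrib_left
  by (rule set_integral_add(2); fold W_def; rule \<Psi>_integrable)

lemma \<Psi>_smult: "\<Psi> a k (smult b q) = b * \<Psi> a k q"
proof -
  have "(\<lambda>\<tau>. \<tau> ^ k * exp (- a * \<tau>) * W (smult b q) \<tau>) = (\<lambda>\<tau>. b * (\<tau> ^ k * exp (- a * \<tau>) * W q \<tau>))"
    by (simp add: W_def mom_smult fun_eq_iff)
  then show ?thesis unfolding \<Psi>_def by simp
qed

lemma \<Psi>_step:
  assumes a: "a > 0"
  shows "\<Psi> a k ([:a, 1:] * q) = (if k = 0 then 0 else real k * \<Psi> a (k - 1) q)"
proof -
  define G where "G \<tau> = \<tau> ^ k * exp (- a * \<tau>) * W q \<tau>" for \<tau>
  define g where "g \<tau> = real k * (\<tau> ^ (k - 1) * exp (- a * \<tau>) * W q \<tau>) - \<tau> ^ k * exp (- a * \<tau>) * W ([:a, 1:] * q) \<tau>" for \<tau>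
  have Wa: "W ([:a, 1:] * q) \<tau> = a * W q \<tau> + W (pCons 0 q) \<tau>" for \<tau>
    by (simp add: W_def mom_add mom_smult)
  have int: "set_integrable lborel {0<..} g" unfolding g_def
    by (intro set_integral_diff(1) set_integrable_mult_right \<Psi>_integrable a)
  obtain B where B: "B \<ge> 0" "\<And>\<tau>. \<tau> > 0 \<Longrightarrow> \<bar>W q \<tau>\<bar> \<le> B" using W_bounded by blast
  have "(LBINT \<tau>=ereal 0..\<infinity>. g \<tau>) = 0 - 0"
  proof (rule interval_integral_FTC_integrable[where F = G])
    show "ereal 0 < \<infinity>" by simp
    fix \<tau> :: real assume "ereal 0 < ereal \<tau>"
    then have \<tau>: "\<tau> > 0" by simp
    have "(G has_real_derivative g \<tau>) (at \<tau>)"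
    proof -
      have "(G has_real_derivative (real k * \<tau> ^ (k - 1) * exp (- a * \<tau>) + - a * exp (- a * \<tau>) * \<tau> ^ k) * W q \<tau> + - W (pCons 0 q) \<tau> * (\<tau> ^ k * exp (- a * \<tau>))) (at \<tau>)"
        unfolding G_def[abs_def] using \<tau> by (auto intro!: derivative_eq_intros W_derivative)
      then show ?thesis by (rule DERIV_cong) (unfold g_def Wa, simp add: algebra_simps)
    qed
    then show "(G has_vector_derivative g \<tau>) (at \<tau>)" by (simp add: has_real_derivative_iff_has_vector_derivative)
    have "continuous_on {0<..} g" unfolding g_def by (intro continuous_intros continuous_on_W)
    then show "isCont g \<tau>" using \<tau> by (simp add: continuous_on_eq_continuous_at)
  next
    show "set_integrable lborel (einterval (ereal 0) \<infinity>) g"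
      using int by (simp add: einterval_eq)
    \<comment> \<open>For \<open>k = 0\<close> the weight tends to 1, and the boundary term vanishes
      because f is flat at the origin.\<close>
    have "(G \<longlongrightarrow> 0) (at_right 0)"
    proof -
      have "((\<lambda>\<tau>. \<tau> ^ k * exp (- a * \<tau>)) \<longlongrightarrow> 0 ^ k * exp (- a * 0)) (at_right 0)" by (intro tendsto_intros)
      from tendsto_mult[OF this W_tendsto_0[of q]] show ?thesis by (simp add: G_def[abs_def])
    qed
    then show "((G \<circ> real_of_ereal) \<longlongrightarrow> 0) (at_right (ereal 0))" by (simp add: ereal_tendsto_simps)
    have "(G \<longlongrightarrow> 0) at_top"
    proof (rule Lim_null_comparison)
      show "eventually (\<lambda>\<tau>. norm (G \<tau>) \<le> B * (\<tau> ^ k * exp (- a * \<tau>))) at_top"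
        using eventually_gt_at_top[of 0]
      proof eventually_elim
        case (elim \<tau>)
        have "\<tau> ^ k * exp (- a * \<tau>) * \<bar>W q \<tau>\<bar> \<le> \<tau> ^ k * exp (- a * \<tau>) * B"
          using elim by (intro mult_left_mono B) auto
        then show ?case using elim by (simp add: G_def abs_mult mult.commute)
      qed
      have "((\<lambda>\<tau>. \<tau> ^ k * exp (- a * \<tau>)) \<longlongrightarrow> 0) at_top" using a by real_asymp
      from tendsto_mult_right_zero[OF this] show "((\<lambda>\<tau>. B * (\<tau> ^ k * exp (- a * \<tau>))) \<longlongrightarrow> 0) at_top" .
    qed
    then show "((G \<circ> real_of_ereal) \<longlongrightarrow> 0) (at_left \<infinity>)" by (simp add: ereal_tendsto_simps)
  qed
  then have "(LBINT \<tau>:{0<..}. g \<tau>) = 0"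
    using interval_lebesgue_integral_0_infty(2)[of lborel g] by (simp add: zero_ereal_def)
  moreover have "(LBINT \<tau>:{0<..}. g \<tau>) = real k * \<Psi> a (k - 1) q - \<Psi> a k ([:a, 1:] * q)"
  proof -
    have i1: "set_integrable lborel {0<..} (\<lambda>\<tau>. real k * (\<tau> ^ (k - 1) * exp (- a * \<tau>) * W q \<tau>))"
      by (intro set_integrable_mult_right \<Psi>_integrable a)
    show ?thesis unfolding g_def \<Psi>_def set_integral_diff(2)[OF i1 \<Psi>_integrable[OF a]] by simp
  qed
  ultimately show ?thesis by (cases "k = 0") auto
qed

lemma \<Psi>_power: "a > 0 \<Longrightarrow> \<Psi> a (k + j) ([:a, 1:] ^ k * q) = fact (k + j) / fact j * \<Psi> a j q"
proof (induction k)
  case (Suc k)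
  have "\<Psi> a (Suc k + j) ([:a, 1:] ^ Suc k * q) = real (Suc k + j) * \<Psi> a (k + j) ([:a, 1:] ^ k * q)"
    using \<Psi>_step[OF Suc.prems, of "Suc k + j" "[:a, 1:] ^ k * q"] by (simp only: power_Suc mult.assoc) simp
  then show ?case using Suc by simp
qed simp

text \<open>At short times the weight \<tau>^n outweighs the rate \<tau>^(-(n+1)/2) of
  \<open>W_bound\<close>, because n \<ge> 1; at long times the exponential makes everything
  integrable.\<close>

lemma \<Psi>_bound:
  assumes a: "a > 0"
  shows "\<exists>C. \<forall>q. (\<Psi> a CARD('n) q)\<^sup>2 \<le> C * mom s (q * q)"
proof -
  define n where "n = CARD('n)"
  define D where "D = K0 * (LBINT \<tau>:{0<..}. \<tau> ^ 0 * exp (- a * \<tau>) + \<tau> ^ n * exp (- a * \<tau>))"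
  have "(\<Psi> a n q)\<^sup>2 \<le> D\<^sup>2 * mom s (q * q)" for q
  proof -
    have i: "set_integrable lborel {0<..} (\<lambda>\<tau>. K0 * L2_norm (app q) * (\<tau> ^ 0 * exp (- a * \<tau>) + \<tau> ^ n * exp (- a * \<tau>)))"
      by (intro set_integrable_mult_right set_integral_add(1) set_integrable_power_exp a)
    have "\<bar>\<Psi> a n q\<bar> \<le> (LBINT \<tau>:{0<..}. \<bar>\<tau> ^ n * exp (- a * \<tau>) * W q \<tau>\<bar>)"
      unfolding \<Psi>_def using set_integral_norm_bound[OF \<Psi>_integrable[OF a, of n q]] by simp
    also have "\<dots> \<le> (LBINT \<tau>:{0<..}. K0 * L2_norm (app q) * (\<tau> ^ 0 * exp (- a * \<tau>) + \<tau> ^ n * exp (- a * \<tau>)))"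
    proof (rule set_integral_mono[OF _ i])
      show "set_integrable lborel {0<..} (\<lambda>\<tau>. \<bar>\<tau> ^ n * exp (- a * \<tau>) * W q \<tau>\<bar>)"
        by (intro set_integrable_abs \<Psi>_integrable a)
      fix \<tau> :: real assume "\<tau> \<in> {0<..}"
      then have \<tau>: "\<tau> > 0" by simp
      \<comment> \<open>For \<tau> \<le> 1 the square of the left side is \<tau>^(n-1); for larger
        \<tau> the root is at most 1.\<close>
      have sq: "\<tau> ^ n * sqrt ((1 / \<tau>) ^ (n + 1)) \<le> 1 + \<tau> ^ n"
      proof (cases "\<tau> \<le> 1")
        case True
        have n1: "n = Suc (n - 1)" by (simp add: n_def)
        have "(\<tau> ^ n * sqrt ((1 / \<tau>) ^ (n + 1)))\<^sup>2 = \<tau> ^ n * \<tau> ^ n * (1 / \<tau>) ^ (n + 1)"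
        proof -
          have "(1 / \<tau>) ^ (n + 1) \<ge> 0" using \<tau> by simp
          then show ?thesis by (simp only: power_mult_distrib real_sqrt_pow2) (simp only: power2_eq_square)
        qed
        also have "\<dots> = \<tau> ^ (n - 1)"
        proof -
          have "\<tau> ^ n * \<tau> ^ n = \<tau> ^ (n + 1) * \<tau> ^ (n - 1)" proof -
            have "n + n = (n + 1) + (n - 1)" using n1 by arith
            then show ?thesis by (simp only: power_add[symmetric])
          qed
          then show ?thesis using \<tau> by (simp add: power_one_over)
        qed
        also have "\<dots> \<le> 1" using True \<tau> by (intro power_le_one) auto
        finally have "\<tau> ^ n * sqrt ((1 / \<tau>) ^ (n + 1)) \<le> 1" using \<tau> by (subst (asm) power_le_one_iff) auto
        then show ?thesis using \<tau> by (simp add: add_increasing2)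
      next
        case False
        have "(1 / \<tau>) ^ (n + 1) \<le> 1" using False \<tau> by (intro power_le_one) auto
        then have "sqrt ((1 / \<tau>) ^ (n + 1)) \<le> 1" by (simp only: real_sqrt_le_1_iff)
        then have "\<tau> ^ n * sqrt ((1 / \<tau>) ^ (n + 1)) \<le> \<tau> ^ n * 1" using \<tau> by (intro mult_left_mono) auto
        then show ?thesis by simp
      qed
      have "\<bar>\<tau> ^ n * exp (- a * \<tau>) * W q \<tau>\<bar> = \<tau> ^ n * exp (- a * \<tau>) * \<bar>W q \<tau>\<bar>" using \<tau> by (simp add: abs_mult)
      also have "\<dots> \<le> \<tau> ^ n * exp (- a * \<tau>) * (K0 * sqrt ((1 / \<tau>) ^ (n + 1)) * L2_norm (app q))"
        using \<tau> W_bound[OF \<tau>, of q] by (intro mult_left_mono) (auto simp: n_def)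
      also have "\<dots> = K0 * L2_norm (app q) * exp (- a * \<tau>) * (\<tau> ^ n * sqrt ((1 / \<tau>) ^ (n + 1)))" by (simp only: mult_ac)
      also have "\<dots> \<le> K0 * L2_norm (app q) * exp (- a * \<tau>) * (1 + \<tau> ^ n)"
        using K0_nonneg L2_norm_nonneg[of "app q"] by (intro mult_left_mono sq) auto
      finally show "\<bar>\<tau> ^ n * exp (- a * \<tau>) * W q \<tau>\<bar> \<le> K0 * L2_norm (app q) * (\<tau> ^ 0 * exp (- a * \<tau>) + \<tau> ^ n * exp (- a * \<tau>))"
        by (simp add: algebra_simps)
    qed
    also have "\<dots> = D * L2_norm (app q)" unfolding D_def by (simp add: mult_ac)
    finally have "\<bar>\<Psi> a n q\<bar>\<^sup>2 \<le> (D * L2_norm (app q))\<^sup>2" by (intro power_mono) auto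
    then show ?thesis by (simp add: power_mult_distrib L2_norm_app)
  qed
  then show ?thesis unfolding n_def by blast
qed

text \<open>Lowering the level n times takes multiples of (x + a)^(n+1) to level 0 with one factor x
  + a left, where \<open>\<Psi>_step\<close> gives 0. The same n steps translate the conclusion of
  \<open>carleman_functional\<close> back into the plain Laplace transform.\<close>

lemma laplace_U_zero: assumes a: "a > 0" shows "(LBINT \<tau>:{0<..}. exp (- a * \<tau>) * U 0 \<tau>) = 0"
proof -
  obtain C where C: "\<And>q. (\<Psi> a CARD('n) q)\<^sup>2 \<le> C * mom s (q * q)" using \<Psi>_bound[OF a] by blast
  have "\<Psi> a CARD('n) ([:a, 1:] ^ CARD('n)) = 0"
  proof (rule carleman_functional[where s = s and C = C and a = a and k = "CARD('n)"])
    show "\<Psi> a CARD('n) ([:a, 1:] ^ Suc CARD('n) * q) = 0" for q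
      using \<Psi>_power[OF a, of "CARD('n)" 0 "[:a, 1:] * q"] \<Psi>_step[OF a, of 0 q] by (simp only: power_Suc2 mult.assoc) simp
  qed (use moment_pos carleman_moments C a in \<open>simp_all add: \<Psi>_add \<Psi>_smult\<close>)
  then have "\<Psi> a 0 1 = 0" using \<Psi>_power[OF a, of "CARD('n)" 0 1] by simp
  then show ?thesis by (simp add: \<Psi>_def W_def)
qed

theorem U_AE_zero: "AE \<tau> in lborel. \<tau> > 0 \<longrightarrow> hpair c f \<tau> = 0"
proof -
  \<comment> \<open>Reflected to the negative axis, because the uniqueness lemma is applied with
    positive \<zeta> in exp(\<zeta> x).\<close>
  define h where "h y = indicator {..<0} y * U 0 (- y)" for y
  have hc: "continuous_on {..<0} (\<lambda>y. U 0 (- y))"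
    by (rule continuous_on_compose2[OF continuous_on_W[of 1, unfolded W_def mom_1]]) (auto intro!: continuous_intros)
  have [measurable]: "h \<in> borel_measurable borel"
    using borel_measurable_continuous_on_indicator[OF _ hc] by (simp add: h_def[abs_def])
  have e: "h (- \<tau>) * exp (\<zeta> * - \<tau>) = indicator {0<..} \<tau> *\<^sub>R (exp (- \<zeta> * \<tau>) * U 0 \<tau>)" for \<tau> \<zeta>
    by (simp add: h_def indicator_def)
  have "AE \<tau> in lborel. h (- \<tau>) = 0"
  proof (rule laplace_zero_imp_AE_zero[where a = 0 and b = 1 and x = uminus])
    fix \<zeta> :: real assume "0 < \<zeta>"
    show "integrable lborel (\<lambda>\<tau>. h (- \<tau>) * exp (\<zeta> * - \<tau>))"
      unfolding e using \<Psi>_integrable[OF \<open>0 < \<zeta>\<close>, of 0 1] by (simp add: set_integrable_def W_def)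
    show "(\<integral>\<tau>. h (- \<tau>) * exp (\<zeta> * - \<tau>) \<partial>lborel) = 0"
      unfolding e using laplace_U_zero[OF \<open>0 < \<zeta>\<close>] by (simp add: set_lebesgue_integral_def)
  qed auto
  then show ?thesis by (rule eventually_mono) (auto simp: h_def U_def F_def)
qed

end
end

subsection \<open>Gauge polar coordinates\<close>

text \<open>For a = cot \<theta> with 0 < \<theta> < \<pi> this is sqrt (sin \<theta>).\<close>

definition kap :: "real \<Rightarrow> real" where "kap a = 1 / sqrt (sqrt (1 + a\<^sup>2))"

text \<open>Coordinates \<open>(z, a)\<close> in which the gauge \<open>|z|^4 + t\<^sup>2\<close> depends on \<open>z\<close> only and \<open>a = t / |z|\<^sup>2\<close> plays the role of \<open>cot \<theta>\<close>.\<close>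
definition polar :: "'n::finite heis \<Rightarrow> 'n heis" where
  "polar p = (kap (snd p) *\<^sub>R fst p, (norm (fst p))\<^sup>2 * snd p * (kap (snd p))\<^sup>2)"

definition jac :: "'n::finite heis \<Rightarrow> real" where
  "jac p = (norm (fst p))\<^sup>2 * kap (snd p) ^ (2 * CARD('n) + 2)"

lemma one_plus_sq_pos: "1 + a\<^sup>2 > (0::real)" "sqrt (1 + a\<^sup>2) > 0" "sqrt (1 + a\<^sup>2) \<ge> 1"
  by (simp_all add: add_pos_nonneg)

lemma kap_pos: "kap a > 0" and kap_le_1: "kap a \<le> 1" and kap_sq: "(kap a)\<^sup>2 = 1 / sqrt (1 + a\<^sup>2)"
  and kap_4: "kap a ^ 4 = 1 / (1 + a\<^sup>2)"
proof -
  show "kap a > 0" unfolding kap_def using one_plus_sq_pos[of a] by simp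
  show "kap a \<le> 1" unfolding kap_def using one_plus_sq_pos[of a] by simp
  show 2: "(kap a)\<^sup>2 = 1 / sqrt (1 + a\<^sup>2)" unfolding kap_def using one_plus_sq_pos[of a] by (simp add: power_divide)
  have "kap a ^ 4 = ((kap a)\<^sup>2)\<^sup>2" by (simp flip: power_mult)
  then show "kap a ^ 4 = 1 / (1 + a\<^sup>2)" unfolding 2 using one_plus_sq_pos[of a] by (simp add: power_divide)
qed

lemma continuous_on_kap [continuous_intros]: "continuous_on S f \<Longrightarrow> continuous_on S (\<lambda>x. kap (f x))"
  unfolding kap_def by (intro continuous_intros) (auto simp: real_sqrt_eq_zero_cancel_iff add_nonneg_eq_0_iff)

lemma continuous_on_polar: "continuous_on UNIV polar" and continuous_on_jac: "continuous_on UNIV jac"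
  unfolding polar_def[abs_def] jac_def[abs_def] by (intro continuous_intros)+

lemma jac_nonneg: "jac p \<ge> 0" using kap_pos[of "snd p"] by (simp add: jac_def)

lemma polar_measurable [measurable]: "polar \<in> borel_measurable borel" and jac_measurable [measurable]: "jac \<in> borel_measurable borel"
  by (auto intro!: borel_measurable_continuous_onI continuous_on_polar continuous_on_jac)

text \<open>The substitution is a scaling of z by \<open>kap a\<close> at fixed a, followed by t =
  |z|^2 a at fixed z, with Jacobians kap(a)^(2n) and |z|^2; Fubini changes the order of integration
  in between.\<close>

lemma nn_integral_polar:
  fixes f :: "'n::finite heis \<Rightarrow> ennreal"
  assumes f[measurable]: "f \<in> borel_measurable borel"
  shows "(\<integral>\<^sup>+p. ennreal (jac p) * f (polar p) \<partial>lborel) = (\<integral>\<^sup>+x. f x \<partial>lborel)"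
proof -
  define n where "n = CARD('n)"
  have shear: "(\<lambda>p::'n heis. (fst p, (norm (fst p))\<^sup>2 * snd p)) \<in> borel_measurable borel"
    by (intro borel_measurable_continuous_onI continuous_intros)
  define g where "g p = ennreal ((norm (fst p))\<^sup>2) * f (fst p, (norm (fst p))\<^sup>2 * snd p)" for p :: "'n heis"
  have gm[measurable]: "g \<in> borel_measurable borel"
  proof -
    have "(\<lambda>p. f (fst p, (norm (fst p))\<^sup>2 * snd p)) \<in> borel_measurable borel" by (rule measurable_compose[OF shear f])
    moreover have "(\<lambda>p::'n heis. ennreal ((norm (fst p))\<^sup>2)) \<in> borel_measurable borel"
      by (intro measurable_compose[OF _ measurable_ennreal] borel_measurable_continuous_onI continuous_intros)
    ultimately show ?thesis unfolding g_def[abs_def] by (rule borel_measurable_times_ennreal[rotated])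
  qed
  define G where "G p = ennreal (jac p) * f (polar p)" for p
  have Gm[measurable]: "G \<in> borel_measurable borel" unfolding G_def[abs_def] by measurable
  have slice: "(\<lambda>z. h (z, a)) \<in> borel_measurable borel" if "h \<in> borel_measurable borel" for h :: "'n heis \<Rightarrow> ennreal" and a
    by (rule measurable_compose[OF _ that]) (auto intro!: borel_measurable_continuous_onI continuous_intros)
  have swap: "(\<integral>\<^sup>+x. h x \<partial>lborel) = (\<integral>\<^sup>+a. \<integral>\<^sup>+z. h (z, a) \<partial>lborel \<partial>lborel)" if h: "h \<in> borel_measurable borel" for h :: "'n heis \<Rightarrow> ennreal"
  proof -
    have "h \<in> borel_measurable (lborel \<Otimes>\<^sub>M lborel)" using h by (simp add: lborel_prod)
    then have "(\<integral>\<^sup>+a. \<integral>\<^sup>+z. h (z, a) \<partial>lborel \<partial>lborel) = (\<integral>\<^sup>+z. \<integral>\<^sup>+a. h (z, a) \<partial>lborel \<partial>lborel)"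
      by (intro lborel_pair.Fubini') simp
    then show ?thesis using nn_integral_heis[OF h] by simp
  qed
  have "(\<integral>\<^sup>+p. G p \<partial>lborel) = (\<integral>\<^sup>+a. \<integral>\<^sup>+z. G (z, a) \<partial>lborel \<partial>lborel)" by (rule swap[OF Gm])
  also have "\<dots> = (\<integral>\<^sup>+a. \<integral>\<^sup>+z. g (z, a) \<partial>lborel \<partial>lborel)"
  proof (rule nn_integral_cong)
    fix a :: real
    define k where "k = kap a"
    have k: "k > 0" by (simp add: k_def kap_pos)
    have "G (z, a) = ennreal (k ^ (2 * n)) * g (k *\<^sub>R z, a)" for z :: "complex ^ 'n"
    proof -
      have "jac (z, a) = k ^ (2 * n) * (norm (k *\<^sub>R z))\<^sup>2"
        using k by (simp add: jac_def k_def n_def power_mult_distrib power_add mult_ac power2_eq_square)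
      moreover have "polar (z, a) = (k *\<^sub>R z, (norm (k *\<^sub>R z))\<^sup>2 * a)"
        using k by (simp add: polar_def k_def power_mult_distrib mult_ac)
      ultimately show ?thesis using k by (simp add: G_def g_def ennreal_mult mult.assoc)
    qed
    then have "(\<integral>\<^sup>+z. G (z, a) \<partial>lborel) = (\<integral>\<^sup>+z. ennreal (k ^ (2 * n)) * g (k *\<^sub>R z, a) \<partial>lborel)" by simp
    also have "\<dots> = ennreal (k ^ (2 * n)) * (\<integral>\<^sup>+z. g (k *\<^sub>R z, a) \<partial>lborel)"
      by (rule nn_integral_cmult) (rule measurable_compose[OF _ slice[OF gm]], simp)
    also have "(\<integral>\<^sup>+z. g (k *\<^sub>R z, a) \<partial>lborel) = ennreal (1 / k ^ DIM(complex ^ 'n)) * (\<integral>\<^sup>+z. g (z, a) \<partial>lborel)"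
      by (rule nn_integral_scale[OF slice[OF gm] k])
    also have "ennreal (k ^ (2 * n)) * (ennreal (1 / k ^ DIM(complex ^ 'n)) * (\<integral>\<^sup>+z. g (z, a) \<partial>lborel)) =
        (ennreal (k ^ (2 * n)) * ennreal (1 / k ^ DIM(complex ^ 'n))) * (\<integral>\<^sup>+z. g (z, a) \<partial>lborel)"
      by (simp only: mult.assoc)
    also have "ennreal (k ^ (2 * n)) * ennreal (1 / k ^ DIM(complex ^ 'n)) = 1"
    proof -
      have "ennreal (k ^ (2 * n)) * ennreal (1 / k ^ DIM(complex ^ 'n)) = ennreal (k ^ (2 * n) * (1 / k ^ DIM(complex ^ 'n)))"
        using k by (intro ennreal_mult[symmetric]) auto
      also have "k ^ (2 * n) * (1 / k ^ DIM(complex ^ 'n)) = 1" using k by (simp add: n_def mult.commute)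
      finally show ?thesis by simp
    qed
    finally show "(\<integral>\<^sup>+z. G (z, a) \<partial>lborel) = (\<integral>\<^sup>+z. g (z, a) \<partial>lborel)" by simp
  qed
  also have "\<dots> = (\<integral>\<^sup>+p. g p \<partial>lborel)" by (rule swap[OF gm, symmetric])
  also have "\<dots> = (\<integral>\<^sup>+z. \<integral>\<^sup>+a. g (z, a) \<partial>lborel \<partial>lborel)" by (rule nn_integral_heis[OF gm])
  also have "\<dots> = (\<integral>\<^sup>+z. \<integral>\<^sup>+t. f (z, t) \<partial>lborel \<partial>lborel)"
  \<comment> \<open>The second substitution degenerates at z = 0, which is a null set.\<close>
  proof (rule nn_integral_cong_AE, rule eventually_mono[OF AE_lborel_singleton[of 0]])
    fix z :: "complex ^ 'n" assume z: "z \<noteq> 0"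
    define q where "q = (norm z)\<^sup>2"
    have q: "q > 0" using z by (simp add: q_def)
    have "(\<integral>\<^sup>+a. g (z, a) \<partial>lborel) = (\<integral>\<^sup>+a. ennreal q * f (z, q *\<^sub>R a) \<partial>lborel)" by (simp add: g_def q_def)
    also have "\<dots> = ennreal q * (\<integral>\<^sup>+a. f (z, q *\<^sub>R a) \<partial>lborel)"
      by (rule nn_integral_cmult) (rule measurable_compose[OF _ measurable_heis_slice(1)[OF f]], simp)
    also have "(\<integral>\<^sup>+a. f (z, q *\<^sub>R a) \<partial>lborel) = ennreal (1 / q) * (\<integral>\<^sup>+t. f (z, t) \<partial>lborel)"
      using nn_integral_scale[OF measurable_heis_slice(1)[OF f] q, of z] by simp
    also have "ennreal q * (ennreal (1 / q) * (\<integral>\<^sup>+t. f (z, t) \<partial>lborel)) = (ennreal q * ennreal (1 / q)) * (\<integral>\<^sup>+t. f (z, t) \<partial>lborel)"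
      by (simp only: mult.assoc)
    also have "ennreal q * ennreal (1 / q) = 1"
    proof -
      have "ennreal q * ennreal (1 / q) = ennreal (q * (1 / q))" using q by (intro ennreal_mult[symmetric]) auto
      then show ?thesis using q by simp
    qed
    finally show "(\<integral>\<^sup>+a. g (z, a) \<partial>lborel) = (\<integral>\<^sup>+t. f (z, t) \<partial>lborel)" by simp
  qed
  also have "\<dots> = (\<integral>\<^sup>+x. f x \<partial>lborel)" by (rule nn_integral_heis[OF f, symmetric])
  finally show ?thesis by (simp add: G_def)
qed

lemma distr_polar: "distr (density lborel (\<lambda>p. ennreal (jac p))) borel polar = (lborel :: 'n::finite heis measure)"
proof (rule measure_eqI)
  let ?D = "density lborel (\<lambda>p::'n heis. ennreal (jac p))"
  fix A assume "A \<in> sets (distr ?D borel polar)"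
  then have A[measurable]: "A \<in> sets borel" by simp
  have m: "polar \<in> measurable ?D borel" by simp
  have "emeasure (distr ?D borel polar) A = (\<integral>\<^sup>+x. indicator A x \<partial>distr ?D borel polar)"
    by (simp add: nn_integral_indicator)
  also have "\<dots> = (\<integral>\<^sup>+p. indicator A (polar p) \<partial>?D)" by (rule nn_integral_distr[OF m]) simp
  also have "\<dots> = (\<integral>\<^sup>+p. ennreal (jac p) * indicator A (polar p) \<partial>lborel)" by (rule nn_integral_density) auto
  also have "\<dots> = (\<integral>\<^sup>+x. indicator A x \<partial>lborel)" by (rule nn_integral_polar) auto
  finally show "emeasure (distr ?D borel polar) A = emeasure lborel A" by simp
qed simp

lemma
  fixes f :: "'n::finite heis \<Rightarrow> real"
  assumes [measurable]: "f \<in> borel_measurable borel"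
  shows integral_polar: "(\<integral>x. f x \<partial>lborel) = (\<integral>p. jac p * f (polar p) \<partial>lborel)"
    and integrable_polar: "integrable lborel f \<longleftrightarrow> integrable lborel (\<lambda>p. jac p * f (polar p))"
proof -
  let ?D = "density lborel (\<lambda>p::'n heis. ennreal (jac p))"
  have m: "polar \<in> measurable ?D borel" by simp
  have "(\<integral>x. f x \<partial>lborel) = (\<integral>p. f (polar p) \<partial>?D)"
    using integral_distr[OF m, of f] by (simp add: distr_polar)
  also have "\<dots> = (\<integral>p. jac p *\<^sub>R f (polar p) \<partial>lborel)"
    by (rule integral_density) (auto simp: jac_nonneg)
  finally show "(\<integral>x. f x \<partial>lborel) = (\<integral>p. jac p * f (polar p) \<partial>lborel)" by simp
  have "integrable lborel f \<longleftrightarrow> integrable ?D (\<lambda>p. f (polar p))"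
    using integrable_distr_eq[OF m, of f] by (simp add: distr_polar)
  also have "\<dots> \<longleftrightarrow> integrable lborel (\<lambda>p. jac p *\<^sub>R f (polar p))"
    by (rule integrable_density) (auto simp: jac_nonneg)
  finally show "integrable lborel f \<longleftrightarrow> integrable lborel (\<lambda>p. jac p * f (polar p))" by simp
qed

section \<open>The kernel in gauge polar coordinates\<close>

definition vec1 :: "complex ^ 'n::finite" where "vec1 = axis undefined 1"

lemma norm_vec1: "norm (vec1 :: complex ^ 'n::finite) = 1"
  by (simp add: vec1_def)

text \<open>Real part of the kernel at \<open>polar (z, a)\<close> for |z|^2 = y. The kernel sees z
  through |z| only, so one unit vector represents all directions.\<close>

definition prof :: "'n::finite itself \<Rightarrow> real \<Rightarrow> real \<Rightarrow> real" where
  "prof N y a = Re (ker 0 0 ((sqrt y * kap a) *\<^sub>R (vec1 :: complex ^ 'n), y * a * (kap a)\<^sup>2))"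

lemma ker_radial:
  fixes x y :: "'n::finite heis"
  assumes "norm (fst x) = norm (fst y)" "snd x = snd y"
  shows "ker j l x = ker j l y"
  using assms by (simp add: ker_def)

lemma heat_polar:
  fixes p :: "'n::finite heis"
  assumes \<tau>: "\<tau> > 0"
  shows "heat c \<tau> (polar p) = ((1 / \<tau>) ^ (CARD('n) + 1) * prof TYPE('n) ((norm (fst p))\<^sup>2 / \<tau>) (snd p)) *\<^sub>R c"
proof -
  have "ker 0 0 (dil \<tau> (polar p)) = ker 0 0 ((sqrt ((norm (fst p))\<^sup>2 / \<tau>) * kap (snd p)) *\<^sub>R (vec1 :: complex ^ 'n), (norm (fst p))\<^sup>2 / \<tau> * snd p * (kap (snd p))\<^sup>2)"
    using \<tau> by (intro ker_radial) (simp_all add: dil_def polar_def norm_vec1 abs_mult real_sqrt_divide)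
  then show ?thesis by (simp add: heat_def prof_def)
qed

text \<open>The bound is uniform in a: the gauge (|z|^4 + t^2)^(1/2) of the point is y for every a,
  and sqrt (1 + a^2) \<le> 1 + |a| compares the excess with it.\<close>

lemma prof_excess: assumes "y \<ge> 0"
  shows "excess ((sqrt y * kap a) *\<^sub>R (vec1 :: complex ^ 'n::finite), y * a * (kap a)\<^sup>2) \<ge> y / 16"
proof -
  have s: "sqrt (1 + a\<^sup>2) \<le> 1 + \<bar>a\<bar>"
    by (rule real_le_lsqrt) (auto simp: power2_eq_square algebra_simps abs_mult_self_eq)
  have "excess ((sqrt y * kap a) *\<^sub>R (vec1 :: complex ^ 'n), y * a * (kap a)\<^sup>2) = y * (kap a)\<^sup>2 / 16 + y * \<bar>a\<bar> * (kap a)\<^sup>2"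
    using assms by (simp add: excess_def norm_vec1 power_mult_distrib abs_mult)
  also have "\<dots> \<ge> y / 16 * ((1 + \<bar>a\<bar>) * (kap a)\<^sup>2)"
    using assms mult_nonneg_nonneg[OF mult_nonneg_nonneg[OF assms abs_ge_zero[of a]] zero_le_power2[of "kap a"]]
    by (simp add: algebra_simps)
  moreover have "(1 + \<bar>a\<bar>) * (kap a)\<^sup>2 \<ge> 1"
    unfolding kap_sq using s one_plus_sq_pos[of a] by (simp add: field_simps)
  then have "y / 16 * ((1 + \<bar>a\<bar>) * (kap a)\<^sup>2) \<ge> y / 16 * 1" using assms by (intro mult_left_mono) auto
  ultimately show ?thesis by simp
qed

lemma prof_bound: "y \<ge> 0 \<Longrightarrow> \<bar>prof TYPE('n::finite) y a\<bar> \<le> heatC TYPE('n) * exp (- y / 16)"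
proof -
  assume y: "y \<ge> 0"
  let ?x = "((sqrt y * kap a) *\<^sub>R (vec1 :: complex ^ 'n), y * a * (kap a)\<^sup>2)"
  have "\<bar>prof TYPE('n) y a\<bar> \<le> norm (ker 0 0 ?x)" unfolding prof_def by (rule abs_Re_le_cmod)
  also have "\<dots> \<le> heatC TYPE('n) * exp (- excess ?x)" by (rule norm_ker_le)
  also have "\<dots> \<le> heatC TYPE('n) * exp (- y / 16)"
    using prof_excess[OF y, of a, where 'n='n] by (intro mult_left_mono heatC_nonneg) auto
  finally show ?thesis .
qed

lemma continuous_on_prof: "continuous_on UNIV (\<lambda>p. prof TYPE('n::finite) (fst p) (snd p))"
  unfolding prof_def
  by (intro continuous_intros continuous_on_compose2[OF continuous_on_ker]) auto

text \<open>At the origin the oscillating and Gaussian factors are 1, and the integrand (x / sinh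
  x)^n is positive.\<close>

lemma ker_0_pos: "Re (ker 0 0 (0 :: 'n::finite heis)) > 0"
proof -
  let ?k = "\<lambda>r. kint TYPE('n) 0 0 0 0 (of_real r)"
  have e: "ker 0 0 (0 :: 'n heis) = (\<integral>r. ?k r \<partial>lborel)" by (simp add: ker_def)
  have i: "integrable lborel ?k" by (rule integrable_kint) simp
  have sh: "shc (of_real r) = of_real (if r = 0 then 1 else sinh r / r)" for r :: real
    by (simp add: shc_def sinh_def exp_of_real scaleR_conv_of_real flip: of_real_minus)
  have pos: "Re (?k r) > 0" for r
  proof -
    have p: "(if r = 0 then 1 else sinh r / r) > 0"
    proof (cases "r > 0")
      case False then show ?thesis by (cases "r = 0") (auto simp: divide_neg_neg)
    qed auto
    have "?k r = of_real ((1 / (if r = 0 then 1 else sinh r / r)) ^ CARD('n))"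
      unfolding kint_def wt_def sh by simp
    then show ?thesis using p by (simp add: Re_complex_of_real del: of_real_power of_real_divide) 
  qed
  have "Re (ker 0 0 (0 :: 'n heis)) = (\<integral>r. Re (?k r) \<partial>lborel)" unfolding e using i by (simp add: integral_Re)
  moreover have "(\<integral>r. Re (?k r) \<partial>lborel) \<noteq> 0"
  proof
    assume "(\<integral>r. Re (?k r) \<partial>lborel) = 0"
    then have "AE r in lborel. Re (?k r) = 0"
      using i pos by (subst (asm) integral_nonneg_eq_0_iff_AE) (auto intro: less_imp_le)
    then have "AE r in (lborel :: real measure). False" using pos by (auto elim!: eventually_mono simp: less_le)
    then show False by (simp add: eventually_False ae_filter_eq_bot_iff)
  qed
  moreover have "(\<integral>r. Re (?k r) \<partial>lborel) \<ge> 0" using pos by (intro Bochner_Integration.integral_nonneg) (auto intro: less_imp_le)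
  ultimately show ?thesis by linarith
qed

text \<open>As y tends to 0 the points approach the origin uniformly in a, because both kap(a) and
  |a| kap(a)^2 are at most 1.\<close>

lemma prof_pos: "\<exists>\<delta>>0. \<forall>y a. 0 \<le> y \<longrightarrow> y < \<delta> \<longrightarrow> prof TYPE('n::finite) y a > 0"
proof -
  have "continuous_on UNIV (\<lambda>x::'n heis. Re (ker 0 0 x))" by (intro continuous_intros continuous_on_ker)
  then have "isCont (\<lambda>x::'n heis. Re (ker 0 0 x)) 0" by (rule continuous_on_interior) simp
  then have "eventually (\<lambda>x::'n heis. Re (ker 0 0 x) > 0) (at 0)"
    unfolding isCont_def using ker_0_pos by (rule order_tendstoD(1))
  then obtain d where d: "d > 0" "\<And>x::'n heis. norm x < d \<Longrightarrow> x \<noteq> 0 \<Longrightarrow> Re (ker 0 0 x) > 0"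
    unfolding eventually_at by auto
  define \<delta> where "\<delta> = min 1 ((d / 2)\<^sup>2)"
  have "prof TYPE('n) y a > 0" if y: "0 \<le> y" "y < \<delta>" for y a
  proof -
    let ?x = "((sqrt y * kap a) *\<^sub>R (vec1 :: complex ^ 'n), y * a * (kap a)\<^sup>2)"
    have sy: "sqrt y < d / 2" using y d(1) by (intro real_less_lsqrt) (auto simp: \<delta>_def)
    have "y = sqrt y * sqrt y" using y by simp
    also have "\<dots> \<le> sqrt y * 1" using y by (intro mult_left_mono) (auto simp: \<delta>_def)
    finally have yy: "y \<le> sqrt y" by simp
    have ak: "\<bar>a\<bar> * (kap a)\<^sup>2 \<le> 1"
    proof -
      have "\<bar>a\<bar> \<le> sqrt (1 + a\<^sup>2)" by (rule real_le_rsqrt) simp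
      then show ?thesis unfolding kap_sq using one_plus_sq_pos[of a] by simp
    qed
    have "norm ?x \<le> norm (fst ?x) + norm (snd ?x)" by (metis norm_Pair_le prod.collapse)
    also have "\<dots> = sqrt y * kap a + y * (\<bar>a\<bar> * (kap a)\<^sup>2)"
      using y kap_pos[of a] by (simp add: norm_vec1 abs_mult)
    also have "\<dots> \<le> sqrt y * 1 + y * 1" using y kap_le_1[of a] ak by (intro add_mono mult_left_mono) auto
    also have "\<dots> < d" using sy yy by simp
    finally have "norm ?x < d" .
    then show ?thesis unfolding prof_def using d(2)[of ?x] ker_0_pos[where 'n='n] by (cases "?x = 0") auto
  qed
  then show ?thesis using d(1) by (intro exI[of _ \<delta>]) (auto simp: \<delta>_def)
qed

subsection \<open>The Mellin transform of the heat evolution\<close>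

lemma AE_lborel_open:
  fixes S :: "'a::euclidean_space set"
  assumes "AE x in lborel. P x" "open S" "S \<noteq> {}"
  shows "\<exists>x\<in>S. P x"
proof (rule ccontr)
  assume "\<not> (\<exists>x\<in>S. P x)"
  then have "S \<subseteq> {x \<in> space lborel. \<not> P x}" by auto
  moreover obtain N where N: "{x \<in> space lborel. \<not> P x} \<subseteq> N" "emeasure lborel N = 0" "N \<in> sets lborel"
    using assms(1) by (rule AE_E)
  ultimately have "S \<subseteq> N" by blast
  moreover have "negligible N"
    using N by (auto simp: negligible_iff_null_sets null_sets_def null_sets_completionI)
  ultimately show False using open_not_negligible[OF assms(2,3)] negligible_subset by blast
qed

lemma
  fixes f :: "'a::euclidean_space \<Rightarrow> real" and g :: "'b::euclidean_space \<Rightarrow> real"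
  assumes f: "integrable lborel f" and g: "integrable lborel g"
  shows integrable_lborel_times: "integrable lborel (\<lambda>p. f (fst p) * g (snd p))"
    and integral_lborel_times: "(\<integral>p. f (fst p) * g (snd p) \<partial>lborel) = (\<integral>x. f x \<partial>lborel) * (\<integral>y. g y \<partial>lborel)"
proof -
  have [measurable]: "f \<in> borel_measurable borel" "g \<in> borel_measurable borel"
    using borel_measurable_integrable[OF f] borel_measurable_integrable[OF g] by simp_all
  have i: "integrable (lborel \<Otimes>\<^sub>M lborel) (\<lambda>p. f (fst p) * g (snd p))"
  proof (rule lborel_pair.Fubini_integrable)
    have "integrable lborel (\<lambda>x. \<bar>f x\<bar> * (\<integral>y. \<bar>g y\<bar> \<partial>lborel))" using f by simp
    then show "integrable lborel (\<lambda>x. \<integral>y. norm (f (fst (x, y)) * g (snd (x, y))) \<partial>lborel)"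
      by (simp add: abs_mult)
  qed (use g in auto)
  then show "integrable lborel (\<lambda>p. f (fst p) * g (snd p))" by (simp add: lborel_prod)
  show "(\<integral>p. f (fst p) * g (snd p) \<partial>lborel) = (\<integral>x. f x \<partial>lborel) * (\<integral>y. g y \<partial>lborel)"
    using lborel_pair.integral_fst'[OF i] by (simp add: lborel_prod)
qed

text \<open>The kernel factor in the variables w = (a, \<sigma>), where \<tau> = |z|^2 \<sigma>. The
  exponent n + 2 is the n + 1 of the heat kernel plus 1 from the Mellin measure d\<sigma> /
  \<sigma>.\<close>

definition mker :: "'n::finite itself \<Rightarrow> real \<times> real \<Rightarrow> real" where
  "mker N w = (if snd w > 0 then kap (fst w) ^ (2 * CARD('n) + 2) * (1 / snd w) ^ (CARD('n) + 2) * prof TYPE('n) (1 / snd w) (fst w) else 0)"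

lemma prof_measurable [measurable]:
  "(\<lambda>p. prof TYPE('n::finite) (fst p) (snd p)) \<in> borel_measurable borel"
  by (rule borel_measurable_continuous_onI[OF continuous_on_prof])

lemma kap_measurable [measurable]: "kap \<in> borel_measurable borel"
  by (intro borel_measurable_continuous_onI continuous_intros)

lemma mker_measurable [measurable]: "mker TYPE('n::finite) \<in> borel_measurable borel"
proof -
  have 1: "(\<lambda>w::real \<times> real. (1 / snd w, fst w)) \<in> borel_measurable borel"
    by (intro borel_measurable_Pair borel_measurable_divide borel_measurable_continuous_onI continuous_intros)
  have [measurable]: "(\<lambda>w. prof TYPE('n) (1 / snd w) (fst w)) \<in> borel_measurable borel"
    using measurable_compose[OF 1 prof_measurable[where 'n='n]] by simp
  have [measurable]: "(\<lambda>w::real \<times> real. fst w) \<in> borel_measurable borel" "(\<lambda>w::real \<times> real. snd w) \<in> borel_measurable borel"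
    by (intro borel_measurable_continuous_onI continuous_intros)+
  have [measurable]: "(\<lambda>w::real \<times> real. kap (fst w)) \<in> borel_measurable borel"
    by (rule measurable_compose[OF _ kap_measurable]) measurable
  show ?thesis unfolding mker_def[abs_def] by measurable
qed

lemma exp_ln_le_max: assumes "0 < x" "0 \<le> \<zeta>" "\<zeta> \<le> 1" shows "exp (\<zeta> * ln x) \<le> 1 + (x::real)"
proof (cases "x \<le> 1")
  case True
  then have "\<zeta> * ln x \<le> 0" using assms by (intro mult_nonneg_nonpos) auto
  then have "exp (\<zeta> * ln x) \<le> 1" by simp
  then show ?thesis using assms(1) by linarith
next
  case False
  then have "\<zeta> * ln x \<le> 1 * ln x" using assms by (intro mult_right_mono) auto
  then have "exp (\<zeta> * ln x) \<le> exp (1 * ln x)" by simp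
  then show ?thesis using assms by simp
qed

text \<open>For small \<sigma> the factor exp(-1 / (16 \<sigma>)) beats every power; for large
  \<sigma> the power \<sigma>^(-(n+2)) with n \<ge> 1 compensates (1 + \<sigma>)(1 + \<sigma>^2). In
  a the bound is \<open>kap_4\<close>.\<close>

lemma mker_bound:
  assumes \<zeta>: "0 < \<zeta>" "\<zeta> < 1"
  shows "\<exists>D. \<forall>a \<sigma>. \<bar>mker TYPE('n::finite) (a, \<sigma>) * exp (\<zeta> * ln \<sigma>)\<bar> \<le> D * (1 / (1 + a\<^sup>2) * (1 / (1 + \<sigma>\<^sup>2)))"
proof -
  define n where "n = CARD('n)"
  define K where "K = 16 ^ (n + 2) * fact (n + 2) * exp (1 / 16 :: real)"
  define D where "D = heatC TYPE('n) * K"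
  have n: "n \<ge> 1" by (simp add: n_def Suc_leI)
  have K: "K \<ge> 0" by (simp add: K_def)
  have D: "D \<ge> 0" by (simp add: D_def heatC_nonneg K)
  have "\<bar>mker TYPE('n) (a, \<sigma>) * exp (\<zeta> * ln \<sigma>)\<bar> \<le> D * (1 / (1 + a\<^sup>2) * (1 / (1 + \<sigma>\<^sup>2)))" for a \<sigma>
  proof (cases "\<sigma> > 0")
    case False
    then show ?thesis using D by (simp add: mker_def add_nonneg_nonneg)
  next
    case \<sigma>: True
    define u where "u = 1 / \<sigma>"
    have u: "u > 0" "\<sigma> = 1 / u" using \<sigma> by (simp_all add: u_def)
    have k: "kap a ^ (2 * n + 2) \<le> 1 / (1 + a\<^sup>2)"
      unfolding kap_4[symmetric] using n kap_pos[of a] kap_le_1[of a] by (intro power_decreasing) auto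
    have "u ^ (n + 2) * ((1 + \<sigma>) * (1 + \<sigma>\<^sup>2)) = u ^ (n - 1) * ((1 + u) * (1 + u\<^sup>2))"
    proof -
      obtain m where m: "n = Suc m" using n by (cases n) auto
      show ?thesis using u(1) unfolding u(2) m by (simp add: field_simps power2_eq_square power3_eq_cube)
    qed
    also have "\<dots> \<le> (1 + u) ^ (n - 1) * ((1 + u) * (1 + u)\<^sup>2)"
      using u(1) by (intro mult_mono power_mono) (auto simp: power2_eq_square algebra_simps)
    also have "\<dots> = (1 + u) ^ (n + 2)"
    proof -
      obtain m where m: "n = Suc m" using n by (cases n) auto
      show ?thesis unfolding m by (simp add: power2_eq_square)
    qed
    also have "\<dots> = 16 ^ (n + 2) * ((1 + u) / 16) ^ (n + 2)" by (simp only: power_divide) simp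
    also have "\<dots> \<le> 16 ^ (n + 2) * (fact (n + 2) * exp ((1 + u) / 16))"
      using u(1) by (intro mult_left_mono power_le_exp) auto
    also have "\<dots> = K * exp (u / 16)" by (simp only: K_def add_divide_distrib exp_add mult.assoc)
    finally have le: "u ^ (n + 2) * ((1 + \<sigma>) * (1 + \<sigma>\<^sup>2)) \<le> K * exp (u / 16)" .
    have "u ^ (n + 2) * exp (\<zeta> * ln \<sigma>) * exp (- u / 16) \<le> u ^ (n + 2) * (1 + \<sigma>) * exp (- u / 16)"
      using u(1) \<sigma> \<zeta> by (intro mult_right_mono mult_left_mono exp_ln_le_max) auto
    also have "\<dots> = (u ^ (n + 2) * ((1 + \<sigma>) * (1 + \<sigma>\<^sup>2))) * exp (- u / 16) / (1 + \<sigma>\<^sup>2)"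
    proof -
      have "1 + \<sigma>\<^sup>2 \<noteq> 0" using one_plus_sq_pos(1)[of \<sigma>] by simp
      then show ?thesis by simp
    qed
    also have "\<dots> \<le> (K * exp (u / 16)) * exp (- u / 16) / (1 + \<sigma>\<^sup>2)"
      using le one_plus_sq_pos(1)[of \<sigma>] by (intro divide_right_mono mult_right_mono) auto
    also have "(K * exp (u / 16)) * exp (- u / 16) = K" by (simp add: mult.assoc flip: exp_add)
    finally have B: "u ^ (n + 2) * exp (\<zeta> * ln \<sigma>) * exp (- u / 16) \<le> K / (1 + \<sigma>\<^sup>2)" .
    have "\<bar>mker TYPE('n) (a, \<sigma>) * exp (\<zeta> * ln \<sigma>)\<bar> = kap a ^ (2 * n + 2) * (u ^ (n + 2) * exp (\<zeta> * ln \<sigma>) * \<bar>prof TYPE('n) u a\<bar>)"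
      using \<sigma> u(1) kap_pos[of a] by (simp add: mker_def n_def u_def abs_mult mult_ac)
    also have "\<dots> \<le> kap a ^ (2 * n + 2) * (u ^ (n + 2) * exp (\<zeta> * ln \<sigma>) * (heatC TYPE('n) * exp (- u / 16)))"
      using u(1) kap_pos[of a] by (intro mult_left_mono prof_bound) auto
    also have "\<dots> = kap a ^ (2 * n + 2) * (heatC TYPE('n) * (u ^ (n + 2) * exp (\<zeta> * ln \<sigma>) * exp (- u / 16)))"
      by (simp only: mult_ac)
    also have "\<dots> \<le> 1 / (1 + a\<^sup>2) * (heatC TYPE('n) * (K / (1 + \<sigma>\<^sup>2)))"
      using u(1) one_plus_sq_pos(1)[of a] by (intro mult_mono mult_left_mono B k heatC_nonneg mult_nonneg_nonneg) auto
    finally show ?thesis by (simp add: D_def)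
  qed
  then show ?thesis by blast
qed

lemma mker_integrable:
  assumes \<zeta>: "0 < \<zeta>" "\<zeta> < 1"
  shows "integrable lborel (\<lambda>w. mker TYPE('n::finite) w * exp (\<zeta> * ln (snd w)))"
proof -
  obtain D where D: "\<And>a \<sigma>. \<bar>mker TYPE('n) (a, \<sigma>) * exp (\<zeta> * ln \<sigma>)\<bar> \<le> D * (1 / (1 + a\<^sup>2) * (1 / (1 + \<sigma>\<^sup>2)))"
    using mker_bound[OF \<zeta>] by blast
  have "integrable lborel (\<lambda>w::real \<times> real. D * (1 / (1 + (fst w)\<^sup>2) * (1 / (1 + (snd w)\<^sup>2))))"
    by (intro integrable_mult_right integrable_lborel_times integrable_one_over_one_plus_sq)
  then show ?thesis
  proof (rule Bochner_Integration.integrable_bound)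
    have [measurable]: "(\<lambda>w::real \<times> real. snd w) \<in> borel_measurable borel"
      by (intro borel_measurable_continuous_onI continuous_intros)
    show "(\<lambda>w. mker TYPE('n) w * exp (\<zeta> * ln (snd w))) \<in> borel_measurable lborel" by measurable
    show "AE w in lborel. norm (mker TYPE('n) w * exp (\<zeta> * ln (snd w))) \<le> norm (D * (1 / (1 + (fst w)\<^sup>2) * (1 / (1 + (snd w)\<^sup>2))))"
    proof (rule AE_I2)
      fix w :: "real \<times> real"
      have "norm (mker TYPE('n) w * exp (\<zeta> * ln (snd w))) \<le> D * (1 / (1 + (fst w)\<^sup>2) * (1 / (1 + (snd w)\<^sup>2)))"
        using D[of "fst w" "snd w"] by simp
      then show "norm (mker TYPE('n) w * exp (\<zeta> * ln (snd w))) \<le> norm (D * (1 / (1 + (fst w)\<^sup>2) * (1 / (1 + (snd w)\<^sup>2))))"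
        unfolding real_norm_def using abs_ge_self order_trans by blast
    qed
  qed
qed

text \<open>If the transform vanished on all of (0, 1/2), uniqueness would permit restricting the
  integral to large \<sigma>. There the kernel is evaluated close to the origin, where
  \<open>prof_pos\<close> makes it positive.\<close>

lemma mker_mellin_nonzero:
  "\<exists>\<zeta>. 0 < \<zeta> \<and> \<zeta> < 1/2 \<and> (\<integral>w. mker TYPE('n::finite) w * exp (\<zeta> * ln (snd w)) \<partial>lborel) \<noteq> 0"
proof (rule ccontr)
  assume "\<not> ?thesis"
  then have zero: "(\<integral>w. mker TYPE('n) w * exp (\<zeta> * ln (snd w)) \<partial>lborel) = 0" if "0 < \<zeta>" "\<zeta> < 1/2" for \<zeta>
    using that by blast
  obtain \<delta> where \<delta>: "\<delta> > 0" "\<And>y a. 0 \<le> y \<Longrightarrow> y < \<delta> \<Longrightarrow> prof TYPE('n) y a > 0" using prof_pos by blast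
  define B where "B = {ln (1 / \<delta>)<..}"
  define I where "I w = indicator B (ln (snd w)) * (mker TYPE('n) w * exp (1/4 * ln (snd w)))" for w
  have [measurable]: "(\<lambda>w::real \<times> real. snd w) \<in> borel_measurable borel"
    by (intro borel_measurable_continuous_onI continuous_intros)
  have I0: "(\<integral>w. I w \<partial>lborel) = 0" unfolding I_def
    by (rule laplace_zero_imp_zero[where a = 0 and b = "1/2"]) (auto simp: B_def intro!: mker_integrable zero)
  have big: "1 / snd w < \<delta>" if "snd w > 0" "ln (snd w) \<in> B" for w :: "real \<times> real"
    using that \<delta>(1) unfolding B_def greaterThan_iff by (simp add: field_simps)
  have I_nn: "I w \<ge> 0" for w
    using big[of w] \<delta>(2)[of "1 / snd w" "fst w"] kap_pos[of "fst w"] by (auto simp: I_def indicator_def mker_def)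
  have "(\<lambda>w::real \<times> real. indicator B (ln (snd w)) :: real) \<in> borel_measurable borel"
    by (rule measurable_compose[OF borel_measurable_ln borel_measurable_indicator]) (simp_all add: B_def)
  moreover have "(\<lambda>w. mker TYPE('n) w * exp (1/4 * ln (snd w))) \<in> borel_measurable borel" by measurable
  ultimately have Im: "I \<in> borel_measurable lborel"
    unfolding I_def[abs_def] measurable_lborel2 by (rule borel_measurable_times)
  have "integrable lborel I"
    by (rule Bochner_Integration.integrable_bound[OF mker_integrable[of "1/4", where 'n='n]])
       (use Im in \<open>auto simp: I_def indicator_def\<close>)
  then have AE: "AE w in lborel. I w = 0" using I0 I_nn by (subst (asm) integral_nonneg_eq_0_iff_AE) auto
  have "open {w::real \<times> real. snd w > 1 / \<delta>}" by (intro open_Collect_less continuous_intros)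
  moreover have "(0, 1 / \<delta> + 1) \<in> {w::real \<times> real. snd w > 1 / \<delta>}" by simp
  ultimately obtain w :: "real \<times> real" where w: "snd w > 1 / \<delta>" "I w = 0" using AE_lborel_open[OF AE] by blast
  have "snd w > 0" using w(1) \<delta>(1) by (meson divide_pos_pos less_trans zero_less_one)
  moreover have "ln (snd w) \<in> B" using w(1) \<delta>(1) \<open>snd w > 0\<close> unfolding B_def greaterThan_iff by (subst ln_less_cancel_iff) auto
  ultimately show False
    using w(2) \<delta>(2)[of "1 / snd w" "fst w"] big[of w] kap_pos[of "fst w"] by (auto simp: I_def indicator_def mker_def)
qed

section \<open>Functions of the gauge and the radial Mellin factor\<close>

lemma gauge_symmetric:
  fixes f :: "'n::finite heis \<Rightarrow> complex"
  assumes sym: "\<And>\<rho> \<omega> \<theta>. \<lbrakk>0 < \<rho>; norm \<omega> = 1; 0 \<le> \<theta>; \<theta> \<le> pi\<rbrakk> \<Longrightarrow>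
           f ((\<rho> * sqrt (sin \<theta>)) *\<^sub>R \<omega>, \<rho>\<^sup>2 * cos \<theta>) = f (\<rho> *\<^sub>R \<omega>, 0)"
  shows "f (z, t) = f (0, sqrt (norm z ^ 4 + t\<^sup>2))"
proof (cases "norm z ^ 4 + t\<^sup>2 = 0")
  case True
  then show ?thesis using add_nonneg_eq_0_iff[of "norm z ^ 4" "t\<^sup>2"] by auto
next
  case False
  define r where "r = sqrt (norm z ^ 4 + t\<^sup>2)"
  define \<omega> where "\<omega> = (if z = 0 then vec1 else (1 / norm z) *\<^sub>R z)"
  have nn: "norm z ^ 4 + t\<^sup>2 > 0" using False by (smt (verit) zero_le_power norm_ge_zero zero_le_power2)
  then have r: "r > 0" by (simp add: r_def)
  have r2: "r\<^sup>2 = norm z ^ 4 + t\<^sup>2" using nn by (simp add: r_def)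
  have \<omega>: "norm \<omega> = 1" "norm z *\<^sub>R \<omega> = z" by (auto simp: \<omega>_def norm_vec1)
  have "\<bar>t\<bar> \<le> r" by (rule power2_le_imp_le) (use r2 r in auto)
  then have tr: "-1 \<le> t / r" "t / r \<le> 1" using r by (auto simp: field_simps)
  have "1 - (t / r)\<^sup>2 = norm z ^ 4 / r\<^sup>2"
    unfolding power_divide r2 using nn by (simp add: field_simps)
  also have "\<dots> = (norm z ^ 2 / r)\<^sup>2" by (simp add: power_divide flip: power_mult)
  finally have "1 - (t / r)\<^sup>2 = (norm z ^ 2 / r)\<^sup>2" .
  then have s: "sin (arccos (t / r)) = (norm z)\<^sup>2 / r" using sin_arccos[OF tr] r by (simp add: real_sqrt_abs)
  have "sqrt r * sqrt ((norm z)\<^sup>2 / r) = norm z" using r by (simp add: real_sqrt_divide)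
  \<comment> \<open>The hypothesis is applied with \<rho> = sqrt r and \<theta> = arccos (t / r),
    and afterwards with \<theta> = 0, which carries the point to the t-axis.\<close>
  then have "f (z, t) = f ((sqrt r * sqrt (sin (arccos (t / r)))) *\<^sub>R \<omega>, (sqrt r)\<^sup>2 * cos (arccos (t / r)))"
    unfolding s using r tr by (simp add: \<omega> cos_arccos)
  also have "\<dots> = f (sqrt r *\<^sub>R \<omega>, 0)"
    using arccos_bounded[OF tr] r \<omega> by (intro sym) auto
  also have "\<dots> = f (0, r)"
    using sym[of "sqrt r" \<omega> 0] r \<omega> by simp
  finally show ?thesis by (simp add: r_def)
qed

lemma gauge_symmetric_polar:
  assumes "\<And>z t. f (z, t) = f (0, sqrt (norm z ^ 4 + t\<^sup>2))"
  shows "f (polar p) = f (0, (norm (fst p))\<^sup>2)"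
proof -
  obtain z a where p: "p = (z, a)" by (cases p)
  have "norm (kap a *\<^sub>R z) ^ 4 + ((norm z)\<^sup>2 * a * (kap a)\<^sup>2)\<^sup>2 = norm z ^ 4 * (kap a ^ 4 * (1 + a\<^sup>2))"
    using kap_pos[of a] by (simp add: power_mult_distrib algebra_simps flip: power_mult)
  also have "kap a ^ 4 * (1 + a\<^sup>2) = 1" using one_plus_sq_pos(1)[of a] by (simp add: kap_4)
  also have "norm z ^ 4 * 1 = ((norm z)\<^sup>2)\<^sup>2" by (simp flip: power_mult)
  finally have e: "norm (kap a *\<^sub>R z) ^ 4 + ((norm z)\<^sup>2 * a * (kap a)\<^sup>2)\<^sup>2 = ((norm z)\<^sup>2)\<^sup>2" .
  have "polar p = (kap a *\<^sub>R z, (norm z)\<^sup>2 * a * (kap a)\<^sup>2)" by (simp add: p polar_def)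
  moreover have "sqrt (((norm z)\<^sup>2)\<^sup>2) = (norm (fst p))\<^sup>2" unfolding real_sqrt_abs by (simp add: p)
  ultimately show ?thesis using assms[of "kap a *\<^sub>R z" "(norm z)\<^sup>2 * a * (kap a)\<^sup>2", unfolded e] by (simp only:)
qed

definition inv_sq_prod :: "'a::euclidean_space \<Rightarrow> real" where
  "inv_sq_prod z = (\<Prod>b\<in>Basis. 1 / (1 + (z \<bullet> b)\<^sup>2))"

lemma inv_sq_prod_integrable: "integrable lborel (inv_sq_prod :: 'a::euclidean_space \<Rightarrow> real)"
proof (rule integrableI_nonneg)
  show "(inv_sq_prod :: 'a \<Rightarrow> real) \<in> borel_measurable lborel"
    unfolding inv_sq_prod_def[abs_def] by measurable
  show "(\<integral>\<^sup>+z. ennreal (inv_sq_prod (z :: 'a)) \<partial>lborel) < \<infinity>"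
    unfolding inv_sq_prod_def by (rule nn_integral_inverse_square_prod)
qed (auto simp: inv_sq_prod_def add_nonneg_nonneg intro!: prod_nonneg)

lemma inv_sq_prod_ge:
  assumes "norm z \<le> R" shows "1 / (1 + R\<^sup>2) ^ DIM('a) \<le> inv_sq_prod (z :: 'a::euclidean_space)"
proof -
  have "(\<Prod>b\<in>(Basis::'a set). 1 / (1 + R\<^sup>2)) \<le> (\<Prod>b\<in>Basis. 1 / (1 + (z \<bullet> b)\<^sup>2))"
  proof (rule prod_mono)
    fix b :: 'a assume b: "b \<in> Basis"
    have "\<bar>z \<bullet> b\<bar> \<le> R" using Basis_le_norm[OF b, of z] assms by simp
    then have "\<bar>z \<bullet> b\<bar>\<^sup>2 \<le> R\<^sup>2" by (intro power_mono) auto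
    then show "0 \<le> 1 / (1 + R\<^sup>2) \<and> 1 / (1 + R\<^sup>2) \<le> 1 / (1 + (z \<bullet> b)\<^sup>2)"
      using one_plus_sq_pos(1)[of "z \<bullet> b"] by (auto intro!: divide_left_mono simp: add_pos_nonneg)
  qed
  then show ?thesis by (simp add: inv_sq_prod_def power_one_over)
qed

text \<open>With y = ln |z|^2 the radial Mellin integral is taken over z itself, in real dimension
  2n; the division by |z|^(2n) turns the radial part of the volume into dr / r.\<close>

definition mweight :: "'n::finite itself \<Rightarrow> (real \<Rightarrow> real) \<Rightarrow> real \<Rightarrow> real" where
  "mweight N g y = g (exp y) / exp y ^ CARD('n)"

abbreviation nsq :: "complex ^ 'n::finite \<Rightarrow> real" where "nsq z \<equiv> (norm z)\<^sup>2"

lemma mweight_measurable: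
  assumes g: "continuous_on UNIV g"
  shows "mweight TYPE('n::finite) g \<in> borel_measurable borel"
  unfolding mweight_def[abs_def]
  by (intro borel_measurable_continuous_onI continuous_intros continuous_on_compose2[OF g]) auto

lemma ln_nsq_measurable [measurable]: "(\<lambda>z::complex ^ 'n::finite. ln (nsq z)) \<in> borel_measurable borel"
  by (rule measurable_compose[OF _ borel_measurable_ln]) measurable

text \<open>For |z| \<le> 1 the flatness bound compensates the denominator. For |z| > 1 the
  condition \<zeta> < 1/2 leaves at most |g| |z| times |z|^(-2n), and the product is at most the sum
  of the squares: the polar L2 density of g and an integrable power.\<close>

lemma mweight_bound:
  fixes z :: "complex ^ 'n::finite"
  assumes bd: "\<And>r. 0 \<le> r \<Longrightarrow> r \<le> 1 \<Longrightarrow> \<bar>g r\<bar> \<le> C * r ^ CARD('n)"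
    and \<zeta>: "0 < \<zeta>" "\<zeta> < 1/2" and z: "z \<noteq> 0"
  shows "\<bar>mweight TYPE('n) g (ln (nsq z)) * exp (\<zeta> * ln (nsq z))\<bar> \<le>
      nsq z * (g (nsq z))\<^sup>2 + (\<bar>C\<bar> + 1) * 2 ^ DIM(complex ^ 'n) * inv_sq_prod z"
proof -
  define q n where "q = nsq z" and "n = CARD('n)"
  have q: "q > 0" using z by (simp add: q_def)
  have e: "\<bar>mweight TYPE('n) g (ln (nsq z)) * exp (\<zeta> * ln (nsq z))\<bar> = \<bar>g q\<bar> / q ^ n * exp (\<zeta> * ln q)"
    using q by (simp add: mweight_def q_def n_def abs_mult)
  have dim: "DIM(complex ^ 'n) = 2 * n" by (simp add: n_def)
  have P: "inv_sq_prod z \<ge> 0" by (simp add: inv_sq_prod_def prod_nonneg add_nonneg_nonneg)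
  have nn: "nsq z * (g (nsq z))\<^sup>2 \<ge> 0" by simp
  show ?thesis
  proof (cases "q \<le> 1")
    case True
    have "\<zeta> * ln q \<le> 0" using \<zeta> q True by (intro mult_nonneg_nonpos) auto
    then have "\<bar>g q\<bar> / q ^ n * exp (\<zeta> * ln q) \<le> \<bar>g q\<bar> / q ^ n * 1" using q by (intro mult_left_mono) auto
    also have "\<dots> \<le> C" using bd[of q] q True by (simp add: n_def divide_le_eq)
    also have "\<dots> \<le> (\<bar>C\<bar> + 1) * 1" by simp
    also have "\<dots> \<le> (\<bar>C\<bar> + 1) * (2 ^ DIM(complex ^ 'n) * inv_sq_prod z)"
    proof (rule mult_left_mono)
      have "(norm z)\<^sup>2 \<le> 1\<^sup>2" using True by (simp add: q_def)
      then have "norm z \<le> 1" by (rule power2_le_imp_le) simp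
      from inv_sq_prod_ge[OF this] show "1 \<le> 2 ^ DIM(complex ^ 'n) * inv_sq_prod z"
        by (simp add: field_simps)
    qed simp
    finally show ?thesis using nn unfolding e by (simp only: mult.assoc)
  next
    case False
    define b where "b = 1 / q ^ n"
    have "\<zeta> * ln q \<le> 1/2 * ln q" using \<zeta> q False by (intro mult_right_mono) auto
    moreover have "exp (1/2 * ln q) = sqrt q"
      using q by (simp add: ln_sqrt[symmetric])
    ultimately have "exp (\<zeta> * ln q) \<le> sqrt q" by (metis exp_le_cancel_iff)
    then have "\<bar>g q\<bar> / q ^ n * exp (\<zeta> * ln q) \<le> \<bar>g q\<bar> / q ^ n * sqrt q" using q by (intro mult_left_mono) auto
    also have "\<dots> = (\<bar>g q\<bar> * sqrt q) * b" by (simp add: b_def)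
    also have "\<dots> \<le> (\<bar>g q\<bar> * sqrt q)\<^sup>2 + b\<^sup>2"
    proof -
      have "(\<bar>g q\<bar> * sqrt q) * b \<ge> 0" using q by (simp add: b_def)
      then show ?thesis using sum_squares_bound[of "\<bar>g q\<bar> * sqrt q" b] by linarith
    qed
    also have "(\<bar>g q\<bar> * sqrt q)\<^sup>2 = nsq z * (g (nsq z))\<^sup>2" using q by (simp add: power_mult_distrib q_def)
    also have "b\<^sup>2 \<le> 2 ^ DIM(complex ^ 'n) * inv_sq_prod z"
    proof -
      have "b\<^sup>2 = 2 ^ (2 * n) * (1 / (q + q) ^ (2 * n))"
      proof -
        have "(q + q) ^ (2 * n) = 2 ^ (2 * n) * q ^ (2 * n)" by (simp add: power_mult_distrib flip: mult_2)
        moreover have "(q ^ n)\<^sup>2 = q ^ (2 * n)" by (simp add: mult.commute flip: power_mult)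
        ultimately show ?thesis by (simp add: b_def power_one_over power_divide)
      qed
      also have "\<dots> \<le> 2 ^ (2 * n) * (1 / (1 + q) ^ (2 * n))"
        using q False by (intro mult_left_mono divide_left_mono power_mono) auto
      also have "\<dots> \<le> 2 ^ (2 * n) * inv_sq_prod z"
        using inv_sq_prod_ge[of z "norm z"] by (intro mult_left_mono) (simp_all add: q_def n_def mult.commute)
      finally show ?thesis by (simp only: dim)
    qed
    also have "nsq z * (g (nsq z))\<^sup>2 + 2 ^ DIM(complex ^ 'n) * inv_sq_prod z \<le>
        nsq z * (g (nsq z))\<^sup>2 + (\<bar>C\<bar> + 1) * (2 ^ DIM(complex ^ 'n) * inv_sq_prod z)"
    proof (rule add_left_mono)
      have "1 * (2 ^ DIM(complex ^ 'n) * inv_sq_prod z) \<le> (\<bar>C\<bar> + 1) * (2 ^ DIM(complex ^ 'n) * inv_sq_prod z)"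
        using P by (intro mult_right_mono) auto
      then show "2 ^ DIM(complex ^ 'n) * inv_sq_prod z \<le> (\<bar>C\<bar> + 1) * (2 ^ DIM(complex ^ 'n) * inv_sq_prod z)" by simp
    qed
    finally show ?thesis unfolding e by (simp only: mult.assoc)
  qed
qed

lemma mweight_integrable:
  assumes g: "continuous_on UNIV g" and bd: "\<And>r. 0 \<le> r \<Longrightarrow> r \<le> 1 \<Longrightarrow> \<bar>g r\<bar> \<le> C * r ^ CARD('n)"
    and L2: "integrable lborel (\<lambda>z::complex ^ 'n::finite. nsq z * (g (nsq z))\<^sup>2)"
    and \<zeta>: "0 < \<zeta>" "\<zeta> < 1/2"
  shows "integrable lborel (\<lambda>z::complex ^ 'n. mweight TYPE('n) g (ln (nsq z)) * exp (\<zeta> * ln (nsq z)))"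
proof -
  have "integrable lborel (\<lambda>z::complex ^ 'n. nsq z * (g (nsq z))\<^sup>2 + (\<bar>C\<bar> + 1) * 2 ^ DIM(complex ^ 'n) * inv_sq_prod z)"
    by (intro Bochner_Integration.integrable_add L2 integrable_mult_right inv_sq_prod_integrable)
  then show ?thesis
  proof (rule Bochner_Integration.integrable_bound)
    show "(\<lambda>z::complex ^ 'n. mweight TYPE('n) g (ln (nsq z)) * exp (\<zeta> * ln (nsq z))) \<in> borel_measurable lborel"
      unfolding measurable_lborel2
      by (intro borel_measurable_times measurable_compose[OF _ mweight_measurable[OF g]]) measurable
    show "AE z in lborel. norm (mweight TYPE('n) g (ln (nsq (z::complex ^ 'n))) * exp (\<zeta> * ln (nsq z))) \<le>
        norm (nsq z * (g (nsq z))\<^sup>2 + (\<bar>C\<bar> + 1) * 2 ^ DIM(complex ^ 'n) * inv_sq_prod z)"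
    proof (rule eventually_mono[OF AE_lborel_singleton[of 0]])
      fix z :: "complex ^ 'n" assume z: "z \<noteq> 0"
      show "norm (mweight TYPE('n) g (ln (nsq z)) * exp (\<zeta> * ln (nsq z))) \<le>
        norm (nsq z * (g (nsq z))\<^sup>2 + (\<bar>C\<bar> + 1) * 2 ^ DIM(complex ^ 'n) * inv_sq_prod z)"
        unfolding real_norm_def using mweight_bound[OF bd \<zeta> z] abs_ge_self order_trans by blast
    qed
  qed
qed

text \<open>The Mellin transform in \<open>\<tau>\<close> of the heat evolution at \<open>0\<close> factorizes into one factor for \<open>g\<close> and one for the kernel.\<close>
lemma mellin_product_zero:
  assumes g: "continuous_on UNIV g" and bd: "\<And>r. 0 \<le> r \<Longrightarrow> r \<le> 1 \<Longrightarrow> \<bar>g r\<bar> \<le> C * r ^ CARD('n)"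
    and L2: "integrable lborel (\<lambda>z::complex ^ 'n::finite. nsq z * (g (nsq z))\<^sup>2)"
    and \<zeta>: "0 < \<zeta>" "\<zeta> < 1/2"
    and zero: "AE \<tau> in lborel. \<tau> > 0 \<longrightarrow> (\<integral>p. jac p * (g (nsq (fst p)) * ((1 / \<tau>) ^ (CARD('n) + 1) *
        prof TYPE('n) (nsq (fst p) / \<tau>) (snd p))) \<partial>(lborel :: 'n heis measure)) = 0"
  shows "(\<integral>z. mweight TYPE('n) g (ln (nsq (z::complex ^ 'n))) * exp (\<zeta> * ln (nsq z)) \<partial>lborel) *
    (\<integral>w. mker TYPE('n) w * exp (\<zeta> * ln (snd w)) \<partial>lborel) = 0"
proof -
  define n where "n = CARD('n)"
  \<comment> \<open>\<open>V (p, \<tau>)\<close> is homogeneous: the substitution \<open>\<tau> = |z|\<^sup>2 \<sigma>\<close> separates \<open>z\<close> from \<open>(a, \<sigma>)\<close>.\<close>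
  define V :: "'n heis \<times> real \<Rightarrow> real" where "V x = (if snd x > 0 then exp ((\<zeta> - 1) * ln (snd x)) * (jac (fst x) * (g (nsq (fst (fst x))) *
    ((1 / snd x) ^ (n + 1) * prof TYPE('n) (nsq (fst (fst x)) / snd x) (snd (fst x))))) else 0)" for x
  define \<Phi> where "\<Phi> z = mweight TYPE('n) g (ln (nsq z)) * exp (\<zeta> * ln (nsq z))" for z :: "complex ^ 'n"
  \<comment> \<open>At z = 0 the value of \<open>\<Phi>\<close> stems from the default value of
    \<open>ln\<close>, whereas \<open>V\<close> vanishes there through \<open>jac\<close>; the
    correction makes the separation of variables hold at every z.\<close>
  define \<Phi>' where "\<Phi>' z = (if z = 0 then 0 else \<Phi> z)" for z
  define K where "K w = mker TYPE('n) w * exp (\<zeta> * ln (snd w))" for w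
  have K: "integrable lborel K" unfolding K_def using mker_integrable[of \<zeta>] \<zeta> by simp
  then have K': "integrable (lborel \<Otimes>\<^sub>M lborel) K" by (simp add: lborel_prod)
  have Km: "K \<in> borel_measurable borel" using borel_measurable_integrable[OF K] by simp
  \<comment> \<open>The pointwise bound gives integrability of every slice, so that
    \<open>Vi\<close> holds for all \<open>a\<close>.\<close>
  have Ka: "integrable lborel (\<lambda>\<sigma>. K (a, \<sigma>))" for a
  proof -
    obtain D where D: "\<And>a \<sigma>. \<bar>K (a, \<sigma>)\<bar> \<le> D * (1 / (1 + a\<^sup>2) * (1 / (1 + \<sigma>\<^sup>2)))"
      using mker_bound[of \<zeta>, where 'n='n] \<zeta> by (auto simp: K_def)
    have "integrable lborel (\<lambda>\<sigma>::real. D * (1 / (1 + a\<^sup>2) * (1 / (1 + \<sigma>\<^sup>2))))"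
      by (intro integrable_mult_right integrable_one_over_one_plus_sq)
    then show ?thesis
    proof (rule Bochner_Integration.integrable_bound)
      show "(\<lambda>\<sigma>. K (a, \<sigma>)) \<in> borel_measurable lborel"
        unfolding measurable_lborel2 by (rule measurable_compose[OF _ Km]) (intro borel_measurable_continuous_onI continuous_intros)
      show "AE \<sigma> in lborel. norm (K (a, \<sigma>)) \<le> norm (D * (1 / (1 + a\<^sup>2) * (1 / (1 + \<sigma>\<^sup>2))))"
        unfolding real_norm_def using D abs_ge_self order_trans by (intro AE_I2) blast
    qed
  qed
  have \<Phi>: "integrable lborel \<Phi>" unfolding \<Phi>_def by (rule mweight_integrable[OF g bd L2 \<zeta>])
  have AE\<Phi>: "AE z in lborel. \<Phi> z = \<Phi>' z"
    by (rule eventually_mono[OF AE_lborel_singleton[of 0]]) (simp add: \<Phi>'_def)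
  have m\<Phi>': "\<Phi>' \<in> borel_measurable lborel"
    using borel_measurable_integrable[OF \<Phi>] unfolding \<Phi>'_def[abs_def] by measurable
  have \<Phi>': "integrable lborel \<Phi>'"
    using \<Phi> integrable_cong_AE[OF borel_measurable_integrable[OF \<Phi>] m\<Phi>' AE\<Phi>] by simp
  have int\<Phi>': "(\<integral>z. \<Phi> z \<partial>lborel) = (\<integral>z. \<Phi>' z \<partial>lborel)"
    by (rule integral_cong_AE[OF borel_measurable_integrable[OF \<Phi>] m\<Phi>' AE\<Phi>])
  have V0: "V ((0, a), \<tau>) = 0" for a \<tau> by (simp add: V_def jac_def)
  have scale: "V ((z, a), 0 + nsq z * \<sigma>) = \<Phi>' z / nsq z * K (a, \<sigma>)" if z: "z \<noteq> 0" for z a \<sigma>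
  proof (cases "\<sigma> > 0")
    case False
    then have "\<not> (nsq z * \<sigma> > 0)" using z by (simp add: zero_less_mult_iff)
    then show ?thesis using False by (simp add: V_def K_def mker_def)
  next
    case \<sigma>: True
    define q where "q = nsq z"
    have q: "q > 0" using z by (simp add: q_def)
    have l: "ln (q * \<sigma>) = ln q + ln \<sigma>" using q \<sigma> by (simp add: ln_mult)
    have "exp ((\<zeta> - 1) * ln (q * \<sigma>)) = exp (\<zeta> * ln q + \<zeta> * ln \<sigma>) / exp (ln (q * \<sigma>))"
      unfolding l by (simp add: algebra_simps flip: exp_diff)
    also have "\<dots> = exp (\<zeta> * ln q) * exp (\<zeta> * ln \<sigma>) / (q * \<sigma>)" using q \<sigma> by (simp add: exp_add)
    finally have "exp ((\<zeta> - 1) * ln (q * \<sigma>)) = exp (\<zeta> * ln q) * exp (\<zeta> * ln \<sigma>) / (q * \<sigma>)" .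
    then have "V ((z, a), 0 + q * \<sigma>) = exp (\<zeta> * ln q) * exp (\<zeta> * ln \<sigma>) / (q * \<sigma>) *
        ((q * kap a ^ (2 * n + 2)) * (g q * ((1 / (q * \<sigma>)) ^ (n + 1) * prof TYPE('n) (1 / \<sigma>) a)))"
      using q \<sigma> by (simp add: V_def jac_def n_def flip: q_def)
    also have "\<dots> = (g q / q ^ n * exp (\<zeta> * ln q)) / q * ((kap a ^ (2 * n + 2) * (1 / \<sigma>) ^ (n + 2) * prof TYPE('n) (1 / \<sigma>) a) * exp (\<zeta> * ln \<sigma>))"
      using q \<sigma> by (simp add: field_simps power_mult_distrib)
    also have "\<dots> = \<Phi>' z / q * K (a, \<sigma>)"
      using q \<sigma> z by (simp add: \<Phi>'_def \<Phi>_def K_def mker_def mweight_def n_def flip: q_def)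
    finally show ?thesis by (simp add: q_def)
  qed
  have Vi: "integrable lborel (\<lambda>\<tau>. V ((z, a), \<tau>))" for z a
  proof (cases "z = 0")
    case False
    have "integrable lborel (\<lambda>\<sigma>. V ((z, a), 0 + nsq z * \<sigma>))"
      unfolding scale[OF False] by (intro integrable_mult_right Ka)
    then show ?thesis using False by (subst (asm) lborel_integrable_real_affine_iff) auto
  qed (simp add: V0)
  have Vint: "(\<integral>\<tau>. V ((z, a), \<tau>) \<partial>lborel) = \<Phi>' z * (\<integral>\<sigma>. K (a, \<sigma>) \<partial>lborel)" for z a
  proof (cases "z = 0")
    case False
    have "(\<integral>\<tau>. V ((z, a), \<tau>) \<partial>lborel) = \<bar>nsq z\<bar> *\<^sub>R (\<integral>\<sigma>. V ((z, a), 0 + nsq z * \<sigma>) \<partial>lborel)"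
      using False by (intro lborel_integral_real_affine) simp
    then show ?thesis unfolding scale[OF False] using False by simp
  qed (simp add: V0 \<Phi>'_def)
  have Vabs: "(\<integral>\<tau>. \<bar>V ((z, a), \<tau>)\<bar> \<partial>lborel) = \<bar>\<Phi>' z\<bar> * (\<integral>\<sigma>. \<bar>K (a, \<sigma>)\<bar> \<partial>lborel)" for z a
  proof (cases "z = 0")
    case False
    have "(\<integral>\<tau>. \<bar>V ((z, a), \<tau>)\<bar> \<partial>lborel) = \<bar>nsq z\<bar> *\<^sub>R (\<integral>\<sigma>. \<bar>V ((z, a), 0 + nsq z * \<sigma>)\<bar> \<partial>lborel)"
      using False by (intro lborel_integral_real_affine) simp
    then show ?thesis unfolding scale[OF False] using False by (simp add: abs_mult)
  qed (simp add: V0 \<Phi>'_def)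
  have Vm: "V \<in> borel_measurable borel"
  proof -
    have [measurable]: "(\<lambda>x::'n heis \<times> real. snd x) \<in> borel_measurable borel"
      "(\<lambda>x::'n heis \<times> real. jac (fst x)) \<in> borel_measurable borel"
      "(\<lambda>x::'n heis \<times> real. g (nsq (fst (fst x)))) \<in> borel_measurable borel"
      by (intro borel_measurable_continuous_onI continuous_intros continuous_on_compose2[OF g]
          continuous_on_compose2[OF continuous_on_jac]; simp)+
    have "(\<lambda>x::'n heis \<times> real. (nsq (fst (fst x)) / snd x, snd (fst x))) \<in> borel_measurable borel"
      by (intro borel_measurable_Pair borel_measurable_divide borel_measurable_continuous_onI continuous_intros)
    from measurable_compose[OF this prof_measurable[where 'n='n]]
    have [measurable]: "(\<lambda>x::'n heis \<times> real. prof TYPE('n) (nsq (fst (fst x)) / snd x) (snd (fst x))) \<in> borel_measurable borel"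
      by simp
    show ?thesis unfolding V_def[abs_def] by measurable
  qed
  have FV: "integrable (lborel \<Otimes>\<^sub>M lborel) V"
  proof (rule lborel_pair.Fubini_integrable)
    show "V \<in> borel_measurable (lborel \<Otimes>\<^sub>M lborel)" using Vm by (simp add: lborel_prod)
    have "integrable lborel (\<lambda>a. \<integral>\<sigma>. \<bar>K (a, \<sigma>)\<bar> \<partial>lborel)"
      using lborel_pair.integrable_fst'[OF integrable_abs[OF K']] .
    then have "integrable lborel (\<lambda>p. \<bar>\<Phi>' (fst p)\<bar> * (\<integral>\<sigma>. \<bar>K (snd p, \<sigma>)\<bar> \<partial>lborel))"
      by (intro integrable_lborel_times[of "\<lambda>z. \<bar>\<Phi>' z\<bar>" "\<lambda>a. \<integral>\<sigma>. \<bar>K (a, \<sigma>)\<bar> \<partial>lborel"] integrable_abs \<Phi>')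
    moreover have "(\<integral>\<tau>. norm (V (p, \<tau>)) \<partial>lborel) = \<bar>\<Phi>' (fst p)\<bar> * (\<integral>\<sigma>. \<bar>K (snd p, \<sigma>)\<bar> \<partial>lborel)" for p
      by (cases p) (simp add: Vabs)
    ultimately show "integrable lborel (\<lambda>p. \<integral>\<tau>. norm (V (p, \<tau>)) \<partial>lborel)" by simp
    show "AE p in lborel. integrable lborel (\<lambda>\<tau>. V (p, \<tau>))"
      by (rule AE_I2) (metis Vi prod.collapse)
  qed
  have "(\<integral>\<tau>. (\<integral>p. V (p, \<tau>) \<partial>lborel) \<partial>lborel) = (\<integral>p. (\<integral>\<tau>. V (p, \<tau>) \<partial>lborel) \<partial>lborel)"
    by (rule lborel_pair.Fubini_integral) (use FV in simp)
  moreover have "(\<integral>\<tau>. (\<integral>p. V (p, \<tau>) \<partial>lborel) \<partial>lborel) = 0"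
  proof (rule integral_eq_zero_AE)
    show "AE \<tau> in lborel. (\<integral>p. V (p, \<tau>) \<partial>lborel) = 0"
      using zero
    proof eventually_elim
      case (elim \<tau>)
      show ?case
      proof (cases "\<tau> > 0")
        case True
        then have "V (p, \<tau>) = exp ((\<zeta> - 1) * ln \<tau>) * (jac p * (g (nsq (fst p)) *
            ((1 / \<tau>) ^ (CARD('n) + 1) * prof TYPE('n) (nsq (fst p) / \<tau>) (snd p))))" for p
          by (simp only: V_def n_def fst_conv snd_conv if_True)
        then show ?thesis using elim True by simp
      qed (simp add: V_def)
    qed
  qed
  moreover have "(\<integral>p. (\<integral>\<tau>. V (p, \<tau>) \<partial>lborel) \<partial>lborel) = (\<integral>p. \<Phi>' (fst p) * (\<integral>\<sigma>. K (snd p, \<sigma>) \<partial>lborel) \<partial>lborel)"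
  proof (rule Bochner_Integration.integral_cong)
    show "(\<integral>\<tau>. V (p, \<tau>) \<partial>lborel) = \<Phi>' (fst p) * (\<integral>\<sigma>. K (snd p, \<sigma>) \<partial>lborel)" for p
      by (cases p) (simp add: Vint)
  qed simp
  moreover have "\<dots> = (\<integral>z. \<Phi>' z \<partial>lborel) * (\<integral>a. (\<integral>\<sigma>. K (a, \<sigma>) \<partial>lborel) \<partial>lborel)"
    by (rule integral_lborel_times[OF \<Phi>' lborel_pair.integrable_fst'[OF K']])
  moreover have "(\<integral>a. (\<integral>\<sigma>. K (a, \<sigma>) \<partial>lborel) \<partial>lborel) = (\<integral>w. K w \<partial>lborel)"
    using lborel_pair.integral_fst'[OF K'] by (simp add: lborel_prod)
  ultimately show ?thesis unfolding int\<Phi>'[unfolded \<Phi>_def] K_def by simp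
qed

text \<open>In polar coordinates the density of |f|^2 separates. Fubini provides some a whose slice
  is integrable, and on that slice the power of \<open>kap a\<close> is a positive constant.\<close>

lemma profile_L2:
  fixes f :: "'n::finite heis \<Rightarrow> complex"
  assumes f: "in_L2 f" and rad: "\<And>p. f (polar p) = f (0, nsq (fst p))"
  shows "integrable lborel (\<lambda>z::complex ^ 'n. nsq z * (norm (f (0, nsq z)))\<^sup>2)"
proof -
  have m: "(\<lambda>x. (norm (f x))\<^sup>2) \<in> borel_measurable borel" using f by (auto simp: in_L2_def)
  have "integrable lborel (\<lambda>p. jac p * (norm (f (polar p)))\<^sup>2)"
    using f by (subst integrable_polar[OF m, symmetric]) (simp add: in_L2_def)
  then have "integrable (lborel \<Otimes>\<^sub>M lborel) (\<lambda>(z::complex ^ 'n, a). nsq z * (norm (f (0, nsq z)))\<^sup>2 * kap a ^ (2 * CARD('n) + 2))"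
    by (simp add: lborel_prod rad jac_def mult_ac split_beta')
  from lborel_pair.AE_integrable_snd[OF this]
  have AE: "AE a in lborel. integrable lborel (\<lambda>z::complex ^ 'n. nsq z * (norm (f (0, nsq z)))\<^sup>2 * kap a ^ (2 * CARD('n) + 2))"
    by simp
  obtain a where "integrable lborel (\<lambda>z::complex ^ 'n. nsq z * (norm (f (0, nsq z)))\<^sup>2 * kap a ^ (2 * CARD('n) + 2))"
    using AE_lborel_open[OF AE open_UNIV UNIV_not_empty] by blast
  then have "integrable lborel (\<lambda>z::complex ^ 'n. nsq z * (norm (f (0, nsq z)))\<^sup>2 * kap a ^ (2 * CARD('n) + 2) / kap a ^ (2 * CARD('n) + 2))"
    by (rule integrable_divide)
  then show ?thesis using kap_pos[of a] by simp
qed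

lemma hpair_polar:
  fixes f :: "'n::finite heis \<Rightarrow> complex"
  assumes f: "f \<in> borel_measurable borel" and rad: "\<And>p. f (polar p) = f (0, nsq (fst p))" and \<tau>: "\<tau> > 0"
  shows "hpair c f \<tau> = (\<integral>p. jac p * ((f (0, nsq (fst p)) \<bullet> c) * ((1 / \<tau>) ^ (CARD('n) + 1) *
        prof TYPE('n) (nsq (fst p) / \<tau>) (snd p))) \<partial>(lborel :: 'n heis measure))"
proof -
  have [measurable]: "(heat c \<tau> :: 'n heis \<Rightarrow> complex) \<in> borel_measurable borel"
    by (intro borel_measurable_continuous_onI hor2_continuous(1) hor2_heat \<tau>)
  have "(\<lambda>x. f x \<bullet> heat c \<tau> x) \<in> borel_measurable borel" using f by measurable
  from integral_polar[OF this] show ?thesis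
    unfolding hpair_def by (simp add: rad heat_polar[OF \<tau>] mult_ac)
qed

theorem theorem1p5:
  fixes f :: "'n::finite heis \<Rightarrow> complex"
  assumes "smooth f"
    and "\<And>\<rho> \<omega> \<theta>. \<lbrakk>0 < \<rho>; norm \<omega> = 1; 0 \<le> \<theta>; \<theta> \<le> pi\<rbrakk> \<Longrightarrow>
           f ((\<rho> * sqrt (sin \<theta>)) *\<^sub>R \<omega>, \<rho>\<^sup>2 * cos \<theta>) = f (\<rho> *\<^sub>R \<omega>, 0)"
    and "\<And>m::nat. in_L2 ((sublaplacian ^^ m) f)"
    and "(\<Sum>m::nat. neg_powr (L2_norm ((sublaplacian ^^ Suc m) f)) (1 / (2 * real (Suc m)))) = \<infinity>"
    and "\<And>vs. set vs \<subseteq> Basis \<Longrightarrow> iter_pd vs f 0 = 0"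
  shows "\<forall>p. f p = 0"
proof -
  have flat: "flat0 f" unfolding flat0_def using assms(1,5) by blast
  have L2: "in_L2 ((lap ^^ m) f)" for m using assms(3)[of m] by (simp add: sublaplacian_pow_eq_lap_pow[OF flat])
  have "(\<Sum>m. neg_powr (L2_norm ((lap ^^ Suc m) f)) (1 / (2 * real (Suc m)))) = \<infinity>"
    using assms(4) unfolding sublaplacian_pow_eq_lap_pow[OF flat] .
  then interpret carleman_orbit f using flat L2 by unfold_locales
  have f_L2: "in_L2 f" using L2[of 0] by simp
  have fc: "continuous_on UNIV f" using hor2_continuous(1)[OF flat0_hor2[OF flat]] .
  have fm: "f \<in> borel_measurable borel" by (rule borel_measurable_continuous_onI[OF fc])
  have gauge: "f (z, t) = f (0, sqrt (norm z ^ 4 + t\<^sup>2))" for z t by (rule gauge_symmetric[OF assms(2)])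
  have rad: "f (polar p) = f (0, nsq (fst p))" for p by (rule gauge_symmetric_polar[OF gauge])
  \<comment> \<open>The Mellin argument is for real profiles; c = 1 and c = \<i> give the real and
    the imaginary part of f.\<close>
  have zero: "f (0, r) \<bullet> c = 0" if c: "norm c = 1" and r: "r > 0" for c r
  proof -
    define g where "g r = f (0, r) \<bullet> c" for r
    have gc: "continuous_on UNIV g" unfolding g_def[abs_def]
      by (intro continuous_intros continuous_on_compose2[OF fc]) auto
    have gf: "\<bar>g r\<bar> \<le> norm (f (0, r))" for r
      using Cauchy_Schwarz_ineq2[of "f (0, r)" c] by (simp add: g_def c)
    obtain C where C: "\<And>x. norm x \<le> 1 \<Longrightarrow> norm (f x) \<le> C * norm x ^ CARD('n)"
      using flat0_bound[OF flat, of "CARD('n)"] by blast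
    have bd: "\<bar>g r\<bar> \<le> C * r ^ CARD('n)" if "0 \<le> r" "r \<le> 1" for r
      using gf[of r] C[of "(0, r)"] that by simp
    have gL2: "integrable lborel (\<lambda>z::complex ^ 'n. nsq z * (g (nsq z))\<^sup>2)"
    proof (rule Bochner_Integration.integrable_bound[OF profile_L2[OF f_L2 rad]])
      show "(\<lambda>z::complex ^ 'n. nsq z * (g (nsq z))\<^sup>2) \<in> borel_measurable lborel"
        unfolding measurable_lborel2
        by (intro borel_measurable_continuous_onI continuous_intros continuous_on_compose2[OF gc]) auto
      show "AE z in lborel. norm (nsq z * (g (nsq (z::complex ^ 'n)))\<^sup>2) \<le> norm (nsq z * (norm (f (0, nsq z)))\<^sup>2)"
        using power_mono[OF gf abs_ge_zero, of _ 2] by (auto intro!: AE_I2 mult_left_mono simp: abs_mult)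
    qed
    have prod: "(\<integral>z. mweight TYPE('n) g (ln (nsq (z::complex ^ 'n))) * exp (\<zeta> * ln (nsq z)) \<partial>lborel) *
        (\<integral>w. mker TYPE('n) w * exp (\<zeta> * ln (snd w)) \<partial>lborel) = 0" if \<zeta>: "0 < \<zeta>" "\<zeta> < 1/2" for \<zeta>
    proof (rule mellin_product_zero[OF gc bd gL2 \<zeta>])
      show "AE \<tau> in lborel. \<tau> > 0 \<longrightarrow> (\<integral>p. jac p * (g (nsq (fst p)) * ((1 / \<tau>) ^ (CARD('n) + 1) *
        prof TYPE('n) (nsq (fst p) / \<tau>) (snd p))) \<partial>(lborel :: 'n heis measure)) = 0"
        using U_AE_zero[of c]
      proof eventually_elim
        case (elim \<tau>)
        show ?case
        proof
          assume \<tau>: "\<tau> > 0"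
          then have "hpair c f \<tau> = 0" using elim by blast
          then show "(\<integral>p. jac p * (g (nsq (fst p)) * ((1 / \<tau>) ^ (CARD('n) + 1) *
            prof TYPE('n) (nsq (fst p) / \<tau>) (snd p))) \<partial>(lborel :: 'n heis measure)) = 0"
            unfolding hpair_polar[OF fm rad \<tau>] g_def .
        qed
      qed
    qed
    obtain \<zeta>1 where \<zeta>1: "0 < \<zeta>1" "\<zeta>1 < 1/2" "(\<integral>w. mker TYPE('n) w * exp (\<zeta>1 * ln (snd w)) \<partial>lborel) \<noteq> 0"
      using mker_mellin_nonzero by blast
    have int: "integrable lborel (\<lambda>z::complex ^ 'n. mweight TYPE('n) g (ln (nsq z)) * exp (\<zeta> * ln (nsq z)))"
      if "0 < \<zeta>" "\<zeta> < 1/2" for \<zeta> by (rule mweight_integrable[OF gc bd gL2 that])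
    note meas = mweight_measurable[OF gc, where 'n='n] measurable_compose[OF ln_nsq_measurable mweight_measurable[OF gc, where 'n='n]]
    have [measurable]: "(\<lambda>w::real \<times> real. ln (snd w)) \<in> borel_measurable borel"
      by (intro borel_measurable_ln borel_measurable_continuous_onI continuous_intros)
    have "AE z in lborel. mweight TYPE('n) g (ln (nsq (z :: complex ^ 'n))) = 0"
    proof (rule laplace_zero_imp_AE_zero[where a = 0 and b = "1/2" and h = "mweight TYPE('n) g" and x = "\<lambda>z. ln (nsq z)"])
      fix \<zeta> :: real assume \<zeta>: "0 < \<zeta>" "\<zeta> < 1/2"
      show "(\<integral>z. mweight TYPE('n) g (ln (nsq (z::complex ^ 'n))) * exp (\<zeta> * ln (nsq z)) \<partial>lborel) = 0"
        by (rule laplace_product_zero[OF _ _ int _ _ _ prod \<zeta>1 \<zeta>])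
           (use meas ln_nsq_measurable in \<open>auto intro!: mker_integrable\<close>)
    qed (use meas ln_nsq_measurable int in auto)
    \<comment> \<open>For z \<noteq> 0 the exponential of ln |z|^2 is |z|^2, and the denominator of
      the weight can be cleared.\<close>
    moreover have "AE z in (lborel :: (complex ^ 'n) measure). z \<noteq> 0" by (rule AE_lborel_singleton)
    ultimately have AE: "AE z in (lborel :: (complex ^ 'n) measure). g (nsq z) = 0"
      by eventually_elim (simp add: mweight_def)
    \<comment> \<open>By continuity a nonzero value would persist on a nonempty open set of z, which
      is not null.\<close>
    show ?thesis
    proof (rule ccontr)
      assume "f (0, r) \<bullet> c \<noteq> 0"
      then have "sqrt r *\<^sub>R vec1 \<in> {z :: complex ^ 'n. g (nsq z) \<noteq> 0}" using r by (simp add: g_def norm_vec1)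
      moreover have "open {z :: complex ^ 'n. g (nsq z) \<noteq> 0}"
        by (intro open_Collect_neq continuous_intros continuous_on_compose2[OF gc]) auto
      ultimately show False using AE_lborel_open[OF AE] by blast
    qed
  qed
  have "f (0, r) = 0" if "r > 0" for r
    using zero[of 1 r] zero[of \<i> r] that by (auto simp: complex_eq_iff inner_complex_def)
  moreover have "f (0, 0) = 0" using flat0_zero[OF flat] by (simp add: zero_prod_def)
  ultimately have "f (0, r) = 0" if "r \<ge> 0" for r using that by (cases "r = 0") auto
  then have "f (z, t) = 0" for z t by (subst gauge) simp
  then show ?thesis by auto
qed

end
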